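(* Let $E$ be a digraph and $K$ a field. Let $D\subseteq X$ be a subset containing exactly one element from each orbit. Then the set $$\{V_{[x],K} : x \text{ is an infinite path},\ x\in D\}\ \cup\ \{V_{[w],K} : w \text{ is not regular}\}\ \cup\ \{V^{f}_{[c^\infty],K} : f \text{ is an irreducible polynomial in } K[t],\ f\neq t-1,\ f\neq t,\ c \text{ is a simple closed path in } E\}$$ forms the full list of all pairwise nonisomorphic simple spectral modules over $L_K(E)$. In particular, all finite dimensional simple modules over $L_K(E)$ are the modules in this list with $x$'s which have finite orbits (where the path $x$ is $w$ for a module $V_{[w],K}$ and $c^\infty$ for a module $V^f_{[c^\infty],K}$).
   Context: Graphs and paths. $E=(E^0,E^1,s,r)$ is a directed graph. A vertex is regular if it emits at least one and only finitely many edges; a non-regular vertex is a sink or an infinite emitter. A finite path of length $|p|=n$ is $p=e_1\cdots e_n$ with $e_i\in E^1$, $r(e_i)=s(e_{i+1})$; $s(p)=s(e_1)$, $r(p)=r(e_n)$. A vertex $v$ is a trivial path of length $0$ with source and range $v$. $F(E)$ is the set of finite paths and $E^\infty$ the set of infinite paths $e_1e_2\cdots$ with $r(e_i)=s(e_{i+1})$ for all $i$. A nontrivial finite path $p$ is closed if $r(p)=s(p)$; a closed path $p$ is simple if $p\neq c^m$ for every closed path $c\neq p$ and every $m$. $c^\infty=ccc\cdots$. Put $X=E^\infty\cup\{p\in F(E): r(p)\text{ is not regular}\}$. Elements $x,y\in X$ are tail-equivalent if there are $\mu,\nu\in F(E)$ and $x'\in X$ with $x=\mu x'$, $y=\nu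 x'$; $[x]$ is the tail-equivalence class of $x$. Leavitt path algebra. $L_K(E)$ is the $K$-algebra generated by $v\in E^0$ and $e,e^*$ ($e\in E^1$) with relations $vw=\delta_{v,w}v$, $s(e)e=e=er(e)$, $r(e)e^*=e^*=e^*s(e)$, $e^*f=\delta_{e,f}r(e)$, and $v=\sum_{s(e)=v}ee^*$ for regular $v$. Modules are left modules. A module $M$ over an algebra $A$ (possibly without unit) is simple if $AM\neq 0$ and its only submodules are $0$ and $M$. Chen modules. For $x\in X$ and a field $F$, $V_{[x],F}$ is the $F$-vector space with basis $[x]$ and left $L_F(E)$-action $v.p=\delta_{v,s(p)}p$, $e.p=\delta_{r(e),s(p)}ep$, and $e^*.p=p'$ if $p=ep'$, $e^*.p=0$ otherwise, for $p\in[x]$, $v\in E^0$, $e\in E^1$. For $\underline a=(a_e)_{e\in E^1}\in(F^* )^{E^1}$ let $\sigma_{\underline a}$ be the automorphism of $L_F(E)$ with $v\mapsto v$, $e\mapsto a_ee$, $e^*\mapsto a_e^{-1}e^*$. The twisted Chen module $V^{\underline a}_{[x],F}$ is the same vector space with $z\in L_F(E)$ sending $p$ to $\sigma_{\underline a}(z).p$. For $q=e_1\cdots e_n$ put $a_q=a_{e_1}\cdots a_{e_n}$. For a simple closed path $c$ and an irreducible polynomial $f\in K[t]$, $f\neq t$, let $K'=K[t,t^{-1}]/(f(t))$, let $\bar t$ be the class of $t$ in $K'$, and take $\underline a\in(K'^* )^{E^1}$ with $a_c=\bar t$. Then $V^f_{[c^\infty],K}$ is the $L_{K'}(E)$-module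 $V^{\underline a}_{[c^\infty],K'}$ restricted to $L_K(E)$. Groupoid, orbits and spectral modules. $G_E=\{(x,k,y): \exists\,\mu,\nu\in F(E),\ x'\in X,\ x=\mu x',\ y=\nu x',\ |\mu|-|\nu|=k\}$ is a groupoid with $(x,k,y)(y,l,z)=(x,k+l,z)$, $(x,k,y)^{-1}=(y,-k,x)$, $r(x,k,y)=x$, $s(x,k,y)=y$. Its unit space $\{(x,0,x): x\in X\}$ is identified with $X$. The orbit of $x\in X$ is $\{y\in X: \exists\,\alpha\in G_E,\ s(\alpha)=y,\ r(\alpha)=x\}$, which is $[x]$. For $\mu,\nu\in F(E)$ with $r(\mu)=r(\nu)$ let $Z_{(\mu,\nu)}=\{(\mu x,|\mu|-|\nu|,\nu x): x\in X\}$ (over those $x$ for which $\mu x,\nu x$ are paths); these sets are compact bisections (the maps $s,r$ are injective on them) and form a basis of the topology of $G_E$. $A_K(G_E)$ is the groupoid algebra, the $K$-span of the indicator functions $1_{Z_{(\mu,\nu)}}$ with convolution product. $L_K(E)\cong A_K(G_E)$ via $\mu\nu^*\mapsto 1_{Z_{(\mu,\nu)}}$, and an $L_K(E)$-module $M$ is regarded as an $A_K(G_E)$-module by $1_{Z_{(\mu,\nu)}}m=(\mu\nu^* )m$. A module $W$ is spectral if there is $x\in X$ with $\mathrm{Res}_x(W):=\bigcap_U 1_UW\neq0$, where $U$ runs over the compact open subsets of $X$ containing $x$.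
   Formalization: V^f is twisted by scalars that may depend on the path, with product t along c, as edge scalars with a_c = t may not exist; G_E has the Hausdorff topology (sets Z and their complements), as the Z alone fail at infinite emitters; f≠t, f≠t-1 are meant up to nonzero scalars. *)

theory Defs
  imports
    "Graph_Theory.Arc_Walk"
    "HOL-Library.Poly_Mapping"
    "HOL-Library.Stream"
    "HOL-Library.Indicator_Function"
    "HOL-Analysis.Abstract_Topology"
    "HOL-Algebra.Module"
    "HOL-Algebra.QuotRing"
    "HOL-Algebra.Algebraic_Closure_Type"
begin

section \<open>Paths, tail equivalence\<close>

text \<open>
  A directed graph is a \<^locale>\<open>wf_digraph\<close> \<open>E\<close>, with \<open>s = tail E\<close> and \<open>r = head E\<close>; vertex
  and edge sets are arbitrary.  A finite path is its source together with its list of edges, so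
  that the trivial path at \<open>v\<close> is \<open>(v, [])\<close>.
\<close>

type_synonym ('v, 'e) fpath = "'v \<times> 'e list"

definition fin_paths :: "('v, 'e) pre_digraph \<Rightarrow> ('v, 'e) fpath set" where
  "fin_paths E = {(u, p). \<exists>v. pre_digraph.awalk E u p v}"

definition prange :: "('v, 'e) pre_digraph \<Rightarrow> ('v, 'e) fpath \<Rightarrow> 'v" where
  "prange E \<mu> = pre_digraph.awlast E (fst \<mu>) (snd \<mu>)"

definition plength :: "('v, 'e) fpath \<Rightarrow> int" where
  "plength \<mu> = int (length (snd \<mu>))"

definition regular :: "('v, 'e) pre_digraph \<Rightarrow> 'v \<Rightarrow> bool" where
  "regular E v \<longleftrightarrow> v \<in> verts E \<and> out_arcs E v \<noteq> {} \<and> finite (out_arcs E v)"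

datatype ('v, 'e) bpath = FinP 'v "'e list" | InfP "'e stream"

definition inf_paths :: "('v, 'e) pre_digraph \<Rightarrow> 'e stream set" where
  "inf_paths E = {\<omega>. sset \<omega> \<subseteq> arcs E \<and> (\<forall>i. head E (\<omega> !! i) = tail E (\<omega> !! Suc i))}"

text \<open>The set \<open>X\<close>.\<close>

definition boundary :: "('v, 'e) pre_digraph \<Rightarrow> ('v, 'e) bpath set" where
  "boundary E = InfP ` inf_paths E \<union>
     {FinP u p | u p. (u, p) \<in> fin_paths E \<and> \<not> regular E (prange E (u, p))}"

fun bsource :: "('v, 'e) pre_digraph \<Rightarrow> ('v, 'e) bpath \<Rightarrow> 'v" where
  "bsource E (FinP u p) = u"
| "bsource E (InfP \<omega>) = tail E (shd \<omega>)"

fun prepend :: "('v, 'e) fpath \<Rightarrow> ('v, 'e) bpath \<Rightarrow> ('v, 'e) bpath" where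
  "prepend (u, p) (FinP v q) = FinP u (p @ q)"
| "prepend (u, p) (InfP \<omega>) = InfP (p @- \<omega>)"

definition composable :: "('v, 'e) pre_digraph \<Rightarrow> ('v, 'e) fpath \<Rightarrow> ('v, 'e) bpath \<Rightarrow> bool" where
  "composable E \<mu> x \<longleftrightarrow> \<mu> \<in> fin_paths E \<and> x \<in> boundary E \<and> prange E \<mu> = bsource E x"

definition tail_class :: "('v, 'e) pre_digraph \<Rightarrow> ('v, 'e) bpath \<Rightarrow> ('v, 'e) bpath set" where
  "tail_class E x = {y. \<exists>\<mu> \<nu> x'. composable E \<mu> x' \<and> composable E \<nu> x' \<and>
     x = prepend \<mu> x' \<and> y = prepend \<nu> x'}"

text \<open>A closed path is given by its (nonempty) list of edges.\<close>

definition simple_closed :: "('v, 'e) pre_digraph \<Rightarrow> 'e list \<Rightarrow> bool" where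
  "simple_closed E c \<longleftrightarrow> wf_digraph.closed_w E c \<and>
     (\<forall>d m. wf_digraph.closed_w E d \<and> d \<noteq> c \<longrightarrow> c \<noteq> concat (replicate m d))"

definition cinf :: "'e list \<Rightarrow> ('v, 'e) bpath" where
  "cinf c = InfP (Stream.cycle c)"


section \<open>The groupoid of the graph\<close>

type_synonym ('v, 'e) arrow = "('v, 'e) bpath \<times> int \<times> ('v, 'e) bpath"

definition gpd_Z :: "('v, 'e) pre_digraph \<Rightarrow> ('v, 'e) fpath \<Rightarrow> ('v, 'e) fpath \<Rightarrow> ('v, 'e) arrow set"
  where
  "gpd_Z E \<mu> \<nu> = {(prepend \<mu> x, plength \<mu> - plength \<nu>, prepend \<nu> x) | x.
     composable E \<mu> x \<and> composable E \<nu> x}"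

definition gpd :: "('v, 'e) pre_digraph \<Rightarrow> ('v, 'e) arrow set" where
  "gpd E = {(prepend \<mu> x', plength \<mu> - plength \<nu>, prepend \<nu> x') | \<mu> \<nu> x'.
     composable E \<mu> x' \<and> composable E \<nu> x'}"

definition orbit :: "('v, 'e) pre_digraph \<Rightarrow> ('v, 'e) bpath \<Rightarrow> ('v, 'e) bpath set" where
  "orbit E x = {y \<in> boundary E. \<exists>k. (x, k, y) \<in> gpd E}"

definition range_pairs :: "('v, 'e) pre_digraph \<Rightarrow> (('v, 'e) fpath \<times> ('v, 'e) fpath) set" where
  "range_pairs E = {(\<mu>, \<nu>). \<mu> \<in> fin_paths E \<and> \<nu> \<in> fin_paths E \<and> prange E \<mu> = prange E \<nu>}"

text \<open>
  The sets \<open>Z\<^sub>(\<^sub>\<mu>\<^sub>,\<^sub>\<nu>\<^sub>)\<close> are compact and open in the Hausdorff groupoid topology, hence also closed.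
  If \<open>r(\<mu>)\<close> is an infinite emitter, the complements have to be included among the generators: the
  sets \<open>Z\<^sub>(\<^sub>\<mu>\<^sub>,\<^sub>\<nu>\<^sub>)\<close> alone would not even separate an infinite emitter \<open>w\<close> from the paths starting at
  \<open>w\<close>.  The usual basis consists of the sets \<open>Z\<^sub>(\<^sub>\<mu>\<^sub>,\<^sub>\<nu>\<^sub>)\<close> minus finitely many \<open>Z\<^sub>(\<^sub>\<mu>\<^sub>\<alpha>\<^sub>,\<^sub>\<nu>\<^sub>\<alpha>\<^sub>)\<close>.
\<close>

definition gpd_topology :: "('v, 'e) pre_digraph \<Rightarrow> ('v, 'e) arrow topology" where
  "gpd_topology E = topology_generated_by
     ({gpd_Z E \<mu> \<nu> | \<mu> \<nu>. (\<mu>, \<nu>) \<in> range_pairs E} \<union>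
      {gpd E - gpd_Z E \<mu> \<nu> | \<mu> \<nu>. (\<mu>, \<nu>) \<in> range_pairs E})"

definition units_of_set :: "('v, 'e) bpath set \<Rightarrow> ('v, 'e) arrow set" where
  "units_of_set U = (\<lambda>x. (x, 0, x)) ` U"

definition compact_open :: "('v, 'e) pre_digraph \<Rightarrow> ('v, 'e) bpath set \<Rightarrow> bool" where
  "compact_open E U \<longleftrightarrow> U \<subseteq> boundary E \<and>
     (let T = subtopology (gpd_topology E) (units_of_set (boundary E))
      in compactin T (units_of_set U) \<and> openin T (units_of_set U))"


section \<open>The Leavitt path algebra\<close>

datatype ('v, 'e) gen = Vx 'v | Ed 'e | Gh 'e  \<comment> \<open>the generators \<open>v\<close>, \<open>e\<close>, \<open>e\<^sup>*\<close>\<close>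

text \<open>
  The free monoid, written additively, because \<open>'g fword \<Rightarrow>\<^sub>0 'k\<close> is then the free unital
  \<open>'k\<close>-algebra on \<open>'g\<close>.
\<close>

datatype 'g fword = FWord (letters: "'g list")

instantiation fword :: (type) monoid_add
begin

definition zero_fword :: "'g fword" where "zero_fword = FWord []"

definition plus_fword :: "'g fword \<Rightarrow> 'g fword \<Rightarrow> 'g fword" where
  "plus_fword u w = FWord (letters u @ letters w)"

instance by standard (auto simp: zero_fword_def plus_fword_def)

end

type_synonym ('v, 'e, 'k) free = "('v, 'e) gen fword \<Rightarrow>\<^sub>0 'k"
type_synonym ('v, 'e, 'k) lpa_elt = "('v, 'e, 'k) free set"

definition gens :: "('v, 'e) pre_digraph \<Rightarrow> ('v, 'e) gen set" where
  "gens E = Vx ` verts E \<union> Ed ` arcs E \<union> Gh ` arcs E"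

definition free_alg :: "('v, 'e) pre_digraph \<Rightarrow> ('v, 'e, 'k :: field) free ring" where
  "free_alg E = ring_of_type_algebra
     \<lparr>carrier := {a. \<forall>w \<in> Poly_Mapping.keys a. set (letters w) \<subseteq> gens E}\<rparr>"

definition mon :: "('v, 'e) gen list \<Rightarrow> ('v, 'e, 'k :: field) free" where
  "mon w = Poly_Mapping.single (FWord w) 1"

definition lpa_relators :: "('v, 'e) pre_digraph \<Rightarrow> ('v, 'e, 'k :: field) free set" where
  "lpa_relators E =
     {mon [Vx v, Vx w] - (if v = w then mon [Vx v] else 0) | v w. v \<in> verts E \<and> w \<in> verts E} \<union>
     {mon [Vx (tail E e), Ed e] - mon [Ed e] | e. e \<in> arcs E} \<union>
     {mon [Ed e, Vx (head E e)] - mon [Ed e] | e. e \<in> arcs E} \<union>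
     {mon [Vx (head E e), Gh e] - mon [Gh e] | e. e \<in> arcs E} \<union>
     {mon [Gh e, Vx (tail E e)] - mon [Gh e] | e. e \<in> arcs E} \<union>
     {mon [Gh e, Ed f] - (if e = f then mon [Vx (head E e)] else 0) | e f.
        e \<in> arcs E \<and> f \<in> arcs E} \<union>
     {mon [Vx v] - (\<Sum>e\<in>out_arcs E v. mon [Ed e, Gh e]) | v. regular E v}"

definition lpa_ideal :: "('v, 'e) pre_digraph \<Rightarrow> ('v, 'e, 'k :: field) free set" where
  "lpa_ideal E = Idl\<^bsub>free_alg E\<^esub> (lpa_relators E)"

definition lpa_class :: "('v, 'e) pre_digraph \<Rightarrow> ('v, 'e, 'k :: field) free \<Rightarrow> ('v, 'e, 'k) lpa_elt"
  where "lpa_class E a = lpa_ideal E +>\<^bsub>free_alg E\<^esub> a"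

text \<open>
  \<open>L\<^sub>K(E)\<close> is in general not unital: it is the image of the free non-unital algebra, i.e. of the
  elements without constant term, so that the field \<^const>\<open>one\<close> is not meaningful.
\<close>

definition lpa :: "('v, 'e) pre_digraph \<Rightarrow> ('k :: field, ('v, 'e, 'k) lpa_elt) module" where
  "lpa E = \<lparr>carrier = {lpa_class E a | a. a \<in> carrier (free_alg E) \<and>
                        Poly_Mapping.lookup a (FWord []) = 0},
            monoid.mult = monoid.mult (free_alg E Quot lpa_ideal E),
            one = one (free_alg E Quot lpa_ideal E),
            ring.zero = ring.zero (free_alg E Quot lpa_ideal E),
            add = add (free_alg E Quot lpa_ideal E),
            module.smult = (\<lambda>k A. monoid.mult (free_alg E Quot lpa_ideal E)
                             (lpa_class E (Poly_Mapping.single (FWord []) k)) A)\<rparr>"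

text \<open>The element \<open>\<mu>\<nu>\<^sup>*\<close>.\<close>

fun path_word :: "('v, 'e) fpath \<Rightarrow> ('v, 'e) gen list" where
  "path_word (v, p) = (if p = [] then [Vx v] else map Ed p)"

fun ghost_word :: "('v, 'e) fpath \<Rightarrow> ('v, 'e) gen list" where
  "ghost_word (v, p) = (if p = [] then [Vx v] else map Gh (rev p))"

definition lpa_mono :: "('v, 'e) pre_digraph \<Rightarrow> ('v, 'e) fpath \<Rightarrow> ('v, 'e) fpath
    \<Rightarrow> ('v, 'e, 'k :: field) lpa_elt" where
  "lpa_mono E \<mu> \<nu> = lpa_class E (mon (path_word \<mu> @ ghost_word \<nu>))"


section \<open>Modules over non-unital algebras\<close>

text \<open>
  The underlying \<open>K\<close>-vector space of a module is a \<^locale>\<open>module\<close> over \<open>K\<close>; as usual for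
  this record, the fields \<^const>\<open>monoid.mult\<close> and \<^const>\<open>one\<close> of a module are ignored.
\<close>

record ('k, 'a, 'm) lmodule = "('k, 'm) module" +
  act :: "'a \<Rightarrow> 'm \<Rightarrow> 'm"

definition alg_module :: "('k :: field, 'a) module \<Rightarrow> ('k, 'a, 'm) lmodule \<Rightarrow> bool" where
  "alg_module A M \<longleftrightarrow> module ring_of_type_algebra M \<and>
     (\<forall>a \<in> carrier A. \<forall>m \<in> carrier M. act M a m \<in> carrier M) \<and>
     (\<forall>a \<in> carrier A. \<forall>b \<in> carrier A. \<forall>m \<in> carrier M.
        act M (a \<oplus>\<^bsub>A\<^esub> b) m = act M a m \<oplus>\<^bsub>M\<^esub> act M b m \<and>
        act M (a \<otimes>\<^bsub>A\<^esub> b) m = act M a (act M b m)) \<and>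
     (\<forall>a \<in> carrier A. \<forall>m \<in> carrier M. \<forall>n \<in> carrier M.
        act M a (m \<oplus>\<^bsub>M\<^esub> n) = act M a m \<oplus>\<^bsub>M\<^esub> act M a n) \<and>
     (\<forall>k. \<forall>a \<in> carrier A. \<forall>m \<in> carrier M.
        act M (k \<odot>\<^bsub>A\<^esub> a) m = k \<odot>\<^bsub>M\<^esub> act M a m \<and>
        act M a (k \<odot>\<^bsub>M\<^esub> m) = k \<odot>\<^bsub>M\<^esub> act M a m)"

definition alg_submodule :: "('k :: field, 'a) module \<Rightarrow> ('k, 'a, 'm) lmodule \<Rightarrow> 'm set \<Rightarrow> bool"
  where
  "alg_submodule A M N \<longleftrightarrow> submodule N (ring_of_type_algebra :: 'k ring) M \<and>
     (\<forall>a \<in> carrier A. \<forall>n \<in> N. act M a n \<in> N)"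

definition simple_module :: "('k :: field, 'a) module \<Rightarrow> ('k, 'a, 'm) lmodule \<Rightarrow> bool" where
  "simple_module A M \<longleftrightarrow> alg_module A M \<and>
     (\<exists>a \<in> carrier A. \<exists>m \<in> carrier M. act M a m \<noteq> \<zero>\<^bsub>M\<^esub>) \<and>
     (\<forall>N. alg_submodule A M N \<longrightarrow> N = {\<zero>\<^bsub>M\<^esub>} \<or> N = carrier M)"

definition module_iso :: "('k :: field, 'a) module \<Rightarrow> ('k, 'a, 'm) lmodule \<Rightarrow> ('k, 'a, 'n) lmodule
    \<Rightarrow> bool" where
  "module_iso A M N \<longleftrightarrow> (\<exists>\<phi>. bij_betw \<phi> (carrier M) (carrier N) \<and>
     (\<forall>m \<in> carrier M. \<forall>n \<in> carrier M. \<phi> (m \<oplus>\<^bsub>M\<^esub> n) = \<phi> m \<oplus>\<^bsub>N\<^esub> \<phi> n) \<and>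
     (\<forall>k. \<forall>m \<in> carrier M. \<phi> (k \<odot>\<^bsub>M\<^esub> m) = k \<odot>\<^bsub>N\<^esub> \<phi> m) \<and>
     (\<forall>a \<in> carrier A. \<forall>m \<in> carrier M. \<phi> (act M a m) = act N a (\<phi> m)))"

definition fin_dim :: "('k :: field, 'a, 'm) lmodule \<Rightarrow> bool" where
  "fin_dim M \<longleftrightarrow> (\<exists>B. finite B \<and> B \<subseteq> carrier M \<and>
     (\<forall>N. submodule N (ring_of_type_algebra :: 'k ring) M \<and> B \<subseteq> N \<longrightarrow> N = carrier M))"


section \<open>Spectral modules\<close>

text \<open>
  \<open>lpa_gpd E\<close> is the graph of the isomorphism \<open>L\<^sub>K(E) \<cong> A\<^sub>K(G\<^sub>E)\<close>, i.e. of the linear map sending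
  \<open>\<mu>\<nu>\<^sup>*\<close> to the indicator function of \<open>Z\<^sub>(\<^sub>\<mu>\<^sub>,\<^sub>\<nu>\<^sub>)\<close>; \<open>A\<^sub>K(G\<^sub>E)\<close> is the set of its values.
\<close>

inductive lpa_gpd :: "('v, 'e) pre_digraph \<Rightarrow> ('v, 'e, 'k :: field) lpa_elt
    \<Rightarrow> (('v, 'e) arrow \<Rightarrow> 'k) \<Rightarrow> bool" for E where
  zero: "lpa_gpd E \<zero>\<^bsub>lpa E\<^esub> (\<lambda>_. 0)"
| step: "lpa_gpd E z F \<Longrightarrow> (\<mu>, \<nu>) \<in> range_pairs E \<Longrightarrow>
    lpa_gpd E (z \<oplus>\<^bsub>lpa E\<^esub> (k \<odot>\<^bsub>lpa E\<^esub> lpa_mono E \<mu> \<nu>))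
              (\<lambda>\<gamma>. F \<gamma> + k * indicator (gpd_Z E \<mu> \<nu>) \<gamma>)"

definition gpd_act :: "('v, 'e) pre_digraph \<Rightarrow> ('k :: field, ('v, 'e, 'k) lpa_elt, 'm) lmodule
    \<Rightarrow> (('v, 'e) arrow \<Rightarrow> 'k) \<Rightarrow> 'm \<Rightarrow> 'm" where
  "gpd_act E M F = act M (THE z. lpa_gpd E z F)"

definition Res :: "('v, 'e) pre_digraph \<Rightarrow> ('k :: field, ('v, 'e, 'k) lpa_elt, 'm) lmodule
    \<Rightarrow> ('v, 'e) bpath \<Rightarrow> 'm set" where
  "Res E M x = (\<Inter>U \<in> {U. compact_open E U \<and> x \<in> U}.
     gpd_act E M (indicator (units_of_set U)) ` carrier M)"

definition spectral :: "('v, 'e) pre_digraph \<Rightarrow> ('k :: field, ('v, 'e, 'k) lpa_elt, 'm) lmodule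
    \<Rightarrow> bool" where
  "spectral E M \<longleftrightarrow> (\<exists>x \<in> boundary E. Res E M x \<noteq> {\<zero>\<^bsub>M\<^esub>})"


section \<open>Chen modules\<close>

text \<open>The (partial) action of the generators on basis paths.\<close>

fun basis_act :: "('v, 'e) pre_digraph \<Rightarrow> ('v, 'e) gen \<Rightarrow> ('v, 'e) bpath \<Rightarrow> ('v, 'e) bpath option"
  where
  "basis_act E (Vx v) p = (if v = bsource E p then Some p else None)"
| "basis_act E (Ed e) p =
     (if head E e = bsource E p then Some (prepend (tail E e, [e]) p) else None)"
| "basis_act E (Gh e) (FinP u []) = None"
| "basis_act E (Gh e) (FinP u (d # q)) = (if d = e then Some (FinP (head E e) q) else None)"
| "basis_act E (Gh e) (InfP \<omega>) = (if shd \<omega> = e then Some (InfP (stl \<omega>)) else None)"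

text \<open>
  Weights \<open>b e p\<close> twist the action to \<open>e.p = b e p \<cdot> ep\<close> and \<open>e\<^sup>*.(ep) = (b e p)\<^sup>-\<^sup>1 \<cdot> p\<close>.  The
  twist by the automorphism \<open>\<sigma>\<^sub>a\<close> of a family \<open>a\<close> of edge weights is the case
  \<open>b = edge_weights a\<close>; the reason for admitting weights that depend on \<open>p\<close> is given below.
\<close>

type_synonym ('v, 'e, 'r) weights = "'e \<Rightarrow> ('v, 'e) bpath \<Rightarrow> 'r"

definition edge_weights :: "('e \<Rightarrow> 'r) \<Rightarrow> ('v, 'e, 'r) weights" where
  "edge_weights a = (\<lambda>e p. a e)"

fun gen_weight :: "('v, 'e) pre_digraph \<Rightarrow> 'r ring \<Rightarrow> ('v, 'e, 'r) weights
    \<Rightarrow> ('v, 'e) gen \<Rightarrow> ('v, 'e) bpath \<Rightarrow> 'r" where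
  "gen_weight E R b (Vx v) p = \<one>\<^bsub>R\<^esub>"
| "gen_weight E R b (Ed e) p = b e p"
| "gen_weight E R b (Gh e) p = inv\<^bsub>R\<^esub> (b e (the (basis_act E (Gh e) p)))"

definition gen_act :: "('v, 'e) pre_digraph \<Rightarrow> 'r ring \<Rightarrow> ('v, 'e) bpath set \<Rightarrow> ('v, 'e, 'r) weights
    \<Rightarrow> ('v, 'e) gen \<Rightarrow> (('v, 'e) bpath \<Rightarrow> 'r) \<Rightarrow> ('v, 'e) bpath \<Rightarrow> 'r" where
  "gen_act E R S b g m = (\<lambda>q. \<Oplus>\<^bsub>R\<^esub>p \<in> {p \<in> S. m p \<noteq> \<zero>\<^bsub>R\<^esub> \<and> basis_act E g p = Some q}.
     gen_weight E R b g p \<otimes>\<^bsub>R\<^esub> m p)"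

definition free_act :: "('v, 'e) pre_digraph \<Rightarrow> 'r ring \<Rightarrow> ('k :: field \<Rightarrow> 'r)
    \<Rightarrow> ('v, 'e) bpath set \<Rightarrow> ('v, 'e, 'r) weights \<Rightarrow> ('v, 'e, 'k) free
    \<Rightarrow> (('v, 'e) bpath \<Rightarrow> 'r) \<Rightarrow> ('v, 'e) bpath \<Rightarrow> 'r" where
  "free_act E R h S b a m = (\<lambda>q. \<Oplus>\<^bsub>R\<^esub>w \<in> Poly_Mapping.keys a.
     h (Poly_Mapping.lookup a w) \<otimes>\<^bsub>R\<^esub> foldr (gen_act E R S b) (letters w) m q)"

text \<open>
  The twisted Chen module with coefficients in a field \<open>R\<close>, restricted from \<open>L\<^sub>R(E)\<close> to \<open>L\<^sub>K(E)\<close>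
  along a homomorphism \<open>h : K \<rightarrow> R\<close>.  An element of \<open>L\<^sub>K(E)\<close> acts through any representative in the
  free algebra.
\<close>

definition twisted_chen :: "('v, 'e) pre_digraph \<Rightarrow> 'r ring \<Rightarrow> ('k :: field \<Rightarrow> 'r)
    \<Rightarrow> ('v, 'e) bpath \<Rightarrow> ('v, 'e, 'r) weights
    \<Rightarrow> ('k, ('v, 'e, 'k) lpa_elt, ('v, 'e) bpath \<Rightarrow> 'r) lmodule" where
  "twisted_chen E R h x b =
     \<lparr>carrier = {m. (\<forall>p. m p \<in> carrier R) \<and> (\<forall>p. p \<notin> tail_class E x \<longrightarrow> m p = \<zero>\<^bsub>R\<^esub>) \<and>
                    finite {p. m p \<noteq> \<zero>\<^bsub>R\<^esub>}},
      monoid.mult = undefined,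
      one = undefined,
      ring.zero = (\<lambda>p. \<zero>\<^bsub>R\<^esub>),
      add = (\<lambda>m n p. m p \<oplus>\<^bsub>R\<^esub> n p),
      module.smult = (\<lambda>k m p. h k \<otimes>\<^bsub>R\<^esub> m p),
      act = (\<lambda>z. free_act E R h (tail_class E x) b (SOME a. a \<in> z))\<rparr>"

definition chen :: "('v, 'e) pre_digraph \<Rightarrow> ('v, 'e) bpath
    \<Rightarrow> ('k :: field, ('v, 'e, 'k) lpa_elt, ('v, 'e) bpath \<Rightarrow> 'k) lmodule" where
  "chen E x = twisted_chen E ring_of_type_algebra id x (edge_weights (\<lambda>e. 1))"

text \<open>The field \<open>K' = K[t, t\<^sup>-\<^sup>1] / (f)\<close>; Laurent polynomials have type \<^typ>\<open>int \<Rightarrow>\<^sub>0 'k\<close>.\<close>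

definition laurent_of_poly :: "'k :: field poly \<Rightarrow> int \<Rightarrow>\<^sub>0 'k" where
  "laurent_of_poly f = (\<Sum>i\<le>degree f. Poly_Mapping.single (int i) (poly.coeff f i))"

definition laurent_ideal :: "'k :: field poly \<Rightarrow> (int \<Rightarrow>\<^sub>0 'k) set" where
  "laurent_ideal f = PIdl\<^bsub>ring_of_type_algebra\<^esub> (laurent_of_poly f)"

definition ext_field :: "'k :: field poly \<Rightarrow> (int \<Rightarrow>\<^sub>0 'k) set ring" where
  "ext_field f = ring_of_type_algebra Quot laurent_ideal f"

definition ext_class :: "'k :: field poly \<Rightarrow> (int \<Rightarrow>\<^sub>0 'k) \<Rightarrow> (int \<Rightarrow>\<^sub>0 'k) set" where
  "ext_class f g = laurent_ideal f +>\<^bsub>ring_of_type_algebra\<^esub> g"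

definition ext_embed :: "'k :: field poly \<Rightarrow> 'k \<Rightarrow> (int \<Rightarrow>\<^sub>0 'k) set" where
  "ext_embed f k = ext_class f (Poly_Mapping.single 0 k)"

definition ext_t :: "'k :: field poly \<Rightarrow> (int \<Rightarrow>\<^sub>0 'k) set" where
  "ext_t f = ext_class f (Poly_Mapping.single 1 1)"

text \<open>
  The scalar by which \<open>c\<close> acts on the basis element \<open>c\<^sup>\<infinity>\<close>: the product over \<open>i\<close> of the weights
  with which \<open>e\<^sub>i\<close> acts on \<open>e\<^sub>i\<^sub>+\<^sub>1 \<dots> e\<^sub>n c\<^sup>\<infinity>\<close>.  For edge weights \<open>a\<close> it is \<open>a\<^sub>c\<close>.
\<close>

definition loop_weight :: "'r ring \<Rightarrow> 'e list \<Rightarrow> ('v, 'e, 'r) weights \<Rightarrow> 'r" where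
  "loop_weight R c b =
     (\<Otimes>\<^bsub>R\<^esub>i \<in> {..<length c}. b (c ! i) (InfP (drop (Suc i) c @- Stream.cycle c)))"

lemma loop_weight_edge_weights:
  "loop_weight R c (edge_weights a) = (\<Otimes>\<^bsub>R\<^esub>i \<in> {..<length c}. a (c ! i))"
  by (simp add: loop_weight_def edge_weights_def)

text \<open>
  The twists defining \<open>V\<^sup>f\<close> at \<open>c\<^sup>\<infinity>\<close>: nonzero weights with \<open>loop_weight\<close> equal to the class of \<open>t\<close>.
  Edge weights \<open>a\<close> with \<open>a\<^sub>c\<close> equal to the class of \<open>t\<close> are among them, but they need not
  exist: for two loops \<open>e\<close>, \<open>g\<close> at one vertex and the simple closed path \<open>c = eegg\<close> one has
  \<open>a\<^sub>c = (a\<^sub>e a\<^sub>g)\<^sup>2\<close>, while \<open>t\<close> may fail to be a square in \<open>K'\<close> (e.g. for \<open>f = t - 2\<close> over the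
  rationals).  Weights depending on the basis path always exist (take \<open>b e p\<close> to be the class of
  \<open>t\<close> if \<open>ep = c\<^sup>\<infinity>\<close> and \<open>1\<close> otherwise), and up to isomorphism the module only depends on the
  loop weight, so they give \<open>V\<^sup>f\<close> for every \<open>c\<close> without changing it when edge weights exist.
\<close>

definition twists :: "('v, 'e) pre_digraph \<Rightarrow> 'k :: field poly \<Rightarrow> 'e list
    \<Rightarrow> ('v, 'e, (int \<Rightarrow>\<^sub>0 'k) set) weights set" where
  "twists E f c = {b.
     (\<forall>e \<in> arcs E. \<forall>p \<in> tail_class E (cinf c). head E e = bsource E p \<longrightarrow>
        b e p \<in> Units (ext_field f)) \<and>
     loop_weight (ext_field f) c b = ext_t f}"

lemma edge_weights_in_twists:
  assumes "\<And>e. e \<in> arcs E \<Longrightarrow> a e \<in> Units (ext_field f)"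
    and "(\<Otimes>\<^bsub>ext_field f\<^esub>i \<in> {..<length c}. a (c ! i)) = ext_t f"
  shows "edge_weights a \<in> twists E f c"
  using assms by (simp add: twists_def loop_weight_edge_weights) (simp add: edge_weights_def)

definition chen_poly :: "('v, 'e) pre_digraph \<Rightarrow> 'k :: field poly \<Rightarrow> 'e list
    \<Rightarrow> ('v, 'e, (int \<Rightarrow>\<^sub>0 'k) set) weights
    \<Rightarrow> ('k, ('v, 'e, 'k) lpa_elt, ('v, 'e) bpath \<Rightarrow> (int \<Rightarrow>\<^sub>0 'k) set) lmodule" where
  "chen_poly E f c b = twisted_chen E (ext_field f) (ext_embed f) (cinf c) b"

text \<open>
  The parameters of the third family.  Since \<open>K'\<close> and the class of \<open>t\<close> depend on \<open>f\<close> only up to a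
  nonzero scalar, so do the conditions \<open>f \<noteq> t\<close> and \<open>f \<noteq> t - 1\<close>.
\<close>

definition poly_params :: "('v, 'e) pre_digraph
    \<Rightarrow> ('k :: field poly \<times> 'e list \<times> ('v, 'e, (int \<Rightarrow>\<^sub>0 'k) set) weights) set" where
  "poly_params E = {(f, c, b).
     Factorial_Ring.irreducible f \<and> (\<forall>k. f \<noteq> Polynomial.smult k [:0, 1:]) \<and>
     (\<forall>k. f \<noteq> Polynomial.smult k [:-1, 1:]) \<and> simple_closed E c \<and> b \<in> twists E f c}"

text \<open>
  \<open>M\<close> is isomorphic to a member of the list whose path (\<open>x\<close>, \<open>w\<close> or \<open>c\<^sup>\<infinity>\<close>) satisfies \<open>P\<close>.
\<close>

definition listed :: "('v, 'e) pre_digraph \<Rightarrow> ('v, 'e) bpath set \<Rightarrow> (('v, 'e) bpath \<Rightarrow> bool)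
    \<Rightarrow> ('k :: field, ('v, 'e, 'k) lpa_elt, 'm) lmodule \<Rightarrow> bool" where
  "listed E D P M \<longleftrightarrow>
     (\<exists>\<omega>. InfP \<omega> \<in> D \<and> P (InfP \<omega>) \<and> module_iso (lpa E) M (chen E (InfP \<omega>))) \<or>
     (\<exists>w \<in> verts E. \<not> regular E w \<and> P (FinP w []) \<and> module_iso (lpa E) M (chen E (FinP w []))) \<or>
     (\<exists>(f, c, b) \<in> poly_params E. P (cinf c) \<and> module_iso (lpa E) M (chen_poly E f c b))"

end

theory Submission
  imports Defs "HOL-Computational_Algebra.Polynomial_Factorial"
begin

text \<open>
  The proof reads a module as a representation of the groupoid of the graph.  For a boundary path \<open>x\<close>
  the stalk of a module at \<open>x\<close> consists of the vectors that every \<open>\<mu>\<mu>\<^sup>*\<close> either fixes or kills, according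
  to whether \<open>\<mu>\<close> is an initial segment of \<open>x\<close>.  An arrow \<open>(q, k, p)\<close> transports the stalk at \<open>p\<close> to the
  stalk at \<open>q\<close> through any monomial \<open>\<mu>\<nu>\<^sup>*\<close> that represents it, transport is functorial, and the algebra
  acts on stalk vectors through transport only (\<open>A_stalk\<close>).  Since cylinders separate points, the sum of
  the stalks is direct (\<open>stalks_independent\<close>).

  The subspaces defining spectral modules are exactly the stalks (\<open>Res_eq_stalk\<close>).  This needs that
  the comparison map from the Leavitt path algebra to the groupoid algebra is injective, so that a
  function on the groupoid determines the element that acts (\<open>lpa_gpd_injective\<close>, by a normal form for
  monomials), and that compact open sets of boundary paths are finite unions of cylinders minus
  finitely many smaller cylinders, so that their indicators belong to the algebra.

  Let now \<open>m\<close> be a nonzero stalk vector at \<open>x\<close> in a simple module.  The module is generated by \<open>m\<close>, and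
  the annihilator of \<open>m\<close> is determined by the linear relations among its translates under the isotropy
  group at \<open>x\<close>; simple modules with stalk vectors satisfying the same isotropy relations are isomorphic
  (\<open>simple_modules_iso\<close>).  Isotropy groups are trivial or infinite cyclic, and in the second case \<open>x\<close> is
  in the orbit of \<open>c\<^sup>\<infinity>\<close> for a simple closed path \<open>c\<close> (\<open>isotropy_cases\<close>).  If the group is trivial, the module
  is the Chen module of \<open>x\<close>.  If it is cyclic, the stalk at \<open>c\<^sup>\<infinity>\<close> is a module over \<open>K[t, 1/t]\<close>, where \<open>t\<close> acts
  through \<open>c\<close>.  Simplicity of the module forces a vector \<open>m\<close> to be annihilated by some nonzero polynomial
  (\<open>stalk_annihilating_laurent\<close>), and one of least degree is irreducible.  For \<open>f = t - 1\<close> the isotropy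
  group fixes a vector and the module is again a Chen module without twist; otherwise it is the module
  of \<open>f\<close>.  All of the listed modules are simple because the functions supported at a single path form the
  stalks and each of them generates; they are pairwise nonisomorphic because an isomorphism preserves the
  set of points with nonzero stalk and the annihilators in \<open>K[t, 1/t]\<close>.

  A finite dimensional simple module has a nonzero stalk, because the decreasing idempotents of the
  initial segments of a path become stationary on every vector; its orbit is finite, because translates
  to distinct points are independent.
\<close>

section \<open>Finite paths, boundary paths and cylinder sets\<close>

definition cyl :: "('v, 'e) pre_digraph => ('v, 'e) fpath => ('v, 'e) bpath set" where
  "cyl E \<mu> = {prepend \<mu> x | x. composable E \<mu> x}"

abbreviation econs :: "('v, 'e) pre_digraph => 'e => ('v, 'e) bpath => ('v, 'e) bpath" where
  "econs E e x \<equiv> prepend (tail E e, [e]) x"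

lemma stream_eqI_stake:
  assumes "\<And>n. stake n s = stake n t"
  shows "s = t"
proof -
  have "s !! n = t !! n" for n
    using stake_nth[of n "Suc n" s] stake_nth[of n "Suc n" t] assms by simp
  thus ?thesis by (metis stream.map_ident stream_smap_nats smap_alt)
qed

locale path_graph = wf_digraph E for E :: "('v, 'e) pre_digraph"
begin

lemma fin_paths_Nil [simp]: "(u, []) \<in> fin_paths E \<longleftrightarrow> u \<in> verts E"
  by (auto simp: fin_paths_def awalk_Nil_iff)

lemma fin_paths_Cons [simp]:
  "(u, e # p) \<in> fin_paths E \<longleftrightarrow> e \<in> arcs E \<and> u = tail E e \<and> (head E e, p) \<in> fin_paths E"
  by (auto simp: fin_paths_def awalk_Cons_iff)

lemma prange_Nil [simp]: "prange E (u, []) = u"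
  by (simp add: prange_def)

lemma prange_Cons [simp]: "prange E (u, e # p) = prange E (head E e, p)"
  by (simp add: prange_def)

lemma prange_append: "prange E (u, p @ q) = prange E (prange E (u, p), q)"
  by (induction p arbitrary: u) auto

lemma fin_paths_append:
  "(u, p @ q) \<in> fin_paths E \<longleftrightarrow> (u, p) \<in> fin_paths E \<and> (prange E (u, p), q) \<in> fin_paths E"
  by (induction p arbitrary: u) (auto, cases q, auto)

lemma fin_paths_source: "(u, p) \<in> fin_paths E ==> u \<in> verts E"
  by (cases p) auto

lemma fin_paths_prange: "(u, p) \<in> fin_paths E ==> prange E (u, p) \<in> verts E"
  by (induction p arbitrary: u) auto

lemma FinP_boundary [simp]:
  "FinP u p \<in> boundary E \<longleftrightarrow> (u, p) \<in> fin_paths E \<and> \<not> regular E (prange E (u, p))"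
  by (auto simp: boundary_def)

lemma InfP_boundary [simp]: "InfP \<omega> \<in> boundary E \<longleftrightarrow> \<omega> \<in> inf_paths E"
  by (auto simp: boundary_def)

lemma inf_paths_SCons [simp]:
  "e ## \<omega> \<in> inf_paths E \<longleftrightarrow> e \<in> arcs E \<and> head E e = tail E (shd \<omega>) \<and> \<omega> \<in> inf_paths E"
proof
  assume "e ## \<omega> \<in> inf_paths E"
  hence a: "sset (e ## \<omega>) \<subseteq> arcs E"
    and b: "\<And>i. head E ((e ## \<omega>) !! i) = tail E ((e ## \<omega>) !! Suc i)"
    by (auto simp: inf_paths_def)
  from b[of 0] have "head E e = tail E (shd \<omega>)" by simp
  moreover have "\<forall>i. head E (\<omega> !! i) = tail E (\<omega> !! Suc i)" using b[of "Suc _"] by simp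
  ultimately show "e \<in> arcs E \<and> head E e = tail E (shd \<omega>) \<and> \<omega> \<in> inf_paths E"
    using a by (auto simp: inf_paths_def)
next
  assume a: "e \<in> arcs E \<and> head E e = tail E (shd \<omega>) \<and> \<omega> \<in> inf_paths E"
  have "head E ((e ## \<omega>) !! i) = tail E ((e ## \<omega>) !! Suc i)" for i
    using a by (cases i) (auto simp: inf_paths_def)
  thus "e ## \<omega> \<in> inf_paths E" using a by (auto simp: inf_paths_def)
qed

lemma bsource_verts: "x \<in> boundary E ==> bsource E x \<in> verts E"
proof (cases x)
  case (InfP \<omega>)
  moreover assume "x \<in> boundary E"
  moreover have "shd \<omega> \<in> sset \<omega>" by (rule shd_sset)
  ultimately show ?thesis by (auto simp: inf_paths_def)
qed (auto dest: fin_paths_source)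

lemma bsource_econs [simp]: "bsource E (econs E e x) = tail E e"
  by (cases x) auto

lemma econs_boundary:
  "head E e = bsource E x ==> econs E e x \<in> boundary E \<longleftrightarrow> e \<in> arcs E \<and> x \<in> boundary E"
  by (cases x) auto

lemma boundary_cases:
  assumes "x \<in> boundary E"
  obtains (vertex) w where "w \<in> verts E" "\<not> regular E w" "x = FinP w []"
  | (edge) e y where "e \<in> arcs E" "y \<in> boundary E" "head E e = bsource E y" "x = econs E e y"
proof (cases x)
  case (FinP u p)
  show thesis
  proof (cases p)
    case Nil
    thus thesis using FinP assms by (intro vertex[of u]) auto
  next
    case (Cons e q)
    thus thesis using FinP assms by (intro edge[of e "FinP (head E e) q"]) auto
  qed
next
  case (InfP \<omega>)
  thus thesis using assms by (cases \<omega>) (auto intro!: edge[of "shd \<omega>" "InfP (stl \<omega>)"])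
qed

lemma econs_inj:
  assumes "econs E e x = econs E e' x'" "head E e = bsource E x" "head E e' = bsource E x'"
  shows "e = e' \<and> x = x'"
  using assms by (cases x; cases x') simp_all

lemma econs_neq_vertex [simp]: "econs E e y \<noteq> FinP w []" "FinP w [] \<noteq> econs E e y"
  by (cases y; simp)+

lemma prepend_Nil: "bsource E x = u ==> prepend (u, []) x = x"
  by (cases x) auto

lemma prepend_Cons: "prepend (tail E e, e # p) x = econs E e (prepend (v, p) x)"
  by (cases x) auto

lemma prepend_append: "prepend (u, p @ q) x = prepend (u, p) (prepend (v, q) x)"
  by (cases x) auto

lemma composable_Nil [simp]:
  "composable E (u, []) x \<longleftrightarrow> x \<in> boundary E \<and> u = bsource E x"
  by (auto simp: composable_def bsource_verts)

lemma composable_Cons [simp]: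
  "composable E (u, e # p) x \<longleftrightarrow> e \<in> arcs E \<and> u = tail E e \<and> composable E (head E e, p) x"
  by (auto simp: composable_def)

lemma composable_boundary: "composable E \<mu> x ==> x \<in> boundary E"
  by (simp add: composable_def)

lemma composable_prepend:
  assumes "composable E (u, p) x"
  shows "prepend (u, p) x \<in> boundary E \<and> bsource E (prepend (u, p) x) = u"
  using assms
proof (induction p arbitrary: u)
  case Nil
  thus ?case by (simp add: prepend_Nil)
next
  case (Cons e p)
  hence *: "prepend (head E e, p) x \<in> boundary E" "bsource E (prepend (head E e, p) x) = head E e"
    and "u = tail E e" "e \<in> arcs E" by auto
  thus ?case using prepend_Cons[of e p x "head E e"] by (simp add: econs_boundary)
qed

lemma composable_append:
  "composable E (u, p @ q) x \<longleftrightarrow>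
     composable E (prange E (u, p), q) x \<and> (u, p) \<in> fin_paths E"
  by (auto simp: composable_def fin_paths_append prange_append)

lemma prepend_eq_prefix:
  assumes "composable E (u, p) x" "composable E (u', p') x'"
    and "prepend (u, p) x = prepend (u', p') x'" "length p \<le> length p'"
  shows "u = u' \<and> (\<exists>q. p' = p @ q \<and> composable E (prange E (u, p), q) x' \<and>
           x = prepend (prange E (u, p), q) x')"
  using assms
proof (induction p arbitrary: u u' p')
  case Nil
  thus ?case using composable_prepend[of u' p' x'] by (auto simp: prepend_Nil)
next
  case (Cons e p)
  obtain e' p'' where p': "p' = e' # p''" using Cons.prems by (cases p') auto
  have c: "composable E (head E e, p) x" "composable E (head E e', p'') x'" "u = tail E e" "u' = tail E e'"
    using Cons.prems p' by auto
  have "econs E e (prepend (head E e, p) x) = econs E e' (prepend (head E e', p'') x')"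
    using Cons.prems(3) prepend_Cons[of e p x] prepend_Cons[of e' p'' x'] by (simp add: c p')
  from econs_inj[OF this] composable_prepend[OF c(1)] composable_prepend[OF c(2)]
  have e: "e = e'" "prepend (head E e, p) x = prepend (head E e', p'') x'" by auto
  from Cons.IH[OF c(1,2) e(2)] Cons.prems(4) p' e c show ?case by auto
qed

lemma prepend_inj:
  assumes "composable E \<mu> x" "composable E \<mu> y" "prepend \<mu> x = prepend \<mu> y"
  shows "x = y"
proof (cases \<mu>)
  case (Pair u p)
  thus ?thesis using prepend_eq_prefix[of u p x u p y] assms
    by (auto simp: prepend_Nil)
qed

lemma cyl_boundary: "x \<in> cyl E \<mu> ==> x \<in> boundary E"
  by (cases \<mu>) (auto simp: cyl_def dest: composable_prepend)

lemma cyl_source: "x \<in> cyl E (u, p) ==> bsource E x = u"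
  by (auto simp: cyl_def dest: composable_prepend)

lemma cyl_fin_paths: "x \<in> cyl E \<mu> ==> \<mu> \<in> fin_paths E"
  by (auto simp: cyl_def composable_def)

lemma cyl_Nil [simp]: "x \<in> cyl E (u, []) \<longleftrightarrow> x \<in> boundary E \<and> bsource E x = u"
  by (auto simp: cyl_def prepend_Nil intro!: exI[of _ x])

lemma cyl_Cons:
  "x \<in> cyl E (u, e # p) \<longleftrightarrow>
     e \<in> arcs E \<and> u = tail E e \<and> (\<exists>y \<in> cyl E (head E e, p). x = econs E e y)"
  by (auto simp: cyl_def prepend_Cons[of e p _ "head E e"])

lemma cyl_append:
  "prepend (u, p) x \<in> cyl E (u, p @ q) \<longleftrightarrow> x \<in> cyl E (prange E (u, p), q)"
  if "composable E (u, p) x" for u p x q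
proof
  assume "prepend (u, p) x \<in> cyl E (u, p @ q)"
  then obtain y where y: "composable E (u, p @ q) y" "prepend (u, p) x = prepend (u, p @ q) y"
    by (auto simp: cyl_def)
  from prepend_eq_prefix[OF that y] y show "x \<in> cyl E (prange E (u, p), q)"
    by (auto simp: cyl_def)
next
  assume "x \<in> cyl E (prange E (u, p), q)"
  then obtain y where "composable E (prange E (u, p), q) y" "x = prepend (prange E (u, p), q) y"
    by (auto simp: cyl_def)
  thus "prepend (u, p) x \<in> cyl E (u, p @ q)" using that
    unfolding cyl_def by (intro CollectI exI[of _ y])
      (simp add: composable_append prepend_append[of u p q _ "prange E (u, p)"] composable_def
        fin_paths_append prange_append)
qed

lemma cyl_append_subset:
  assumes "x \<in> cyl E (u, p @ q)"
  shows "x \<in> cyl E (u, p)"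
proof -
  obtain y where y: "composable E (u, p @ q) y" "x = prepend (u, p @ q) y"
    using assms by (auto simp: cyl_def)
  hence "composable E (u, p) (prepend (prange E (u, p), q) y)"
    using composable_prepend[of "prange E (u, p)" q y] by (auto simp: composable_append composable_def fin_paths_append prange_append)
  thus ?thesis using y by (auto simp: cyl_def prepend_append[of u p q _ "prange E (u, p)"])
qed

lemma cyl_meet:
  assumes "x \<in> cyl E (u, p)" "x \<in> cyl E (u', p')" "length p \<le> length p'"
  shows "u = u' \<and> (\<exists>q. p' = p @ q)"
proof -
  obtain y y' where "composable E (u, p) y" "composable E (u', p') y'"
    "prepend (u, p) y = prepend (u', p') y'"
    using assms by (auto simp: cyl_def)
  from prepend_eq_prefix[OF this assms(3)] show ?thesis by blast
qed

lemma cyl_exact: "FinP u p \<in> boundary E ==> FinP u p \<in> cyl E (u, p)"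
  by (auto simp: cyl_def composable_def fin_paths_prange intro!: exI[of _ "FinP (prange E (u, p)) []"])

lemma cyl_stake:
  assumes "\<omega> \<in> inf_paths E"
  shows "InfP \<omega> \<in> cyl E (tail E (shd \<omega>), stake n \<omega>)"
  using assms
proof (induction n arbitrary: \<omega>)
  case 0
  thus ?case by simp
next
  case (Suc n)
  obtain e \<eta> where \<omega>: "\<omega> = e ## \<eta>" by (cases \<omega>)
  hence "InfP \<eta> \<in> cyl E (tail E (shd \<eta>), stake n \<eta>)" "head E e = tail E (shd \<eta>)" "e \<in> arcs E"
    using Suc by auto
  thus ?case by (auto simp: \<omega> cyl_Cons intro!: bexI[of _ "InfP \<eta>"])
qed

lemma cyl_finite:
  assumes "FinP v l \<in> cyl E (u, p)"
  shows "length p \<le> length l \<and> v = u"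
proof -
  obtain y where "FinP v l = prepend (u, p) y" using assms by (auto simp: cyl_def)
  thus ?thesis by (cases y) auto
qed

lemma prepend_InfP: "prepend \<mu> (InfP \<omega>) = InfP (snd \<mu> @- \<omega>)"
  by (cases \<mu>) simp

lemma prepend_FinP: "prepend \<mu> (FinP v q) = FinP (fst \<mu>) (snd \<mu> @ q)"
  by (cases \<mu>) simp

text \<open>Cylinder sets separate points; in the topology generated by them and their complements this
  is the Hausdorff property.\<close>

lemma cyl_separates:
  assumes "x \<in> boundary E" "y \<in> boundary E" and eq: "\<And>\<mu>. x \<in> cyl E \<mu> \<longleftrightarrow> y \<in> cyl E \<mu>"
  shows "x = y"
proof (cases x)
  case x: (FinP u p)
  show ?thesis
  proof (cases y)
    case y: (FinP v q)
    have "y \<in> cyl E (u, p)" "x \<in> cyl E (v, q)" using eq cyl_exact x y assms(1,2) by blast+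
    hence "length p = length q" using cyl_finite[of v q u p] cyl_finite[of u p v q] x y by simp
    thus ?thesis using cyl_meet[OF \<open>y \<in> cyl E (u, p)\<close>, of v q] cyl_exact[of v q] assms(2) x y by auto
  next
    case y: (InfP \<eta>)
    have "x \<in> cyl E (tail E (shd \<eta>), stake (Suc (length p)) \<eta>)"
      using cyl_stake[of \<eta>] assms(2) y by (simp add: eq del: stake.simps)
    from cyl_finite[OF this[unfolded x]] show ?thesis by simp
  qed
next
  case x: (InfP \<omega>)
  show ?thesis
  proof (cases y)
    case y: (FinP v q)
    have "y \<in> cyl E (tail E (shd \<omega>), stake (Suc (length q)) \<omega>)"
      using cyl_stake[of \<omega>] assms(1) x by (simp add: eq[symmetric] del: stake.simps)
    from cyl_finite[OF this[unfolded y]] show ?thesis by simp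
  next
    case y: (InfP \<eta>)
    have "stake n \<omega> = stake n \<eta>" for n
    proof -
      have "x \<in> cyl E (tail E (shd \<omega>), stake n \<omega>)" "x \<in> cyl E (tail E (shd \<eta>), stake n \<eta>)"
        using eq cyl_stake assms(1,2) x y by auto
      then obtain q where "stake n \<eta> = stake n \<omega> @ q" using cyl_meet by fastforce
      moreover from arg_cong[OF this, of length] have "q = []" by simp
      ultimately show ?thesis by simp
    qed
    hence "\<omega> = \<eta>" by (rule stream_eqI_stake)
    thus ?thesis using x y by simp
  qed
qed

end

section \<open>The groupoid and its isotropy\<close>

context path_graph
begin

text \<open>Cylinders are nested or disjoint, so adding a point to a finite set only requires refining
  one cylinder that contains it.\<close>

lemma cyl_isolates:
  assumes "finite P" "P \<noteq> {}" "P \<subseteq> boundary E"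
  shows "\<exists>p\<in>P. \<exists>\<mu>. P \<inter> cyl E \<mu> = {p}"
  using assms
proof (induction rule: finite_ne_induct)
  case (singleton x)
  thus ?case by (intro bexI[of _ x] exI[of _ "(bsource E x, [])"]) auto
next
  case (insert q P)
  then obtain p \<mu> where p: "p \<in> P" "P \<inter> cyl E \<mu> = {p}" by auto
  show ?case
  proof (cases "q \<in> cyl E \<mu>")
    case False
    thus ?thesis using p by (intro bexI[of _ p] exI[of _ \<mu>]) auto
  next
    case True
    have "p \<noteq> q" using p insert.hyps by auto
    then obtain \<nu> where \<nu>: "(p \<in> cyl E \<nu>) \<noteq> (q \<in> cyl E \<nu>)"
      using cyl_separates[of p q] insert.prems p by auto
    then obtain a b where ab: "{a, b} = {p, q}" "a \<in> cyl E \<nu>" "b \<notin> cyl E \<nu>"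
      by (cases "p \<in> cyl E \<nu>") auto
    have a: "a \<in> cyl E \<mu>" "b \<in> cyl E \<mu>" using ab True p by (auto simp: doubleton_eq_iff)
    have "cyl E \<nu> \<subseteq> cyl E \<mu>"
    proof (cases "length (snd \<mu>) \<le> length (snd \<nu>)")
      case True
      thus ?thesis using cyl_meet[of a "fst \<mu>" "snd \<mu>" "fst \<nu>" "snd \<nu>"] a ab cyl_append_subset
        by (metis prod.collapse subsetI)
    next
      case False
      hence "cyl E \<mu> \<subseteq> cyl E \<nu>"
        using cyl_meet[of a "fst \<nu>" "snd \<nu>" "fst \<mu>" "snd \<mu>"] a ab cyl_append_subset
        by (metis prod.collapse subsetI nle_le)
      thus ?thesis using a ab by auto
    qed
    hence "insert q P \<inter> cyl E \<nu> \<subseteq> {p, q}" using p by auto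
    hence "insert q P \<inter> cyl E \<nu> = {a}" using ab p by (auto simp: doubleton_eq_iff)
    thus ?thesis using ab p by (intro bexI[of _ a] exI[of _ \<nu>]) (auto simp: doubleton_eq_iff)
  qed
qed

lemma composable_extend:
  assumes "composable E \<mu> z" "z = prepend (bsource E z, q) y" "composable E (bsource E z, q) y"
  shows "composable E (fst \<mu>, snd \<mu> @ q) y" "prepend (fst \<mu>, snd \<mu> @ q) y = prepend \<mu> z"
proof -
  have "prange E (fst \<mu>, snd \<mu>) = bsource E z" using assms by (simp add: composable_def)
  thus "composable E (fst \<mu>, snd \<mu> @ q) y"
    using assms by (auto simp: composable_append) (simp add: composable_def)
  show "prepend (fst \<mu>, snd \<mu> @ q) y = prepend \<mu> z"
    using prepend_append[of "fst \<mu>" "snd \<mu>" q y "bsource E z"] assms(2) by simp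
qed

lemma gpdI:
  "composable E \<mu> z ==> composable E \<nu> z ==> k = plength \<mu> - plength \<nu> ==>
     (prepend \<mu> z, k, prepend \<nu> z) \<in> gpd E"
  unfolding gpd_def by blast

lemma gpdE:
  assumes "(x, k, y) \<in> gpd E"
  obtains \<mu> \<nu> z where "composable E \<mu> z" "composable E \<nu> z" "k = plength \<mu> - plength \<nu>"
    "x = prepend \<mu> z" "y = prepend \<nu> z"
  using assms by (auto simp: gpd_def)

lemma gpd_boundary: "(x, k, y) \<in> gpd E ==> x \<in> boundary E \<and> y \<in> boundary E"
  by (metis gpdE composable_prepend prod.collapse)

lemma gpd_refl: "x \<in> boundary E ==> (x, 0, x) \<in> gpd E"
  using gpdI[of "(bsource E x, [])" x "(bsource E x, [])"] by (simp add: prepend_Nil)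

lemma gpd_inv: "(x, k, y) \<in> gpd E ==> (y, - k, x) \<in> gpd E"
  by (elim gpdE) (auto intro!: gpdI)

lemma gpd_econs:
  assumes "e \<in> arcs E" "y \<in> boundary E" "head E e = bsource E y"
  shows "(econs E e y, 1, y) \<in> gpd E"
  using gpdI[of "(tail E e, [e])" y "(bsource E y, [])" 1] assms
  by (simp add: prepend_Nil plength_def)

lemma gpd_common:
  assumes "composable E \<mu> z" "composable E \<nu> z'" "prepend \<mu> z = prepend \<nu> z'"
    and "length (snd \<mu>) \<le> length (snd \<nu>)"
  obtains q where "\<nu> = (fst \<mu>, snd \<mu> @ q)" "z = prepend (bsource E z, q) z'"
    "composable E (bsource E z, q) z'"
proof -
  from prepend_eq_prefix[of "fst \<mu>" "snd \<mu>" z "fst \<nu>" "snd \<nu>" z'] assms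
  obtain q where "fst \<mu> = fst \<nu>" "snd \<nu> = snd \<mu> @ q" "composable E (prange E \<mu>, q) z'"
    "z = prepend (prange E \<mu>, q) z'" by auto
  thus thesis using that[of q] assms(1) by (cases \<nu>) (auto simp: composable_def)
qed

lemma gpd_comp:
  assumes "(x, k, y) \<in> gpd E" "(y, l, w) \<in> gpd E"
  shows "(x, k + l, w) \<in> gpd E"
proof -
  from assms(1) obtain \<mu> \<nu> z where 1: "composable E \<mu> z" "composable E \<nu> z"
    "k = plength \<mu> - plength \<nu>" "x = prepend \<mu> z" "y = prepend \<nu> z" by (rule gpdE)
  from assms(2) obtain \<kappa> \<rho> z' where 2: "composable E \<kappa> z'" "composable E \<rho> z'"
    "l = plength \<kappa> - plength \<rho>" "y = prepend \<kappa> z'" "w = prepend \<rho> z'" by (rule gpdE)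
  show ?thesis
  proof (cases "length (snd \<nu>) \<le> length (snd \<kappa>)")
    case True
    from 1 2 obtain q where q: "\<kappa> = (fst \<nu>, snd \<nu> @ q)" "z = prepend (bsource E z, q) z'"
      "composable E (bsource E z, q) z'"
      using gpd_common[OF _ _ _ True, of z z'] by auto
    from composable_extend[OF 1(1) q(2,3)] gpdI[of "(fst \<mu>, snd \<mu> @ q)" z' \<rho>] 1 2 q
    show ?thesis by (auto simp: plength_def algebra_simps)
  next
    case False
    from 1 2 False obtain q where q: "\<nu> = (fst \<kappa>, snd \<kappa> @ q)" "z' = prepend (bsource E z', q) z"
      "composable E (bsource E z', q) z"
      using gpd_common[of \<kappa> z' \<nu> z] by auto
    from composable_extend[OF 2(2) q(2,3)] gpdI[of \<mu> z "(fst \<rho>, snd \<rho> @ q)"] 1 2 q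
    show ?thesis by (auto simp: plength_def algebra_simps)
  qed
qed

lemma tail_class_eq: "tail_class E x = {y. \<exists>k. (x, k, y) \<in> gpd E}"
  by (auto simp: tail_class_def gpd_def) blast+

lemma orbit_eq_tail_class: "orbit E x = tail_class E x"
  using gpd_boundary by (auto simp: orbit_def tail_class_eq)

lemma tail_class_refl: "x \<in> boundary E ==> x \<in> tail_class E x"
  using gpd_refl by (auto simp: tail_class_eq)

lemma tail_class_subset: "tail_class E x \<subseteq> boundary E"
  using gpd_boundary by (auto simp: tail_class_eq)

lemma tail_class_eqI: "(x, k, y) \<in> gpd E ==> tail_class E x = tail_class E y"
  unfolding tail_class_eq using gpd_inv gpd_comp by blast

lemma tail_class_econs:
  assumes "e \<in> arcs E" "y \<in> boundary E" "head E e = bsource E y"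
  shows "econs E e y \<in> tail_class E x \<longleftrightarrow> y \<in> tail_class E x"
  using gpd_econs[OF assms] gpd_comp gpd_inv unfolding tail_class_eq by blast


lemma gpd_FinP:
  assumes "(x, k, FinP v q) \<in> gpd E"
  shows "\<exists>u p. x = FinP u p \<and> k = int (length p) - int (length q) \<and> prange E (u, p) = prange E (v, q)"
proof -
  from assms obtain \<mu> \<nu> z where *: "composable E \<mu> z" "composable E \<nu> z"
    "k = plength \<mu> - plength \<nu>" "x = prepend \<mu> z" "FinP v q = prepend \<nu> z" by (rule gpdE)
  then obtain w r where z: "z = FinP w r" by (cases z) (auto simp: prepend_InfP)
  have "prange E (fst \<mu>, snd \<mu> @ r) = prange E (fst \<nu>, snd \<nu> @ r)"
    using *(1,2) by (simp add: prange_append composable_def)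
  thus ?thesis using * by (auto simp: z prepend_FinP plength_def)
qed

lemma gpd_vertex:
  assumes "FinP u p \<in> boundary E"
  shows "(FinP u p, int (length p), FinP (prange E (u, p)) []) \<in> gpd E"
  using gpdI[of "(u, p)" "FinP (prange E (u, p)) []" "(prange E (u, p), [])"] assms
  by (simp add: plength_def composable_def fin_paths_prange)


lemma stake_composable:
  assumes "\<omega> \<in> inf_paths E"
  shows "composable E (tail E (shd \<omega>), stake n \<omega>) (InfP (sdrop n \<omega>))"
proof -
  obtain y where y: "composable E (tail E (shd \<omega>), stake n \<omega>) y"
    "InfP \<omega> = prepend (tail E (shd \<omega>), stake n \<omega>) y"
    using cyl_stake[OF assms, of n] by (auto simp: cyl_def)
  then obtain \<eta> where "y = InfP \<eta>" by (cases y) auto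
  with y(2) have "stake n \<omega> @- sdrop n \<omega> = stake n \<omega> @- \<eta>" by (simp add: stake_sdrop)
  thus ?thesis using y(1) \<open>y = InfP \<eta>\<close> by simp
qed

lemma gpd_InfP_iff:
  assumes "\<omega> \<in> inf_paths E" "\<eta> \<in> inf_paths E"
  shows "(InfP \<omega>, k, InfP \<eta>) \<in> gpd E \<longleftrightarrow>
     (\<exists>m n. k = int m - int n \<and> sdrop m \<omega> = sdrop n \<eta>)"
proof
  assume "(InfP \<omega>, k, InfP \<eta>) \<in> gpd E"
  then obtain \<mu> \<nu> z where "composable E \<mu> z" "composable E \<nu> z"
    and *: "k = plength \<mu> - plength \<nu>" "InfP \<omega> = prepend \<mu> z" "InfP \<eta> = prepend \<nu> z"
    by (rule gpdE)
  then obtain \<zeta> where z: "z = InfP \<zeta>" by (cases z) (auto simp: prepend_FinP)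
  thus "\<exists>m n. k = int m - int n \<and> sdrop m \<omega> = sdrop n \<eta>" using *
    by (intro exI[of _ "length (snd \<mu>)"] exI[of _ "length (snd \<nu>)"])
      (auto simp: prepend_InfP plength_def sdrop_shift)
next
  assume "\<exists>m n. k = int m - int n \<and> sdrop m \<omega> = sdrop n \<eta>"
  then obtain m n where mn: "k = int m - int n" "sdrop m \<omega> = sdrop n \<eta>" by blast
  have "composable E (tail E (shd \<eta>), stake n \<eta>) (InfP (sdrop m \<omega>))"
    using stake_composable[OF assms(2), of n] mn by simp
  from gpdI[OF stake_composable[OF assms(1), of m] this, of k] mn(1)
  show "(InfP \<omega>, k, InfP \<eta>) \<in> gpd E"
    by (simp add: plength_def stake_sdrop) (simp add: mn(2) stake_sdrop)
qed

lemma tail_class_InfP: "y \<in> tail_class E (InfP \<omega>) ==> \<exists>\<eta>. y = InfP \<eta>"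
proof -
  assume "y \<in> tail_class E (InfP \<omega>)"
  then obtain k where k: "(InfP \<omega>, k, y) \<in> gpd E" by (auto simp: tail_class_eq)
  thus ?thesis using gpd_FinP by (cases y) fastforce+
qed

end

lemma shift_fixed_unique:
  assumes "s = c @- s" "t = c @- t" "c \<noteq> []"
  shows "s = t"
proof -
  have "s !! n = t !! n" for n
  proof (induction n rule: less_induct)
    case (less n)
    show ?case
    proof (cases "n < length c")
      case True
      thus ?thesis using assms(1,2) by (metis shift_snth_less)
    next
      case False
      hence "s !! n = s !! (n - length c)" "t !! n = t !! (n - length c)"
        using assms(1,2) by (metis not_less shift_snth_ge)+
      moreover have "n - length c < n" using False assms(3) by (cases c) auto
      ultimately show ?thesis using less by simp
    qed
  qed
  thus ?thesis by (metis stream.map_ident smap_alt)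
qed

lemma sdrop_period_cycle:
  assumes "sdrop n s = s" "n > 0"
  shows "s = Stream.cycle (stake n s)"
proof (rule shift_fixed_unique[of _ "stake n s"])
  show "s = stake n s @- s" using stake_sdrop[of n s] assms by simp
  show "Stream.cycle (stake n s) = stake n s @- Stream.cycle (stake n s)"
    using assms by (intro cycle_decomp) auto
qed (use assms in auto)

lemma sdrop_period_mult: "sdrop n s = s ==> sdrop (k * n) s = s"
  by (induction k) (auto simp flip: sdrop_add)

lemma stake_period_mult:
  "sdrop n s = s ==> stake (k * n) s = concat (replicate k (stake n s))"
  by (induction k) (simp_all flip: stake_add)

lemma sdrop_period_dvd:
  assumes "sdrop g s = s" "g > 0" "\<And>i. 0 < i ==> i < g ==> sdrop i s \<noteq> s" "sdrop n s = s"
  shows "g dvd n"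
proof (rule ccontr)
  assume "\<not> g dvd n"
  hence r: "0 < n mod g" "n mod g < g" using assms(2) by (auto simp: dvd_eq_mod_eq_0)
  have "sdrop (n mod g) (sdrop ((n div g) * g) s) = sdrop n s"
    by (simp add: mult.commute)
  hence "sdrop (n mod g) s = s" using sdrop_period_mult[OF assms(1)] assms(4) by simp
  thus False using assms(3) r by blast
qed

lemma obtain_least_period:
  assumes "sdrop n s = s" "n > (0 :: nat)"
  obtains g where "sdrop g s = s" "g > 0" "\<And>i. 0 < i ==> i < g ==> sdrop i s \<noteq> s"
proof -
  let ?P = "\<lambda>g. 0 < g \<and> sdrop g s = s"
  have "?P (Least ?P)" by (rule LeastI[of ?P n]) (simp add: assms)
  moreover have "\<not> ?P i" if "i < Least ?P" for i using that by (rule not_less_Least)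
  ultimately show thesis using that[of "Least ?P"] by blast
qed

lemma rotate_concat_replicate:
  "rotate (length d) (concat (replicate m d)) = concat (replicate m d)"
proof (cases m)
  case (Suc k)
  have "concat (replicate k d) @ d = d @ concat (replicate k d)"
    by (induction k) auto
  thus ?thesis using Suc by (simp add: rotate_append)
qed simp

context path_graph
begin

lemma closed_walk_nth:
  assumes "awalk u c v" "Suc i < length c"
  shows "head E (c ! i) = tail E (c ! Suc i)"
  using assms
proof (induction c arbitrary: u i)
  case (Cons e c)
  then obtain f c' where "c = f # c'" by (cases c) auto
  thus ?case using Cons by (cases i) (auto simp: awalk_Cons_iff)
qed simp

lemma closed_walk_last: "awalk u c v ==> c \<noteq> [] ==> head E (last c) = v"
proof (induction c arbitrary: u)
  case (Cons e c)
  thus ?case by (cases c) (simp_all add: awalk_simps)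
qed simp

lemma closed_w_cycle:
  assumes "closed_w c"
  shows "c \<noteq> []" "Stream.cycle c \<in> inf_paths E" "(bsource E (cinf c), c) \<in> fin_paths E"
    "prange E (bsource E (cinf c), c) = bsource E (cinf c)"
proof -
  from assms obtain u where u: "awalk u c u" "c \<noteq> []" by (auto simp: closed_w_def)
  thus "c \<noteq> []" by simp
  have dec: "Stream.cycle c = c @- Stream.cycle c" using u by (rule_tac cycle_decomp) auto
  have hd: "tail E (hd c) = u" using u by (cases c) (auto simp: awalk_Cons_iff)
  have s: "bsource E (cinf c) = u" using u hd by (simp add: cinf_def)
  have shift: "Stream.cycle c !! n = (if n < length c then c ! n else Stream.cycle c !! (n - length c))" for n
    by (subst dec) (simp add: shift_snth)
  have "head E (Stream.cycle c !! i) = tail E (Stream.cycle c !! Suc i)" for i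
  proof (induction i rule: less_induct)
    case (less i)
    consider "Suc i < length c" | "Suc i = length c" | "length c \<le> i" by linarith
    thus ?case
    proof cases
      case 1
      thus ?thesis using closed_walk_nth[OF u(1)] shift[of i] shift[of "Suc i"] by simp
    next
      case 2
      hence "c ! i = last c" using u(2) by (metis last_conv_nth diff_Suc_1)
      moreover have "Stream.cycle c !! 0 = hd c" using u by simp
      ultimately show ?thesis using 2 closed_walk_last[OF u] shift[of i] shift[of "Suc i"] hd
        by simp
    next
      case 3
      moreover have "Suc i - length c = Suc (i - length c)" using 3 by simp
      moreover have "i - length c < i" using 3 u(2) by (cases c) auto
      ultimately show ?thesis using less[of "i - length c"] shift[of i] shift[of "Suc i"]
        by simp
    qed
  qed
  thus "Stream.cycle c \<in> inf_paths E" using u by (auto simp: inf_paths_def)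
  show "(bsource E (cinf c), c) \<in> fin_paths E" using u by (auto simp: s fin_paths_def)
  show "prange E (bsource E (cinf c), c) = bsource E (cinf c)" using u by (simp add: s prange_def)
qed

lemma periodic_stake_closed:
  assumes "\<omega> \<in> inf_paths E" "sdrop n \<omega> = \<omega>" "n > 0"
  shows "closed_w (stake n \<omega>)"
proof -
  have "composable E (tail E (shd \<omega>), stake n \<omega>) (InfP \<omega>)"
    using stake_composable[OF assms(1), of n] assms(2) by simp
  hence "awalk (tail E (shd \<omega>)) (stake n \<omega>) (tail E (shd \<omega>))"
    by (auto simp: composable_def fin_paths_def prange_def)
  thus ?thesis using assms(3) by (auto simp: closed_w_def)
qed

text \<open>A simple closed path is a primitive word: its length is the least period of \<open>c\<^sup>\<infinity>\<close>.\<close>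

lemma simple_closed_period:
  assumes "simple_closed E c"
  shows "sdrop n (Stream.cycle c) = Stream.cycle c \<longleftrightarrow> length c dvd n"
proof
  let ?s = "Stream.cycle c"
  have cl: "closed_w c" and prim: "\<And>d m. closed_w d ==> d \<noteq> c ==> c \<noteq> concat (replicate m d)"
    using assms by (auto simp: simple_closed_def)
  note c = closed_w_cycle[OF cl]
  have per: "sdrop (length c) ?s = ?s" using c by simp
  obtain g where g: "sdrop g ?s = ?s" "g > 0" "\<And>i. 0 < i ==> i < g ==> sdrop i ?s \<noteq> ?s"
    using obtain_least_period[OF per] c(1) by auto
  then obtain m where m: "length c = m * g" using sdrop_period_dvd[OF g(1,2) _ per]
    by (metis dvdE mult.commute)
  have "c = stake (m * g) ?s" using c(1) m by (metis stake_cycle_eq)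
  hence "c = concat (replicate m (stake g ?s))" using stake_period_mult[OF g(1)] by simp
  hence "stake g ?s = c" using prim[OF periodic_stake_closed[OF c(2) g(1,2)]] by blast
  hence "length c = g" by (metis length_stake)
  thus "sdrop n ?s = ?s ==> length c dvd n" using sdrop_period_dvd[OF g(1,2)] g(3) by blast
  show "length c dvd n ==> sdrop n ?s = ?s" using sdrop_period_mult[OF per]
    by (metis dvdE mult.commute)
qed

lemma cinf_boundary: "simple_closed E c ==> cinf c \<in> boundary E"
  using closed_w_cycle[of c] by (simp add: simple_closed_def cinf_def)

lemma simple_closed_isotropy:
  assumes "simple_closed E c"
  shows "(cinf c, k, cinf c) \<in> gpd E \<longleftrightarrow> int (length c) dvd k"
proof -
  let ?s = "Stream.cycle c"
  have c: "c \<noteq> []" "?s \<in> inf_paths E"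
    using assms closed_w_cycle by (auto simp: simple_closed_def)
  have per: "sdrop m ?s = sdrop (m + i) ?s \<longleftrightarrow> length c dvd i" for m i
  proof -
    \<comment> \<open>move both sides forward to a multiple of the period\<close>
    have "sdrop (m * length c - m) (sdrop m ?s) = sdrop (m * length c - m) (sdrop (m + i) ?s) \<longleftrightarrow>
      sdrop (m * length c) ?s = sdrop (i + m * length c) ?s"
      using c(1) by (cases "length c") (auto simp: algebra_simps)
    also have "\<dots> \<longleftrightarrow> ?s = sdrop i ?s"
      using sdrop_period_mult[of "length c" ?s m] c(1) simple_closed_period[OF assms]
      by (metis add.commute dvd_refl sdrop_add)
    finally have "sdrop m ?s = sdrop (m + i) ?s ==> length c dvd i"
      using simple_closed_period[OF assms, of i] by auto
    moreover have "length c dvd i ==> sdrop m ?s = sdrop (m + i) ?s"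
      using simple_closed_period[OF assms, of i] by (metis add.commute sdrop_add)
    ultimately show ?thesis by blast
  qed
  show ?thesis
  proof
    assume "(cinf c, k, cinf c) \<in> gpd E"
    then obtain m n where mn: "k = int m - int n" "sdrop m ?s = sdrop n ?s"
      using gpd_InfP_iff[OF c(2) c(2)] by (auto simp: cinf_def)
    show "int (length c) dvd k"
    proof (cases "m \<le> n")
      case True
      then obtain i where "n = m + i" by (auto simp: le_iff_add)
      thus ?thesis using mn per by auto
    next
      case False
      then obtain i where "m = n + i" by (metis le_iff_add nle_le)
      thus ?thesis using mn per[of n i] by simp
    qed
  next
    assume "int (length c) dvd k"
    moreover have "(cinf c, int i, cinf c) \<in> gpd E" if "length c dvd i" for i
    proof -
      have "int i = int i - int 0" "sdrop i ?s = sdrop 0 ?s"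
        using that simple_closed_period[OF assms] by simp_all
      thus ?thesis unfolding cinf_def gpd_InfP_iff[OF c(2) c(2)] by blast
    qed
    ultimately have "(cinf c, \<bar>k\<bar>, cinf c) \<in> gpd E"
      by (metis abs_ge_zero dvd_abs_iff int_dvd_int_iff nonneg_int_cases)
    thus "(cinf c, k, cinf c) \<in> gpd E" using gpd_inv[of "cinf c" "\<bar>k\<bar>" "cinf c"]
      by (cases "k \<ge> 0") auto
  qed
qed

text \<open>A boundary path with nontrivial isotropy is eventually periodic; cutting at the least period
  yields a simple closed path.\<close>

lemma isotropy_cases:
  assumes "x \<in> boundary E"
  obtains (trivial) "\<And>k. (x, k, x) \<in> gpd E ==> k = 0"
    | (periodic) c where "simple_closed E c" "x \<in> tail_class E (cinf c)"
proof (cases "\<forall>k. (x, k, x) \<in> gpd E --> k = 0")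
  case True
  thus thesis using trivial by blast
next
  case False
  then obtain k where k: "(x, k, x) \<in> gpd E" "k \<noteq> 0" by blast
  then obtain \<omega> where x: "x = InfP \<omega>" using gpd_FinP by (cases x) fastforce+
  hence \<omega>: "\<omega> \<in> inf_paths E" using assms by simp
  obtain m n where "k = int m - int n" "sdrop m \<omega> = sdrop n \<omega>"
    using gpd_InfP_iff[OF \<omega> \<omega>] k x by auto
  then obtain m n where mn: "sdrop m \<omega> = sdrop n \<omega>" "m < n" using k(2)
    by (metis linorder_neqE_nat diff_self)
  define s where "s = sdrop m \<omega>"
  have "sdrop (n - m) s = sdrop (m + (n - m)) \<omega>" unfolding s_def by (rule sdrop_add)
  hence "sdrop (n - m) s = s" using mn by (simp add: s_def)
  then obtain g where g: "sdrop g s = s" "g > 0" "\<And>i. 0 < i ==> i < g ==> sdrop i s \<noteq> s"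
    using obtain_least_period[of "n - m" s] mn(2) by auto
  have s: "s \<in> inf_paths E" using stake_composable[OF \<omega>, of m] by (simp add: composable_def s_def)
  let ?c = "stake g s"
  have sc: "s = Stream.cycle ?c" using sdrop_period_cycle[OF g(1,2)] .
  have "simple_closed E ?c" unfolding simple_closed_def
  proof (intro conjI allI impI)
    show "closed_w ?c" using periodic_stake_closed[OF s g(1,2)] .
    fix d j assume d: "closed_w d \<and> d \<noteq> ?c"
    show "?c \<noteq> concat (replicate j d)"
    proof
      assume e: "?c = concat (replicate j d)"
      have "rotate (length d) ?c = ?c"
        using rotate_concat_replicate[of d j] unfolding e[symmetric] .
      hence "sdrop (length d) (Stream.cycle ?c) = Stream.cycle ?c"
        using sdrop_cycle[of ?c "length d"] g(2) rotate_conv_mod[of "length d" ?c] by simp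
      hence "sdrop (length d) s = s" unfolding sc[symmetric] .
      moreover have "g = j * length d"
        using arg_cong[OF e, of length] by (simp add: length_concat sum_list_replicate)
      moreover have "j \<noteq> 1"
      proof
        assume "j = 1"
        hence "?c = d" using e by simp
        thus False using d by simp
      qed
      moreover have "length d > 0" using d by (auto simp: closed_w_def)
      ultimately have "length d < g" using g(2) by (cases j) auto
      thus False using g(3)[of "length d"] \<open>length d > 0\<close> \<open>sdrop (length d) s = s\<close> by blast
    qed
  qed
  moreover have "x \<in> tail_class E (cinf ?c)"
  proof -
    have "- int m = int 0 - int m" "sdrop 0 s = sdrop m \<omega>" by (simp_all add: s_def)
    hence "(InfP s, - int m, InfP \<omega>) \<in> gpd E"
      unfolding gpd_InfP_iff[OF s \<omega>] by blast
    moreover have ceq: "cinf ?c = InfP s" by (simp only: cinf_def sc[symmetric])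
    ultimately have "(cinf ?c, - int m, x) \<in> gpd E" by (simp only: x ceq)
    thus ?thesis unfolding tail_class_eq by blast
  qed
  ultimately show thesis by (rule periodic)
qed

end

section \<open>Vector spaces given by records\<close>

abbreviation single :: "'i => 'b :: zero => 'i \<Rightarrow>\<^sub>0 'b" where "single \<equiv> Poly_Mapping.single"
abbreviation lookup :: "('i \<Rightarrow>\<^sub>0 'b :: zero) => 'i => 'b" where "lookup \<equiv> Poly_Mapping.lookup"
abbreviation keys :: "('i \<Rightarrow>\<^sub>0 'b :: zero) => 'i set" where "keys \<equiv> Poly_Mapping.keys"

lemma type_ring_simps [simp]:
  "carrier ring_of_type_algebra = UNIV"
  "x \<otimes>\<^bsub>ring_of_type_algebra\<^esub> y = x * y"
  "\<one>\<^bsub>ring_of_type_algebra\<^esub> = 1"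
  "x \<oplus>\<^bsub>ring_of_type_algebra\<^esub> y = x + y"
  "\<zero>\<^bsub>ring_of_type_algebra\<^esub> = 0"
  by (simp_all add: ring_of_type_algebra_def)

lemma type_ring: "ring (ring_of_type_algebra :: 'a :: ring_1 ring)"
proof -
  have "\<exists>y. x + y = 0" "\<exists>y. y + x = 0" for x :: 'a
    by (rule exI[of _ "- x"], simp)+
  thus ?thesis
    by unfold_locales (auto simp: algebra_simps Units_def)
qed

lemma type_ring_minus: "\<ominus>\<^bsub>ring_of_type_algebra\<^esub> x = - (x :: 'a :: ring_1)"
proof -
  interpret ring "ring_of_type_algebra :: 'a ring" by (rule type_ring)
  show ?thesis using minus_equality[of "- x" x] by simp
qed

lemma poly_mapping_sum_singles:
  "a = (\<Sum>i\<in>keys a. single i (lookup a i))"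
  by (intro poly_mapping_eqI)
    (auto simp: lookup_sum lookup_single when_def in_keys_iff if_distrib sum.delta cong: if_cong)

definition lcomb :: "('k :: field, 'm, 'z) module_scheme => ('i => 'm) => ('i \<Rightarrow>\<^sub>0 'k) => 'm" where
  "lcomb M \<tau> a = (\<Oplus>\<^bsub>M\<^esub>i\<in>keys a. lookup a i \<odot>\<^bsub>M\<^esub> \<tau> i)"

definition linmap :: "('k :: field, 'm, 'y) module_scheme => ('k, 'n, 'z) module_scheme => ('m => 'n) => bool"
  where
  "linmap M N f \<longleftrightarrow> (\<forall>m\<in>carrier M. f m \<in> carrier N) \<and>
     (\<forall>m\<in>carrier M. \<forall>n\<in>carrier M. f (m \<oplus>\<^bsub>M\<^esub> n) = f m \<oplus>\<^bsub>N\<^esub> f n) \<and>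
     (\<forall>k. \<forall>m\<in>carrier M. f (k \<odot>\<^bsub>M\<^esub> m) = k \<odot>\<^bsub>N\<^esub> f m)"

lemma linmapD:
  assumes "linmap M N f"
  shows "m \<in> carrier M ==> f m \<in> carrier N"
    and "m \<in> carrier M ==> n \<in> carrier M ==> f (m \<oplus>\<^bsub>M\<^esub> n) = f m \<oplus>\<^bsub>N\<^esub> f n"
    and "m \<in> carrier M ==> f (k \<odot>\<^bsub>M\<^esub> m) = k \<odot>\<^bsub>N\<^esub> f m"
  using assms by (auto simp: linmap_def)

lemma linmap_comp: "linmap M N f ==> linmap N L g ==> linmap M L (\<lambda>m. g (f m))"
  by (simp add: linmap_def)

locale vspace = module "ring_of_type_algebra :: 'k ring" M
  for M :: "('k :: field, 'm, 'z) module_scheme" (structure)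
begin

lemma vsmult_closed [simp, intro]: "m \<in> carrier M ==> k \<odot> m \<in> carrier M"
  using smult_closed[of k m] by simp

lemma vsmult_add: "m \<in> carrier M ==> (k + l) \<odot> m = k \<odot> m \<oplus> l \<odot> m"
  using smult_l_distr[of k l m] by simp

lemma vsmult_distrib: "m \<in> carrier M ==> n \<in> carrier M ==> k \<odot> (m \<oplus> n) = k \<odot> m \<oplus> k \<odot> n"
  using smult_r_distr[of k m n] by simp

lemma vsmult_mult: "m \<in> carrier M ==> (k * l) \<odot> m = k \<odot> (l \<odot> m)"
  using smult_assoc1[of k l m] by simp

lemma vsmult_one [simp]: "m \<in> carrier M ==> 1 \<odot> m = m"
  using smult_one[of m] by simp

lemma vsmult_zero [simp]: "m \<in> carrier M ==> 0 \<odot> m = \<zero>\<^bsub>M\<^esub>"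
  using smult_l_null[of m] by simp

lemma vsmult_zero_right [simp]: "k \<odot> \<zero>\<^bsub>M\<^esub> = \<zero>\<^bsub>M\<^esub>"
  using smult_r_null[of k] by simp

lemma vsmult_minus_one: "m \<in> carrier M ==> (-1) \<odot> m = \<ominus> m"
  using vsmult_add[of m "-1" 1] M.minus_equality[of "(-1) \<odot> m" m] by simp

lemma minus_zero_imp_eq: "m \<in> carrier M ==> n \<in> carrier M ==> m \<ominus> n = \<zero>\<^bsub>M\<^esub> ==> m = n"
  using M.minus_equality[of m "\<ominus> n"] by (simp add: a_minus_def)

lemma vsmult_eq_zero: "m \<in> carrier M ==> k \<odot> m = \<zero>\<^bsub>M\<^esub> ==> k = 0 \<or> m = \<zero>\<^bsub>M\<^esub>"
proof (rule ccontr)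
  assume *: "m \<in> carrier M" "k \<odot> m = \<zero>\<^bsub>M\<^esub>" "\<not> (k = 0 \<or> m = \<zero>\<^bsub>M\<^esub>)"
  hence "m = (inverse k * k) \<odot> m" by simp
  also have "\<dots> = inverse k \<odot> (k \<odot> m)" using * by (intro vsmult_mult)
  also have "\<dots> = \<zero>\<^bsub>M\<^esub>" using * by simp
  finally show False using * by simp
qed

lemma linmap_zero:
  assumes "linmap M N f" "vspace N"
  shows "f \<zero>\<^bsub>M\<^esub> = \<zero>\<^bsub>N\<^esub>"
proof -
  interpret N: vspace N by fact
  have "f (0 \<odot> \<zero>\<^bsub>M\<^esub>) = 0 \<odot>\<^bsub>N\<^esub> f \<zero>\<^bsub>M\<^esub>" using linmapD(3)[OF assms(1)] by blast
  thus ?thesis using linmapD(1)[OF assms(1)] by simp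
qed

lemma linmap_finsum:
  assumes "linmap M N f" "vspace N" "finite I" "\<And>i. i \<in> I ==> \<tau> i \<in> carrier M"
  shows "f (\<Oplus>i\<in>I. \<tau> i) = (\<Oplus>\<^bsub>N\<^esub>i\<in>I. f (\<tau> i))"
proof -
  interpret N: vspace N by fact
  note f = linmapD[OF assms(1)]
  show ?thesis using assms(3,4)
  proof (induction I rule: finite_induct)
    case empty
    thus ?case using linmap_zero[OF assms(1,2)] by simp
  next
    case (insert i I)
    thus ?case by (simp add: f Pi_def)
  qed
qed

lemma linmap_smult: "linmap M M (\<lambda>m. k \<odot> m)"
  by (simp add: linmap_def vsmult_distrib mult.commute flip: vsmult_mult)

lemma lcomb_superset:
  assumes "finite I" "keys a \<subseteq> I" "\<And>i. i \<in> I ==> \<tau> i \<in> carrier M"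
  shows "lcomb M \<tau> a = (\<Oplus>i\<in>I. lookup a i \<odot> \<tau> i)"
  unfolding lcomb_def using assms
  by (intro M.add.finprod_mono_neutral_cong_left) (auto simp: in_keys_iff)

lemma lcomb_closed: "(\<And>i. i \<in> keys a ==> \<tau> i \<in> carrier M) ==> lcomb M \<tau> a \<in> carrier M"
  unfolding lcomb_def by (intro M.finsum_closed) auto

lemma lcomb_zero [simp]: "lcomb M \<tau> 0 = \<zero>\<^bsub>M\<^esub>"
  by (simp add: lcomb_def)

lemma lcomb_single:
  assumes "\<tau> i \<in> carrier M"
  shows "lcomb M \<tau> (single i k) = k \<odot> \<tau> i"
proof (cases "k = 0")
  case False
  thus ?thesis using assms by (simp add: lcomb_def)
qed (use assms in simp)

lemma lcomb_add:
  assumes "\<And>i. i \<in> keys a \<union> keys b ==> \<tau> i \<in> carrier M"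
  shows "lcomb M \<tau> (a + b) = lcomb M \<tau> a \<oplus> lcomb M \<tau> b"
proof -
  let ?I = "keys a \<union> keys b"
  have "lcomb M \<tau> (a + b) = (\<Oplus>i\<in>?I. lookup (a + b) i \<odot> \<tau> i)"
    using assms keys_add[of a b] by (intro lcomb_superset) auto
  also have "\<dots> = (\<Oplus>i\<in>?I. lookup a i \<odot> \<tau> i \<oplus> lookup b i \<odot> \<tau> i)"
    using assms by (intro M.finsum_cong') (auto simp: lookup_add vsmult_add)
  also have "\<dots> = (\<Oplus>i\<in>?I. lookup a i \<odot> \<tau> i) \<oplus> (\<Oplus>i\<in>?I. lookup b i \<odot> \<tau> i)"
    using assms by (intro M.finsum_addf) auto
  finally show ?thesis
    using assms lcomb_superset[of ?I a \<tau>] lcomb_superset[of ?I b \<tau>] by simp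
qed

lemma lcomb_uminus:
  assumes "\<And>i. i \<in> keys a ==> \<tau> i \<in> carrier M"
  shows "lcomb M \<tau> (- a) = \<ominus> lcomb M \<tau> a"
proof -
  have "lcomb M \<tau> (- a) \<oplus> lcomb M \<tau> a = \<zero>\<^bsub>M\<^esub>"
    using lcomb_add[of "- a" a \<tau>] assms by simp
  thus ?thesis using M.minus_equality lcomb_closed[of a \<tau>] lcomb_closed[of "- a" \<tau>] assms by simp
qed

lemma lcomb_cong:
  assumes "\<And>i. i \<in> keys a ==> \<tau> i = \<tau>' i"
    and "\<And>i. i \<in> keys a ==> \<tau>' i \<in> carrier M"
  shows "lcomb M \<tau> a = lcomb M \<tau>' a"
  unfolding lcomb_def using assms by (intro M.finsum_cong') auto

lemma linmap_lcomb:
  assumes "linmap M N f" "vspace N" "\<And>i. i \<in> keys a ==> \<tau> i \<in> carrier M"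
  shows "f (lcomb M \<tau> a) = lcomb N (\<lambda>i. f (\<tau> i)) a"
proof -
  interpret N: vspace N by fact
  note f = linmapD[OF assms(1)]
  show ?thesis unfolding lcomb_def using assms
    by (subst linmap_finsum[OF assms(1,2)]) (auto intro!: N.M.finsum_cong' simp: f)
qed

lemma linmap_lcomb_vectors:
  assumes "\<And>i. i \<in> keys a ==> linmap N M (\<lambda>m. \<tau> m i)"
  shows "linmap N M (\<lambda>m. lcomb M (\<tau> m) a)"
proof -
  note t = linmapD[OF assms]
  show ?thesis unfolding linmap_def
  proof (intro conjI ballI allI)
    fix m n k assume m: "m \<in> carrier N"
    show "lcomb M (\<tau> m) a \<in> carrier M" using t(1) m by (intro lcomb_closed)
    have "k \<odot> lcomb M (\<tau> m) a = lcomb M (\<lambda>i. k \<odot> \<tau> m i) a"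
      using t(1) m by (intro linmap_lcomb[OF linmap_smult]) (auto intro: vspace_axioms)
    also have "\<dots> = lcomb M (\<tau> (k \<odot>\<^bsub>N\<^esub> m)) a"
      using t m by (intro lcomb_cong) auto
    finally show "lcomb M (\<tau> (k \<odot>\<^bsub>N\<^esub> m)) a = k \<odot> lcomb M (\<tau> m) a" by simp
    assume n: "n \<in> carrier N"
    have "lcomb M (\<tau> (m \<oplus>\<^bsub>N\<^esub> n)) a =
        (\<Oplus>i\<in>keys a. lookup a i \<odot> \<tau> m i \<oplus> lookup a i \<odot> \<tau> n i)"
      unfolding lcomb_def using t m n by (intro M.finsum_cong') (auto simp: vsmult_distrib)
    also have "\<dots> = lcomb M (\<tau> m) a \<oplus> lcomb M (\<tau> n) a"
      unfolding lcomb_def using t m n by (intro M.finsum_addf) auto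
    finally show "lcomb M (\<tau> (m \<oplus>\<^bsub>N\<^esub> n)) a = lcomb M (\<tau> m) a \<oplus> lcomb M (\<tau> n) a" .
  qed
qed

lemma linmap_id: "linmap M M (\<lambda>m. m)"
  by (simp add: linmap_def)

lemma subspace_finsum:
  assumes "submodule N (ring_of_type_algebra :: 'k ring) M" "finite I" "\<And>i. i \<in> I ==> \<tau> i \<in> N"
  shows "(\<Oplus>i\<in>I. \<tau> i) \<in> N"
  using assms(2,3)
proof (induction I rule: finite_induct)
  case empty
  thus ?case using subgroup.one_closed[OF submodule.axioms(1)[OF assms(1)]] by simp
next
  case (insert i I)
  have "N \<subseteq> carrier M" using submoduleE(1)[OF assms(1)] .
  hence "(\<Oplus>j\<in>insert i I. \<tau> j) = \<tau> i \<oplus> (\<Oplus>j\<in>I. \<tau> j)"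
    using insert by (intro M.finsum_insert) auto
  thus ?case using insert submoduleE(5)[OF assms(1)] by simp
qed

lemma subspaceD:
  assumes "submodule N (ring_of_type_algebra :: 'k ring) M"
  shows "N \<subseteq> carrier M" "\<zero>\<^bsub>M\<^esub> \<in> N" "m \<in> N ==> n \<in> N ==> m \<oplus> n \<in> N" "m \<in> N ==> k \<odot> m \<in> N"
  using submoduleE[OF assms] subgroup.one_closed[OF submodule.axioms(1)[OF assms]] by auto

lemma subspaceI:
  assumes "N \<subseteq> carrier M" "\<zero>\<^bsub>M\<^esub> \<in> N" "\<And>m n. m \<in> N ==> n \<in> N ==> m \<oplus> n \<in> N"
    "\<And>k m. m \<in> N ==> k \<odot> m \<in> N"
  shows "submodule N (ring_of_type_algebra :: 'k ring) M"
proof (rule submoduleI)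
  fix m assume "m \<in> N"
  thus "\<ominus> m \<in> N" using assms(4)[of m "-1"] assms(1) vsmult_minus_one[of m] by auto
qed (use assms in auto)

end


section \<open>Leavitt path algebras and their modules\<close>

abbreviation unit_word :: "'g fword" where "unit_word \<equiv> FWord []"

lemma unit_word_zero: "unit_word = 0"
  by (simp add: zero_fword_def)

lemma FWord_add: "FWord u + FWord w = FWord (u @ w)"
  by (simp add: plus_fword_def)

lemma letters_add [simp]: "letters (u + w) = letters u @ letters w"
  by (simp add: plus_fword_def)

lemma letters_zero [simp]: "letters 0 = []"
  by (simp add: zero_fword_def)

lemma mon_mult: "mon (u @ w) = mon u * mon w"
  by (simp add: mon_def mult_single FWord_add)

definition free_elts :: "('v, 'e) pre_digraph => ('v, 'e, 'k :: field) free set" where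
  "free_elts E = {a. \<forall>w \<in> keys a. set (letters w) \<subseteq> gens E}"

text \<open>The augmentation ideal of the free algebra, i.e. the free non-unital algebra.\<close>

definition aug :: "('v, 'e) pre_digraph => ('v, 'e, 'k :: field) free set" where
  "aug E = {a \<in> free_elts E. lookup a unit_word = 0}"

lemma free_alg_simps [simp]:
  "carrier (free_alg E) = free_elts E"
  "x \<otimes>\<^bsub>free_alg E\<^esub> y = x * y"
  "\<one>\<^bsub>free_alg E\<^esub> = 1"
  "x \<oplus>\<^bsub>free_alg E\<^esub> y = x + y"
  "\<zero>\<^bsub>free_alg E\<^esub> = 0"
  by (simp_all add: free_alg_def free_elts_def ring_of_type_algebra_def)

lemma free_elts_zero [simp]: "0 \<in> free_elts E"
  and free_elts_one [simp]: "1 \<in> free_elts E"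
  by (auto simp: free_elts_def)

lemma free_elts_add [simp, intro]: "a \<in> free_elts E ==> b \<in> free_elts E ==> a + b \<in> free_elts E"
  using keys_add[of a b] by (auto simp: free_elts_def)

lemma free_elts_uminus [simp]: "- a \<in> free_elts E \<longleftrightarrow> a \<in> free_elts E"
  by (simp add: free_elts_def)

lemma free_elts_diff [simp, intro]: "a \<in> free_elts E ==> b \<in> free_elts E ==> a - b \<in> free_elts E"
  using free_elts_add[of a E "- b"] by simp

lemma free_elts_mult [simp, intro]: "a \<in> free_elts E ==> b \<in> free_elts E ==> a * b \<in> free_elts E"
  using keys_mult[of a b] by (fastforce simp: free_elts_def)

lemma free_elts_sum [intro]: "(\<And>i. i \<in> I ==> f i \<in> free_elts E) ==> (\<Sum>i\<in>I. f i) \<in> free_elts E"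
  by (induction I rule: infinite_finite_induct) auto

lemma free_elts_single [simp]:
  "set (letters w) \<subseteq> gens E ==> single w k \<in> free_elts E"
  by (auto simp: free_elts_def)

lemma free_elts_mon [simp]: "set w \<subseteq> gens E ==> mon w \<in> free_elts E"
  by (simp add: mon_def)

lemma aug_free [dest]: "a \<in> aug E ==> a \<in> free_elts E"
  by (simp add: aug_def)

lemma FWord_add_unit: "u + w = unit_word \<longleftrightarrow> u = unit_word \<and> w = unit_word"
  by (cases u; cases w) (auto simp: plus_fword_def)

lemma aug_add [simp, intro]: "a \<in> aug E ==> b \<in> aug E ==> a + b \<in> aug E"
  and aug_diff [simp, intro]: "a \<in> aug E ==> b \<in> aug E ==> a - b \<in> aug E"
  and aug_zero [simp]: "0 \<in> aug E"
  by (auto simp: aug_def lookup_add lookup_minus)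

lemma aug_mult [simp, intro]:
  assumes "a \<in> free_elts E" "b \<in> aug E"
  shows "a * b \<in> aug E"
proof -
  have "unit_word \<notin> keys (a * b)"
  proof
    assume "unit_word \<in> keys (a * b)"
    then obtain u w where "w \<in> keys b" "unit_word = u + w"
      using keys_mult[of a b] by auto
    hence "unit_word \<in> keys b" by (metis FWord_add_unit)
    thus False using assms by (simp add: aug_def in_keys_iff)
  qed
  thus ?thesis using assms by (auto simp: aug_def in_keys_iff)
qed

lemma aug_sum [intro]: "(\<And>i. i \<in> I ==> f i \<in> aug E) ==> (\<Sum>i\<in>I. f i) \<in> aug E"
  by (induction I rule: infinite_finite_induct) auto

lemma aug_mon [simp]: "set w \<subseteq> gens E ==> w \<noteq> [] ==> mon w \<in> aug E"
  by (auto simp: aug_def mon_def lookup_single)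

lemma aug_single [simp]: "set w \<subseteq> gens E ==> w \<noteq> [] ==> single (FWord w) k \<in> aug E"
  by (auto simp: aug_def lookup_single)

lemma aug_scale [simp]: "a \<in> aug E ==> single unit_word k * a \<in> aug E"
  by (intro aug_mult) auto

lemma aug_keys:
  assumes "a \<in> aug E" "w \<in> keys a"
  shows "letters w \<noteq> [] \<and> set (letters w) \<subseteq> gens E"
proof -
  have "w \<noteq> unit_word" using assms by (auto simp: aug_def in_keys_iff)
  hence "letters w \<noteq> []" by (cases w) simp
  thus ?thesis using assms by (simp add: aug_def free_elts_def)
qed

lemma scale_single:
  "single unit_word k * single w l = single w (k * l)"
  by (simp add: mult_single unit_word_zero)

context path_graph
begin

lemma free_alg_ring: "ring (free_alg E :: ('v, 'e, 'k :: field) free ring)"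
proof -
  interpret R: ring "ring_of_type_algebra :: ('v, 'e, 'k) free ring" by (rule type_ring)
  have "subring (free_elts E :: ('v, 'e, 'k) free set) ring_of_type_algebra"
    by (rule R.subringI) (auto simp: type_ring_minus)
  from R.subring_is_ring[OF this] show ?thesis by (simp add: free_alg_def free_elts_def)
qed

lemma gens_simps [simp]:
  "Vx v \<in> gens E \<longleftrightarrow> v \<in> verts E" "Ed e \<in> gens E \<longleftrightarrow> e \<in> arcs E" "Gh e \<in> gens E \<longleftrightarrow> e \<in> arcs E"
  by (auto simp: gens_def)

lemma relators_free: "(lpa_relators E :: ('v, 'e, 'k :: field) free set) \<subseteq> free_elts E"
proof -
  have "(\<Sum>e\<in>out_arcs E v. mon [Ed e, Gh e]) \<in> (free_elts E :: ('v, 'e, 'k) free set)" for v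
    by (intro free_elts_sum free_elts_mon) auto
  thus ?thesis by (auto simp: lpa_relators_def regular_def)
qed

lemma lpa_ideal: "ideal (lpa_ideal E :: ('v, 'e, 'k :: field) free set) (free_alg E)"
  unfolding lpa_ideal_def
  by (rule ring.genideal_ideal[OF free_alg_ring]) (simp add: relators_free)

lemma relator_in_ideal: "a \<in> lpa_relators E ==> a \<in> lpa_ideal E"
  unfolding lpa_ideal_def
  using ring.genideal_self[OF free_alg_ring, of "lpa_relators E"] relators_free by auto

lemma lpa_class_eq: "lpa_class E a = {i + a | i. i \<in> lpa_ideal E}"
  unfolding lpa_class_def by (auto simp: a_r_coset_def')

lemma ideal_ops:
  fixes a b c :: "('v, 'e, 'k :: field) free"
  shows ideal_zero: "0 \<in> (lpa_ideal E :: ('v, 'e, 'k) free set)"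
    and ideal_add: "a \<in> lpa_ideal E ==> b \<in> lpa_ideal E ==> a + b \<in> lpa_ideal E"
    and ideal_mult_left: "a \<in> lpa_ideal E ==> c \<in> free_elts E ==> c * a \<in> lpa_ideal E"
    and ideal_mult_right: "a \<in> lpa_ideal E ==> c \<in> free_elts E ==> a * c \<in> lpa_ideal E"
    and ideal_subset: "(lpa_ideal E :: ('v, 'e, 'k) free set) \<subseteq> free_elts E"
proof -
  interpret I: ideal "lpa_ideal E :: ('v, 'e, 'k) free set" "free_alg E" by (rule lpa_ideal)
  show "0 \<in> (lpa_ideal E :: ('v, 'e, 'k) free set)"
    using additive_subgroup.zero_closed[OF I.additive_subgroup_axioms] by simp
  show "a \<in> lpa_ideal E ==> b \<in> lpa_ideal E ==> a + b \<in> lpa_ideal E"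
    using additive_subgroup.a_closed[OF I.additive_subgroup_axioms] by simp
  show "a \<in> lpa_ideal E ==> c \<in> free_elts E ==> c * a \<in> lpa_ideal E"
    using I.I_l_closed by simp
  show "a \<in> lpa_ideal E ==> c \<in> free_elts E ==> a * c \<in> lpa_ideal E"
    using I.I_r_closed by simp
  show "(lpa_ideal E :: ('v, 'e, 'k) free set) \<subseteq> free_elts E" using I.a_subset by simp
qed

lemma ideal_uminus: "a \<in> lpa_ideal E ==> - a \<in> lpa_ideal E"
  using ideal_mult_left[of a "- 1"] by simp

lemma ideal_diff: "a \<in> lpa_ideal E ==> b \<in> lpa_ideal E ==> a - b \<in> lpa_ideal E"
  using ideal_add[of a "- b"] ideal_uminus[of b] by simp

lemma lpa_class_eq_iff: "lpa_class E a = lpa_class E b \<longleftrightarrow> a - b \<in> lpa_ideal E"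
proof
  assume "lpa_class E a = lpa_class E b"
  moreover have "0 + a \<in> lpa_class E a" unfolding lpa_class_eq using ideal_zero by blast
  ultimately obtain i where "i \<in> lpa_ideal E" "a = i + b" by (auto simp: lpa_class_eq)
  thus "a - b \<in> lpa_ideal E" by simp
next
  assume *: "a - b \<in> lpa_ideal E"
  have "i + a = (i + (a - b)) + b" "i + b = (i - (a - b)) + a" for i by (simp_all add: algebra_simps)
  thus "lpa_class E a = lpa_class E b" unfolding lpa_class_eq
    using ideal_add[OF _ *] ideal_diff[OF _ *] by blast
qed

lemma lpa_carrier: "carrier (lpa E) = lpa_class E ` aug E"
  by (auto simp: lpa_def aug_def)

lemma lpa_zero: "\<zero>\<^bsub>lpa E\<^esub> = lpa_class E 0"
  by (simp add: lpa_def FactRing_def lpa_class_eq)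

lemma lpa_class_hom: "lpa_class E \<in> ring_hom (free_alg E) (free_alg E Quot lpa_ideal E)"
  using ideal.rcos_ring_hom[OF lpa_ideal] unfolding lpa_class_def[abs_def] .

lemma lpa_add:
  "a \<in> free_elts E ==> b \<in> free_elts E ==>
     lpa_class E a \<oplus>\<^bsub>lpa E\<^esub> lpa_class E b = lpa_class E (a + b)"
  using ring_hom_add[OF lpa_class_hom, of a b] by (simp add: lpa_def)

lemma lpa_mult:
  "a \<in> free_elts E ==> b \<in> free_elts E ==>
     lpa_class E a \<otimes>\<^bsub>lpa E\<^esub> lpa_class E b = lpa_class E (a * b)"
  using ring_hom_mult[OF lpa_class_hom, of a b] by (simp add: lpa_def)

lemma lpa_smult:
  "a \<in> free_elts E ==>
     k \<odot>\<^bsub>lpa E\<^esub> lpa_class E a = lpa_class E (single unit_word k * a)"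
  using ring_hom_mult[OF lpa_class_hom, of "single unit_word k" a]
  by (simp add: lpa_def)

end

locale lpa_module = path_graph E + vspace M
  for E :: "('v, 'e) pre_digraph"
    and M :: "('k :: field, ('v, 'e, 'k) lpa_elt, 'm) lmodule" +
  assumes alg_module: "alg_module (lpa E) M"

lemma lpa_moduleI:
  "wf_digraph E ==> alg_module (lpa E) M ==> lpa_module E M"
  by (simp add: lpa_module_def lpa_module_axioms_def path_graph_def vspace_def alg_module_def)

context lpa_module
begin

definition A :: "('v, 'e, 'k) free => 'm => 'm" where
  "A a = act M (lpa_class E a)"

definition G :: "('v, 'e) gen => 'm => 'm" where
  "G g = A (mon [g])"

lemma act_closed: "z \<in> carrier (lpa E) ==> m \<in> carrier M ==> act M z m \<in> carrier M"
  using alg_module by (simp add: alg_module_def)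

lemma A_closed [simp, intro]: "a \<in> aug E ==> m \<in> carrier M ==> A a m \<in> carrier M"
  using act_closed by (simp add: A_def lpa_carrier)

lemma A_add:
  assumes "a \<in> aug E" "b \<in> aug E" "m \<in> carrier M"
  shows "A (a + b) m = A a m \<oplus>\<^bsub>M\<^esub> A b m"
proof -
  have "lpa_class E a \<in> carrier (lpa E)" "lpa_class E b \<in> carrier (lpa E)"
    using assms by (auto simp: lpa_carrier)
  hence "act M (lpa_class E a \<oplus>\<^bsub>lpa E\<^esub> lpa_class E b) m = A a m \<oplus>\<^bsub>M\<^esub> A b m"
    using alg_module assms by (simp add: alg_module_def A_def)
  thus ?thesis using assms by (simp add: A_def lpa_add aug_free)
qed

lemma A_mult:
  assumes "a \<in> aug E" "b \<in> aug E" "m \<in> carrier M"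
  shows "A (a * b) m = A a (A b m)"
proof -
  have "lpa_class E a \<in> carrier (lpa E)" "lpa_class E b \<in> carrier (lpa E)"
    using assms by (auto simp: lpa_carrier)
  hence "act M (lpa_class E a \<otimes>\<^bsub>lpa E\<^esub> lpa_class E b) m = A a (A b m)"
    using alg_module assms by (simp add: alg_module_def A_def)
  thus ?thesis using assms by (simp add: A_def lpa_mult aug_free)
qed

lemma A_scale:
  assumes "a \<in> aug E" "m \<in> carrier M"
  shows "A (single unit_word k * a) m = k \<odot>\<^bsub>M\<^esub> A a m"
proof -
  have "lpa_class E a \<in> carrier (lpa E)"
    using assms by (auto simp: lpa_carrier)
  hence "act M (k \<odot>\<^bsub>lpa E\<^esub> lpa_class E a) m = k \<odot>\<^bsub>M\<^esub> A a m"
    using alg_module assms by (simp add: alg_module_def A_def)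
  thus ?thesis using assms by (simp add: A_def lpa_smult aug_free)
qed

lemma A_linmap: "a \<in> aug E ==> linmap M M (A a)"
proof -
  assume "a \<in> aug E"
  hence "lpa_class E a \<in> carrier (lpa E)" by (auto simp: lpa_carrier)
  thus ?thesis using alg_module by (simp add: alg_module_def A_def linmap_def)
qed

lemma A_zero: "m \<in> carrier M ==> A 0 m = \<zero>\<^bsub>M\<^esub>"
  using A_scale[of 0 m 0] by simp

lemma A_uminus: "a \<in> aug E ==> m \<in> carrier M ==> A (- a) m = \<ominus>\<^bsub>M\<^esub> A a m"
  using A_add[of "- a" a m] A_zero[of m] aug_diff[of 0 E a] M.minus_equality[of "A (- a) m" "A a m"]
  by simp

lemma A_diff: "a \<in> aug E ==> b \<in> aug E ==> m \<in> carrier M ==> A (a - b) m = A a m \<ominus>\<^bsub>M\<^esub> A b m"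
  using A_add[of a "- b" m] A_uminus[of b m] aug_diff[of 0 E b] by (simp add: a_minus_def)

lemma A_ideal: "a \<in> lpa_ideal E ==> m \<in> carrier M ==> A a m = \<zero>\<^bsub>M\<^esub>"
  using lpa_class_eq_iff[of a 0] A_zero[of m] by (simp add: A_def)

lemma A_sum:
  assumes "finite I" "\<And>i. i \<in> I ==> f i \<in> aug E" "m \<in> carrier M"
  shows "A (\<Sum>i\<in>I. f i) m = (\<Oplus>\<^bsub>M\<^esub>i\<in>I. A (f i) m)"
  using assms
proof (induction I rule: finite_induct)
  case (insert i I)
  hence "A (\<Sum>i\<in>insert i I. f i) m = A (f i) m \<oplus>\<^bsub>M\<^esub> A (\<Sum>i\<in>I. f i) m"
    by (simp add: A_add aug_sum)
  also have "\<dots> = (\<Oplus>\<^bsub>M\<^esub>i\<in>insert i I. A (f i) m)" using insert by (simp add: Pi_def)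
  finally show ?case .
qed (simp add: A_zero)

lemma G_linmap: "g \<in> gens E ==> linmap M M (G g)"
  unfolding G_def by (rule A_linmap) simp

lemmas G_closed [simp, intro] = linmapD(1)[OF G_linmap]
  and G_add = linmapD(2)[OF G_linmap]
  and G_smult = linmapD(3)[OF G_linmap]

lemma G_zero [simp]: "g \<in> gens E ==> G g \<zero>\<^bsub>M\<^esub> = \<zero>\<^bsub>M\<^esub>"
  using linmap_zero[OF G_linmap] vspace_axioms by blast

lemma word_linmap: "set w \<subseteq> gens E ==> linmap M M (foldr G w)"
  by (induction w) (auto simp: linmap_id comp_def id_def intro: linmap_comp G_linmap)

lemma word_closed [simp, intro]: "set w \<subseteq> gens E ==> m \<in> carrier M ==> foldr G w m \<in> carrier M"
  using linmapD(1)[OF word_linmap] .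

lemma A_mon:
  assumes "set w \<subseteq> gens E" "w \<noteq> []" "m \<in> carrier M"
  shows "A (mon w) m = foldr G w m"
  using assms
proof (induction w)
  case (Cons g w)
  show ?case
  proof (cases "w = []")
    case True
    thus ?thesis by (simp add: G_def)
  next
    case False
    have "A (mon ([g] @ w)) m = A (mon [g]) (A (mon w) m)"
      unfolding mon_mult using Cons.prems False by (intro A_mult) auto
    thus ?thesis using Cons False by (simp add: G_def)
  qed
qed simp

lemma A_expand:
  assumes "a \<in> aug E" "m \<in> carrier M"
  shows "A a m = lcomb M (\<lambda>w. foldr G (letters w) m) a"
proof -
  have *: "single w (lookup a w) =
      single unit_word (lookup a w) * mon (letters w)" for w
    by (simp add: mon_def scale_single)
  have "A a m = (\<Oplus>\<^bsub>M\<^esub>w\<in>keys a. A (single w (lookup a w)) m)"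
    using assms aug_keys[OF assms(1)] unfolding *
    by (subst poly_mapping_sum_singles[of a], subst A_sum[symmetric]) (auto simp: *)
  also have "\<dots> = lcomb M (\<lambda>w. foldr G (letters w) m) a"
    unfolding lcomb_def * using assms aug_keys[OF assms(1)]
    by (intro M.finsum_cong') (auto simp: A_scale A_mon)
  finally show ?thesis .
qed


lemma relator_mon:
  assumes "(mon u - mon w :: ('v, 'e, 'k) free) \<in> lpa_relators E" "set u \<subseteq> gens E" "set w \<subseteq> gens E" "u \<noteq> []" "w \<noteq> []"
    "m \<in> carrier M"
  shows "foldr G u m = foldr G w m"
proof -
  have "A (mon u - mon w) m = \<zero>\<^bsub>M\<^esub>"
    by (rule A_ideal[OF relator_in_ideal[OF assms(1)] assms(6)])
  moreover have c: "mon u \<in> aug E" "mon w \<in> aug E" using assms by simp_all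
  ultimately have "A (mon u) m \<ominus>\<^bsub>M\<^esub> A (mon w) m = \<zero>\<^bsub>M\<^esub>"
    by (simp only: A_diff[OF c assms(6)])
  hence "A (mon u) m = A (mon w) m"
    by (rule minus_zero_imp_eq[OF A_closed[OF c(1) assms(6)] A_closed[OF c(2) assms(6)]])
  thus ?thesis unfolding A_mon[OF assms(2,4,6)] A_mon[OF assms(3,5,6)] .
qed

lemma relator_zero:
  assumes "(mon u :: ('v, 'e, 'k) free) \<in> lpa_relators E" "set u \<subseteq> gens E" "u \<noteq> []" "m \<in> carrier M"
  shows "foldr G u m = \<zero>\<^bsub>M\<^esub>"
  using A_ideal[OF relator_in_ideal[OF assms(1)]] A_mon assms by simp

lemma G_vertex_vertex:
  assumes "v \<in> verts E" "w \<in> verts E" "m \<in> carrier M"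
  shows "G (Vx v) (G (Vx w) m) = (if v = w then G (Vx v) m else \<zero>\<^bsub>M\<^esub>)"
proof -
  have "mon [Vx v, Vx w] - (if v = w then mon [Vx v] else 0) \<in> lpa_relators E"
    using assms unfolding lpa_relators_def by blast
  thus ?thesis using relator_mon[of "[Vx v, Vx w]" "[Vx v]" m] relator_zero[of "[Vx v, Vx w]" m] assms
    by (auto split: if_splits)
qed

lemma edge_relators:
  assumes "e \<in> arcs E"
  shows "mon [Vx (tail E e), Ed e] - mon [Ed e] \<in> lpa_relators E"
    and "mon [Ed e, Vx (head E e)] - mon [Ed e] \<in> lpa_relators E"
    and "mon [Vx (head E e), Gh e] - mon [Gh e] \<in> lpa_relators E"
    and "mon [Gh e, Vx (tail E e)] - mon [Gh e] \<in> lpa_relators E"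
  using assms unfolding lpa_relators_def by blast+

lemma
  assumes "e \<in> arcs E" "m \<in> carrier M"
  shows G_source_edge: "G (Vx (tail E e)) (G (Ed e) m) = G (Ed e) m"
    and G_edge_range: "G (Ed e) (G (Vx (head E e)) m) = G (Ed e) m"
    and G_range_ghost: "G (Vx (head E e)) (G (Gh e) m) = G (Gh e) m"
    and G_ghost_source: "G (Gh e) (G (Vx (tail E e)) m) = G (Gh e) m"
  using assms relator_mon[OF edge_relators(1), of e m] relator_mon[OF edge_relators(2), of e m]
    relator_mon[OF edge_relators(3), of e m] relator_mon[OF edge_relators(4), of e m]
  by simp_all

lemma G_ghost_edge:
  assumes "e \<in> arcs E" "f \<in> arcs E" "m \<in> carrier M"
  shows "G (Gh e) (G (Ed f) m) = (if e = f then G (Vx (head E e)) m else \<zero>\<^bsub>M\<^esub>)"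
proof -
  have "mon [Gh e, Ed f] - (if e = f then mon [Vx (head E e)] else 0) \<in> lpa_relators E"
    using assms unfolding lpa_relators_def by blast
  thus ?thesis using relator_mon[of "[Gh e, Ed f]" "[Vx (head E e)]" m]
      relator_zero[of "[Gh e, Ed f]" m] assms
    by (auto split: if_splits)
qed

lemma G_regular:
  assumes "regular E v" "m \<in> carrier M"
  shows "G (Vx v) m = (\<Oplus>\<^bsub>M\<^esub>e\<in>out_arcs E v. G (Ed e) (G (Gh e) m))"
proof -
  have v: "v \<in> verts E" "finite (out_arcs E v)" using assms by (auto simp: regular_def)
  let ?s = "\<Sum>e\<in>out_arcs E v. mon [Ed e, Gh e] :: ('v, 'e, 'k) free"
  have s: "?s \<in> aug E" by (intro aug_sum aug_mon) auto
  have "mon [Vx v] - ?s \<in> lpa_relators E" using assms unfolding lpa_relators_def by blast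
  hence "A (mon [Vx v] - ?s) m = \<zero>\<^bsub>M\<^esub>" using A_ideal[OF relator_in_ideal assms(2)] by simp
  hence "A (mon [Vx v]) m = A ?s m"
    using A_diff s assms v minus_zero_imp_eq[of "A (mon [Vx v]) m" "A ?s m"] by simp
  also have "A ?s m = (\<Oplus>\<^bsub>M\<^esub>e\<in>out_arcs E v. A (mon [Ed e, Gh e]) m)"
    using assms v by (intro A_sum) auto
  also have "\<dots> = (\<Oplus>\<^bsub>M\<^esub>e\<in>out_arcs E v. G (Ed e) (G (Gh e) m))"
    using assms by (intro M.finsum_cong') (auto simp: A_mon)
  finally show ?thesis by (simp add: G_def)
qed


fun pa :: "'v => 'e list => 'm => 'm" where
  "pa u [] m = G (Vx u) m"
| "pa u (e # p) m = G (Ed e) (pa (head E e) p m)"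

fun gh :: "'v => 'e list => 'm => 'm" where
  "gh u [] m = G (Vx u) m"
| "gh u (e # p) m = gh (head E e) p (G (Gh e) m)"

lemma pa_linmap: "(u, p) \<in> fin_paths E ==> linmap M M (pa u p)"
proof (induction p arbitrary: u)
  case Nil
  thus ?case by (simp add: linmap_def G_add G_smult)
next
  case (Cons e p)
  thus ?case using linmap_comp[OF Cons.IH[of "head E e"] G_linmap[of "Ed e"]] by (auto simp: linmap_def)
qed

lemma gh_linmap: "(u, p) \<in> fin_paths E ==> linmap M M (gh u p)"
proof (induction p arbitrary: u)
  case Nil
  thus ?case by (simp add: linmap_def G_add G_smult)
next
  case (Cons e p)
  thus ?case using linmap_comp[OF G_linmap[of "Gh e"] Cons.IH[of "head E e"]] by (auto simp: linmap_def)
qed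

lemmas pa_closed [simp, intro] = linmapD(1)[OF pa_linmap]
  and gh_closed [simp, intro] = linmapD(1)[OF gh_linmap]

lemma pa_zero [simp]: "(u, p) \<in> fin_paths E ==> pa u p \<zero>\<^bsub>M\<^esub> = \<zero>\<^bsub>M\<^esub>"
  using linmap_zero[OF pa_linmap] vspace_axioms by blast

lemma gh_zero [simp]: "(u, p) \<in> fin_paths E ==> gh u p \<zero>\<^bsub>M\<^esub> = \<zero>\<^bsub>M\<^esub>"
  using linmap_zero[OF gh_linmap] vspace_axioms by blast

lemma path_word_eq:
  assumes "\<mu> \<in> fin_paths E" "m \<in> carrier M"
  shows "foldr G (path_word \<mu>) m = pa (fst \<mu>) (snd \<mu>) m"
proof -
  obtain u p where \<mu>: "\<mu> = (u, p)" by (cases \<mu>)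
  have "(u, p) \<in> fin_paths E ==> p \<noteq> [] ==> foldr G (map Ed p) m = pa u p m"
  proof (induction p arbitrary: u)
    case (Cons e p)
    thus ?case using G_edge_range[of e m] assms by (cases p) auto
  qed simp
  thus ?thesis using assms \<mu> by auto
qed

lemma ghost_word_eq:
  assumes "\<mu> \<in> fin_paths E" "m \<in> carrier M"
  shows "foldr G (ghost_word \<mu>) m = gh (fst \<mu>) (snd \<mu>) m"
proof -
  obtain u p where \<mu>: "\<mu> = (u, p)" by (cases \<mu>)
  have "(u, p) \<in> fin_paths E ==> p \<noteq> [] ==> n \<in> carrier M ==>
      foldr G (map Gh (rev p)) n = gh u p n" for n
  proof (induction p arbitrary: u n)
    case (Cons e p)
    show ?case
    proof (cases "p = []")
      case True
      thus ?thesis using G_range_ghost[of e n] Cons.prems by auto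
    next
      case False
      have "foldr G (map Gh (rev (e # p))) n = foldr G (map Gh (rev p)) (G (Gh e) n)" by simp
      also have "\<dots> = gh (head E e) p (G (Gh e) n)" using Cons False by (intro Cons.IH) auto
      finally show ?thesis by simp
    qed
  qed simp
  thus ?thesis using assms \<mu> by auto
qed

lemma words_gens:
  assumes "\<mu> \<in> fin_paths E"
  shows "set (path_word \<mu>) \<subseteq> gens E" "set (ghost_word \<mu>) \<subseteq> gens E"
    "path_word \<mu> \<noteq> []" "ghost_word \<mu> \<noteq> []"
proof -
  obtain u p where \<mu>: "\<mu> = (u, p)" by (cases \<mu>)
  have "(u, p) \<in> fin_paths E ==> set p \<subseteq> arcs E" by (induction p arbitrary: u) auto
  thus "set (path_word \<mu>) \<subseteq> gens E" "set (ghost_word \<mu>) \<subseteq> gens E"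
    "path_word \<mu> \<noteq> []" "ghost_word \<mu> \<noteq> []" using assms \<mu> by auto
qed

lemma act_lpa_mono:
  assumes "\<mu> \<in> fin_paths E" "\<nu> \<in> fin_paths E" "m \<in> carrier M"
  shows "act M (lpa_mono E \<mu> \<nu>) m = pa (fst \<mu>) (snd \<mu>) (gh (fst \<nu>) (snd \<nu>) m)"
proof -
  have "act M (lpa_mono E \<mu> \<nu>) m = A (mon (path_word \<mu> @ ghost_word \<nu>)) m"
    by (simp add: A_def lpa_mono_def)
  also have "\<dots> = foldr G (path_word \<mu> @ ghost_word \<nu>) m"
    using words_gens[OF assms(1)] words_gens[OF assms(2)] assms by (intro A_mon) auto
  finally show ?thesis
    using words_gens[OF assms(2)] assms gh_closed[of "fst \<nu>" "snd \<nu>" m]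
    by (simp add: path_word_eq ghost_word_eq)
qed

lemma pa_source:
  "(u, p) \<in> fin_paths E ==> v \<in> verts E ==> m \<in> carrier M ==>
     G (Vx v) (pa u p m) = (if v = u then pa u p m else \<zero>\<^bsub>M\<^esub>)"
proof (cases p)
  case (Cons e q)
  assume *: "(u, p) \<in> fin_paths E" "v \<in> verts E" "m \<in> carrier M"
  hence e: "e \<in> arcs E" "u = tail E e" "(head E e, q) \<in> fin_paths E" using Cons by auto
  have "G (Vx v) (G (Vx u) (pa u p m)) = (if v = u then G (Vx u) (pa u p m) else \<zero>\<^bsub>M\<^esub>)"
    using * e by (subst G_vertex_vertex) auto
  moreover have "G (Vx u) (pa u p m) = pa u p m"
    using e * Cons by (simp add: G_source_edge)
  ultimately show ?thesis by simp
qed (simp add: G_vertex_vertex)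

lemma gh_source:
  "(u, p) \<in> fin_paths E ==> v \<in> verts E ==> m \<in> carrier M ==>
     gh u p (G (Vx v) m) = (if v = u then gh u p m else \<zero>\<^bsub>M\<^esub>)"
proof (cases p)
  case (Cons e q)
  assume *: "(u, p) \<in> fin_paths E" "v \<in> verts E" "m \<in> carrier M"
  hence e: "e \<in> arcs E" "u = tail E e" "(head E e, q) \<in> fin_paths E" using Cons by auto
  have "gh u p (G (Vx v) m) = gh u p (G (Vx u) (G (Vx v) m))"
    using * e Cons by (simp add: G_ghost_source)
  also have "\<dots> = (if v = u then gh u p (G (Vx u) m) else \<zero>\<^bsub>M\<^esub>)"
    using * e by (subst G_vertex_vertex) auto
  also have "gh u p (G (Vx u) m) = gh u p m" using e * Cons by (simp add: G_ghost_source)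
  finally show ?thesis .
qed (auto simp add: G_vertex_vertex)

lemma pa_append:
  "(u, p @ q) \<in> fin_paths E ==> m \<in> carrier M ==> pa u (p @ q) m = pa u p (pa (prange E (u, p)) q m)"
proof (induction p arbitrary: u)
  case Nil
  thus ?case using pa_source[of u q u m] by (auto dest: fin_paths_source)
qed auto

lemma gh_append:
  "(u, p @ q) \<in> fin_paths E ==> m \<in> carrier M ==> gh u (p @ q) m = gh (prange E (u, p)) q (gh u p m)"
proof (induction p arbitrary: u m)
  case Nil
  thus ?case using gh_source[of u q u m] by (auto dest: fin_paths_source)
qed auto

lemma gh_range:
  "(u, p) \<in> fin_paths E ==> m \<in> carrier M ==> G (Vx (prange E (u, p))) (gh u p m) = gh u p m"
  using gh_append[of u p "[]" m] by (auto simp: fin_paths_append fin_paths_prange)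

lemma gh_pa:
  "(u, p) \<in> fin_paths E ==> m \<in> carrier M ==> gh u p (pa u p m) = G (Vx (prange E (u, p))) m"
proof (induction p arbitrary: u)
  case Nil
  thus ?case by (simp add: G_vertex_vertex)
next
  case (Cons e p)
  hence "gh u (e # p) (pa u (e # p) m) = gh (head E e) p (G (Vx (head E e)) (pa (head E e) p m))"
    by (simp add: G_ghost_edge)
  also have "\<dots> = gh (head E e) p (pa (head E e) p m)"
    using Cons.prems by (simp add: pa_source)
  finally show ?case using Cons by simp
qed

lemma gh_pa_incomparable:
  assumes "(u, p) \<in> fin_paths E" "(u', p') \<in> fin_paths E" "m \<in> carrier M"
    and "\<not> (u = u' \<and> (\<exists>q. p' = p @ q \<or> p = p' @ q))"
  shows "gh u p (pa u' p' m) = \<zero>\<^bsub>M\<^esub>"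
  using assms
proof (induction p arbitrary: u u' p')
  case Nil
  hence "u \<noteq> u'" by auto
  thus ?case using Nil by (simp add: pa_source)
next
  case (Cons e p)
  show ?case
  proof (cases p')
    case Nil
    hence "u \<noteq> u'" using Cons.prems by auto
    thus ?thesis using Nil Cons.prems gh_source[OF Cons.prems(1), of u' m] by simp
  next
    case p': (Cons e' q')
    have e: "e \<in> arcs E" "e' \<in> arcs E" "u = tail E e" "u' = tail E e'"
      "(head E e, p) \<in> fin_paths E" "(head E e', q') \<in> fin_paths E"
      using Cons.prems p' by auto
    show ?thesis
    proof (cases "e = e'")
      case False
      thus ?thesis using e Cons.prems p' by (simp add: G_ghost_edge)
    next
      case True
      have "gh (head E e) p (pa (head E e) q' m) = \<zero>\<^bsub>M\<^esub>"
        using Cons.prems p' True by (intro Cons.IH) auto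
      thus ?thesis using e True p' Cons.prems by (simp add: G_ghost_edge pa_source)
    qed
  qed
qed

definition proj :: "('v, 'e) fpath => 'm => 'm" where
  "proj \<mu> m = pa (fst \<mu>) (snd \<mu>) (gh (fst \<mu>) (snd \<mu>) m)"

lemma proj_linmap: "\<mu> \<in> fin_paths E ==> linmap M M (proj \<mu>)"
  unfolding proj_def[abs_def] using linmap_comp[OF gh_linmap pa_linmap] by simp

lemmas proj_closed [simp, intro] = linmapD(1)[OF proj_linmap]

lemma proj_zero [simp]: "\<mu> \<in> fin_paths E ==> proj \<mu> \<zero>\<^bsub>M\<^esub> = \<zero>\<^bsub>M\<^esub>"
  using linmap_zero[OF proj_linmap] vspace_axioms by blast

lemma proj_Nil: "u \<in> verts E ==> m \<in> carrier M ==> proj (u, []) m = G (Vx u) m"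
  by (simp add: proj_def G_vertex_vertex)

lemma proj_pa:
  assumes "(u, p) \<in> fin_paths E" "(prange E (u, p), q) \<in> fin_paths E" "m \<in> carrier M"
  shows "proj (u, p @ q) (pa u p m) = pa u p (proj (prange E (u, p), q) m)"
  using assms
  by (simp add: proj_def pa_append gh_append fin_paths_append gh_pa gh_source fin_paths_prange)

lemma gh_proj:
  assumes "(u, p) \<in> fin_paths E" "(prange E (u, p), q) \<in> fin_paths E" "m \<in> carrier M"
  shows "gh u p (proj (u, p @ q) m) = proj (prange E (u, p), q) (gh u p m)"
  using assms
  by (simp add: proj_def pa_append gh_append fin_paths_append gh_pa pa_source fin_paths_prange)

lemma proj_pa_prefix:
  assumes "(u, p @ q) \<in> fin_paths E" "m \<in> carrier M"
  shows "proj (u, p) (pa u (p @ q) m) = pa u (p @ q) m"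
  using assms
  by (simp add: proj_def pa_append fin_paths_append gh_pa pa_source fin_paths_prange)

lemma proj_pa_incomparable:
  assumes "(u, p) \<in> fin_paths E" "(u', p') \<in> fin_paths E" "m \<in> carrier M"
    and "\<not> (u = u' \<and> (\<exists>q. p' = p @ q \<or> p = p' @ q))"
  shows "proj (u, p) (pa u' p' m) = \<zero>\<^bsub>M\<^esub>"
  using gh_pa_incomparable[OF assms] assms by (simp add: proj_def)

lemma proj_idem: "\<mu> \<in> fin_paths E ==> m \<in> carrier M ==> proj \<mu> (proj \<mu> m) = proj \<mu> m"
  using proj_pa_prefix[of "fst \<mu>" "snd \<mu>" "[]" "gh (fst \<mu>) (snd \<mu>) m"]
  by (simp only: proj_def[of \<mu> m]) simp

end

section \<open>The representation of the groupoid attached to a module\<close>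

text \<open>Any two representatives \<open>\<mu>\<nu>\<^sup>*\<close> of an arrow induce the same operator between stalks, so the choice made
  here is harmless.\<close>

definition arrow_rep :: "('v, 'e) pre_digraph => ('v, 'e) bpath => int => ('v, 'e) bpath
    => ('v, 'e) fpath \<times> ('v, 'e) fpath" where
  "arrow_rep E q k p = (SOME (\<mu>, \<nu>). \<exists>z. composable E \<mu> z \<and> composable E \<nu> z \<and>
     k = plength \<mu> - plength \<nu> \<and> q = prepend \<mu> z \<and> p = prepend \<nu> z)"

fun gdeg :: "('v, 'e) gen => int" where
  "gdeg (Vx v) = 0" | "gdeg (Ed e) = 1" | "gdeg (Gh e) = -1"

text \<open>The arrow through which a word in the generators moves the point \<open>x\<close>, if any.\<close>

fun word_act :: "('v, 'e) pre_digraph => ('v, 'e) gen list => ('v, 'e) bpath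
    => (('v, 'e) bpath \<times> int) option" where
  "word_act E [] x = Some (x, 0)"
| "word_act E (g # w) x = (case word_act E w x of None => None
     | Some (p, k) => (case basis_act E g p of None => None | Some q => Some (q, gdeg g + k)))"

lemma simple_alg_module: "simple_module A M ==> alg_module A M"
  by (simp add: simple_module_def)

lemma simple_moduleD:
  "simple_module A M ==> alg_submodule A M N ==> N = {\<zero>\<^bsub>M\<^esub>} \<or> N = carrier M"
  by (simp add: simple_module_def)

lemma (in path_graph) arrow_rep:
  assumes "(q, k, p) \<in> gpd E"
  obtains \<mu> \<nu> z where "arrow_rep E q k p = (\<mu>, \<nu>)" "composable E \<mu> z" "composable E \<nu> z"
    "k = plength \<mu> - plength \<nu>" "q = prepend \<mu> z" "p = prepend \<nu> z"
proof -
  let ?P = "\<lambda>(\<mu>, \<nu>). \<exists>z. composable E \<mu> z \<and> composable E \<nu> z \<and>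
     k = plength \<mu> - plength \<nu> \<and> q = prepend \<mu> z \<and> p = prepend \<nu> z"
  from assms obtain \<mu> \<nu> z where "composable E \<mu> z" "composable E \<nu> z"
    "k = plength \<mu> - plength \<nu>" "q = prepend \<mu> z" "p = prepend \<nu> z" by (rule gpdE)
  hence "?P (\<mu>, \<nu>)" by auto
  hence "?P (arrow_rep E q k p)" unfolding arrow_rep_def by (rule someI)
  thus thesis using that by (cases "arrow_rep E q k p") auto
qed

context vspace
begin

lemma minus_eq_zero_iff: "m \<in> carrier M ==> n \<in> carrier M ==> m \<ominus> n = \<zero>\<^bsub>M\<^esub> \<longleftrightarrow> m = n"
  using minus_zero_imp_eq[of m n] M.r_neg[of n] by (auto simp: a_minus_def)

lemma finsum_group:
  assumes "finite I" "\<And>i. i \<in> I ==> f i \<in> carrier M"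
  shows "(\<Oplus>i\<in>I. f i) = (\<Oplus>p\<in>g ` I. \<Oplus>i\<in>{i \<in> I. g i = p}. f i)"
proof -
  have "(\<Oplus>p\<in>g ` I. \<Oplus>i\<in>{i \<in> I. g i = p}. f i) = (\<Oplus>i\<in>(\<Union>p\<in>g ` I. {i \<in> I. g i = p}). f i)"
    using assms by (intro M.add.finprod_UN_disjoint[symmetric]) (auto simp: pairwise_def disjnt_def)
  also have "(\<Union>p\<in>g ` I. {i \<in> I. g i = p}) = I" by auto
  finally show ?thesis by simp
qed

end

context lpa_module
begin

text \<open>
  The stalk of a module at \<open>x\<close>: the vectors on which \<open>1\<^sub>U\<close> acts as multiplication with \<open>1\<^sub>U(x)\<close>, for
  all cylinders \<open>U\<close>.
\<close>

definition stalk :: "('v, 'e) bpath => 'm set" where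
  "stalk x = {m \<in> carrier M. \<forall>\<mu>\<in>fin_paths E. proj \<mu> m = (if x \<in> cyl E \<mu> then m else \<zero>\<^bsub>M\<^esub>)}"

definition tr :: "('v, 'e) bpath => int => ('v, 'e) bpath => 'm => 'm" where
  "tr q k p m = (case arrow_rep E q k p of (\<mu>, \<nu>) => pa (fst \<mu>) (snd \<mu>) (gh (fst \<nu>) (snd \<nu>) m))"

lemma stalkD:
  assumes "m \<in> stalk x"
  shows "m \<in> carrier M" "\<mu> \<in> fin_paths E ==> proj \<mu> m = (if x \<in> cyl E \<mu> then m else \<zero>\<^bsub>M\<^esub>)"
  using assms by (simp_all add: stalk_def)

lemma stalk_zero [simp]: "\<zero>\<^bsub>M\<^esub> \<in> stalk x"
  by (simp add: stalk_def)

lemma stalk_add: "m \<in> stalk x ==> n \<in> stalk x ==> m \<oplus>\<^bsub>M\<^esub> n \<in> stalk x"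
  by (simp add: stalk_def linmapD(2)[OF proj_linmap])

lemma stalk_smult: "m \<in> stalk x ==> k \<odot>\<^bsub>M\<^esub> m \<in> stalk x"
  by (simp add: stalk_def linmapD(3)[OF proj_linmap])

lemma stalkI:
  assumes "m \<in> carrier M"
    and "\<And>u p. (u, p) \<in> fin_paths E ==> proj (u, p) m = (if x \<in> cyl E (u, p) then m else \<zero>\<^bsub>M\<^esub>)"
  shows "m \<in> stalk x"
  using assms by (auto simp: stalk_def)

lemma stalk_carrier [simp]: "m \<in> stalk x ==> m \<in> carrier M"
  by (rule stalkD(1))

lemma stalk_subspace: "submodule (stalk x) (ring_of_type_algebra :: 'k ring) M"
  by (rule subspaceI) (auto intro: stalk_add stalk_smult)

lemma stalk_finsum:
  "finite I ==> (\<And>i. i \<in> I ==> f i \<in> stalk x) ==> (\<Oplus>\<^bsub>M\<^esub>i\<in>I. f i) \<in> stalk x"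
  by (rule subspace_finsum[OF stalk_subspace])

text \<open>Lengthening both paths of a representative by the same path does not change the operator on
  the stalk, because \<open>\<beta>\<beta>\<^sup>*\<close> fixes the stalk at a point of the cylinder of \<open>\<beta>\<close>.\<close>

lemma transport_extend:
  assumes "composable E (u, a) z" "composable E (v, b) z" "composable E (bsource E z, s) y"
    "z = prepend (bsource E z, s) y" "m \<in> stalk (prepend (v, b) z)"
  shows "pa u (a @ s) (gh v (b @ s) m) = pa u a (gh v b m)"
proof -
  let ?w = "bsource E z"
  have f: "(u, a) \<in> fin_paths E" "(v, b) \<in> fin_paths E" "(?w, s) \<in> fin_paths E"
    "prange E (u, a) = ?w" "prange E (v, b) = ?w"
    using assms by (auto simp: composable_def)
  have m: "m \<in> carrier M" using assms(5) by simp
  have "prepend (v, b) z \<in> cyl E (v, b @ s)"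
    using cyl_append[OF assms(2), of s] assms(3,4) f by (auto simp: cyl_def)
  hence p: "proj (v, b @ s) m = m"
    using stalkD(2)[OF assms(5), of "(v, b @ s)"] f by (simp add: fin_paths_append)
  have "pa u (a @ s) (gh v (b @ s) m) = pa u a (proj (?w, s) (gh v b m))"
    using f m by (simp add: pa_append gh_append fin_paths_append proj_def)
  also have "proj (?w, s) (gh v b m) = gh v b (proj (v, b @ s) m)"
    using gh_proj[of v b s m] f m by simp
  finally show ?thesis using p by simp
qed

lemma tr_unique:
  assumes "composable E \<mu> z" "composable E \<nu> z" "composable E \<mu>' z'" "composable E \<nu>' z'"
    "plength \<mu> - plength \<nu> = plength \<mu>' - plength \<nu>'"
    "prepend \<mu> z = prepend \<mu>' z'" "prepend \<nu> z = prepend \<nu>' z'"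
    "length (snd \<nu>) \<le> length (snd \<nu>')" "m \<in> stalk (prepend \<nu> z)"
  shows "pa (fst \<mu>) (snd \<mu>) (gh (fst \<nu>) (snd \<nu>) m) = pa (fst \<mu>') (snd \<mu>') (gh (fst \<nu>') (snd \<nu>') m)"
proof -
  obtain s where s: "\<nu>' = (fst \<nu>, snd \<nu> @ s)" "z = prepend (bsource E z, s) z'"
    "composable E (bsource E z, s) z'"
    using gpd_common[OF assms(2,4,7,8)] by blast
  note e = composable_extend[OF assms(1) s(2,3)]
  have "length (snd \<mu>') = length (snd \<mu> @ s)" using assms(5) s(1) by (simp add: plength_def)
  then obtain t where "\<mu>' = (fst \<mu>, (snd \<mu> @ s) @ t)" "length (snd \<mu>') = length (snd \<mu> @ s)"
    using gpd_common[OF e(1) assms(3)] e(2) assms(6) by (metis eq_iff fst_conv snd_conv)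
  hence "\<mu>' = (fst \<mu>, snd \<mu> @ s)" by simp
  thus ?thesis
    using transport_extend[of "fst \<mu>" "snd \<mu>" z "fst \<nu>" "snd \<nu>" s z' m] assms s by simp
qed

lemma tr_eq:
  assumes "composable E \<mu> z" "composable E \<nu> z" "k = plength \<mu> - plength \<nu>"
    "q = prepend \<mu> z" "p = prepend \<nu> z" "m \<in> stalk p"
  shows "tr q k p m = pa (fst \<mu>) (snd \<mu>) (gh (fst \<nu>) (snd \<nu>) m)"
proof -
  have "(q, k, p) \<in> gpd E" using gpdI[OF assms(1-3)] assms by simp
  then obtain \<mu>' \<nu>' z' where r: "arrow_rep E q k p = (\<mu>', \<nu>')" "composable E \<mu>' z'"
    "composable E \<nu>' z'" "k = plength \<mu>' - plength \<nu>'" "q = prepend \<mu>' z'" "p = prepend \<nu>' z'"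
    by (rule arrow_rep)
  have "tr q k p m = pa (fst \<mu>') (snd \<mu>') (gh (fst \<nu>') (snd \<nu>') m)" by (simp add: tr_def r(1))
  also have "\<dots> = pa (fst \<mu>) (snd \<mu>) (gh (fst \<nu>) (snd \<nu>) m)"
  proof (cases "length (snd \<nu>) \<le> length (snd \<nu>')")
    case True
    show ?thesis
      by (rule tr_unique[OF assms(1,2) r(2,3) _ _ _ True, symmetric]) (use assms r in simp_all)
  next
    case False
    hence le: "length (snd \<nu>') \<le> length (snd \<nu>)" by simp
    show ?thesis
      by (rule tr_unique[OF r(2,3) assms(1,2) _ _ _ le]) (use assms r in simp_all)
  qed
  finally show ?thesis .
qed

lemma tr_linmap:
  assumes "(q, k, p) \<in> gpd E"
  shows "linmap M M (tr q k p)"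
proof -
  from assms obtain \<mu> \<nu> z where "arrow_rep E q k p = (\<mu>, \<nu>)" "composable E \<mu> z" "composable E \<nu> z"
    by (rule arrow_rep)
  thus ?thesis
    using linmap_comp[OF gh_linmap[of "fst \<nu>" "snd \<nu>"] pa_linmap[of "fst \<mu>" "snd \<mu>"]]
    by (simp add: tr_def[abs_def] composable_def)
qed

lemma transport_stalk:
  assumes "composable E (u, a) z" "composable E (v, b) z" "m \<in> stalk (prepend (v, b) z)"
  shows "pa u a (gh v b m) \<in> stalk (prepend (u, a) z)"
proof -
  have f: "(u, a) \<in> fin_paths E" "(v, b) \<in> fin_paths E" "prange E (u, a) = prange E (v, b)"
    using assms by (auto simp: composable_def)
  have m: "m \<in> carrier M" using assms(3) by simp
  let ?q = "prepend (u, a) z"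
  have q: "?q \<in> cyl E (u, a)" using assms(1) by (auto simp: cyl_def)
  have "proj (c, d) (pa u a (gh v b m)) = (if ?q \<in> cyl E (c, d) then pa u a (gh v b m) else \<zero>\<^bsub>M\<^esub>)"
    if cd: "(c, d) \<in> fin_paths E" for c d
  proof -
    consider (long) s where "c = u" "d = a @ s" | (short) s where "c = u" "a = d @ s"
      | (other) "\<not> (c = u \<and> (\<exists>s. a = d @ s \<or> d = a @ s))" by blast
    thus ?thesis
    proof cases
      case long
      have s: "(prange E (u, a), s) \<in> fin_paths E" using cd long by (simp add: fin_paths_append)
      have "proj (c, d) (pa u a (gh v b m)) = pa u a (proj (prange E (v, b), s) (gh v b m))"
        using proj_pa[OF f(1) s] f m long by simp
      also have "\<dots> = pa u a (gh v b (proj (v, b @ s) m))"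
        using gh_proj[of v b s m] f m s by simp
      also have "proj (v, b @ s) m = (if prepend (v, b) z \<in> cyl E (v, b @ s) then m else \<zero>\<^bsub>M\<^esub>)"
        using stalkD(2)[OF assms(3)] f s by (simp add: fin_paths_append)
      also have "prepend (v, b) z \<in> cyl E (v, b @ s) \<longleftrightarrow> ?q \<in> cyl E (c, d)"
        using cyl_append[OF assms(1), of s] cyl_append[OF assms(2), of s] f long by simp
      finally show ?thesis using f by simp
    next
      case short
      have "?q \<in> cyl E (c, d)" using q short cyl_append_subset by simp
      thus ?thesis using proj_pa_prefix[of u d s "gh v b m"] f m short by simp
    next
      case other
      have "?q \<notin> cyl E (c, d)"
      proof
        assume "?q \<in> cyl E (c, d)"
        thus False using other cyl_meet[OF q, of c d] cyl_meet[of ?q c d u a] q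
          by (cases "length a \<le> length d") auto
      qed
      thus ?thesis using proj_pa_incomparable[OF cd f(1), of "gh v b m"] f m other by simp
    qed
  qed
  thus ?thesis using f m by (intro stalkI) auto
qed

lemma tr_stalk:
  assumes "(q, k, p) \<in> gpd E" "m \<in> stalk p"
  shows "tr q k p m \<in> stalk q"
proof -
  from assms(1) obtain \<mu> \<nu> z where r: "arrow_rep E q k p = (\<mu>, \<nu>)" "composable E \<mu> z"
    "composable E \<nu> z" "k = plength \<mu> - plength \<nu>" "q = prepend \<mu> z" "p = prepend \<nu> z"
    by (rule arrow_rep)
  show ?thesis
    using transport_stalk[of "fst \<mu>" "snd \<mu>" z "fst \<nu>" "snd \<nu>" m] r assms(2) by (simp add: tr_def)
qed

lemma tr_closed: "(q, k, p) \<in> gpd E ==> m \<in> carrier M ==> tr q k p m \<in> carrier M"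
  using linmapD(1)[OF tr_linmap] .

lemma tr_comp:
  assumes "(r, l, q) \<in> gpd E" "(q, k, p) \<in> gpd E" "m \<in> stalk p"
  shows "tr r l q (tr q k p m) = tr r (l + k) p m"
proof -
  have m: "m \<in> carrier M" using assms(3) by simp
  from assms(1) obtain \<mu> \<nu> z where 1: "composable E \<mu> z" "composable E \<nu> z"
    "l = plength \<mu> - plength \<nu>" "r = prepend \<mu> z" "q = prepend \<nu> z" by (rule gpdE)
  from assms(2) obtain \<kappa> \<rho> y where 2: "composable E \<kappa> y" "composable E \<rho> y"
    "k = plength \<kappa> - plength \<rho>" "q = prepend \<kappa> y" "p = prepend \<rho> y" by (rule gpdE)
  have f: "\<mu> \<in> fin_paths E" "\<nu> \<in> fin_paths E" "\<kappa> \<in> fin_paths E" "\<rho> \<in> fin_paths E"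
    "prange E \<mu> = bsource E z" "prange E \<nu> = bsource E z" "prange E \<kappa> = bsource E y"
    "prange E \<rho> = bsource E y"
    using 1 2 by (auto simp: composable_def)
  define n where "n = gh (fst \<rho>) (snd \<rho>) m"
  have n: "n \<in> carrier M" using f m by (simp add: n_def)
  have "tr q k p m = pa (fst \<kappa>) (snd \<kappa>) n" using tr_eq[OF 2 assms(3)] by (simp add: n_def)
  hence L: "tr r l q (tr q k p m) = pa (fst \<mu>) (snd \<mu>) (gh (fst \<nu>) (snd \<nu>) (pa (fst \<kappa>) (snd \<kappa>) n))"
    using tr_eq[OF 1] tr_stalk[OF assms(2,3)] by simp
  show ?thesis
  proof (cases "length (snd \<nu>) \<le> length (snd \<kappa>)")
    case True
    obtain s where s: "\<kappa> = (fst \<nu>, snd \<nu> @ s)" "z = prepend (bsource E z, s) y"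
      "composable E (bsource E z, s) y"
      using gpd_common[OF 1(2) 2(1) _ True] 1 2 by auto
    have fs: "(bsource E z, s) \<in> fin_paths E" "(fst \<nu>, snd \<nu> @ s) \<in> fin_paths E"
      "(fst \<mu>, snd \<mu> @ s) \<in> fin_paths E"
      using s f by (auto simp: composable_def fin_paths_append)
    note e = composable_extend[OF 1(1) s(2,3)]
    have "tr r (l + k) p m = pa (fst \<mu>) (snd \<mu> @ s) n"
      using tr_eq[OF e(1) 2(2) _ _ 2(5) assms(3), of "l + k" r] e(2) 1 2 s
      by (simp add: n_def plength_def)
    also have "\<dots> = pa (fst \<mu>) (snd \<mu>) (pa (bsource E z) s n)"
      using fs n f by (simp add: pa_append)
    also have "pa (bsource E z) s n = gh (fst \<nu>) (snd \<nu>) (pa (fst \<nu>) (snd \<nu> @ s) n)"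
      using fs n f by (simp add: pa_append gh_pa pa_source fin_paths_source[of _ s])
    finally show ?thesis using L s(1) by simp
  next
    case False
    hence "length (snd \<kappa>) \<le> length (snd \<nu>)" by simp
    then obtain s where s: "\<nu> = (fst \<kappa>, snd \<kappa> @ s)" "y = prepend (bsource E y, s) z"
      "composable E (bsource E y, s) z"
      using gpd_common[OF 2(1) 1(2)] 1 2 by auto
    have fs: "(bsource E y, s) \<in> fin_paths E" "(fst \<kappa>, snd \<kappa> @ s) \<in> fin_paths E"
      "(fst \<rho>, snd \<rho> @ s) \<in> fin_paths E"
      using s f by (auto simp: composable_def fin_paths_append)
    note e = composable_extend[OF 2(2) s(2,3)]
    have "tr r (l + k) p m = pa (fst \<mu>) (snd \<mu>) (gh (fst \<rho>) (snd \<rho> @ s) m)"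
      using tr_eq[OF 1(1) e(1) _ 1(4) _ assms(3), of "l + k"] e(2) 1 2 s
      by (simp add: plength_def)
    also have "gh (fst \<rho>) (snd \<rho> @ s) m = gh (bsource E y) s n"
      using fs m f by (simp add: gh_append n_def)
    also have "\<dots> = gh (fst \<kappa>) (snd \<kappa> @ s) (pa (fst \<kappa>) (snd \<kappa>) n)"
      using fs n f by (simp add: gh_append gh_pa gh_source fin_paths_source[of _ s])
    finally show ?thesis using L s(1) by simp
  qed
qed

lemma tr_id:
  assumes "x \<in> boundary E" "m \<in> stalk x"
  shows "tr x 0 x m = m"
proof -
  have "tr x 0 x m = proj (bsource E x, []) m"
    using tr_eq[of "(bsource E x, [])" x "(bsource E x, [])" 0 x x m] assms
    by (simp add: prepend_Nil proj_def)
  thus ?thesis using stalkD(2)[OF assms(2), of "(bsource E x, [])"] assms(1)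
    by (simp add: bsource_verts)
qed

lemma tr_inverse:
  assumes "(q, k, p) \<in> gpd E" "m \<in> stalk p"
  shows "tr p (- k) q (tr q k p m) = m"
  using tr_comp[OF gpd_inv[OF assms(1)] assms] tr_id[of p m] gpd_boundary[OF assms(1)] assms(2)
  by simp

lemma tr_eq_zero:
  assumes "(q, k, p) \<in> gpd E" "m \<in> stalk p" "tr q k p m = \<zero>\<^bsub>M\<^esub>"
  shows "m = \<zero>\<^bsub>M\<^esub>"
  using tr_inverse[OF assms(1,2)] linmap_zero[OF tr_linmap[OF gpd_inv[OF assms(1)]] vspace_axioms] assms(3)
  by simp

lemma ghost_zero_iff:
  assumes "e \<in> arcs E" "m \<in> carrier M" "proj (tail E e, [e]) m = \<zero>\<^bsub>M\<^esub>"
  shows "G (Gh e) m = \<zero>\<^bsub>M\<^esub>"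
proof -
  have "G (Gh e) (proj (tail E e, [e]) m) = G (Gh e) m"
    using assms(1,2)
    by (simp add: proj_def G_vertex_vertex G_edge_range G_range_ghost G_ghost_edge)
  thus ?thesis using assms by simp
qed

lemma basis_act_ghost:
  assumes "p \<in> boundary E"
  shows "p \<in> cyl E (tail E e, [e]) ==>
      \<exists>y\<in>boundary E. e \<in> arcs E \<and> head E e = bsource E y \<and> p = econs E e y \<and>
        basis_act E (Gh e) p = Some y"
    and "e \<in> arcs E ==> p \<notin> cyl E (tail E e, [e]) ==> basis_act E (Gh e) p = None"
proof -
  show "\<exists>y\<in>boundary E. e \<in> arcs E \<and> head E e = bsource E y \<and> p = econs E e y \<and>
        basis_act E (Gh e) p = Some y" if c: "p \<in> cyl E (tail E e, [e])"
  proof -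
    obtain y where y: "y \<in> boundary E" "bsource E y = head E e" "p = econs E e y" "e \<in> arcs E"
      using c by (auto simp: cyl_Cons)
    hence "basis_act E (Gh e) p = Some y" by (cases y) auto
    thus ?thesis using y by auto
  qed
  show "basis_act E (Gh e) p = None" if e: "e \<in> arcs E" and c: "p \<notin> cyl E (tail E e, [e])"
    using assms
  proof (cases rule: boundary_cases)
    case (edge f y)
    hence "f \<noteq> e" using c e by (auto simp: cyl_Cons)
    thus ?thesis using edge by (cases y) auto
  qed simp
qed

lemma G_stalk:
  assumes "p \<in> boundary E" "m \<in> stalk p" "g \<in> gens E"
  shows "(\<forall>q. basis_act E g p = Some q --> (q, gdeg g, p) \<in> gpd E) \<and>
     G g m = (case basis_act E g p of None => \<zero>\<^bsub>M\<^esub> | Some q => tr q (gdeg g) p m)"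
proof -
  have m: "m \<in> carrier M" using assms by simp
  have vertex: "G (Vx v) m = (if v = bsource E p then m else \<zero>\<^bsub>M\<^esub>)" if "v \<in> verts E" for v
    using stalkD(2)[OF assms(2), of "(v, [])"] that m assms(1) by (auto simp: proj_Nil)
  show ?thesis
  proof (cases g)
    case (Vx v)
    thus ?thesis using assms vertex[of v] tr_id gpd_refl by auto
  next
    case (Ed e)
    hence e: "e \<in> arcs E" using assms by simp
    show ?thesis
    proof (cases "head E e = bsource E p")
      case True
      have "tr (econs E e p) 1 p m = G (Ed e) (G (Vx (head E e)) (G (Vx (head E e)) m))"
        using tr_eq[of "(tail E e, [e])" p "(head E e, [])" 1 "econs E e p" p m] True assms e
        by (simp add: plength_def prepend_Nil)
      also have "\<dots> = G (Ed e) m" using e m by (simp add: G_edge_range)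
      finally show ?thesis using True gpd_econs[OF e assms(1) True] Ed by simp
    next
      case False
      have "G (Ed e) m = G (Ed e) (G (Vx (head E e)) m)" using e m by (simp add: G_edge_range)
      also have "\<dots> = \<zero>\<^bsub>M\<^esub>" using vertex[of "head E e"] False e by simp
      finally show ?thesis using False Ed by simp
    qed
  next
    case (Gh e)
    hence e: "e \<in> arcs E" using assms by simp
    show ?thesis
    proof (cases "p \<in> cyl E (tail E e, [e])")
      case True
      then obtain y where y: "y \<in> boundary E" "head E e = bsource E y" "p = econs E e y"
        "basis_act E (Gh e) p = Some y" using basis_act_ghost(1)[OF assms(1)] by blast
      have "tr y (-1) p m = G (Vx (head E e)) (G (Vx (head E e)) (G (Gh e) m))"
        using tr_eq[of "(head E e, [])" y "(tail E e, [e])" "-1" y p m] y assms e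
        by (simp add: plength_def prepend_Nil)
      also have "\<dots> = G (Gh e) m" using e m by (simp add: G_range_ghost)
      finally show ?thesis using gpd_inv[OF gpd_econs[OF e y(1,2)]] y Gh by simp
    next
      case False
      have "proj (tail E e, [e]) m = \<zero>\<^bsub>M\<^esub>" using stalkD(2)[OF assms(2), of "(tail E e, [e])"] False e
        by simp
      thus ?thesis using ghost_zero_iff[OF e m] basis_act_ghost(2)[OF assms(1) e False] Gh by simp
    qed
  qed
qed

lemma word_stalk:
  assumes "x \<in> boundary E" "m \<in> stalk x" "set w \<subseteq> gens E"
  shows "(\<forall>q k. word_act E w x = Some (q, k) --> (q, k, x) \<in> gpd E) \<and>
     foldr G w m = (case word_act E w x of None => \<zero>\<^bsub>M\<^esub> | Some (q, k) => tr q k x m)"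
  using assms(3)
proof (induction w)
  case Nil
  thus ?case using tr_id[OF assms(1,2)] gpd_refl[OF assms(1)] by simp
next
  case (Cons g w)
  hence g: "g \<in> gens E" by simp
  show ?case
  proof (cases "word_act E w x")
    case None
    thus ?thesis using Cons g by simp
  next
    case (Some pk)
    obtain p k where pk: "pk = (p, k)" by (cases pk)
    have IH: "(p, k, x) \<in> gpd E" "foldr G w m = tr p k x m" using Cons Some pk by simp_all
    have p: "p \<in> boundary E" "tr p k x m \<in> stalk p"
      using gpd_boundary[OF IH(1)] tr_stalk[OF IH(1) assms(2)] by auto
    note Gp = G_stalk[OF p g]
    show ?thesis
    proof (cases "basis_act E g p")
      case None
      thus ?thesis using Some pk IH Gp by simp
    next
      case q: (Some q)
      hence "(q, gdeg g, p) \<in> gpd E" using Gp by simp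
      thus ?thesis using Some pk IH Gp q gpd_comp[OF _ IH(1)] tr_comp[OF _ IH(1) assms(2)] by simp
    qed
  qed
qed

text \<open>So on a stalk the algebra acts through the transport operators.\<close>

lemma A_stalk:
  assumes "x \<in> boundary E" "m \<in> stalk x" "a \<in> aug E"
  shows "A a m = (\<Oplus>\<^bsub>M\<^esub>w\<in>{w \<in> keys a. word_act E (letters w) x \<noteq> None}.
      lookup a w \<odot>\<^bsub>M\<^esub>
        tr (fst (the (word_act E (letters w) x))) (snd (the (word_act E (letters w) x))) x m)"
proof -
  have k: "set (letters w) \<subseteq> gens E" if "w \<in> keys a" for w
    using aug_keys[OF assms(3) that] by simp
  note ws = word_stalk[OF assms(1,2) k]
  have m: "m \<in> carrier M" using assms(2) by simp
  show ?thesis unfolding A_expand[OF assms(3) m] lcomb_def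
  proof (rule M.add.finprod_mono_neutral_cong_right)
    fix w assume w: "w \<in> keys a - {w \<in> keys a. word_act E (letters w) x \<noteq> None}"
    thus "lookup a w \<odot>\<^bsub>M\<^esub> foldr G (letters w) m = \<zero>\<^bsub>M\<^esub>"
      using ws[of w] by (cases "word_act E (letters w) x") auto
  next
    fix w assume w: "w \<in> {w \<in> keys a. word_act E (letters w) x \<noteq> None}"
    thus "lookup a w \<odot>\<^bsub>M\<^esub> foldr G (letters w) m = lookup a w \<odot>\<^bsub>M\<^esub>
        tr (fst (the (word_act E (letters w) x))) (snd (the (word_act E (letters w) x))) x m"
      using ws[of w] by (auto split: option.splits)
  qed (use k m in auto)
qed

lemma word_act_gpd:
  assumes "x \<in> boundary E" "a \<in> aug E" "w \<in> keys a" "word_act E (letters w) x = Some (q, k)"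
  shows "(q, k, x) \<in> gpd E"
  using word_stalk[OF assms(1) stalk_zero, of "letters w"] aug_keys[OF assms(2,3)] assms(4) by simp

text \<open>Cylinders separate finitely many points, so the sum of the stalks is direct.\<close>

lemma stalks_independent:
  assumes "finite P" "P \<subseteq> boundary E" "\<And>p. p \<in> P ==> u p \<in> stalk p" "(\<Oplus>\<^bsub>M\<^esub>p\<in>P. u p) = \<zero>\<^bsub>M\<^esub>"
  shows "\<forall>p\<in>P. u p = \<zero>\<^bsub>M\<^esub>"
  using assms
proof (induction "card P" arbitrary: P)
  case (Suc n)
  hence "P \<noteq> {}" by auto
  then obtain p \<mu> where p: "p \<in> P" "P \<inter> cyl E \<mu> = {p}"
    using cyl_isolates[of P] Suc.prems by blast
  hence \<mu>: "\<mu> \<in> fin_paths E" using cyl_fin_paths by blast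
  have c: "u q \<in> carrier M" if "q \<in> P" for q using Suc.prems(3)[OF that] by simp
  have "\<zero>\<^bsub>M\<^esub> = proj \<mu> (\<Oplus>\<^bsub>M\<^esub>q\<in>P. u q)" using Suc.prems \<mu> by simp
  also have "\<dots> = (\<Oplus>\<^bsub>M\<^esub>q\<in>P. proj \<mu> (u q))"
    using Suc.prems(1) c by (intro linmap_finsum[OF proj_linmap[OF \<mu>] vspace_axioms]) auto
  also have "\<dots> = (\<Oplus>\<^bsub>M\<^esub>q\<in>P. if p = q then u q else \<zero>\<^bsub>M\<^esub>)"
  proof (intro M.finsum_cong' refl)
    fix q assume q: "q \<in> P"
    have "q \<in> P \<inter> cyl E \<mu> \<longleftrightarrow> p = q" unfolding p(2) by auto
    hence "q \<in> cyl E \<mu> \<longleftrightarrow> p = q" using q by simp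
    thus "proj \<mu> (u q) = (if p = q then u q else \<zero>\<^bsub>M\<^esub>)"
      using stalkD(2)[OF Suc.prems(3)[OF q] \<mu>] by simp
  qed (use c in auto)
  also have "\<dots> = u p"
    using M.add.finprod_singleton[OF p(1) Suc.prems(1), of u] c by simp
  finally have up: "u p = \<zero>\<^bsub>M\<^esub>" by simp
  have "P = insert p (P - {p})" using p by auto
  hence "(\<Oplus>\<^bsub>M\<^esub>q\<in>P. u q) = u p \<oplus>\<^bsub>M\<^esub> (\<Oplus>\<^bsub>M\<^esub>q\<in>P - {p}. u q)"
    using M.finsum_insert[of "P - {p}" p u] Suc.prems(1) c p(1) by auto
  moreover have "(\<Oplus>\<^bsub>M\<^esub>q\<in>P - {p}. u q) \<in> carrier M" using c by (intro M.finsum_closed) auto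
  ultimately have "(\<Oplus>\<^bsub>M\<^esub>q\<in>P - {p}. u q) = \<zero>\<^bsub>M\<^esub>" using Suc.prems(4) up by simp
  hence "\<forall>q\<in>P - {p}. u q = \<zero>\<^bsub>M\<^esub>"
    using Suc.hyps(2) Suc.prems p by (intro Suc.hyps(1)) auto
  thus ?case using up by auto
qed auto

lemma cyclic_submodule:
  assumes "m \<in> carrier M"
  shows "alg_submodule (lpa E) M {A a m | a. a \<in> aug E}"
  unfolding alg_submodule_def
proof (intro conjI ballI)
  show "submodule {A a m | a. a \<in> aug E} (ring_of_type_algebra :: 'k ring) M"
  proof (rule subspaceI)
    show "{A a m |a. a \<in> aug E} \<subseteq> carrier M" using assms by auto
    show "\<zero>\<^bsub>M\<^esub> \<in> {A a m |a. a \<in> aug E}" using A_zero[OF assms] aug_zero[of E] by force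
    show "m' \<oplus>\<^bsub>M\<^esub> n \<in> {A a m |a. a \<in> aug E}"
      if mn: "m' \<in> {A a m |a. a \<in> aug E}" "n \<in> {A a m |a. a \<in> aug E}" for m' n
    proof -
      obtain a b where "a \<in> aug E" "b \<in> aug E" "m' = A a m" "n = A b m" using mn by auto
      thus ?thesis using A_add[of a b m] assms by (intro CollectI exI[of _ "a + b"]) auto
    qed
    show "k \<odot>\<^bsub>M\<^esub> m' \<in> {A a m |a. a \<in> aug E}" if mn: "m' \<in> {A a m |a. a \<in> aug E}" for k m'
    proof -
      obtain a where "a \<in> aug E" "m' = A a m" using mn by auto
      thus ?thesis using A_scale[of a m k] assms
        by (intro CollectI exI[of _ "single unit_word k * a"]) auto
    qed
  qed
  fix z :: "('v, 'e, 'k) lpa_elt" and n assume "z \<in> carrier (lpa E)" "n \<in> {A a m |a. a \<in> aug E}"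
  then obtain a b where "a \<in> aug E" "b \<in> aug E" "z = lpa_class E a" "n = A b m"
    by (auto simp: lpa_carrier)
  thus "act M z n \<in> {A a m |a. a \<in> aug E}" using A_mult[of a b m] assms
    by (intro CollectI exI[of _ "a * b"]) (auto simp: A_def aug_free)
qed

lemma stalk_unit:
  assumes "x \<in> boundary E" "m \<in> stalk x"
  shows "A (mon [Vx (bsource E x)]) m = m" "mon [Vx (bsource E x)] \<in> aug E"
  using stalkD(2)[OF assms(2), of "(bsource E x, [])"] assms bsource_verts[OF assms(1)]
  by (simp_all add: A_mon proj_Nil)

lemma simple_generated:
  assumes "simple_module (lpa E) M" "x \<in> boundary E" "m \<in> stalk x" "m \<noteq> \<zero>\<^bsub>M\<^esub>" "n \<in> carrier M"
  obtains a where "a \<in> aug E" "n = A a m"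
proof -
  have "m \<in> {A a m | a. a \<in> aug E}" using stalk_unit[OF assms(2,3)] by force
  hence "{A a m | a. a \<in> aug E} \<noteq> {\<zero>\<^bsub>M\<^esub>}" using assms(4) by auto
  hence "{A a m | a. a \<in> aug E} = carrier M"
    using simple_moduleD[OF assms(1) cyclic_submodule[of m]] assms(3) by simp
  thus thesis using assms(5) that by blast
qed

end

section \<open>Isomorphisms of simple modules with a nonzero stalk\<close>

lemma module_isoE:
  assumes "module_iso A M N"
  obtains f where "bij_betw f (carrier M) (carrier N)" "linmap M N f"
    "\<forall>a\<in>carrier A. \<forall>m\<in>carrier M. f (act M a m) = act N a (f m)"
proof -
  from assms obtain f where f: "bij_betw f (carrier M) (carrier N)"
    "\<forall>m \<in> carrier M. \<forall>n \<in> carrier M. f (m \<oplus>\<^bsub>M\<^esub> n) = f m \<oplus>\<^bsub>N\<^esub> f n"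
    "\<forall>k. \<forall>m \<in> carrier M. f (k \<odot>\<^bsub>M\<^esub> m) = k \<odot>\<^bsub>N\<^esub> f m"
    "\<forall>a \<in> carrier A. \<forall>m \<in> carrier M. f (act M a m) = act N a (f m)"
    unfolding module_iso_def by blast
  have "linmap M N f" using f bij_betw_apply[OF f(1)] by (simp add: linmap_def)
  thus thesis using that f by blast
qed

lemma module_isoI:
  assumes "bij_betw f (carrier M) (carrier N)" "linmap M N f"
    "\<And>a m. a \<in> carrier A ==> m \<in> carrier M ==> f (act M a m) = act N a (f m)"
  shows "module_iso A M N"
  unfolding module_iso_def using assms by (intro exI[of _ f]) (simp add: linmap_def)

lemma module_iso_sym:
  assumes "alg_module A M" "module_iso A M N"
  shows "module_iso A N M"
proof -
  have M: "vspace M" using assms(1) by (simp add: vspace_def alg_module_def)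
  interpret M: vspace M by fact
  from assms(2) obtain f where f: "bij_betw f (carrier M) (carrier N)" "linmap M N f"
    "\<forall>a\<in>carrier A. \<forall>m\<in>carrier M. f (act M a m) = act N a (f m)"
    by (rule module_isoE)
  let ?g = "inv_into (carrier M) f"
  have g: "?g n \<in> carrier M" "f (?g n) = n" if "n \<in> carrier N" for n
    using f(1) that by (auto simp: bij_betw_def inv_into_into f_inv_into_f)
  have gf: "?g (f m) = m" if "m \<in> carrier M" for m
    using f(1) that by (simp add: bij_betw_def)
  have act: "act M a m \<in> carrier M" if "a \<in> carrier A" "m \<in> carrier M" for a m
    using assms(1) that by (simp add: alg_module_def)
  show ?thesis
  proof (rule module_isoI)
    show "bij_betw ?g (carrier N) (carrier M)" by (rule bij_betw_inv_into[OF f(1)])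
    show "linmap N M ?g" unfolding linmap_def
    proof (intro conjI ballI allI)
      fix m n k assume m: "m \<in> carrier N"
      show "?g m \<in> carrier M" using g m by simp
      have "k \<odot>\<^bsub>N\<^esub> m = f (k \<odot>\<^bsub>M\<^esub> ?g m)" using linmapD(3)[OF f(2)] g m by simp
      thus "?g (k \<odot>\<^bsub>N\<^esub> m) = k \<odot>\<^bsub>M\<^esub> ?g m" using gf g m by simp
      assume n: "n \<in> carrier N"
      have "m \<oplus>\<^bsub>N\<^esub> n = f (?g m \<oplus>\<^bsub>M\<^esub> ?g n)" using linmapD(2)[OF f(2)] g m n by simp
      thus "?g (m \<oplus>\<^bsub>N\<^esub> n) = ?g m \<oplus>\<^bsub>M\<^esub> ?g n" using gf g m n by simp
    qed
    fix a n assume a: "a \<in> carrier A" "n \<in> carrier N"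
    have "act N a n = f (act M a (?g n))" using f(3) a g by simp
    thus "?g (act N a n) = act M a (?g n)" using gf act a g by simp
  qed
qed

text \<open>Annihilators of stalk vectors are controlled by their isotropy: a linear relation among the
  translates of \<open>v\<close> splits, by independence of the stalks, into relations over the points of the
  orbit, and each of those is a translate of one at \<open>x\<close>.\<close>

lemma stalk_annihilator:
  fixes V :: "('k :: field, ('v, 'e, 'k) lpa_elt, 'm) lmodule"
    and M :: "('k, ('v, 'e, 'k) lpa_elt, 'n) lmodule"
  assumes V: "lpa_module E V" and M: "lpa_module E M" and x: "x \<in> boundary E"
    and v: "v \<in> lpa_module.stalk E V x" and m: "m \<in> lpa_module.stalk E M x"
    and isotropy: "\<And>(I :: ('v, 'e) gen fword set) \<kappa> j. finite I ==> (\<And>i. i \<in> I ==> (x, j i, x) \<in> gpd E) ==>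
       (\<Oplus>\<^bsub>V\<^esub>i\<in>I. \<kappa> i \<odot>\<^bsub>V\<^esub> lpa_module.tr E V x (j i) x v) = \<zero>\<^bsub>V\<^esub> ==>
       (\<Oplus>\<^bsub>M\<^esub>i\<in>I. \<kappa> i \<odot>\<^bsub>M\<^esub> lpa_module.tr E M x (j i) x m) = \<zero>\<^bsub>M\<^esub>"
    and a: "a \<in> aug E" "lpa_module.A E V a v = \<zero>\<^bsub>V\<^esub>"
  shows "lpa_module.A E M a m = \<zero>\<^bsub>M\<^esub>"
proof -
  interpret V: lpa_module E V by fact
  interpret M: lpa_module E M by fact
  let ?I = "{w \<in> keys a. word_act E (letters w) x \<noteq> None}"
  let ?p = "\<lambda>w. fst (the (word_act E (letters w) x))"
  let ?k = "\<lambda>w. snd (the (word_act E (letters w) x))"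
  let ?\<kappa> = "lookup a"
  have fin: "finite ?I" by simp
  have gp: "(?p w, ?k w, x) \<in> gpd E" if "w \<in> ?I" for w
  proof -
    from that have "word_act E (letters w) x \<noteq> None" by simp
    then obtain q k where "word_act E (letters w) x = Some (q, k)"
      by (cases "word_act E (letters w) x") auto
    thus ?thesis using V.word_act_gpd[OF x a(1), of w q k] that by simp
  qed
  let ?J = "\<lambda>p. {w \<in> ?I. ?p w = p}"
  have V1: "V.tr (?p w) (?k w) x v \<in> V.stalk (?p w)" if "w \<in> ?I" for w
    using V.tr_stalk[OF gp[OF that] v] .
  have M1: "M.tr (?p w) (?k w) x m \<in> M.stalk (?p w)" if "w \<in> ?I" for w
    using M.tr_stalk[OF gp[OF that] m] .
  have VJ: "?\<kappa> w \<odot>\<^bsub>V\<^esub> V.tr (?p w) (?k w) x v \<in> V.stalk p" if "w \<in> ?J p" for w p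
    using V.stalk_smult[OF V1[of w], of "?\<kappa> w"] that by simp
  have MJ: "?\<kappa> w \<odot>\<^bsub>M\<^esub> M.tr (?p w) (?k w) x m \<in> M.stalk p" if "w \<in> ?J p" for w p
    using M.stalk_smult[OF M1[of w], of "?\<kappa> w"] that by simp
  have "\<zero>\<^bsub>V\<^esub> = (\<Oplus>\<^bsub>V\<^esub>w\<in>?I. ?\<kappa> w \<odot>\<^bsub>V\<^esub> V.tr (?p w) (?k w) x v)"
    using V.A_stalk[OF x v a(1)] a(2) by simp
  also have "\<dots> = (\<Oplus>\<^bsub>V\<^esub>p\<in>?p ` ?I. \<Oplus>\<^bsub>V\<^esub>w\<in>?J p. ?\<kappa> w \<odot>\<^bsub>V\<^esub> V.tr (?p w) (?k w) x v)"
    by (intro V.finsum_group[OF fin] V.vsmult_closed V.stalkD(1)[OF V1])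
  finally have z: "(\<Oplus>\<^bsub>V\<^esub>p\<in>?p ` ?I. \<Oplus>\<^bsub>V\<^esub>w\<in>?J p. ?\<kappa> w \<odot>\<^bsub>V\<^esub> V.tr (?p w) (?k w) x v) = \<zero>\<^bsub>V\<^esub>" by simp
  have "\<forall>p\<in>?p ` ?I. (\<Oplus>\<^bsub>V\<^esub>w\<in>?J p. ?\<kappa> w \<odot>\<^bsub>V\<^esub> V.tr (?p w) (?k w) x v) = \<zero>\<^bsub>V\<^esub>"
  proof (rule V.stalks_independent[OF _ _ _ z])
    show "finite (?p ` ?I)" using fin by simp
    show "?p ` ?I \<subseteq> boundary E" using V.gpd_boundary[OF gp] by blast
    show "(\<Oplus>\<^bsub>V\<^esub>w\<in>?J p. ?\<kappa> w \<odot>\<^bsub>V\<^esub> V.tr (?p w) (?k w) x v) \<in> V.stalk p" for p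
      using VJ by (intro V.stalk_finsum) auto
  qed
  hence Vz: "(\<Oplus>\<^bsub>V\<^esub>w\<in>?J p. ?\<kappa> w \<odot>\<^bsub>V\<^esub> V.tr (?p w) (?k w) x v) = \<zero>\<^bsub>V\<^esub>" if "p \<in> ?p ` ?I" for p
    using that by blast
  have Mz: "(\<Oplus>\<^bsub>M\<^esub>w\<in>?J p. ?\<kappa> w \<odot>\<^bsub>M\<^esub> M.tr (?p w) (?k w) x m) = \<zero>\<^bsub>M\<^esub>" if p: "p \<in> ?p ` ?I" for p
  proof -
    obtain w0 where w0: "w0 \<in> ?I" "?p w0 = p" using p by blast
    define k0 where "k0 = ?k w0"
    have g0: "(p, k0, x) \<in> gpd E" using gp[OF w0(1)] w0(2) by (simp add: k0_def)
    note g1 = V.gpd_inv[OF g0]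
    have gJ: "(p, ?k w, x) \<in> gpd E" if "w \<in> ?J p" for w using gp[of w] that by simp
    have gx: "(x, - k0 + ?k w, x) \<in> gpd E" if "w \<in> ?J p" for w
      by (rule V.gpd_comp[OF g1 gJ[OF that]])
    have finJ: "finite (?J p)" by simp
    have "\<zero>\<^bsub>V\<^esub> = V.tr x (- k0) p (\<Oplus>\<^bsub>V\<^esub>w\<in>?J p. ?\<kappa> w \<odot>\<^bsub>V\<^esub> V.tr (?p w) (?k w) x v)"
      using Vz[OF p] V.linmap_zero[OF V.tr_linmap[OF g1] V.vspace_axioms] by simp
    also have "\<dots> = (\<Oplus>\<^bsub>V\<^esub>w\<in>?J p. V.tr x (- k0) p (?\<kappa> w \<odot>\<^bsub>V\<^esub> V.tr (?p w) (?k w) x v))"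
      by (rule V.linmap_finsum[OF V.tr_linmap[OF g1] V.vspace_axioms finJ])
        (rule V.stalkD(1)[OF VJ])
    also have "\<dots> = (\<Oplus>\<^bsub>V\<^esub>w\<in>?J p. ?\<kappa> w \<odot>\<^bsub>V\<^esub> V.tr x (- k0 + ?k w) x v)"
    proof (intro V.M.finsum_cong' refl)
      fix w assume w: "w \<in> ?J p"
      have "V.tr p (?k w) x v \<in> V.stalk p" using V1[of w] w by simp
      thus "V.tr x (- k0) p (?\<kappa> w \<odot>\<^bsub>V\<^esub> V.tr (?p w) (?k w) x v) = ?\<kappa> w \<odot>\<^bsub>V\<^esub> V.tr x (- k0 + ?k w) x v"
        using linmapD(3)[OF V.tr_linmap[OF g1]] V.tr_comp[OF g1 gJ[OF w] v] w by simp
    next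
      show "(\<lambda>w. ?\<kappa> w \<odot>\<^bsub>V\<^esub> V.tr x (- k0 + ?k w) x v) \<in> ?J p \<rightarrow> carrier V"
        using V.tr_stalk[OF gx v] by (intro Pi_I V.vsmult_closed V.stalkD(1))
    qed
    finally have *: "(\<Oplus>\<^bsub>M\<^esub>w\<in>?J p. ?\<kappa> w \<odot>\<^bsub>M\<^esub> M.tr x (- k0 + ?k w) x m) = \<zero>\<^bsub>M\<^esub>"
      by (intro isotropy[OF finJ gx]) simp_all
    have "\<zero>\<^bsub>M\<^esub> = M.tr p k0 x (\<Oplus>\<^bsub>M\<^esub>w\<in>?J p. ?\<kappa> w \<odot>\<^bsub>M\<^esub> M.tr x (- k0 + ?k w) x m)"
      using * M.linmap_zero[OF M.tr_linmap[OF g0] M.vspace_axioms] by simp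
    also have "\<dots> = (\<Oplus>\<^bsub>M\<^esub>w\<in>?J p. M.tr p k0 x (?\<kappa> w \<odot>\<^bsub>M\<^esub> M.tr x (- k0 + ?k w) x m))"
      by (rule M.linmap_finsum[OF M.tr_linmap[OF g0] M.vspace_axioms finJ])
        (rule M.vsmult_closed[OF M.stalkD(1)[OF M.tr_stalk[OF gx m]]])
    also have "\<dots> = (\<Oplus>\<^bsub>M\<^esub>w\<in>?J p. ?\<kappa> w \<odot>\<^bsub>M\<^esub> M.tr (?p w) (?k w) x m)"
    proof (intro M.M.finsum_cong' refl)
      fix w assume w: "w \<in> ?J p"
      have "M.tr x (- k0 + ?k w) x m \<in> M.stalk x" using M.tr_stalk[OF gx[OF w] m] .
      thus "M.tr p k0 x (?\<kappa> w \<odot>\<^bsub>M\<^esub> M.tr x (- k0 + ?k w) x m) = ?\<kappa> w \<odot>\<^bsub>M\<^esub> M.tr (?p w) (?k w) x m"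
        using linmapD(3)[OF M.tr_linmap[OF g0]] M.tr_comp[OF g0 gx[OF w] m] w by simp
    next
      show "(\<lambda>w. ?\<kappa> w \<odot>\<^bsub>M\<^esub> M.tr (?p w) (?k w) x m) \<in> ?J p \<rightarrow> carrier M"
        by (rule Pi_I) (rule M.stalkD(1)[OF MJ])
    qed
    finally show ?thesis by simp
  qed
  have "M.A a m = (\<Oplus>\<^bsub>M\<^esub>p\<in>?p ` ?I. \<Oplus>\<^bsub>M\<^esub>w\<in>?J p. ?\<kappa> w \<odot>\<^bsub>M\<^esub> M.tr (?p w) (?k w) x m)"
    unfolding M.A_stalk[OF x m a(1)] by (intro M.finsum_group[OF fin] M.vsmult_closed M.stalkD(1)[OF M1])
  also have "\<dots> = (\<Oplus>\<^bsub>M\<^esub>p\<in>?p ` ?I. \<zero>\<^bsub>M\<^esub>)"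
    by (rule M.M.finsum_cong') (simp_all only: Mz refl, auto)
  finally show ?thesis by simp
qed

text \<open>If the isotropy relations of \<open>v\<close> hold for \<open>m\<close>, then \<open>a v \<mapsto> a m\<close> is a well defined
  homomorphism between the cyclic modules \<open>V\<close> and \<open>M\<close>; it is bijective by simplicity.\<close>

theorem simple_modules_iso:
  fixes V :: "('k :: field, ('v, 'e, 'k) lpa_elt, 'm) lmodule"
    and M :: "('k, ('v, 'e, 'k) lpa_elt, 'n) lmodule"
  assumes E: "wf_digraph E" and sV: "simple_module (lpa E) V" and sM: "simple_module (lpa E) M"
    and x: "x \<in> boundary E"
    and v: "v \<in> lpa_module.stalk E V x" "v \<noteq> \<zero>\<^bsub>V\<^esub>" and m: "m \<in> lpa_module.stalk E M x" "m \<noteq> \<zero>\<^bsub>M\<^esub>"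
    and isotropy: "\<And>(I :: ('v, 'e) gen fword set) \<kappa> j. finite I ==> (\<And>i. i \<in> I ==> (x, j i, x) \<in> gpd E) ==>
       (\<Oplus>\<^bsub>V\<^esub>i\<in>I. \<kappa> i \<odot>\<^bsub>V\<^esub> lpa_module.tr E V x (j i) x v) = \<zero>\<^bsub>V\<^esub> ==>
       (\<Oplus>\<^bsub>M\<^esub>i\<in>I. \<kappa> i \<odot>\<^bsub>M\<^esub> lpa_module.tr E M x (j i) x m) = \<zero>\<^bsub>M\<^esub>"
  shows "module_iso (lpa E) V M"
proof -
  interpret V: lpa_module E V by (rule lpa_moduleI[OF E simple_alg_module[OF sV]])
  interpret M: lpa_module E M by (rule lpa_moduleI[OF E simple_alg_module[OF sM]])
  have vc: "v \<in> carrier V" and mc: "m \<in> carrier M" using v m by simp_all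
  have ann: "M.A a m = \<zero>\<^bsub>M\<^esub>" if "a \<in> aug E" "V.A a v = \<zero>\<^bsub>V\<^esub>" for a
    by (rule stalk_annihilator[OF V.lpa_module_axioms M.lpa_module_axioms x v(1) m(1) isotropy that])
  \<comment> \<open>the vectors \<open>a v\<close> with \<open>a m = 0\<close> form a submodule not containing \<open>v\<close>\<close>
  define N where "N = {V.A a v | a. a \<in> aug E \<and> M.A a m = \<zero>\<^bsub>M\<^esub>}"
  have "alg_submodule (lpa E) V N" unfolding alg_submodule_def
  proof (intro conjI ballI)
    show "submodule N (ring_of_type_algebra :: 'k ring) V"
    proof (rule V.subspaceI)
      show "N \<subseteq> carrier V" using vc by (auto simp: N_def)
      have "V.A 0 v = \<zero>\<^bsub>V\<^esub>" "M.A 0 m = \<zero>\<^bsub>M\<^esub>" using V.A_zero[OF vc] M.A_zero[OF mc] by auto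
      thus "\<zero>\<^bsub>V\<^esub> \<in> N" unfolding N_def using aug_zero[of E] by (intro CollectI exI[of _ 0]) simp
      show "n \<oplus>\<^bsub>V\<^esub> n' \<in> N" if nn: "n \<in> N" "n' \<in> N" for n n'
      proof -
        obtain a b where "a \<in> aug E" "b \<in> aug E" "n = V.A a v" "n' = V.A b v"
          "M.A a m = \<zero>\<^bsub>M\<^esub>" "M.A b m = \<zero>\<^bsub>M\<^esub>" using nn by (auto simp: N_def)
        thus ?thesis unfolding N_def using V.A_add[of a b v] M.A_add[of a b m] vc mc
          by (intro CollectI exI[of _ "a + b"]) auto
      qed
      show "k \<odot>\<^bsub>V\<^esub> n \<in> N" if n: "n \<in> N" for k n
      proof -
        obtain a where "a \<in> aug E" "n = V.A a v" "M.A a m = \<zero>\<^bsub>M\<^esub>" using n by (auto simp: N_def)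
        thus ?thesis unfolding N_def using V.A_scale[of a v k] M.A_scale[of a m k] vc mc
          by (intro CollectI exI[of _ "single unit_word k * a"]) auto
      qed
    qed
    fix z :: "('v, 'e, 'k) lpa_elt" and n assume "z \<in> carrier (lpa E)" "n \<in> N"
    then obtain a b where ab: "a \<in> aug E" "b \<in> aug E" "z = lpa_class E a" "n = V.A b v" "M.A b m = \<zero>\<^bsub>M\<^esub>"
      by (auto simp: V.lpa_carrier N_def)
    hence "M.A (a * b) m = \<zero>\<^bsub>M\<^esub>"
      using M.A_mult[of a b m] mc M.linmap_zero[OF M.A_linmap[OF ab(1)] M.vspace_axioms] by simp
    thus "act V z n \<in> N" unfolding N_def using V.A_mult[of a b v] vc ab
      by (intro CollectI exI[of _ "a * b"]) (auto simp: V.A_def aug_free)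
  qed
  moreover have "N \<noteq> carrier V"
  proof
    assume "N = carrier V"
    then obtain a where a: "a \<in> aug E" "v = V.A a v" "M.A a m = \<zero>\<^bsub>M\<^esub>" using vc by (auto simp: N_def)
    let ?u = "mon [Vx (bsource E x)] :: ('v, 'e, 'k) free"
    note uV = V.stalk_unit[OF x v(1)] and uM = M.stalk_unit[OF x m(1)]
    have "V.A (a - ?u) v = \<zero>\<^bsub>V\<^esub>" using V.A_diff[OF a(1) uV(2) vc] uV(1) a(2)[symmetric] vc by (simp add: V.minus_eq_zero_iff)
    hence "M.A (a - ?u) m = \<zero>\<^bsub>M\<^esub>" using a(1) uV(2) by (intro ann) auto
    hence "\<zero>\<^bsub>M\<^esub> \<ominus>\<^bsub>M\<^esub> m = \<zero>\<^bsub>M\<^esub>" using M.A_diff[OF a(1) uM(2) mc] uM(1) a(3) by simp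
    hence "m = \<zero>\<^bsub>M\<^esub>" using M.minus_zero_imp_eq[of "\<zero>\<^bsub>M\<^esub>" m] mc by simp
    thus False using m(2) by simp
  qed
  ultimately have N: "N = {\<zero>\<^bsub>V\<^esub>}" using simple_moduleD[OF sV, of N] by simp
  have ann': "V.A a v = \<zero>\<^bsub>V\<^esub>" if "a \<in> aug E" "M.A a m = \<zero>\<^bsub>M\<^esub>" for a
  proof -
    have "V.A a v \<in> N" unfolding N_def using that by blast
    thus ?thesis using N by simp
  qed
  have eq: "V.A a v = V.A b v \<longleftrightarrow> M.A a m = M.A b m" if ab: "a \<in> aug E" "b \<in> aug E" for a b
  proof -
    have "V.A a v = V.A b v \<longleftrightarrow> V.A (a - b) v = \<zero>\<^bsub>V\<^esub>"
      using V.A_diff[OF ab vc] V.minus_eq_zero_iff[of "V.A a v" "V.A b v"] ab vc by simp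
    also have "\<dots> \<longleftrightarrow> M.A (a - b) m = \<zero>\<^bsub>M\<^esub>"
      by (rule iffI[OF ann[OF aug_diff[OF ab]] ann'[OF aug_diff[OF ab]]])
    also have "\<dots> \<longleftrightarrow> M.A a m = M.A b m"
      using M.A_diff[OF ab mc] M.minus_eq_zero_iff[of "M.A a m" "M.A b m"] ab mc by simp
    finally show ?thesis .
  qed
  define f where "f n = M.A (SOME a. a \<in> aug E \<and> n = V.A a v) m" for n
  have f: "f (V.A a v) = M.A a m" if a: "a \<in> aug E" for a
  proof -
    let ?b = "SOME b. b \<in> aug E \<and> V.A a v = V.A b v"
    have "?b \<in> aug E \<and> V.A a v = V.A ?b v"
      by (rule someI[of "\<lambda>b. b \<in> aug E \<and> V.A a v = V.A b v" a]) (simp add: a)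
    thus ?thesis using eq[of a ?b] a by (simp add: f_def)
  qed
  have genV: "\<exists>a\<in>aug E. n = V.A a v" if "n \<in> carrier V" for n
    using V.simple_generated[OF sV x v that] by blast
  have genM: "\<exists>a\<in>aug E. n = M.A a m" if "n \<in> carrier M" for n
    using M.simple_generated[OF sM x m that] by blast
  show ?thesis
  proof (rule module_isoI)
    show "bij_betw f (carrier V) (carrier M)" unfolding bij_betw_def
    proof
      show "inj_on f (carrier V)"
      proof (rule inj_onI)
        fix n n' assume "n \<in> carrier V" "n' \<in> carrier V" "f n = f n'"
        obtain a where a: "a \<in> aug E" "n = V.A a v" using genV[OF \<open>n \<in> carrier V\<close>] by blast
        obtain b where b: "b \<in> aug E" "n' = V.A b v" using genV[OF \<open>n' \<in> carrier V\<close>] by blast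
        show "n = n'" using \<open>f n = f n'\<close> eq[OF a(1) b(1)] f[OF a(1)] f[OF b(1)] a(2) b(2) by simp
      qed
      show "f ` carrier V = carrier M"
      proof
        show "f ` carrier V \<subseteq> carrier M"
        proof
          fix y assume "y \<in> f ` carrier V"
          then obtain n where "n \<in> carrier V" "y = f n" by blast
          then obtain a where "a \<in> aug E" "y = f (V.A a v)" using genV[of n] by blast
          thus "y \<in> carrier M" using f mc by simp
        qed
        show "carrier M \<subseteq> f ` carrier V"
        proof
          fix y assume "y \<in> carrier M"
          then obtain a where "a \<in> aug E" "y = M.A a m" using genM[of y] by blast
          hence "y = f (V.A a v)" "V.A a v \<in> carrier V" using f vc by simp_all
          thus "y \<in> f ` carrier V" by blast
        qed
      qed
    qed
    show "linmap V M f" unfolding linmap_def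
    proof (intro conjI ballI allI)
      fix n n' k assume "n \<in> carrier V"
      then obtain a where a: "a \<in> aug E" "n = V.A a v" using genV[of n] by blast
      show "f n \<in> carrier M" using a f mc by simp
      let ?ka = "single unit_word k * a"
      have "f (V.A ?ka v) = M.A ?ka m" using a by (intro f) simp
      thus "f (k \<odot>\<^bsub>V\<^esub> n) = k \<odot>\<^bsub>M\<^esub> f n" using a f vc mc by (simp add: V.A_scale M.A_scale)
      assume "n' \<in> carrier V"
      then obtain b where b: "b \<in> aug E" "n' = V.A b v" using genV[of n'] by blast
      have "f (V.A (a + b) v) = M.A (a + b) m" using a b by (intro f) simp
      thus "f (n \<oplus>\<^bsub>V\<^esub> n') = f n \<oplus>\<^bsub>M\<^esub> f n'" using a b f vc mc by (simp add: V.A_add M.A_add)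
    qed
    fix z :: "('v, 'e, 'k) lpa_elt" and n assume "z \<in> carrier (lpa E)" "n \<in> carrier V"
    then obtain a b where ab: "a \<in> aug E" "b \<in> aug E" "z = lpa_class E a" "n = V.A b v"
      using genV[of n] unfolding V.lpa_carrier by blast
    have "f (V.A (a * b) v) = M.A (a * b) m" using ab by (intro f) (simp add: aug_free)
    hence "f (V.A a n) = M.A a (f n)" using ab f vc mc by (simp add: V.A_mult M.A_mult)
    thus "f (act V z n) = act M z (f n)" by (simp add: V.A_def M.A_def ab(3))
  qed
qed


locale lpa_hom = M: lpa_module E M + N: lpa_module E N
  for E :: "('v, 'e) pre_digraph"
    and M :: "('k :: field, ('v, 'e, 'k) lpa_elt, 'm) lmodule"
    and N :: "('k, ('v, 'e, 'k) lpa_elt, 'n) lmodule" +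
  fixes f :: "'m => 'n"
  assumes lin: "linmap M N f"
    and act: "\<And>a m. a \<in> carrier (lpa E) ==> m \<in> carrier M ==> f (act M a m) = act N a (f m)"
begin

lemma hom_path_ghost:
  assumes "(u, p) \<in> fin_paths E" "(v, q) \<in> fin_paths E" "m \<in> carrier M"
  shows "f (M.pa u p (M.gh v q m)) = N.pa u p (N.gh v q (f m))"
proof -
  have "mon (path_word (u, p) @ ghost_word (v, q)) \<in> aug E"
    using M.words_gens[OF assms(1)] M.words_gens[OF assms(2)] by (intro aug_mon) auto
  hence "lpa_mono E (u, p) (v, q) \<in> carrier (lpa E)" unfolding M.lpa_carrier lpa_mono_def by blast
  from act[OF this assms(3)] show ?thesis
    using M.act_lpa_mono[OF assms] N.act_lpa_mono[OF assms(1,2), of "f m"] linmapD(1)[OF lin assms(3)]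
    by simp
qed

lemma hom_stalk:
  assumes "m \<in> M.stalk x"
  shows "f m \<in> N.stalk x"
proof (rule N.stalkI)
  show "f m \<in> carrier N" using linmapD(1)[OF lin] assms by simp
  fix u p assume up: "(u, p) \<in> fin_paths E"
  have "N.proj (u, p) (f m) = f (M.proj (u, p) m)"
    using hom_path_ghost[OF up up, of m] assms by (simp add: M.proj_def N.proj_def)
  thus "N.proj (u, p) (f m) = (if x \<in> cyl E (u, p) then f m else \<zero>\<^bsub>N\<^esub>)"
    using M.stalkD(2)[OF assms up] M.linmap_zero[OF lin N.vspace_axioms] by simp
qed

lemma hom_tr:
  assumes "(q, k, p) \<in> gpd E" "m \<in> carrier M"
  shows "f (M.tr q k p m) = N.tr q k p (f m)"
proof -
  from assms(1) obtain \<mu> \<nu> z where r: "arrow_rep E q k p = (\<mu>, \<nu>)" "composable E \<mu> z" "composable E \<nu> z"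
    by (rule M.arrow_rep)
  thus ?thesis using hom_path_ghost[of "fst \<mu>" "snd \<mu>" "fst \<nu>" "snd \<nu>" m] assms(2)
    by (simp add: M.tr_def N.tr_def composable_def)
qed

end

section \<open>Normal forms in the Leavitt path algebra\<close>

text \<open>A chosen edge at every regular vertex.  The monomials \<open>\<mu>\<nu>\<^sup>*\<close> in which \<open>\<mu>\<close> and \<open>\<nu>\<close> do not both end in
  the same chosen edge form a basis of the Leavitt path algebra.\<close>

definition special :: "('v, 'e) pre_digraph => 'v => 'e" where
  "special E v = (SOME e. e \<in> out_arcs E v)"

definition normal_pairs :: "('v, 'e) pre_digraph => (('v, 'e) fpath \<times> ('v, 'e) fpath) set" where
  "normal_pairs E = {(\<mu>, \<nu>) \<in> range_pairs E.
     \<not> (\<exists>u p v q w. \<mu> = (u, p @ [special E w]) \<and> \<nu> = (v, q @ [special E w]) \<and> regular E w)}"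

definition pair_word :: "('v, 'e) fpath \<times> ('v, 'e) fpath => ('v, 'e) gen list" where
  "pair_word i = path_word (fst i) @ ghost_word (snd i)"

abbreviation pair_Z :: "('v, 'e) pre_digraph => ('v, 'e) fpath \<times> ('v, 'e) fpath => ('v, 'e) arrow set" where
  "pair_Z E i \<equiv> gpd_Z E (fst i) (snd i)"

text \<open>\<open>nf E a F\<close>: modulo the relations, \<open>a\<close> is a combination of normal monomials whose image in the
  groupoid algebra is \<open>F\<close>.\<close>

definition nf :: "('v, 'e) pre_digraph => ('v, 'e, 'k :: field) free => (('v, 'e) arrow => 'k) => bool" where
  "nf E a F \<longleftrightarrow> (\<exists>S c. finite S \<and> S \<subseteq> normal_pairs E \<and> (\<forall>i. i \<notin> S --> c i = 0) \<and>
     a - (\<Sum>i\<in>S. single (FWord (pair_word i)) (c i)) \<in> lpa_ideal E \<and>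
     F = (\<lambda>\<gamma>. \<Sum>i\<in>S. c i * indicator (pair_Z E i) \<gamma>))"

context path_graph
begin

lemma special:
  assumes "regular E v"
  shows "special E v \<in> arcs E \<and> tail E (special E v) = v"
proof -
  have "\<exists>e. e \<in> out_arcs E v" using assms unfolding regular_def by blast
  from someI_ex[OF this] show ?thesis by (simp add: special_def)
qed

lemma scale_minus_one:
  fixes a :: "'g fword \<Rightarrow>\<^sub>0 'k :: field"
  shows "single unit_word (-1) * a = - a"
proof -
  have "single unit_word (-1) = (- 1 :: 'g fword \<Rightarrow>\<^sub>0 'k)"
    by (simp add: unit_word_zero single_uminus)
  thus ?thesis by simp
qed

lemma nf_zero: "nf E 0 (\<lambda>_. 0)"
  unfolding nf_def by (intro exI[of _ "{}"] exI[of _ "\<lambda>_. 0"]) (simp add: ideal_zero)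

lemma nf_linear:
  fixes a b :: "('v, 'e, 'k :: field) free"
  assumes "nf E a F" "nf E b H"
  shows "nf E (a + single unit_word k * b) (\<lambda>\<gamma>. F \<gamma> + k * H \<gamma>)"
proof -
  obtain S c where S: "finite S" "S \<subseteq> normal_pairs E" "\<And>i. i \<notin> S ==> c i = 0"
    "a - (\<Sum>i\<in>S. single (FWord (pair_word i)) (c i)) \<in> lpa_ideal E"
    "F = (\<lambda>\<gamma>. \<Sum>i\<in>S. c i * indicator (pair_Z E i) \<gamma>)" using assms(1) unfolding nf_def by blast
  obtain T d where T: "finite T" "T \<subseteq> normal_pairs E" "\<And>i. i \<notin> T ==> d i = 0"
    "b - (\<Sum>i\<in>T. single (FWord (pair_word i)) (d i)) \<in> lpa_ideal E"
    "H = (\<lambda>\<gamma>. \<Sum>i\<in>T. d i * indicator (pair_Z E i) \<gamma>)" using assms(2) unfolding nf_def by blast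
  let ?s = "\<lambda>i x. single (FWord (pair_word i)) x :: ('v, 'e, 'k) free"
  have "(\<Sum>i\<in>S. ?s i (c i)) = (\<Sum>i\<in>S \<union> T. ?s i (c i))"
    using S(1,3) T(1) by (intro sum.mono_neutral_left) auto
  moreover have "(\<Sum>i\<in>T. ?s i (d i)) = (\<Sum>i\<in>S \<union> T. ?s i (d i))"
    using T(1,3) S(1) by (intro sum.mono_neutral_left) auto
  moreover have "(\<Sum>i\<in>S \<union> T. ?s i (c i + k * d i)) =
      (\<Sum>i\<in>S \<union> T. ?s i (c i)) + single unit_word k * (\<Sum>i\<in>S \<union> T. ?s i (d i))"
    by (simp add: single_add sum.distrib sum_distrib_left scale_single)
  ultimately have "a + single unit_word k * b - (\<Sum>i\<in>S \<union> T. ?s i (c i + k * d i)) =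
     (a - (\<Sum>i\<in>S. ?s i (c i))) + single unit_word k * (b - (\<Sum>i\<in>T. ?s i (d i)))"
    by (simp add: algebra_simps)
  moreover have "\<dots> \<in> lpa_ideal E"
    using S(4) T(4) by (intro ideal_add ideal_mult_left) auto
  moreover have "(\<Sum>i\<in>S. c i * indicator (pair_Z E i) \<gamma>) = (\<Sum>i\<in>S \<union> T. c i * indicator (pair_Z E i) \<gamma>)" for \<gamma>
    using S(1,3) T(1) by (intro sum.mono_neutral_left) auto
  moreover have "(\<Sum>i\<in>T. d i * indicator (pair_Z E i) \<gamma>) = (\<Sum>i\<in>S \<union> T. d i * indicator (pair_Z E i) \<gamma>)" for \<gamma>
    using T(1,3) S(1) by (intro sum.mono_neutral_left) auto
  ultimately show ?thesis unfolding nf_def using S T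
    by (intro exI[of _ "S \<union> T"] exI[of _ "\<lambda>i. c i + k * d i"])
      (simp add: sum_distrib_left sum.distrib[symmetric] algebra_simps)
qed

lemma nf_sum:
  fixes a :: "('v, 'e, 'k :: field) free"
  assumes "finite T" "\<And>i. i \<in> T ==> nf E (f i) (H i)" "nf E a F"
  shows "nf E (a - (\<Sum>i\<in>T. f i)) (\<lambda>\<gamma>. F \<gamma> - (\<Sum>i\<in>T. H i \<gamma>))"
  using assms(1,2)
proof (induction T rule: finite_induct)
  case (insert i T)
  have "nf E ((a - (\<Sum>i\<in>T. f i)) + single unit_word (-1) * f i)
      (\<lambda>\<gamma>. (F \<gamma> - (\<Sum>i\<in>T. H i \<gamma>)) + (-1) * H i \<gamma>)"
    using insert by (intro nf_linear) auto
  thus ?case using insert.hyps by (simp add: scale_minus_one algebra_simps)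
qed (use assms(3) in simp)

lemma nf_cong:
  assumes "nf E a F" "b - a \<in> lpa_ideal E"
  shows "nf E b F"
proof -
  obtain S c where S: "finite S" "S \<subseteq> normal_pairs E" "\<forall>i. i \<notin> S --> c i = 0"
    "a - (\<Sum>i\<in>S. single (FWord (pair_word i)) (c i)) \<in> lpa_ideal E"
    "F = (\<lambda>\<gamma>. \<Sum>i\<in>S. c i * indicator (pair_Z E i) \<gamma>)" using assms(1) unfolding nf_def by blast
  have "b - (\<Sum>i\<in>S. single (FWord (pair_word i)) (c i)) \<in> lpa_ideal E"
    using ideal_add[OF assms(2) S(4)] by simp
  thus ?thesis unfolding nf_def using S(1,2,3,5) by blast
qed

definition eqm :: "('v, 'e, 'k :: field) free => ('v, 'e, 'k) free => bool" (infix \<open>\<doteq>\<close> 50) where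
  "a \<doteq> b \<longleftrightarrow> a - b \<in> lpa_ideal E"

lemma eqm_refl: "a \<doteq> a" by (simp add: eqm_def ideal_zero)

lemma eqm_sym: "a \<doteq> b ==> b \<doteq> a"
  unfolding eqm_def using ideal_uminus[of "a - b"] by simp

lemma eqm_trans: "a \<doteq> b ==> b \<doteq> c ==> a \<doteq> c"
  unfolding eqm_def using ideal_add[of "a - b" "b - c"] by simp

lemma eqm_left: "a \<doteq> b ==> c \<in> free_elts E ==> c * a \<doteq> c * b"
  unfolding eqm_def using ideal_mult_left[of "a - b" c] by (simp add: algebra_simps)

lemma eqm_right: "a \<doteq> b ==> c \<in> free_elts E ==> a * c \<doteq> b * c"
  unfolding eqm_def using ideal_mult_right[of "a - b" c] by (simp add: algebra_simps)

lemma eqm_sum: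
  assumes "finite I" "\<And>i. i \<in> I ==> f i \<doteq> g i"
  shows "(\<Sum>i\<in>I. f i) \<doteq> (\<Sum>i\<in>I. g i)"
  using assms
proof (induction I rule: finite_induct)
  case (insert i I)
  have "f i - g i \<in> lpa_ideal E" using insert.prems[of i] by (simp add: eqm_def)
  moreover have "(\<Sum>i\<in>I. f i) - (\<Sum>i\<in>I. g i) \<in> lpa_ideal E"
    using insert.IH insert.prems by (simp add: eqm_def)
  ultimately have "(f i - g i) + ((\<Sum>i\<in>I. f i) - (\<Sum>i\<in>I. g i)) \<in> lpa_ideal E" by (rule ideal_add)
  moreover have "(f i - g i) + ((\<Sum>i\<in>I. f i) - (\<Sum>i\<in>I. g i)) =
      (\<Sum>i\<in>insert i I. f i) - (\<Sum>i\<in>insert i I. g i)"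
    using insert.hyps by (simp add: algebra_simps)
  ultimately show ?case by (simp add: eqm_def)
qed (simp add: eqm_refl)

lemma eqm_vertex: "v \<in> verts E ==> mon [Vx v, Vx v] \<doteq> mon [Vx v]"
proof -
  assume "v \<in> verts E"
  hence "mon [Vx v, Vx v] - (if v = v then mon [Vx v] else 0) \<in> lpa_relators E"
    unfolding lpa_relators_def by blast
  thus ?thesis using relator_in_ideal by (simp add: eqm_def)
qed

lemma eqm_source: "e \<in> arcs E ==> mon [Vx (tail E e), Ed e] \<doteq> mon [Ed e]"
  unfolding eqm_def by (rule relator_in_ideal) (unfold lpa_relators_def, blast)

lemma eqm_range: "e \<in> arcs E ==> mon [Ed e, Vx (head E e)] \<doteq> mon [Ed e]"
  unfolding eqm_def by (rule relator_in_ideal) (unfold lpa_relators_def, blast)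

lemma eqm_ghost: "e \<in> arcs E ==> mon [Gh e, Vx (tail E e)] \<doteq> mon [Gh e]"
  unfolding eqm_def by (rule relator_in_ideal) (unfold lpa_relators_def, blast)

lemma eqm_regular: "regular E v ==> mon [Vx v] \<doteq> (\<Sum>e\<in>out_arcs E v. mon [Ed e, Gh e])"
  unfolding eqm_def by (rule relator_in_ideal) (unfold lpa_relators_def, blast)

lemma path_words_gens:
  assumes "\<mu> \<in> fin_paths E"
  shows "set (path_word \<mu>) \<subseteq> gens E" "set (ghost_word \<mu>) \<subseteq> gens E"
proof -
  obtain u p where \<mu>: "\<mu> = (u, p)" by (cases \<mu>)
  have "(u, p) \<in> fin_paths E ==> set p \<subseteq> arcs E" by (induction p arbitrary: u) auto
  thus "set (path_word \<mu>) \<subseteq> gens E" "set (ghost_word \<mu>) \<subseteq> gens E" using assms \<mu> by auto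
qed

lemma eqm_path_vertex:
  assumes "(u, p) \<in> fin_paths E"
  shows "mon (path_word (u, p)) \<doteq> mon (path_word (u, p)) * mon [Vx (prange E (u, p))]"
proof (cases p rule: rev_cases)
  case Nil
  thus ?thesis using eqm_sym[OF eqm_vertex[of u]] assms by (simp add: mon_mult[symmetric])
next
  case (snoc q e)
  have e: "e \<in> arcs E" "prange E (u, p) = head E e" "set (map Ed q) \<subseteq> gens E"
    using assms snoc path_words_gens[OF assms] by (auto simp: fin_paths_append prange_append)
  have "mon (map Ed q) * mon [Ed e] \<doteq> mon (map Ed q) * mon [Ed e, Vx (head E e)]"
    using e by (intro eqm_left eqm_sym[OF eqm_range] free_elts_mon)
  thus ?thesis using e snoc by (simp add: mon_mult[symmetric])
qed

lemma eqm_path_edge: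
  assumes "(u, p @ [f]) \<in> fin_paths E"
  shows "mon (path_word (u, p)) * mon [Ed f] \<doteq> mon (path_word (u, p @ [f]))"
proof (cases "p = []")
  case True
  thus ?thesis using assms eqm_source[of f] by (simp add: mon_mult[symmetric])
qed (simp add: mon_mult[symmetric] eqm_refl)

lemma eqm_ghost_edge:
  assumes "(u, p @ [f]) \<in> fin_paths E"
  shows "mon [Gh f] * mon (ghost_word (u, p)) \<doteq> mon (ghost_word (u, p @ [f]))"
proof (cases "p = []")
  case True
  thus ?thesis using assms eqm_ghost[of f] by (simp add: mon_mult[symmetric])
qed (simp add: mon_mult[symmetric] eqm_refl)

lemma regular_expand:
  assumes "(u, p) \<in> fin_paths E" "(v, q) \<in> fin_paths E" "prange E (u, p) = w" "prange E (v, q) = w"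
    "regular E w"
  shows "mon (pair_word ((u, p), (v, q))) \<doteq>
     (\<Sum>f\<in>out_arcs E w. mon (pair_word ((u, p @ [f]), (v, q @ [f]))))"
proof -
  let ?a = "mon (path_word (u, p))" and ?b = "mon (ghost_word (v, q))"
  have fr: "?a \<in> free_elts E" "?b \<in> free_elts E"
    using path_words_gens[OF assms(1)] path_words_gens[OF assms(2)] by auto
  have fin: "finite (out_arcs E w)" using assms by (simp add: regular_def)
  have f: "(u, p @ [f]) \<in> fin_paths E" "(v, q @ [f]) \<in> fin_paths E" "f \<in> arcs E" if "f \<in> out_arcs E w" for f
    using that assms by (auto simp: fin_paths_append)
  have 1: "?a * ?b \<doteq> (?a * mon [Vx w]) * ?b"
    using eqm_path_vertex[OF assms(1)] assms(3) fr by (intro eqm_right) auto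
  have 2: "?a * mon [Vx w] * ?b \<doteq> ?a * (\<Sum>f\<in>out_arcs E w. mon [Ed f, Gh f]) * ?b"
    using fr by (intro eqm_right eqm_left eqm_regular assms)
  have me: "mon [Ed f, Gh f] = mon [Ed f] * mon [Gh f]" for f :: 'e
    using mon_mult[of "[Ed f]" "[Gh f]"] by simp
  have 3: "?a * (\<Sum>f\<in>out_arcs E w. mon [Ed f, Gh f]) * ?b =
      (\<Sum>f\<in>out_arcs E w. (?a * mon [Ed f]) * (mon [Gh f] * ?b))"
    by (simp only: me sum_distrib_left sum_distrib_right mult.assoc)
  have 4: "(\<Sum>f\<in>out_arcs E w. (?a * mon [Ed f]) * (mon [Gh f] * ?b)) \<doteq>
      (\<Sum>f\<in>out_arcs E w. mon (path_word (u, p @ [f])) * mon (ghost_word (v, q @ [f])))"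
  proof (rule eqm_sum[OF fin])
    fix g assume "g \<in> out_arcs E w"
    note g = f[OF this]
    have "?a * mon [Ed g] * (mon [Gh g] * ?b) \<doteq> mon (path_word (u, p @ [g])) * (mon [Gh g] * ?b)"
      using fr g by (intro eqm_right eqm_path_edge) auto
    moreover have "mon (path_word (u, p @ [g])) * (mon [Gh g] * ?b) \<doteq>
        mon (path_word (u, p @ [g])) * mon (ghost_word (v, q @ [g]))"
      using path_words_gens[OF g(1)] by (intro eqm_left eqm_ghost_edge g free_elts_mon)
    ultimately show "?a * mon [Ed g] * (mon [Gh g] * ?b) \<doteq>
        mon (path_word (u, p @ [g])) * mon (ghost_word (v, q @ [g]))" by (rule eqm_trans)
  qed
  show ?thesis unfolding pair_word_def fst_conv snd_conv mon_mult
    by (rule eqm_trans[OF 1 eqm_trans[OF 2 4[folded 3]]])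
qed

lemma regular_expand_indicator:
  assumes "(u, p) \<in> fin_paths E" "(v, q) \<in> fin_paths E" "prange E (u, p) = w" "prange E (v, q) = w"
    "regular E w"
  shows "(indicator (gpd_Z E (u, p) (v, q)) \<gamma> :: 'k :: field) =
     (\<Sum>f\<in>out_arcs E w. indicator (gpd_Z E (u, p @ [f]) (v, q @ [f])) \<gamma>)"
proof -
  have fin: "finite (out_arcs E w)" using assms by (simp add: regular_def)
  have mem: "\<gamma> \<in> gpd_Z E (u, p @ [f]) (v, q @ [f]) \<longleftrightarrow> (\<exists>y. composable E (w, [f]) y \<and>
      \<gamma> = (prepend (u, p) (econs E f y), int (length p) - int (length q), prepend (v, q) (econs E f y)))"
    if "f \<in> out_arcs E w" for f
    using assms prepend_append[of u p "[f]" _ w] prepend_append[of v q "[f]" _ w] that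
    by (auto simp: gpd_Z_def composable_append plength_def)
  have comp: "composable E (u, p) (econs E f y)" "composable E (v, q) (econs E f y)"
    if "f \<in> out_arcs E w" "composable E (w, [f]) y" for f y
  proof -
    have "econs E f y \<in> boundary E" "bsource E (econs E f y) = w"
      using that econs_boundary[of f y] bsource_econs[of f y] by (simp_all del: bsource_econs)
    thus "composable E (u, p) (econs E f y)" "composable E (v, q) (econs E f y)"
      using assms by (simp_all add: composable_def del: bsource_econs)
  qed
  show ?thesis
  proof (cases "\<gamma> \<in> gpd_Z E (u, p) (v, q)")
    case True
    then obtain z where z: "composable E (u, p) z" "composable E (v, q) z"
      "\<gamma> = (prepend (u, p) z, int (length p) - int (length q), prepend (v, q) z)"
      by (auto simp: gpd_Z_def plength_def)
    have zw: "z \<in> boundary E" "bsource E z = w" using z assms by (auto simp: composable_def)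
    from zw(1) obtain e y where e: "e \<in> arcs E" "y \<in> boundary E" "head E e = bsource E y" "z = econs E e y"
      using assms(5) zw(2) by (cases rule: boundary_cases) auto
    have ew: "e \<in> out_arcs E w" using e zw by simp
    have "\<gamma> \<in> gpd_Z E (u, p @ [f]) (v, q @ [f]) \<longleftrightarrow> f = e" if f: "f \<in> out_arcs E w" for f
    proof
      assume "\<gamma> \<in> gpd_Z E (u, p @ [f]) (v, q @ [f])"
      then obtain y' where y': "composable E (w, [f]) y'" "prepend (u, p) z = prepend (u, p) (econs E f y')"
        using mem[OF f] z(3) by auto
      hence "z = econs E f y'" using prepend_inj[OF z(1) comp(1)[OF f]] by simp
      thus "f = e" using econs_inj[of f y' e y] e y'(1) by auto
    next
      assume "f = e"
      thus "\<gamma> \<in> gpd_Z E (u, p @ [f]) (v, q @ [f])" using mem[OF f] e z(3) zw by auto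
    qed
    hence "(\<Sum>f\<in>out_arcs E w. indicator (gpd_Z E (u, p @ [f]) (v, q @ [f])) \<gamma>) =
        (\<Sum>f\<in>out_arcs E w. if f = e then 1 else 0 :: 'k)"
      by (intro sum.cong refl) (simp add: indicator_def)
    also have "\<dots> = 1" using ew fin by simp
    finally show ?thesis using True by simp
  next
    case False
    have "\<gamma> \<notin> gpd_Z E (u, p @ [f]) (v, q @ [f])" if f: "f \<in> out_arcs E w" for f
    proof
      assume "\<gamma> \<in> gpd_Z E (u, p @ [f]) (v, q @ [f])"
      then obtain y where "composable E (w, [f]) y"
        "\<gamma> = (prepend (u, p) (econs E f y), int (length p) - int (length q), prepend (v, q) (econs E f y))"
        using mem[OF f] by auto
      hence "\<gamma> \<in> gpd_Z E (u, p) (v, q)" using comp[OF f] by (auto simp: gpd_Z_def plength_def)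
      thus False using False by simp
    qed
    thus ?thesis using False by simp
  qed
qed

lemma nf_normal:
  assumes "i \<in> normal_pairs E"
  shows "nf E (mon (pair_word i)) (indicator (pair_Z E i))"
  unfolding nf_def using assms
  by (intro exI[of _ "{i}"] exI[of _ "\<lambda>j. if j = i then 1 else 0"]) (simp add: mon_def ideal_zero)

lemma nf_mono:
  assumes "(\<mu>, \<nu>) \<in> range_pairs E"
  shows "nf E (mon (pair_word (\<mu>, \<nu>)) :: ('v, 'e, 'k :: field) free) (indicator (gpd_Z E \<mu> \<nu>))"
  using assms
proof (induction "length (snd \<mu>)" arbitrary: \<mu> \<nu> rule: less_induct)
  case less
  show ?case
  proof (cases "(\<mu>, \<nu>) \<in> normal_pairs E")
    case True
    from nf_normal[OF this] show ?thesis by simp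
  next
    case False
    then obtain u p v q w where *: "\<mu> = (u, p @ [special E w])" "\<nu> = (v, q @ [special E w])" "regular E w"
      using less.prems unfolding normal_pairs_def by blast
    let ?e = "special E w"
    have e: "?e \<in> out_arcs E w" using special[OF *(3)] by simp
    have fp: "(u, p) \<in> fin_paths E" "(v, q) \<in> fin_paths E" "prange E (u, p) = w" "prange E (v, q) = w"
      using less.prems * e by (auto simp: range_pairs_def fin_paths_append)
    have fin: "finite (out_arcs E w)" using *(3) by (simp add: regular_def)
    let ?m = "\<lambda>f. ((u, p @ [f]), (v, q @ [f]))"
    have base: "nf E (mon (pair_word ((u, p), (v, q))) :: ('v, 'e, 'k) free) (indicator (gpd_Z E (u, p) (v, q)))"
      using * fp by (intro less.hyps) (auto simp: range_pairs_def)
    have nm: "nf E (mon (pair_word (?m f)) :: ('v, 'e, 'k) free) (indicator (pair_Z E (?m f)))"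
      if f: "f \<in> out_arcs E w - {?e}" for f
    proof (rule nf_normal)
      have "?m f \<in> range_pairs E" using f fp by (auto simp: range_pairs_def fin_paths_append prange_append)
      moreover have "f \<noteq> special E w'" if "regular E w'" for w'
        using special[OF that] f by auto
      ultimately show "?m f \<in> normal_pairs E" by (auto simp: normal_pairs_def)
    qed
    have N2: "(\<lambda>\<gamma>. indicator (gpd_Z E (u, p) (v, q)) \<gamma> -
        (\<Sum>f\<in>out_arcs E w - {?e}. indicator (pair_Z E (?m f)) \<gamma>)) = (indicator (gpd_Z E \<mu> \<nu>) :: _ => 'k)"
      unfolding regular_expand_indicator[OF fp *(3)] sum.remove[OF fin e] by (simp add: * fun_eq_iff)
    have N1: "nf E (mon (pair_word ((u, p), (v, q))) -
        (\<Sum>f\<in>out_arcs E w - {?e}. mon (pair_word (?m f)) :: ('v, 'e, 'k) free)) (indicator (gpd_Z E \<mu> \<nu>))"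
      unfolding N2[symmetric] by (rule nf_sum[OF _ nm base]) (use fin in simp)
    have N3: "(mon (pair_word (\<mu>, \<nu>)) :: ('v, 'e, 'k) free) -
        (mon (pair_word ((u, p), (v, q))) - (\<Sum>f\<in>out_arcs E w - {?e}. mon (pair_word (?m f)))) \<in> lpa_ideal E"
    proof -
      have "(\<Sum>f\<in>out_arcs E w. mon (pair_word (?m f)) :: ('v, 'e, 'k) free) - mon (pair_word ((u, p), (v, q))) \<in> lpa_ideal E"
        using eqm_sym[OF regular_expand[OF fp *(3)]] by (simp add: eqm_def)
      thus ?thesis unfolding sum.remove[OF fin e] by (simp add: * algebra_simps)
    qed
    show ?thesis by (rule nf_cong[OF N1 N3])
  qed
qed

lemma pair_word_aug: "(\<mu>, \<nu>) \<in> range_pairs E ==> mon (pair_word (\<mu>, \<nu>)) \<in> free_elts E"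
  using path_words_gens[of \<mu>] path_words_gens[of \<nu>] by (auto simp: pair_word_def range_pairs_def)

lemma lpa_gpd_nf:
  fixes z :: "('v, 'e, 'k :: field) lpa_elt"
  assumes "lpa_gpd E z F"
  shows "\<exists>a\<in>free_elts E. z = lpa_class E a \<and> nf E a F"
  using assms
proof induction
  case zero
  thus ?case using nf_zero by (auto simp: lpa_zero intro!: bexI[of _ 0])
next
  case (step z F \<mu> \<nu> k)
  then obtain a where a: "a \<in> free_elts E" "z = lpa_class E a" "nf E a F" by blast
  let ?m = "mon (pair_word (\<mu>, \<nu>)) :: ('v, 'e, 'k) free"
  have m: "?m \<in> free_elts E" using pair_word_aug[OF step.hyps(2)] .
  have "lpa_mono E \<mu> \<nu> = lpa_class E ?m" by (simp add: lpa_mono_def pair_word_def)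
  hence "z \<oplus>\<^bsub>lpa E\<^esub> k \<odot>\<^bsub>lpa E\<^esub> lpa_mono E \<mu> \<nu> = lpa_class E (a + single unit_word k * ?m)"
    using a m by (simp add: lpa_smult lpa_add)
  thus ?case using nf_linear[OF a(3) nf_mono[OF step.hyps(2)], of k] a m
    by (intro bexI[of _ "a + single unit_word k * ?m"]) auto
qed


text \<open>From every vertex there is a boundary path that follows the chosen edges as long as possible.
  It detects the normal monomials: \<open>\<mu>\<alpha>(\<nu>\<alpha>)\<^sup>*\<close> is not normal for any nontrivial initial segment \<open>\<alpha>\<close>.\<close>

definition follows_special :: "('v, 'e) bpath => bool" where
  "follows_special x \<longleftrightarrow> (\<forall>u s y. s \<noteq> [] --> composable E (u, s) y --> x = prepend (u, s) y -->
     (\<exists>w. regular E w \<and> last s = special E w))"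

lemma special_path_exists:
  assumes "w \<in> verts E"
  shows "\<exists>x\<in>boundary E. bsource E x = w \<and> follows_special x"
proof -
  let ?n = "\<lambda>v. head E (special E v)"
  have singular: "\<exists>x\<in>boundary E. bsource E x = w \<and> follows_special x"
    if "w \<in> verts E" "\<not> regular E w" for w
  proof -
    have "follows_special (FinP w [])" unfolding follows_special_def
    proof (intro allI impI)
      fix u :: 'v and s :: "'e list" and y
      assume "s \<noteq> []" "composable E (u, s) y" "FinP w [] = prepend (u, s) y"
      thus "\<exists>w. regular E w \<and> last s = special E w" by (cases y) auto
    qed
    thus ?thesis using that by (intro bexI[of _ "FinP w []"]) auto
  qed
  show ?thesis
  proof (cases "\<exists>N. \<not> regular E ((?n ^^ N) w)")
    case True
    then obtain N where "\<not> regular E ((?n ^^ N) w)" ..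
    thus ?thesis using assms
    proof (induction N arbitrary: w)
      case 0
      thus ?case using singular by simp
    next
      case (Suc N)
      show ?case
      proof (cases "regular E w")
        case False
        thus ?thesis using singular Suc.prems(2) by blast
      next
        case True
        note sp = special[OF True]
        have "\<not> regular E ((?n ^^ N) (?n w))"
          using Suc.prems(1) by (simp add: funpow_Suc_right del: funpow.simps)
        moreover have "?n w \<in> verts E" using sp by simp
        ultimately obtain x where x: "x \<in> boundary E" "bsource E x = ?n w" "follows_special x"
          using Suc.IH[of "?n w"] by blast
        have "follows_special (econs E (special E w) x)" unfolding follows_special_def
        proof (intro allI impI)
          fix u :: 'v and s :: "'e list" and y assume *: "s \<noteq> []" "composable E (u, s) y" "econs E (special E w) x = prepend (u, s) y"
          then obtain e t where s: "s = e # t" by (cases s) auto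
          have ct: "composable E (head E e, t) y" "u = tail E e" using * s by auto
          have "econs E (special E w) x = econs E e (prepend (head E e, t) y)"
            using *(3) prepend_Cons[of e t y] s ct by simp
          hence "e = special E w \<and> x = prepend (head E e, t) y"
            using econs_inj[of "special E w" x e "prepend (head E e, t) y"] x composable_prepend[OF ct(1)]
            by simp
          thus "\<exists>w. regular E w \<and> last s = special E w"
            using x(3) ct True s unfolding follows_special_def by (cases "t = []") auto
        qed
        moreover have "econs E (special E w) x \<in> boundary E" using econs_boundary[of "special E w" x] x sp by simp
        moreover have "bsource E (econs E (special E w) x) = w" using bsource_econs[of "special E w" x] sp by metis
        ultimately show ?thesis by blast
      qed
    qed
  next
    case False
    hence reg: "regular E ((?n ^^ i) w)" for i by blast
    let ?\<omega> = "smap (special E) (siterate ?n w)"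
    have nth: "?\<omega> !! i = special E ((?n ^^ i) w)" for i by simp
    have "?\<omega> \<in> inf_paths E" unfolding inf_paths_def
    proof (intro CollectI conjI allI)
      show "sset ?\<omega> \<subseteq> arcs E" unfolding sset_range using special[OF reg] nth by auto
      show "head E (?\<omega> !! i) = tail E (?\<omega> !! Suc i)" for i
        unfolding nth using special[OF reg[of "Suc i"]] by simp
    qed
    moreover have "follows_special (InfP ?\<omega>)" unfolding follows_special_def
    proof (intro allI impI)
      fix u :: 'v and s :: "'e list" and y assume *: "s \<noteq> []" "composable E (u, s) y" "InfP ?\<omega> = prepend (u, s) y"
      then obtain \<eta> where "y = InfP \<eta>" by (cases y) auto
      hence "?\<omega> = s @- \<eta>" using * by simp
      hence "last s = ?\<omega> !! (length s - 1)" using *(1) by (simp add: last_conv_nth)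
      thus "\<exists>w. regular E w \<and> last s = special E w" using reg nth by auto
    qed
    moreover have "tail E (shd ?\<omega>) = w" using special[OF reg[of 0]] by simp
    ultimately show ?thesis by (intro bexI[of _ "InfP ?\<omega>"]) auto
  qed
qed

lemma normal_indicators_independent:
  fixes c :: "('v, 'e) fpath \<times> ('v, 'e) fpath => 'k :: field"
  assumes "finite S" "S \<subseteq> normal_pairs E" "\<And>\<gamma>. (\<Sum>i\<in>S. c i * indicator (pair_Z E i) \<gamma>) = 0" "i \<in> S"
  shows "c i = 0"
proof (rule ccontr)
  assume "c i \<noteq> 0"
  let ?T = "{i \<in> S. c i \<noteq> 0}"
  have "?T \<noteq> {}" using assms(4) \<open>c i \<noteq> 0\<close> by blast
  moreover have "finite ?T" using assms(1) by simp
  ultimately obtain i where "is_arg_min (\<lambda>j. length (snd (fst j))) (\<lambda>j. j \<in> ?T) i"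
    using ex_is_arg_min_if_finite by blast
  hence i: "i \<in> ?T" "\<And>j. j \<in> ?T ==> length (snd (fst i)) \<le> length (snd (fst j))"
    unfolding is_arg_min_linorder by blast+
  obtain \<mu> \<nu> where \<mu>\<nu>: "i = (\<mu>, \<nu>)" by (cases i)
  have fp: "\<mu> \<in> fin_paths E" "\<nu> \<in> fin_paths E" "prange E \<mu> = prange E \<nu>"
    using i(1) assms(2) \<mu>\<nu> by (auto simp: normal_pairs_def range_pairs_def)
  have "prange E \<mu> \<in> verts E" using fp(1) fin_paths_prange[of "fst \<mu>" "snd \<mu>"] by simp
  then obtain x where x: "x \<in> boundary E" "bsource E x = prange E \<mu>" "follows_special x"
    using special_path_exists by blast
  have cx: "composable E \<mu> x" "composable E \<nu> x" using x fp by (auto simp: composable_def)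
  let ?\<gamma> = "(prepend \<mu> x, plength \<mu> - plength \<nu>, prepend \<nu> x)"
  have "?\<gamma> \<in> pair_Z E j \<longleftrightarrow> j = i" if j: "j \<in> ?T" for j
  proof
    assume "j = i"
    thus "?\<gamma> \<in> pair_Z E j" using cx \<mu>\<nu> by (auto simp: gpd_Z_def)
  next
    assume g: "?\<gamma> \<in> pair_Z E j"
    obtain \<mu>' \<nu>' where j': "j = (\<mu>', \<nu>')" by (cases j)
    obtain y where y: "composable E \<mu>' y" "composable E \<nu>' y" "prepend \<mu> x = prepend \<mu>' y"
      "plength \<mu> - plength \<nu> = plength \<mu>' - plength \<nu>'" "prepend \<nu> x = prepend \<nu>' y"
      using g j' by (auto simp: gpd_Z_def)
    have le: "length (snd \<mu>) \<le> length (snd \<mu>')" using i(2)[OF j] \<mu>\<nu> j' by simp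
    hence le': "length (snd \<nu>) \<le> length (snd \<nu>')" using y(4) by (simp add: plength_def)
    obtain s where s: "\<mu>' = (fst \<mu>, snd \<mu> @ s)" "x = prepend (bsource E x, s) y" "composable E (bsource E x, s) y"
      using gpd_common[OF cx(1) y(1,3) le] by blast
    obtain t where t: "\<nu>' = (fst \<nu>, snd \<nu> @ t)" "x = prepend (bsource E x, t) y" "composable E (bsource E x, t) y"
      using gpd_common[OF cx(2) y(2,5) le'] by blast
    have "length s = length t" using y(4) s(1) t(1) by (simp add: plength_def)
    hence st: "s = t" using prepend_eq_prefix[OF s(3) t(3)] s(2) t(2) by auto
    show "j = i"
    proof (cases "s = []")
      case True
      thus ?thesis using s t st \<mu>\<nu> j' by simp
    next
      case False
      then obtain w where w: "regular E w" "last s = special E w"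
        using x(3) s(2,3) unfolding follows_special_def by blast
      have "snd \<mu> @ s = (snd \<mu> @ butlast s) @ [special E w]" "snd \<nu> @ s = (snd \<nu> @ butlast s) @ [special E w]"
        using False w(2) append_butlast_last_id[OF False] by simp_all
      hence "j \<notin> normal_pairs E" unfolding normal_pairs_def j' s(1) t(1) st[symmetric] using w(1) by blast
      thus ?thesis using j assms(2) by blast
    qed
  qed
  hence "(\<Sum>j\<in>?T. c j * indicator (pair_Z E j) ?\<gamma>) = (\<Sum>j\<in>?T. if j = i then c j else 0)"
    by (intro sum.cong refl) (simp add: indicator_def)
  also have "\<dots> = c i" using i(1) assms(1) by simp
  also have "(\<Sum>j\<in>?T. c j * indicator (pair_Z E j) ?\<gamma>) = (\<Sum>j\<in>S. c j * indicator (pair_Z E j) ?\<gamma>)"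
    using assms(1) by (intro sum.mono_neutral_left) auto
  finally show False using assms(3)[of ?\<gamma>] i(1) by simp
qed

text \<open>Hence the map from the Leavitt path algebra to the groupoid algebra is injective.\<close>

theorem lpa_gpd_injective:
  fixes z z' :: "('v, 'e, 'k :: field) lpa_elt"
  assumes "lpa_gpd E z F" "lpa_gpd E z' F"
  shows "z = z'"
proof -
  obtain a where a: "a \<in> free_elts E" "z = lpa_class E a" "nf E a F" using lpa_gpd_nf[OF assms(1)] by blast
  obtain b where b: "b \<in> free_elts E" "z' = lpa_class E b" "nf E b F" using lpa_gpd_nf[OF assms(2)] by blast
  have "nf E (a + single unit_word (-1) * b) (\<lambda>\<gamma>. F \<gamma> + (-1) * F \<gamma>)"
    by (rule nf_linear[OF a(3) b(3)])
  hence "nf E (a - b) (\<lambda>_. 0)" by (simp add: scale_minus_one)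
  then obtain S c where S: "finite S" "S \<subseteq> normal_pairs E"
    "a - b - (\<Sum>i\<in>S. single (FWord (pair_word i)) (c i)) \<in> lpa_ideal E"
    "(\<lambda>_. 0) = (\<lambda>\<gamma>. \<Sum>i\<in>S. c i * indicator (pair_Z E i) \<gamma>)" unfolding nf_def by blast
  have "c i = 0" if "i \<in> S" for i
    by (rule normal_indicators_independent[OF S(1,2) fun_cong[OF S(4), symmetric] that])
  hence "a - b \<in> lpa_ideal E" using S(3) by simp
  thus ?thesis using a b lpa_class_eq_iff[of a b] by simp
qed

end

section \<open>Compact open sets of boundary paths\<close>

definition basic :: "('v, 'e) pre_digraph => ('v, 'e) fpath => ('v, 'e) fpath set => ('v, 'e) bpath set" where
  "basic E \<nu> Fs = cyl E \<nu> - (\<Union>\<kappa>\<in>Fs. cyl E \<kappa>)"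

lemma units_of_set_iff [simp]: "(x, k, y) \<in> units_of_set U \<longleftrightarrow> x \<in> U \<and> k = 0 \<and> y = x"
  by (auto simp: units_of_set_def)

lemma units_of_set_mono: "U \<subseteq> V ==> units_of_set U \<subseteq> units_of_set V"
  by (auto simp: units_of_set_def)

context path_graph
begin

lemma gpd_Z_unit:
  assumes "(x, 0, x) \<in> gpd_Z E \<mu> \<nu>"
  shows "\<mu> = \<nu> \<and> x \<in> cyl E \<mu>"
proof -
  obtain z where z: "composable E \<mu> z" "composable E \<nu> z" "x = prepend \<mu> z" "x = prepend \<nu> z"
    "plength \<mu> = plength \<nu>" using assms by (auto simp: gpd_Z_def)
  hence "length (snd \<mu>) = length (snd \<nu>)" by (simp add: plength_def)
  then obtain q where "\<nu> = (fst \<mu>, snd \<mu> @ q)" "length q = 0"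
    using gpd_common[OF z(1,2)] z(3,4) by (metis add_cancel_left_right eq_iff length_append snd_conv)
  hence "\<mu> = \<nu>" by simp
  thus ?thesis using z by (auto simp: cyl_def)
qed

lemma unit_gpd_Z: "x \<in> cyl E \<mu> ==> (x, 0, x) \<in> gpd_Z E \<mu> \<mu>"
  by (auto simp: cyl_def gpd_Z_def)

lemma gpd_Z_diag: "gpd_Z E \<mu> \<mu> = units_of_set (cyl E \<mu>)"
proof (intro subset_antisym subsetI)
  fix \<gamma> assume "\<gamma> \<in> gpd_Z E \<mu> \<mu>"
  then obtain z where "composable E \<mu> z" "\<gamma> = (prepend \<mu> z, 0, prepend \<mu> z)"
    unfolding gpd_Z_def by auto
  thus "\<gamma> \<in> units_of_set (cyl E \<mu>)" unfolding units_of_set_def cyl_def by blast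
next
  fix \<gamma> assume "\<gamma> \<in> units_of_set (cyl E \<mu>)"
  then obtain x where "x \<in> cyl E \<mu>" "\<gamma> = (x, 0, x)" unfolding units_of_set_def by blast
  thus "\<gamma> \<in> gpd_Z E \<mu> \<mu>" using unit_gpd_Z by simp
qed

lemma range_pairs_diag: "\<mu> \<in> fin_paths E ==> (\<mu>, \<mu>) \<in> range_pairs E"
  by (simp add: range_pairs_def)

lemma cyl_nested:
  assumes "x \<in> cyl E \<mu>" "x \<in> cyl E \<nu>" "length (snd \<mu>) \<le> length (snd \<nu>)"
  shows "cyl E \<nu> \<subseteq> cyl E \<mu>"
proof -
  obtain q where "fst \<nu> = fst \<mu>" "snd \<nu> = snd \<mu> @ q"
    using cyl_meet[of x "fst \<mu>" "snd \<mu>" "fst \<nu>" "snd \<nu>"] assms by auto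
  hence "\<nu> = (fst \<mu>, snd \<mu> @ q)" by (cases \<nu>) simp
  thus ?thesis using cyl_append_subset[of _ "fst \<mu>" "snd \<mu>" q] by auto
qed

lemma basic_Int:
  assumes "x \<in> basic E \<mu> Fs" "x \<in> basic E \<nu> Gs"
  shows "\<exists>\<rho>. x \<in> basic E \<rho> (Fs \<union> Gs) \<and> basic E \<rho> (Fs \<union> Gs) \<subseteq> basic E \<mu> Fs \<inter> basic E \<nu> Gs"
proof -
  have x: "x \<in> cyl E \<mu>" "x \<in> cyl E \<nu>" using assms by (auto simp: basic_def)
  have "\<exists>\<rho>. x \<in> cyl E \<rho> \<and> cyl E \<rho> \<subseteq> cyl E \<mu> \<inter> cyl E \<nu>"
  proof (cases "length (snd \<mu>) \<le> length (snd \<nu>)")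
    case True
    thus ?thesis using cyl_nested[OF x] x by (intro exI[of _ \<nu>]) simp
  next
    case False
    thus ?thesis using cyl_nested[OF x(2,1)] x by (intro exI[of _ \<mu>]) simp
  qed
  then obtain \<rho> where \<rho>: "x \<in> cyl E \<rho>" "cyl E \<rho> \<subseteq> cyl E \<mu> \<inter> cyl E \<nu>" by blast
  have "x \<in> basic E \<rho> (Fs \<union> Gs)" using assms \<rho>(1) by (simp add: basic_def)
  moreover have "basic E \<rho> (Fs \<union> Gs) \<subseteq> basic E \<mu> Fs \<inter> basic E \<nu> Gs"
    using \<rho>(2) unfolding basic_def by blast
  ultimately show ?thesis by blast
qed

lemma open_basic:
  assumes "openin (gpd_topology E) W" "x \<in> boundary E" "(x, 0, x) \<in> W"
  shows "\<exists>\<nu> Fs. finite Fs \<and> Fs \<subseteq> fin_paths E \<and> x \<in> basic E \<nu> Fs \<and> units_of_set (basic E \<nu> Fs) \<subseteq> W"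
proof -
  let ?S = "{gpd_Z E \<mu> \<nu> | \<mu> \<nu>. (\<mu>, \<nu>) \<in> range_pairs E} \<union>
      {gpd E - gpd_Z E \<mu> \<nu> | \<mu> \<nu>. (\<mu>, \<nu>) \<in> range_pairs E}"
  have "generate_topology_on ?S W"
    using assms(1) unfolding gpd_topology_def openin_topology_generated_by_iff .
  thus ?thesis using assms(3)
  proof (induction rule: generate_topology_on.induct)
    case (Int a b)
    hence "(x, 0, x) \<in> a" "(x, 0, x) \<in> b" by simp_all
    from Int.IH(1)[OF this(1)] Int.IH(2)[OF this(2)]
    obtain \<mu> Fs \<nu> Gs where *: "finite Fs" "Fs \<subseteq> fin_paths E" "x \<in> basic E \<mu> Fs" "units_of_set (basic E \<mu> Fs) \<subseteq> a"
      "finite Gs" "Gs \<subseteq> fin_paths E" "x \<in> basic E \<nu> Gs" "units_of_set (basic E \<nu> Gs) \<subseteq> b" by blast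
    obtain \<rho> where \<rho>: "x \<in> basic E \<rho> (Fs \<union> Gs)" "basic E \<rho> (Fs \<union> Gs) \<subseteq> basic E \<mu> Fs \<inter> basic E \<nu> Gs"
      using basic_Int[OF *(3,7)] by blast
    have "units_of_set (basic E \<rho> (Fs \<union> Gs)) \<subseteq> a \<inter> b"
      using units_of_set_mono[of "basic E \<rho> (Fs \<union> Gs)" "basic E \<mu> Fs"]
        units_of_set_mono[of "basic E \<rho> (Fs \<union> Gs)" "basic E \<nu> Gs"] \<rho>(2) *(4,8) by blast
    thus ?case using \<rho>(1) * by (intro exI[of _ \<rho>] exI[of _ "Fs \<union> Gs"]) simp
  next
    case (UN K)
    then obtain k where k: "k \<in> K" "(x, 0, x) \<in> k" by blast
    from UN.IH[OF k] obtain \<nu> Fs where "finite Fs" "Fs \<subseteq> fin_paths E" "x \<in> basic E \<nu> Fs" "units_of_set (basic E \<nu> Fs) \<subseteq> k"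
      by blast
    thus ?case using \<open>k \<in> K\<close> by (intro exI[of _ \<nu>] exI[of _ Fs] conjI) auto
  next
    case (Basis W)
    let ?s = "(bsource E x, [])"
    have sx: "x \<in> cyl E ?s" using assms(2) by simp
    from Basis(1) consider (Z) \<mu> \<nu> where "(\<mu>, \<nu>) \<in> range_pairs E" "W = gpd_Z E \<mu> \<nu>"
      | (C) \<mu> \<nu> where "(\<mu>, \<nu>) \<in> range_pairs E" "W = gpd E - gpd_Z E \<mu> \<nu>" by blast
    thus ?case
    proof cases
      case Z
      hence "\<mu> = \<nu>" "x \<in> cyl E \<mu>" using gpd_Z_unit Basis(2) by auto
      thus ?thesis using Z gpd_Z_diag[of \<mu>]
        by (intro exI[of _ \<mu>] exI[of _ "{}"]) (simp add: basic_def)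
    next
      case C
      show ?thesis
      proof (cases "\<mu> = \<nu>")
        case True
        hence "x \<notin> cyl E \<mu>" using C(2) Basis(2) unit_gpd_Z[of x \<mu>] by auto
        moreover have "units_of_set (basic E ?s {\<mu>}) \<subseteq> W"
          unfolding C(2) True[symmetric] gpd_Z_diag using cyl_boundary gpd_refl
          by (auto simp: units_of_set_def basic_def)
        ultimately show ?thesis using sx C(1)
          by (intro exI[of _ ?s] exI[of _ "{\<mu>}"]) (auto simp: basic_def range_pairs_def)
      next
        case False
        have "units_of_set (basic E ?s {}) \<subseteq> W"
          unfolding C(2) using gpd_Z_unit[of _ \<mu> \<nu>] False gpd_refl by (auto simp: units_of_set_def basic_def)
        thus ?thesis using sx by (intro exI[of _ ?s] exI[of _ "{}"]) (simp add: basic_def)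
      qed
    qed
  qed simp
qed

lemma gpd_Z_subset: "gpd_Z E \<mu> \<nu> \<subseteq> gpd E"
proof
  fix \<gamma> assume "\<gamma> \<in> gpd_Z E \<mu> \<nu>"
  then obtain z where "composable E \<mu> z" "composable E \<nu> z"
    "\<gamma> = (prepend \<mu> z, plength \<mu> - plength \<nu>, prepend \<nu> z)" unfolding gpd_Z_def by blast
  thus "\<gamma> \<in> gpd E" using gpdI[of \<mu> z \<nu>] by simp
qed

lemma gpd_covered:
  assumes "\<gamma> \<in> gpd E"
  shows "\<exists>\<mu> \<nu>. (\<mu>, \<nu>) \<in> range_pairs E \<and> \<gamma> \<in> gpd_Z E \<mu> \<nu>"
proof -
  obtain x k y where \<gamma>: "\<gamma> = (x, k, y)" by (cases \<gamma>)
  then obtain \<mu> \<nu> z where z: "composable E \<mu> z" "composable E \<nu> z" "k = plength \<mu> - plength \<nu>"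
    "x = prepend \<mu> z" "y = prepend \<nu> z" using assms gpdE[of x k y] by metis
  have "(\<mu>, \<nu>) \<in> range_pairs E" using z(1,2) by (simp add: range_pairs_def composable_def)
  moreover have "\<gamma> \<in> gpd_Z E \<mu> \<nu>" unfolding gpd_Z_def \<gamma> z(3-5) using z(1,2) by blast
  ultimately show ?thesis by blast
qed

lemma topspace_gpd: "topspace (gpd_topology E) = gpd E"
  unfolding gpd_topology_def topology_generated_by_topspace
proof (intro subset_antisym subsetI)
  fix \<gamma> assume "\<gamma> \<in> \<Union> ({gpd_Z E \<mu> \<nu> |\<mu> \<nu>. (\<mu>, \<nu>) \<in> range_pairs E} \<union>
      {gpd E - gpd_Z E \<mu> \<nu> |\<mu> \<nu>. (\<mu>, \<nu>) \<in> range_pairs E})"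
  then obtain \<mu> \<nu> where "\<gamma> \<in> gpd_Z E \<mu> \<nu> \<or> \<gamma> \<in> gpd E - gpd_Z E \<mu> \<nu>" by blast
  thus "\<gamma> \<in> gpd E" using gpd_Z_subset[of \<mu> \<nu>] by blast
next
  fix \<gamma> assume "\<gamma> \<in> gpd E"
  from gpd_covered[OF this] show "\<gamma> \<in> \<Union> ({gpd_Z E \<mu> \<nu> |\<mu> \<nu>. (\<mu>, \<nu>) \<in> range_pairs E} \<union>
      {gpd E - gpd_Z E \<mu> \<nu> |\<mu> \<nu>. (\<mu>, \<nu>) \<in> range_pairs E})" by blast
qed

lemma openin_gpd_Z:
  "(\<mu>, \<nu>) \<in> range_pairs E ==> openin (gpd_topology E) (gpd_Z E \<mu> \<nu>)"
  "(\<mu>, \<nu>) \<in> range_pairs E ==> openin (gpd_topology E) (gpd E - gpd_Z E \<mu> \<nu>)"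
  unfolding gpd_topology_def by (rule topology_generated_by_Basis, blast)+

text \<open>
  Compactness of cylinders.  If a cylinder is not finitely covered, neither is the cylinder of some
  proper extension of its path; the extensions converge to an infinite path, and the member of the
  cover containing that path covers a whole cylinder of the sequence.
\<close>

definition covered :: "('v, 'e) arrow set set => ('v, 'e) bpath set => bool" where
  "covered \<C> U \<longleftrightarrow> (\<exists>\<F>. finite \<F> \<and> \<F> \<subseteq> \<C> \<and> units_of_set U \<subseteq> \<Union>\<F>)"

lemma covered_mono:
  assumes "covered \<C> U" "V \<subseteq> U"
  shows "covered \<C> V"
proof -
  obtain \<F> where "finite \<F>" "\<F> \<subseteq> \<C>" "units_of_set U \<subseteq> \<Union>\<F>"
    using assms(1) unfolding covered_def by blast
  thus ?thesis unfolding covered_def using units_of_set_mono[OF assms(2)]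
    by (intro exI[of _ \<F>] conjI) (auto dest: subsetD)
qed

lemma covered_member: "C \<in> \<C> ==> units_of_set U \<subseteq> C ==> covered \<C> U"
  unfolding covered_def by (intro exI[of _ "{C}"]) auto

lemma covered_Un: "covered \<C> U ==> covered \<C> V ==> covered \<C> (U \<union> V)"
proof -
  assume "covered \<C> U" "covered \<C> V"
  then obtain \<F> \<G> where "finite \<F>" "\<F> \<subseteq> \<C>" "units_of_set U \<subseteq> \<Union>\<F>" "finite \<G>" "\<G> \<subseteq> \<C>" "units_of_set V \<subseteq> \<Union>\<G>"
    unfolding covered_def by blast
  thus ?thesis unfolding covered_def
    by (intro exI[of _ "\<F> \<union> \<G>"]) (auto simp: units_of_set_def)
qed

lemma covered_UN: "finite I ==> (\<And>i. i \<in> I ==> covered \<C> (U i)) ==> covered \<C> (\<Union>i\<in>I. U i)"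
proof (induction I rule: finite_induct)
  case empty
  show ?case unfolding covered_def by (intro exI[of _ "{}"]) (simp add: units_of_set_def)
next
  case (insert i I)
  thus ?case using covered_Un[of \<C> "U i" "\<Union>i\<in>I. U i"] by simp
qed

lemma uncovered_extension:
  assumes opn: "\<And>C. C \<in> \<C> ==> openin (gpd_topology E) C"
    and cov: "units_of_set (cyl E (u, p)) \<subseteq> \<Union>\<C>"
    and un: "\<not> covered \<C> (cyl E (u, p))" and fp: "(u, p) \<in> fin_paths E"
  shows "\<exists>q. q \<noteq> [] \<and> (u, p @ q) \<in> fin_paths E \<and> \<not> covered \<C> (cyl E (u, p @ q))"
proof (cases "regular E (prange E (u, p))")
  case True
  let ?w = "prange E (u, p)"
  have sub: "cyl E (u, p) \<subseteq> (\<Union>f\<in>out_arcs E ?w. cyl E (u, p @ [f]))"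
  proof
    fix x assume "x \<in> cyl E (u, p)"
    then obtain z where z: "composable E (u, p) z" "x = prepend (u, p) z" by (auto simp: cyl_def)
    hence zw: "z \<in> boundary E" "bsource E z = ?w" by (auto simp: composable_def)
    from zw(1) obtain e y where e: "e \<in> arcs E" "y \<in> boundary E" "head E e = bsource E y" "z = econs E e y"
      using True zw(2) by (cases rule: boundary_cases) auto
    hence "z \<in> cyl E (?w, [e])" using zw by (auto simp: cyl_Cons)
    hence "x \<in> cyl E (u, p @ [e])" using cyl_append[OF z(1), of "[e]"] z(2) by simp
    moreover have "e \<in> out_arcs E ?w" using e zw by simp
    ultimately show "x \<in> (\<Union>f\<in>out_arcs E ?w. cyl E (u, p @ [f]))" by blast
  qed
  have "\<exists>f\<in>out_arcs E ?w. \<not> covered \<C> (cyl E (u, p @ [f]))"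
  proof (rule ccontr)
    assume "\<not> ?thesis"
    hence "\<forall>f\<in>out_arcs E ?w. covered \<C> (cyl E (u, p @ [f]))" by blast
    hence c: "covered \<C> (\<Union>f\<in>out_arcs E ?w. cyl E (u, p @ [f]))"
      using True by (intro covered_UN) (simp_all add: regular_def)
    show False using covered_mono[OF c sub] un by simp
  qed
  then obtain f where "f \<in> out_arcs E ?w" "\<not> covered \<C> (cyl E (u, p @ [f]))" by blast
  thus ?thesis using fp by (intro exI[of _ "[f]"]) (auto simp: fin_paths_append)
next
  case False
  \<comment> \<open>here \<open>p\<close> itself is a boundary path, and a neighbourhood of it omits finitely many extensions\<close>
  let ?x = "FinP u p"
  have x: "?x \<in> boundary E" "?x \<in> cyl E (u, p)" using False fp cyl_exact[of u p] by auto
  hence "(?x, 0, ?x) \<in> \<Union>\<C>" using cov by (meson subsetD units_of_set_iff)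
  then obtain C where C: "C \<in> \<C>" "(?x, 0, ?x) \<in> C" by blast
  obtain \<nu> Fs where \<nu>: "finite Fs" "Fs \<subseteq> fin_paths E" "?x \<in> basic E \<nu> Fs" "units_of_set (basic E \<nu> Fs) \<subseteq> C"
    using open_basic[OF opn[OF C(1)] x(1) C(2)] by blast
  have x\<nu>: "?x \<in> cyl E (fst \<nu>, snd \<nu>)" using \<nu>(3) by (simp add: basic_def)
  have "length (snd \<nu>) \<le> length p" using cyl_finite[OF x\<nu>] by simp
  then obtain r where "u = fst \<nu>" "p = snd \<nu> @ r" using cyl_meet[OF x\<nu> x(2)] by auto
  hence sub: "cyl E (u, p) \<subseteq> cyl E \<nu>" using cyl_append_subset[of _ "fst \<nu>" "snd \<nu>" r] by auto
  have "\<exists>\<kappa>\<in>Fs. \<not> covered \<C> (cyl E (u, p) \<inter> cyl E \<kappa>)"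
  proof (rule ccontr)
    assume "\<not> ?thesis"
    hence "covered \<C> (\<Union>\<kappa>\<in>Fs. cyl E (u, p) \<inter> cyl E \<kappa>)" using \<nu>(1) by (intro covered_UN) auto
    moreover have "covered \<C> (basic E \<nu> Fs)" by (rule covered_member[OF C(1) \<nu>(4)])
    ultimately have "covered \<C> ((\<Union>\<kappa>\<in>Fs. cyl E (u, p) \<inter> cyl E \<kappa>) \<union> basic E \<nu> Fs)" by (rule covered_Un)
    moreover have "cyl E (u, p) \<subseteq> (\<Union>\<kappa>\<in>Fs. cyl E (u, p) \<inter> cyl E \<kappa>) \<union> basic E \<nu> Fs"
      using sub by (auto simp: basic_def)
    ultimately have "covered \<C> (cyl E (u, p))" by (rule covered_mono)
    thus False using un by simp
  qed
  then obtain \<kappa> where \<kappa>: "\<kappa> \<in> Fs" "\<not> covered \<C> (cyl E (u, p) \<inter> cyl E \<kappa>)" by blast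
  have "cyl E (u, p) \<inter> cyl E \<kappa> \<noteq> {}"
  proof
    assume "cyl E (u, p) \<inter> cyl E \<kappa> = {}"
    thus False using \<kappa>(2) covered_UN[of "{}" \<C>] by simp
  qed
  then obtain y where y: "y \<in> cyl E (u, p)" "y \<in> cyl E (fst \<kappa>, snd \<kappa>)" by auto
  have nx: "?x \<notin> cyl E \<kappa>" using \<nu>(3) \<kappa>(1) by (auto simp: basic_def)
  have "\<not> length (snd \<kappa>) \<le> length p"
  proof
    assume "length (snd \<kappa>) \<le> length p"
    then obtain r where "u = fst \<kappa>" "p = snd \<kappa> @ r" using cyl_meet[OF y(2,1)] by auto
    thus False using nx x(2) cyl_append_subset[of ?x "fst \<kappa>" "snd \<kappa>" r] by auto
  qed
  then obtain q where q: "\<kappa> = (u, p @ q)" "q \<noteq> []"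
    using cyl_meet[OF y] by (cases \<kappa>) fastforce
  have "\<not> covered \<C> (cyl E (u, p @ q))"
    using covered_mono[of \<C> "cyl E (u, p @ q)" "cyl E (u, p) \<inter> cyl E \<kappa>"] \<kappa>(2) q(1) by auto
  thus ?thesis using q \<kappa>(1) \<nu>(2) by (intro exI[of _ q]) auto
qed

lemma cyl_covered:
  assumes opn: "\<And>C. C \<in> \<C> ==> openin (gpd_topology E) C"
    and cov: "units_of_set (cyl E (u, p)) \<subseteq> \<Union>\<C>" and fp: "(u, p) \<in> fin_paths E"
  shows "covered \<C> (cyl E (u, p))"
proof (rule ccontr)
  assume un: "\<not> covered \<C> (cyl E (u, p))"
  let ?bad = "\<lambda>r. (u, r) \<in> fin_paths E \<and> \<not> covered \<C> (cyl E (u, r)) \<and> (\<exists>s. r = p @ s)"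
  define nxt where "nxt r = r @ (SOME q. q \<noteq> [] \<and> ?bad (r @ q))" for r
  have nxt: "\<exists>q. nxt r = r @ q \<and> q \<noteq> [] \<and> ?bad (nxt r)" if r: "?bad r" for r
  proof -
    have "cyl E (u, r) \<subseteq> cyl E (u, p)" using r cyl_append_subset by auto
    hence "units_of_set (cyl E (u, r)) \<subseteq> \<Union>\<C>" using cov units_of_set_mono by blast
    then obtain q where "q \<noteq> []" "?bad (r @ q)" using uncovered_extension[OF opn, of \<C> u r] r by fastforce
    hence "(SOME q. q \<noteq> [] \<and> ?bad (r @ q)) \<noteq> [] \<and> ?bad (r @ (SOME q. q \<noteq> [] \<and> ?bad (r @ q)))"
      using someI_ex[of "\<lambda>q. q \<noteq> [] \<and> ?bad (r @ q)"] by blast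
    thus ?thesis unfolding nxt_def by blast
  qed
  define a where "a n = (nxt ^^ n) p" for n
  have a0: "a 0 = p" and aS: "a (Suc n) = nxt (a n)" for n by (simp_all add: a_def)
  have bad: "?bad (a n)" for n
  proof (induction n)
    case 0
    show ?case using fp un by (simp add: a0)
  next
    case (Suc n)
    show ?case unfolding aS using nxt[OF Suc] by blast
  qed
  have step: "\<exists>q. a (Suc n) = a n @ q \<and> q \<noteq> []" for n unfolding aS using nxt[OF bad[of n]] by blast
  have len: "n \<le> length (a n)" for n
  proof (induction n)
    case (Suc n)
    obtain q where "a (Suc n) = a n @ q" "q \<noteq> []" using step[of n] by blast
    thus ?case using Suc by (cases q) auto
  qed simp
  have pre: "\<exists>q. a (n + m) = a n @ q" for n m
  proof (induction m)
    case (Suc m)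
    thus ?case using step[of "n + m"] by auto
  qed simp
  define \<omega> where "\<omega> = smap (\<lambda>i. a (Suc i) ! i) nats"
  have nth: "a n ! i = \<omega> !! i" if "i < length (a n)" for n i
  proof -
    have "a n ! i = a (Suc i) ! i"
    proof (cases "n \<le> Suc i")
      case True
      then obtain q where "a (Suc i) = a n @ q" using pre[of n "Suc i - n"] by auto
      thus ?thesis using that by (simp add: nth_append)
    next
      case False
      then obtain q where "a n = a (Suc i) @ q" using pre[of "Suc i" "n - Suc i"] by auto
      thus ?thesis using len[of "Suc i"] by (simp add: nth_append)
    qed
    thus ?thesis by (simp add: \<omega>_def)
  qed
  have st: "stake (length (a n)) \<omega> = a n" for n
    by (rule nth_equalityI) (simp_all add: nth)
  have walk: "awalk u (a n) (prange E (u, a n))" for n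
    using bad[of n] by (auto simp: fin_paths_def prange_def)
  have inf: "\<omega> \<in> inf_paths E" unfolding inf_paths_def
  proof (intro CollectI conjI allI)
    show "sset \<omega> \<subseteq> arcs E" unfolding sset_range
    proof
      fix e assume "e \<in> range ((!!) \<omega>)"
      then obtain i where "e = \<omega> !! i" by auto
      hence "e \<in> set (a (Suc i))" using nth[of i "Suc i"] len[of "Suc i"] nth_mem[of i "a (Suc i)"] by simp
      thus "e \<in> arcs E" using walk[of "Suc i"] by (auto simp: awalk_def)
    qed
    show "head E (\<omega> !! i) = tail E (\<omega> !! Suc i)" for i
      using closed_walk_nth[OF walk[of "Suc (Suc i)"], of i] len[of "Suc (Suc i)"]
        nth[of i "Suc (Suc i)"] nth[of "Suc i" "Suc (Suc i)"] by simp
  qed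
  obtain e r where er: "a 1 = e # r" using len[of 1] by (cases "a 1") auto
  hence "shd \<omega> = e" using nth[of 0 1] by simp
  hence u: "tail E (shd \<omega>) = u" using bad[of 1] er by simp
  have x: "InfP \<omega> \<in> cyl E (u, a n)" for n using cyl_stake[OF inf, of "length (a n)"] u st by simp
  have "(InfP \<omega>, 0, InfP \<omega>) \<in> \<Union>\<C>" using cov x[of 0] a0 by (metis subsetD units_of_set_iff)
  then obtain C where C: "C \<in> \<C>" "(InfP \<omega>, 0, InfP \<omega>) \<in> C" by blast
  have xb: "InfP \<omega> \<in> boundary E" using inf by simp
  obtain \<nu> Fs where \<nu>: "finite Fs" "InfP \<omega> \<in> basic E \<nu> Fs" "units_of_set (basic E \<nu> Fs) \<subseteq> C"
    using open_basic[OF opn[OF C(1)] xb C(2)] by blast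
  define n where "n = Max (insert (length (snd \<nu>)) ((\<lambda>\<kappa>. length (snd \<kappa>)) ` Fs))"
  have n: "length (snd \<nu>) \<le> length (a n)" "\<And>\<kappa>. \<kappa> \<in> Fs ==> length (snd \<kappa>) \<le> length (a n)"
  proof -
    have "length (snd \<nu>) \<le> n" "\<And>\<kappa>. \<kappa> \<in> Fs ==> length (snd \<kappa>) \<le> n"
      unfolding n_def using \<nu>(1) by (auto intro!: Max_ge)
    thus "length (snd \<nu>) \<le> length (a n)" "\<And>\<kappa>. \<kappa> \<in> Fs ==> length (snd \<kappa>) \<le> length (a n)"
      using len[of n] by (meson le_trans)+
  qed
  have "cyl E (u, a n) \<subseteq> basic E \<nu> Fs"
  proof
    fix y assume y: "y \<in> cyl E (u, a n)"
    have sub: "y \<in> cyl E \<kappa> \<longleftrightarrow> InfP \<omega> \<in> cyl E \<kappa>" if l: "length (snd \<kappa>) \<le> length (a n)" for \<kappa>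
    proof -
      have "z' \<in> cyl E \<kappa>" if z: "z \<in> cyl E (u, a n)" "z' \<in> cyl E (u, a n)" "z \<in> cyl E \<kappa>" for z z'
      proof -
        obtain s where "\<kappa> = (u, snd \<kappa>)" "a n = snd \<kappa> @ s"
          using cyl_meet[of z "fst \<kappa>" "snd \<kappa>" u "a n"] z l by (metis prod.collapse)
        thus ?thesis using z(2) cyl_append_subset[of z' u "snd \<kappa>" s] by simp
      qed
      from this[OF y x] this[OF x y] show ?thesis by blast
    qed
    show "y \<in> basic E \<nu> Fs" using \<nu>(2) sub[OF n(1)] sub[OF n(2)] by (auto simp: basic_def)
  qed
  hence "covered \<C> (cyl E (u, a n))" by (rule covered_mono[OF covered_member[OF C(1) \<nu>(3)]])
  thus False using bad[of n] by simp
qed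

lemma compactin_cyl:
  assumes "\<mu> \<in> fin_paths E"
  shows "compactin (gpd_topology E) (units_of_set (cyl E \<mu>))"
  unfolding compactin_def topspace_gpd
proof (intro conjI allI impI)
  show "units_of_set (cyl E \<mu>) \<subseteq> gpd E"
    using gpd_Z_subset[of \<mu> \<mu>] gpd_Z_diag[of \<mu>] by simp
  fix \<C> assume "Ball \<C> (openin (gpd_topology E)) \<and> units_of_set (cyl E \<mu>) \<subseteq> \<Union>\<C>"
  hence "covered \<C> (cyl E \<mu>)" using cyl_covered[of \<C> "fst \<mu>" "snd \<mu>"] assms by auto
  thus "\<exists>\<F>. finite \<F> \<and> \<F> \<subseteq> \<C> \<and> units_of_set (cyl E \<mu>) \<subseteq> \<Union>\<F>" unfolding covered_def .
qed

lemma units_of_basic: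
  "units_of_set (basic E \<mu> Fs) = (gpd_Z E \<mu> \<mu> \<inter> (\<Inter>\<kappa>\<in>Fs. gpd E - gpd_Z E \<kappa> \<kappa>)) \<inter> units_of_set (boundary E)"
  by (auto simp: gpd_Z_diag basic_def units_of_set_def dest: cyl_boundary intro: gpd_refl)

lemma openin_basic:
  assumes "\<mu> \<in> fin_paths E" "finite Fs" "Fs \<subseteq> fin_paths E"
  shows "openin (subtopology (gpd_topology E) (units_of_set (boundary E))) (units_of_set (basic E \<mu> Fs))"
proof -
  have "openin (gpd_topology E) (gpd_Z E \<mu> \<mu> \<inter> (\<Inter>\<kappa>\<in>Fs. gpd E - gpd_Z E \<kappa> \<kappa>))"
  proof (cases "Fs = {}")
    case False
    thus ?thesis using assms range_pairs_diag openin_gpd_Z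
      by (intro openin_Int openin_Inter) (auto simp: subset_iff)
  qed (use assms range_pairs_diag openin_gpd_Z in simp)
  thus ?thesis unfolding units_of_basic openin_subtopology by blast
qed

lemma compact_open_basic:
  assumes "\<mu> \<in> fin_paths E" "finite Fs" "Fs \<subseteq> fin_paths E"
  shows "compact_open E (basic E \<mu> Fs)"
  unfolding compact_open_def Let_def
proof (intro conjI)
  show b: "basic E \<mu> Fs \<subseteq> boundary E" by (auto simp: basic_def dest: cyl_boundary)
  show "openin (subtopology (gpd_topology E) (units_of_set (boundary E))) (units_of_set (basic E \<mu> Fs))"
    by (rule openin_basic[OF assms])
  have "closedin (gpd_topology E) (gpd E - (\<Union>\<kappa>\<in>Fs. gpd_Z E \<kappa> \<kappa>))"
    using assms range_pairs_diag openin_gpd_Z(1) gpd_Z_subset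
    by (intro closedin_diff[OF closedin_topspace[of "gpd_topology E", unfolded topspace_gpd]] openin_Union) (auto simp: subset_iff)
  hence "compactin (gpd_topology E) ((gpd E - (\<Union>\<kappa>\<in>Fs. gpd_Z E \<kappa> \<kappa>)) \<inter> units_of_set (cyl E \<mu>))"
    by (rule closed_Int_compactin[OF _ compactin_cyl[OF assms(1)]])
  moreover have "(gpd E - (\<Union>\<kappa>\<in>Fs. gpd_Z E \<kappa> \<kappa>)) \<inter> units_of_set (cyl E \<mu>) = units_of_set (basic E \<mu> Fs)"
    by (auto simp: gpd_Z_diag basic_def units_of_set_def dest: cyl_boundary intro: gpd_refl)
  ultimately show "compactin (subtopology (gpd_topology E) (units_of_set (boundary E))) (units_of_set (basic E \<mu> Fs))"
    unfolding compactin_subtopology using units_of_set_mono[OF b] by simp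
qed

text \<open>Conversely a compact open set is a finite union of basic neighbourhoods, so its indicator is a
  combination of indicators of cylinders.\<close>

lemma compact_open_finite_union:
  assumes "compact_open E U"
  shows "\<exists>\<I>. finite \<I> \<and> (\<forall>(\<mu>, Fs)\<in>\<I>. \<mu> \<in> fin_paths E \<and> finite Fs \<and> Fs \<subseteq> fin_paths E) \<and>
    U = (\<Union>(\<mu>, Fs)\<in>\<I>. basic E \<mu> Fs)"
proof -
  let ?T = "subtopology (gpd_topology E) (units_of_set (boundary E))"
  have U: "U \<subseteq> boundary E" "compactin ?T (units_of_set U)" "openin ?T (units_of_set U)"
    using assms by (auto simp: compact_open_def Let_def)
  then obtain W where W: "openin (gpd_topology E) W" "units_of_set U = W \<inter> units_of_set (boundary E)"
    by (auto simp: openin_subtopology)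
  let ?J = "{(\<mu>, Fs). \<mu> \<in> fin_paths E \<and> finite Fs \<and> Fs \<subseteq> fin_paths E \<and> basic E \<mu> Fs \<subseteq> U}"
  let ?B = "\<lambda>(\<mu>, Fs). units_of_set (basic E \<mu> Fs)"
  have "units_of_set U \<subseteq> \<Union>(?B ` ?J)"
  proof
    fix \<gamma> assume "\<gamma> \<in> units_of_set U"
    then obtain x where x: "x \<in> U" "\<gamma> = (x, 0, x)" by (auto simp: units_of_set_def)
    have xb: "x \<in> boundary E" using U(1) x by blast
    have "(x, 0, x) \<in> W" using W(2) x(1) by (metis IntD1 units_of_set_iff)
    then obtain \<nu> Fs where \<nu>: "finite Fs" "Fs \<subseteq> fin_paths E" "x \<in> basic E \<nu> Fs" "units_of_set (basic E \<nu> Fs) \<subseteq> W"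
      using open_basic[OF W(1) xb] by blast
    have "y \<in> U" if y: "y \<in> basic E \<nu> Fs" for y
    proof -
      have "y \<in> boundary E" using y by (auto simp: basic_def dest: cyl_boundary)
      hence "(y, 0, y) \<in> W \<inter> units_of_set (boundary E)" using \<nu>(4) y by auto
      thus ?thesis unfolding W(2)[symmetric] by simp
    qed
    moreover have "\<nu> \<in> fin_paths E" using \<nu>(3) by (auto simp: basic_def dest: cyl_fin_paths)
    ultimately have "(\<nu>, Fs) \<in> ?J" using \<nu> by blast
    moreover have "\<gamma> \<in> ?B (\<nu>, Fs)" using \<nu>(3) x by simp
    ultimately show "\<gamma> \<in> \<Union>(?B ` ?J)" by blast
  qed
  moreover have "\<forall>B\<in>?B ` ?J. openin ?T B" using openin_basic by auto
  ultimately obtain \<F> where \<F>: "finite \<F>" "\<F> \<subseteq> ?B ` ?J" "units_of_set U \<subseteq> \<Union>\<F>"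
    using U(2) unfolding compactin_def by meson
  then obtain \<I> where \<I>: "\<I> \<subseteq> ?J" "finite \<I>" "\<F> = ?B ` \<I>"
    using finite_subset_image[OF \<F>(1,2)] by blast
  have "U = (\<Union>(\<mu>, Fs)\<in>\<I>. basic E \<mu> Fs)"
  proof
    show "(\<Union>(\<mu>, Fs)\<in>\<I>. basic E \<mu> Fs) \<subseteq> U" using \<I>(1) by auto
    show "U \<subseteq> (\<Union>(\<mu>, Fs)\<in>\<I>. basic E \<mu> Fs)"
    proof
      fix x assume "x \<in> U"
      hence "(x, 0, x) \<in> \<Union>(?B ` \<I>)" using \<F>(3) \<I>(3) by (metis subsetD units_of_set_iff)
      then obtain i where "i \<in> \<I>" "(x, 0, x) \<in> ?B i" by blast
      thus "x \<in> (\<Union>(\<mu>, Fs)\<in>\<I>. basic E \<mu> Fs)" by (cases i) auto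
    qed
  qed
  thus ?thesis using \<I> by (intro exI[of _ \<I>]) auto
qed

inductive_set cyl_span :: "(('v, 'e) bpath => 'k :: field) set" where
  zero: "(\<lambda>_. 0) \<in> cyl_span"
| step: "f \<in> cyl_span ==> \<mu> \<in> fin_paths E ==> (\<lambda>x. f x + k * indicator (cyl E \<mu>) x) \<in> cyl_span"

lemma cyl_span_add: "g \<in> cyl_span ==> f \<in> cyl_span ==> (\<lambda>x. f x + g x) \<in> cyl_span"
proof (induction rule: cyl_span.induct)
  case (step g \<mu> k)
  have "(\<lambda>x. (f x + g x) + k * indicator (cyl E \<mu>) x) \<in> cyl_span"
    using step by (intro cyl_span.step) auto
  thus ?case by (simp add: add.assoc)
qed simp

lemma cyl_span_scale: "g \<in> cyl_span ==> (\<lambda>x. k * g x) \<in> cyl_span"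
proof (induction rule: cyl_span.induct)
  case (step g \<mu> l)
  have "(\<lambda>x. k * g x + (k * l) * indicator (cyl E \<mu>) x) \<in> cyl_span"
    using step by (intro cyl_span.step) auto
  thus ?case by (simp add: algebra_simps)
qed (simp add: cyl_span.zero)

lemma cyl_span_cyl: "\<mu> \<in> fin_paths E ==> (indicator (cyl E \<mu>) :: _ => 'k :: field) \<in> cyl_span"
  using cyl_span.step[OF cyl_span.zero, of \<mu> 1] by simp

lemma cyl_span_mult_cyl:
  assumes "\<mu> \<in> fin_paths E"
  shows "g \<in> cyl_span ==> (\<lambda>x. g x * indicator (cyl E \<mu>) x) \<in> cyl_span"
proof (induction rule: cyl_span.induct)
  case (step g \<nu> k)
  have "(\<lambda>x. indicator (cyl E \<nu> \<inter> cyl E \<mu>) x :: 'a) \<in> cyl_span"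
  proof (cases "cyl E \<nu> \<inter> cyl E \<mu> = {}")
    case False
    then obtain x where x: "x \<in> cyl E \<nu>" "x \<in> cyl E \<mu>" by blast
    hence "cyl E \<nu> \<inter> cyl E \<mu> = cyl E \<mu> \<or> cyl E \<nu> \<inter> cyl E \<mu> = cyl E \<nu>"
      using cyl_nested[OF x] cyl_nested[OF x(2,1)] by (meson inf.absorb1 inf.absorb2 nle_le)
    thus ?thesis using cyl_span_cyl[OF assms] cyl_span_cyl[OF step(2)] by auto
  qed (simp add: cyl_span.zero)
  from cyl_span_add[OF cyl_span_scale[OF this, of k] step.IH]
  show ?case by (simp add: algebra_simps indicator_inter_arith)
qed (simp add: cyl_span.zero)

lemma cyl_span_mult: "g \<in> cyl_span ==> f \<in> cyl_span ==> (\<lambda>x. f x * g x) \<in> cyl_span"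
proof (induction rule: cyl_span.induct)
  case (step g \<mu> k)
  have "(\<lambda>x. f x * g x + k * (f x * indicator (cyl E \<mu>) x)) \<in> cyl_span"
    using step by (intro cyl_span_add[OF cyl_span_scale[OF cyl_span_mult_cyl]]) auto
  thus ?case by (simp add: algebra_simps)
qed (simp add: cyl_span.zero)

lemma cyl_span_basic:
  assumes "\<mu> \<in> fin_paths E" "finite Fs" "Fs \<subseteq> fin_paths E"
  shows "(indicator (basic E \<mu> Fs) :: _ => 'k :: field) \<in> cyl_span"
  using assms(2,3)
proof (induction Fs rule: finite_induct)
  case empty
  show ?case using cyl_span_cyl[OF assms(1)] by (simp add: basic_def)
next
  case (insert \<kappa> Fs)
  let ?i = "indicator (basic E \<mu> Fs) :: _ => 'k"
  have i: "?i \<in> cyl_span" using insert by simp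
  have "(\<lambda>x. ?i x + (-1) * (?i x * indicator (cyl E \<kappa>) x)) \<in> cyl_span"
    using insert by (intro cyl_span_add[OF cyl_span_scale[OF cyl_span_mult_cyl[OF _ i]] i]) auto
  moreover have "(\<lambda>x. ?i x + (-1) * (?i x * indicator (cyl E \<kappa>) x)) = indicator (basic E \<mu> (insert \<kappa> Fs))"
    by (auto simp: basic_def indicator_def fun_eq_iff)
  ultimately show ?case by simp
qed

lemma cyl_span_compact_open:
  assumes "compact_open E U"
  shows "(indicator U :: _ => 'k :: field) \<in> cyl_span"
proof -
  obtain \<I> where \<I>: "finite \<I>" "\<forall>(\<mu>, Fs)\<in>\<I>. \<mu> \<in> fin_paths E \<and> finite Fs \<and> Fs \<subseteq> fin_paths E"
    "U = (\<Union>(\<mu>, Fs)\<in>\<I>. basic E \<mu> Fs)" using compact_open_finite_union[OF assms] by blast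
  have "(indicator (\<Union>(\<mu>, Fs)\<in>\<I>. basic E \<mu> Fs) :: _ => 'k) \<in> cyl_span"
    using \<I>(1,2)
  proof (induction \<I> rule: finite_induct)
    case empty
    show ?case using cyl_span.zero by simp
  next
    case (insert i \<I>)
    obtain \<mu> Fs where i: "i = (\<mu>, Fs)" by (cases i)
    let ?A = "\<Union>(\<mu>, Fs)\<in>\<I>. basic E \<mu> Fs" and ?B = "basic E \<mu> Fs"
    have A: "(indicator ?A :: _ => 'k) \<in> cyl_span" using insert by simp
    have B: "(indicator ?B :: _ => 'k) \<in> cyl_span" using insert.prems i by (intro cyl_span_basic) auto
    have "(\<lambda>x. (indicator ?A x + indicator ?B x) + (-1) * (indicator ?A x * indicator ?B x) :: 'k) \<in> cyl_span"
      by (intro cyl_span_add[OF cyl_span_scale[OF cyl_span_mult[OF B A]] cyl_span_add[OF B A]])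
    moreover have "(\<lambda>x. (indicator ?A x + indicator ?B x) + (-1) * (indicator ?A x * indicator ?B x) :: 'k) =
        indicator (\<Union>(\<mu>, Fs)\<in>insert i \<I>. basic E \<mu> Fs)"
      by (auto simp: i indicator_def fun_eq_iff)
    ultimately show ?case by simp
  qed
  thus ?thesis using \<I>(3) by simp
qed

end

context lpa_module
begin

lemma lpa_step:
  assumes "a \<in> aug E" "c \<in> aug E"
  shows "lpa_class E a \<oplus>\<^bsub>lpa E\<^esub> k \<odot>\<^bsub>lpa E\<^esub> lpa_class E c =
    lpa_class E (a + single unit_word k * c)"
  by (simp only: lpa_smult[OF aug_free[OF assms(2)]]
      lpa_add[OF aug_free[OF assms(1)] aug_free[OF aug_scale[OF assms(2)]]])

lemma lpa_mono_eq: "lpa_mono E \<mu> \<nu> = lpa_class E (mon (pair_word (\<mu>, \<nu>)))"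
  by (simp add: lpa_mono_def pair_word_def)

lemma lpa_gpd_in_carrier: "lpa_gpd E z (F :: _ => 'k) ==> z \<in> carrier (lpa E)"
proof (induction rule: lpa_gpd.induct)
  case zero
  show ?case unfolding lpa_zero lpa_carrier by (rule imageI) simp
next
  case (step z F \<mu> \<nu> k)
  obtain a where a: "a \<in> aug E" "z = lpa_class E a" using step.IH unfolding lpa_carrier by blast
  have "mon (pair_word (\<mu>, \<nu>)) \<in> aug E"
    using step.hyps(2) words_gens[of \<mu>] words_gens[of \<nu>] by (auto simp: range_pairs_def pair_word_def)
  hence "a + single unit_word k * mon (pair_word (\<mu>, \<nu>)) \<in> aug E"
    using a by (intro aug_add aug_scale)
  moreover have "z \<oplus>\<^bsub>lpa E\<^esub> k \<odot>\<^bsub>lpa E\<^esub> lpa_mono E \<mu> \<nu> =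
      lpa_class E (a + single unit_word k * mon (pair_word (\<mu>, \<nu>)))"
    unfolding a(2) lpa_mono_eq using a(1) \<open>mon (pair_word (\<mu>, \<nu>)) \<in> aug E\<close> by (rule lpa_step)
  ultimately show ?case unfolding lpa_carrier by blast
qed

text \<open>A function in the span of the cylinders acts on the stalk at \<open>x\<close> by its value at \<open>x\<close>.\<close>

lemma cyl_span_acts:
  assumes "(f :: _ => 'k) \<in> cyl_span"
  shows "\<exists>z. lpa_gpd E z (\<lambda>(x, k, y). if k = 0 \<and> x = y then f x else 0) \<and>
     (\<forall>x. \<forall>m\<in>stalk x. act M z m = f x \<odot>\<^bsub>M\<^esub> m)"
  using assms
proof (induction rule: cyl_span.induct)
  case zero
  have "(\<lambda>(x, k, y). if k = 0 \<and> x = y then 0 else 0) = (\<lambda>_. 0)" by auto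
  moreover have "act M \<zero>\<^bsub>lpa E\<^esub> m = 0 \<odot>\<^bsub>M\<^esub> m" if "m \<in> stalk x" for m x
    using that A_zero[of m] by (simp add: lpa_zero A_def)
  ultimately show ?case using lpa_gpd.zero[of E] by (intro exI[of _ "\<zero>\<^bsub>lpa E\<^esub>"]) auto
next
  case (step f \<mu> k)
  then obtain z where z: "lpa_gpd E z (\<lambda>(x, k, y). if k = 0 \<and> x = y then f x else 0)"
    "\<forall>x. \<forall>m\<in>stalk x. act M z m = f x \<odot>\<^bsub>M\<^esub> m" by blast
  let ?z = "z \<oplus>\<^bsub>lpa E\<^esub> k \<odot>\<^bsub>lpa E\<^esub> lpa_mono E \<mu> \<mu>"
  have "(\<lambda>\<gamma>. (case \<gamma> of (x, k, y) => if k = 0 \<and> x = y then f x else 0) + k * indicator (gpd_Z E \<mu> \<mu>) \<gamma>)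
     = (\<lambda>(x, l, y). if l = 0 \<and> x = y then f x + k * indicator (cyl E \<mu>) x else 0)"
    unfolding gpd_Z_diag by (auto simp: fun_eq_iff indicator_def)
  hence g: "lpa_gpd E ?z (\<lambda>(x, l, y). if l = 0 \<and> x = y then f x + k * indicator (cyl E \<mu>) x else 0)"
    using lpa_gpd.step[OF z(1) range_pairs_diag[OF step.hyps(2)], of k] by simp
  have "act M ?z m = (f x + k * indicator (cyl E \<mu>) x) \<odot>\<^bsub>M\<^esub> m" if m: "m \<in> stalk x" for x m
  proof -
    have mc: "m \<in> carrier M" using m by simp
    obtain a where a: "a \<in> aug E" "z = lpa_class E a"
      using lpa_gpd_in_carrier[OF z(1)] unfolding lpa_carrier by blast
    let ?m = "mon (pair_word (\<mu>, \<mu>)) :: ('v, 'e, 'k) free"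
    have m': "?m \<in> aug E" using words_gens[OF step.hyps(2)] by (simp add: pair_word_def)
    have mono: "lpa_mono E \<mu> \<mu> = lpa_class E ?m" by (simp add: lpa_mono_def pair_word_def)
    have "act M ?z m = A (a + single unit_word k * ?m) m"
      unfolding a(2) mono lpa_step[OF a(1) m'] A_def ..
    also have "\<dots> = act M z m \<oplus>\<^bsub>M\<^esub> k \<odot>\<^bsub>M\<^esub> act M (lpa_mono E \<mu> \<mu>) m"
      using A_add[OF a(1) aug_scale[OF m'] mc] A_scale[OF m' mc] a(2) by (simp add: A_def mono)
    also have "act M (lpa_mono E \<mu> \<mu>) m = proj \<mu> m"
      using act_lpa_mono[OF step.hyps(2,2) mc] by (simp add: proj_def)
    also have "act M z m = f x \<odot>\<^bsub>M\<^esub> m" using z(2) m by blast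
    finally show ?thesis using stalkD(2)[OF m step.hyps(2)] mc by (simp add: vsmult_add)
  qed
  thus ?case using g by blast
qed

lemma gpd_act_eq:
  assumes "lpa_gpd E z F"
  shows "gpd_act E M F = act M z"
proof -
  have "(THE z. lpa_gpd E z F) = z"
    by (rule the_equality[of "\<lambda>z. lpa_gpd E z F" z, OF assms]) (rule lpa_gpd_injective[OF _ assms])
  thus ?thesis by (simp add: gpd_act_def)
qed

lemma indicator_units:
  "(\<lambda>(x, k, y). if k = 0 \<and> x = y then indicator U x else 0 :: 'k) = indicator (units_of_set U)"
  by (auto simp: fun_eq_iff indicator_def)

text \<open>Compact open sets act through elements of the algebra, and the intersection of their images is
  the stalk.\<close>

theorem Res_eq_stalk:
  assumes "x \<in> boundary E"
  shows "Res E M x = stalk x"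
proof
  show "stalk x \<subseteq> Res E M x" unfolding Res_def
  proof (intro subsetI INT_I)
    fix m U assume m: "m \<in> stalk x" and "U \<in> {U. compact_open E U \<and> x \<in> U}"
    hence U: "compact_open E U" "x \<in> U" by auto
    obtain z where z: "lpa_gpd E z (indicator (units_of_set U))"
      "\<forall>x. \<forall>m\<in>stalk x. act M z m = indicator U x \<odot>\<^bsub>M\<^esub> m"
      using cyl_span_acts[OF cyl_span_compact_open[OF U(1)]] unfolding indicator_units by blast
    have "gpd_act E M (indicator (units_of_set U)) m = m"
      unfolding gpd_act_eq[OF z(1)] using z(2) m U(2) by simp
    thus "m \<in> gpd_act E M (indicator (units_of_set U)) ` carrier M" using m by (metis imageI stalk_carrier)
  qed
  show "Res E M x \<subseteq> stalk x"
  proof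
    fix m assume m: "m \<in> Res E M x"
    have mU: "\<exists>n\<in>carrier M. m = act M z n"
      if "lpa_gpd E z (indicator (units_of_set U))" "compact_open E U" "x \<in> U" for z U
      using m that(2,3) unfolding Res_def gpd_act_eq[OF that(1), symmetric] by blast
    have mono: "lpa_gpd E (z \<oplus>\<^bsub>lpa E\<^esub> k \<odot>\<^bsub>lpa E\<^esub> lpa_mono E \<mu> \<mu>)
        (\<lambda>\<gamma>. F \<gamma> + k * indicator (units_of_set (cyl E \<mu>)) \<gamma>)"
      if "lpa_gpd E z F" "\<mu> \<in> fin_paths E" for z F \<mu> and k :: 'k
      using lpa_gpd.step[OF that(1) range_pairs_diag[OF that(2)], of k] unfolding gpd_Z_diag .
    have mon_aug: "mon (pair_word (\<mu>, \<mu>)) \<in> aug E" if "\<mu> \<in> fin_paths E" for \<mu>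
      using words_gens[OF that] by (simp add: pair_word_def)
    have act1: "act M (\<zero>\<^bsub>lpa E\<^esub> \<oplus>\<^bsub>lpa E\<^esub> 1 \<odot>\<^bsub>lpa E\<^esub> lpa_mono E \<mu> \<mu>) n = proj \<mu> n"
      if "\<mu> \<in> fin_paths E" "n \<in> carrier M" for \<mu> n
    proof -
      have "\<zero>\<^bsub>lpa E\<^esub> \<oplus>\<^bsub>lpa E\<^esub> 1 \<odot>\<^bsub>lpa E\<^esub> lpa_mono E \<mu> \<mu> = lpa_mono E \<mu> \<mu>"
        unfolding lpa_mono_eq lpa_zero lpa_step[OF aug_zero mon_aug[OF that(1)]] by (simp add: unit_word_zero)
      thus ?thesis using act_lpa_mono[OF that(1,1,2)] by (metis proj_def)
    qed
    have lg1: "lpa_gpd E (\<zero>\<^bsub>lpa E\<^esub> \<oplus>\<^bsub>lpa E\<^esub> 1 \<odot>\<^bsub>lpa E\<^esub> lpa_mono E \<mu> \<mu>)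
        (indicator (units_of_set (cyl E \<mu>)) :: _ => 'k)" if "\<mu> \<in> fin_paths E" for \<mu>
      using mono[OF lpa_gpd.zero that, of 1] by simp
    have im: "\<exists>n\<in>carrier M. m = proj \<mu> n" if \<mu>: "\<mu> \<in> fin_paths E" "x \<in> cyl E \<mu>" for \<mu>
    proof -
      have "compact_open E (cyl E \<mu>)" using compact_open_basic[OF \<mu>(1), of "{}"] by (simp add: basic_def)
      from mU[OF lg1[OF \<mu>(1)] this \<mu>(2)] show ?thesis using act1[OF \<mu>(1)] by auto
    qed
    have fix1: "proj \<mu> m = m" if \<mu>: "\<mu> \<in> fin_paths E" "x \<in> cyl E \<mu>" for \<mu>
      using im[OF \<mu>] proj_idem[OF \<mu>(1)] by auto
    let ?s = "(bsource E x, [])"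
    have s: "?s \<in> fin_paths E" "x \<in> cyl E ?s" using assms bsource_verts by auto
    have mc: "m \<in> carrier M" using im[OF s] s(1) by auto
    have fix0: "proj \<mu> m = \<zero>\<^bsub>M\<^esub>" if \<mu>: "\<mu> \<in> fin_paths E" "x \<notin> cyl E \<mu>" for \<mu>
    proof -
      obtain u p where up: "\<mu> = (u, p)" by (cases \<mu>)
      hence f: "(u, p) \<in> fin_paths E" "u \<in> verts E" using \<mu> fin_paths_source by auto
      have Gs: "G (Vx (bsource E x)) m = m" using fix1[OF s] mc s by (simp add: proj_Nil)
      show ?thesis
      proof (cases "u = bsource E x")
        case False
        have "gh u p m = gh u p (G (Vx (bsource E x)) m)" using Gs by simp
        also have "\<dots> = \<zero>\<^bsub>M\<^esub>" using gh_source[OF f(1) _ mc, of "bsource E x"] False s(1) by simp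
        finally show ?thesis using f by (simp add: proj_def up)
      next
        case True
        let ?z1 = "\<zero>\<^bsub>lpa E\<^esub> \<oplus>\<^bsub>lpa E\<^esub> 1 \<odot>\<^bsub>lpa E\<^esub> lpa_mono E ?s ?s :: ('v, 'e, 'k) lpa_elt"
        let ?z = "?z1 \<oplus>\<^bsub>lpa E\<^esub> (-1) \<odot>\<^bsub>lpa E\<^esub> lpa_mono E \<mu> \<mu>"
        have sub: "cyl E \<mu> \<subseteq> cyl E ?s" using cyl_source cyl_boundary True up by auto
        have "(\<lambda>\<gamma>. indicator (units_of_set (cyl E ?s)) \<gamma> + (-1) * indicator (units_of_set (cyl E \<mu>)) \<gamma> :: 'k)
            = indicator (units_of_set (basic E ?s {\<mu>}))"
          using sub by (auto simp: fun_eq_iff indicator_def basic_def)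
        hence "lpa_gpd E ?z (indicator (units_of_set (basic E ?s {\<mu>})) :: _ => 'k)"
          using mono[OF lg1[OF s(1)] \<mu>(1), of "-1"] by simp
        moreover have "x \<in> basic E ?s {\<mu>}" using s(2) \<mu>(2) by (simp add: basic_def)
        ultimately obtain n where n: "n \<in> carrier M" "m = act M ?z n"
          using mU compact_open_basic[OF s(1), of "{\<mu>}"] \<mu>(1) by blast
        obtain a where a: "a \<in> aug E" "?z1 = lpa_class E a"
          using lpa_gpd_in_carrier[OF lg1[OF s(1)]] unfolding lpa_carrier by blast
        let ?m = "mon (pair_word (\<mu>, \<mu>)) :: ('v, 'e, 'k) free"
        have mono': "lpa_mono E \<mu> \<mu> = lpa_class E ?m" by (simp add: lpa_mono_def pair_word_def)
        have "?z = lpa_class E (a + single unit_word (-1) * ?m)"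
          unfolding a(2) mono' by (rule lpa_step[OF a(1) mon_aug[OF \<mu>(1)]])
        hence "m = A (a + single unit_word (-1) * ?m) n" using n(2) by (simp add: A_def)
        also have "\<dots> = A a n \<oplus>\<^bsub>M\<^esub> (-1) \<odot>\<^bsub>M\<^esub> A ?m n"
          using A_add[OF a(1) aug_scale[OF mon_aug[OF \<mu>(1)]] n(1)] A_scale[OF mon_aug[OF \<mu>(1)] n(1)] by simp
        also have "A a n = proj ?s n" using act1[OF s(1) n(1)] a(2) by (simp add: A_def)
        also have "A ?m n = proj \<mu> n" using act_lpa_mono[OF \<mu>(1,1) n(1)] by (simp add: A_def mono' proj_def)
        finally have "m = proj ?s n \<oplus>\<^bsub>M\<^esub> (-1) \<odot>\<^bsub>M\<^esub> proj \<mu> n" .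
        hence "proj \<mu> m = proj \<mu> (proj ?s n) \<oplus>\<^bsub>M\<^esub> (-1) \<odot>\<^bsub>M\<^esub> proj \<mu> (proj \<mu> n)"
          using linmapD[OF proj_linmap[OF \<mu>(1)]] proj_closed[OF \<mu>(1) n(1)] proj_closed[OF s(1) n(1)] by simp
        also have "proj \<mu> (proj ?s n) = proj \<mu> n"
          using gh_source[OF f(1,2) n(1)] True n(1) f(2) by (simp add: proj_def up G_vertex_vertex)
        also have "proj \<mu> (proj \<mu> n) = proj \<mu> n" by (rule proj_idem[OF \<mu>(1) n(1)])
        finally show ?thesis using \<mu>(1) n(1) vsmult_minus_one M.r_neg by simp
      qed
    qed
    show "m \<in> stalk x" using mc fix1 fix0 by (intro stalkI) auto
  qed
qed

lemma spectral_iff: "spectral E M \<longleftrightarrow> (\<exists>x\<in>boundary E. \<exists>m\<in>stalk x. m \<noteq> \<zero>\<^bsub>M\<^esub>)"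
proof -
  have "Res E M x \<noteq> {\<zero>\<^bsub>M\<^esub>} \<longleftrightarrow> (\<exists>m\<in>stalk x. m \<noteq> \<zero>\<^bsub>M\<^esub>)" if "x \<in> boundary E" for x
    unfolding Res_eq_stalk[OF that] using stalk_zero[of x] by blast
  thus ?thesis unfolding spectral_def by (rule bex_cong[OF refl])
qed

end

section \<open>Modules from operators that satisfy the relations\<close>

locale lpa_operators = path_graph E + vspace V
  for E :: "('v, 'e) pre_digraph"
    and V :: "('k :: field, ('v, 'e, 'k) lpa_elt, 'm) lmodule" +
  fixes h :: "('v, 'e) gen => 'm => 'm"
  assumes h_linmap: "g \<in> gens E ==> linmap V V (h g)"
    and h_vertex: "v \<in> verts E ==> w \<in> verts E ==> m \<in> carrier V ==>
      h (Vx v) (h (Vx w) m) = (if v = w then h (Vx v) m else \<zero>\<^bsub>V\<^esub>)"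
    and h_source_edge: "e \<in> arcs E ==> m \<in> carrier V ==> h (Vx (tail E e)) (h (Ed e) m) = h (Ed e) m"
    and h_edge_range: "e \<in> arcs E ==> m \<in> carrier V ==> h (Ed e) (h (Vx (head E e)) m) = h (Ed e) m"
    and h_range_ghost: "e \<in> arcs E ==> m \<in> carrier V ==> h (Vx (head E e)) (h (Gh e) m) = h (Gh e) m"
    and h_ghost_source: "e \<in> arcs E ==> m \<in> carrier V ==> h (Gh e) (h (Vx (tail E e)) m) = h (Gh e) m"
    and h_ghost_edge: "e \<in> arcs E ==> f \<in> arcs E ==> m \<in> carrier V ==>
      h (Gh e) (h (Ed f) m) = (if e = f then h (Vx (head E e)) m else \<zero>\<^bsub>V\<^esub>)"
    and h_regular: "regular E v ==> m \<in> carrier V ==>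
      h (Vx v) m = (\<Oplus>\<^bsub>V\<^esub>e\<in>out_arcs E v. h (Ed e) (h (Gh e) m))"
begin

definition free_op :: "('v, 'e, 'k) free => 'm => 'm" where
  "free_op a m = lcomb V (\<lambda>w. foldr h (letters w) m) a"

lemma word_op_linmap: "set w \<subseteq> gens E ==> linmap V V (foldr h w)"
  by (induction w) (auto simp: linmap_id comp_def id_def intro: linmap_comp h_linmap)

lemmas word_op_closed [simp, intro] = linmapD(1)[OF word_op_linmap]

lemma free_keys: "a \<in> free_elts E ==> w \<in> keys a ==> set (letters w) \<subseteq> gens E"
  by (simp add: free_elts_def)

lemma free_op_linmap: "a \<in> free_elts E ==> linmap V V (free_op a)"
  unfolding free_op_def[abs_def]
  by (rule linmap_lcomb_vectors) (rule word_op_linmap, rule free_keys)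

lemmas free_op_closed [simp, intro] = linmapD(1)[OF free_op_linmap]

lemma free_op_add:
  assumes "a \<in> free_elts E" "b \<in> free_elts E" "m \<in> carrier V"
  shows "free_op (a + b) m = free_op a m \<oplus>\<^bsub>V\<^esub> free_op b m"
  unfolding free_op_def using free_keys[OF assms(1)] free_keys[OF assms(2)] assms(3)
  by (intro lcomb_add) auto

lemma free_op_uminus: "a \<in> free_elts E ==> m \<in> carrier V ==> free_op (- a) m = \<ominus>\<^bsub>V\<^esub> free_op a m"
  unfolding free_op_def by (intro lcomb_uminus word_op_closed free_keys)

lemma free_op_single:
  "set (letters w) \<subseteq> gens E ==> m \<in> carrier V ==>
     free_op (single w k) m = k \<odot>\<^bsub>V\<^esub> foldr h (letters w) m"
  unfolding free_op_def by (intro lcomb_single word_op_closed)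

lemma free_op_sum:
  assumes "finite I" "\<And>i. i \<in> I ==> f i \<in> free_elts E" "m \<in> carrier V"
  shows "free_op (\<Sum>i\<in>I. f i) m = (\<Oplus>\<^bsub>V\<^esub>i\<in>I. free_op (f i) m)"
  using assms
proof (induction I rule: finite_induct)
  case empty
  show ?case by (simp add: free_op_def)
next
  case (insert i I)
  hence "free_op (\<Sum>i\<in>insert i I. f i) m = free_op (f i) m \<oplus>\<^bsub>V\<^esub> free_op (\<Sum>i\<in>I. f i) m"
    by (simp add: free_op_add free_elts_sum)
  also have "\<dots> = (\<Oplus>\<^bsub>V\<^esub>i\<in>insert i I. free_op (f i) m)" using insert by (simp add: Pi_def)
  finally show ?case .
qed

lemma free_op_single_mult:
  assumes "set (letters w) \<subseteq> gens E" "b \<in> free_elts E" "m \<in> carrier V"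
  shows "free_op (single w k * b) m = k \<odot>\<^bsub>V\<^esub> foldr h (letters w) (free_op b m)"
proof -
  let ?B = "keys b" and ?l = "lookup b"
  note kb = free_keys[OF assms(2)]
  have "single w k * b = (\<Sum>u\<in>?B. single (w + u) (k * ?l u))"
    by (subst poly_mapping_sum_singles[of b]) (simp add: sum_distrib_left mult_single)
  hence "free_op (single w k * b) m =
      (\<Oplus>\<^bsub>V\<^esub>u\<in>?B. free_op (single (w + u) (k * ?l u)) m)"
    using assms kb by (simp add: free_op_sum free_elts_def)
  also have "\<dots> = (\<Oplus>\<^bsub>V\<^esub>u\<in>?B. k \<odot>\<^bsub>V\<^esub> foldr h (letters w) (?l u \<odot>\<^bsub>V\<^esub> foldr h (letters u) m))"
  proof (intro M.finsum_cong' refl)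
    fix u assume u: "u \<in> ?B"
    have "free_op (single (w + u) (k * ?l u)) m =
        (k * ?l u) \<odot>\<^bsub>V\<^esub> foldr h (letters w) (foldr h (letters u) m)"
      using free_op_single[of "w + u" m] assms kb[OF u] by simp
    thus "free_op (single (w + u) (k * ?l u)) m =
        k \<odot>\<^bsub>V\<^esub> foldr h (letters w) (?l u \<odot>\<^bsub>V\<^esub> foldr h (letters u) m)"
      using linmapD(3)[OF word_op_linmap[OF assms(1)]] assms kb[OF u] by (simp add: vsmult_mult)
  qed (use assms kb in auto)
  also have "\<dots> = k \<odot>\<^bsub>V\<^esub> foldr h (letters w) (\<Oplus>\<^bsub>V\<^esub>u\<in>?B. ?l u \<odot>\<^bsub>V\<^esub> foldr h (letters u) m)"
    using linmap_finsum[OF linmap_comp[OF word_op_linmap[OF assms(1)] linmap_smult[of k]] vspace_axioms,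
        of ?B "\<lambda>u. ?l u \<odot>\<^bsub>V\<^esub> foldr h (letters u) m"] assms kb by simp
  finally show ?thesis by (simp add: free_op_def lcomb_def)
qed

lemma free_op_mult:
  assumes "a \<in> free_elts E" "b \<in> free_elts E" "m \<in> carrier V"
  shows "free_op (a * b) m = free_op a (free_op b m)"
proof -
  let ?A = "keys a" and ?l = "lookup a"
  note ka = free_keys[OF assms(1)]
  have "a * b = (\<Sum>w\<in>?A. single w (?l w) * b)"
    by (subst poly_mapping_sum_singles[of a]) (simp add: sum_distrib_right)
  hence "free_op (a * b) m = (\<Oplus>\<^bsub>V\<^esub>w\<in>?A. free_op (single w (?l w) * b) m)"
    using assms ka by (simp add: free_op_sum)
  also have "\<dots> = (\<Oplus>\<^bsub>V\<^esub>w\<in>?A. ?l w \<odot>\<^bsub>V\<^esub> foldr h (letters w) (free_op b m))"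
    using assms ka by (intro M.finsum_cong' refl) (auto simp: free_op_single_mult)
  finally show ?thesis by (simp add: free_op_def lcomb_def)
qed

lemma free_op_mon: "set w \<subseteq> gens E ==> m \<in> carrier V ==> free_op (mon w) m = foldr h w m"
  using free_op_single[of "FWord w" m 1] by (simp add: mon_def)

lemma free_op_diff_mon:
  assumes "set u \<subseteq> gens E" "b \<in> free_elts E" "m \<in> carrier V" "foldr h u m = free_op b m"
  shows "free_op (mon u - b) m = \<zero>\<^bsub>V\<^esub>"
proof -
  have "free_op (mon u + (- b)) m = foldr h u m \<ominus>\<^bsub>V\<^esub> free_op b m"
    using assms by (simp only: free_op_add free_op_uminus free_op_mon free_elts_mon free_elts_uminus a_minus_def)
  thus ?thesis using assms minus_eq_zero_iff[of "foldr h u m" "free_op b m"] by simp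
qed

lemma free_op_relator:
  assumes "r \<in> lpa_relators E" "m \<in> carrier V"
  shows "free_op r m = \<zero>\<^bsub>V\<^esub>"
proof -
  have z: "free_op 0 m = \<zero>\<^bsub>V\<^esub>" by (simp add: free_op_def)
  consider (v) v w where "v \<in> verts E" "w \<in> verts E" "r = mon [Vx v, Vx w] - (if v = w then mon [Vx v] else 0)"
    | (se) e where "e \<in> arcs E" "r = mon [Vx (tail E e), Ed e] - mon [Ed e]"
    | (er) e where "e \<in> arcs E" "r = mon [Ed e, Vx (head E e)] - mon [Ed e]"
    | (rg) e where "e \<in> arcs E" "r = mon [Vx (head E e), Gh e] - mon [Gh e]"
    | (gs) e where "e \<in> arcs E" "r = mon [Gh e, Vx (tail E e)] - mon [Gh e]"
    | (ge) e f where "e \<in> arcs E" "f \<in> arcs E" "r = mon [Gh e, Ed f] - (if e = f then mon [Vx (head E e)] else 0)"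
    | (ck) v where "regular E v" "r = mon [Vx v] - (\<Sum>e\<in>out_arcs E v. mon [Ed e, Gh e])"
    using assms(1) unfolding lpa_relators_def by blast
  thus ?thesis
  proof cases
    case v
    show ?thesis unfolding v(3)
      by (rule free_op_diff_mon) (use v assms z in \<open>auto simp: free_op_mon h_vertex\<close>)
  next
    case se
    show ?thesis unfolding se(2)
      by (rule free_op_diff_mon) (use se assms in \<open>auto simp: free_op_mon h_source_edge\<close>)
  next
    case er
    show ?thesis unfolding er(2)
      by (rule free_op_diff_mon) (use er assms in \<open>auto simp: free_op_mon h_edge_range\<close>)
  next
    case rg
    show ?thesis unfolding rg(2)
      by (rule free_op_diff_mon) (use rg assms in \<open>auto simp: free_op_mon h_range_ghost\<close>)
  next
    case gs
    show ?thesis unfolding gs(2)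
      by (rule free_op_diff_mon) (use gs assms in \<open>auto simp: free_op_mon h_ghost_source\<close>)
  next
    case ge
    show ?thesis unfolding ge(3)
      by (rule free_op_diff_mon) (use ge assms z in \<open>auto simp: free_op_mon h_ghost_edge\<close>)
  next
    case ck
    have fin: "finite (out_arcs E v)" "v \<in> verts E" using ck(1) by (auto simp: regular_def)
    have m: "(mon [Ed e, Gh e] :: ('v, 'e, 'k) free) \<in> free_elts E" if "e \<in> out_arcs E v" for e using that by simp
    have "free_op (\<Sum>e\<in>out_arcs E v. mon [Ed e, Gh e]) m = (\<Oplus>\<^bsub>V\<^esub>e\<in>out_arcs E v. free_op (mon [Ed e, Gh e]) m)"
      by (rule free_op_sum[OF fin(1) _ assms(2)]) (rule m)
    also have "\<dots> = (\<Oplus>\<^bsub>V\<^esub>e\<in>out_arcs E v. h (Ed e) (h (Gh e) m))"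
    proof (rule M.finsum_cong'[OF refl])
      show "(\<lambda>e. h (Ed e) (h (Gh e) m)) \<in> out_arcs E v \<rightarrow> carrier V"
        using assms(2) by (auto intro!: linmapD(1)[OF h_linmap])
      fix e assume "e \<in> out_arcs E v"
      thus "free_op (mon [Ed e, Gh e]) m = h (Ed e) (h (Gh e) m)" using assms(2) by (simp add: free_op_mon)
    qed
    finally have "free_op (\<Sum>e\<in>out_arcs E v. mon [Ed e, Gh e]) m = (\<Oplus>\<^bsub>V\<^esub>e\<in>out_arcs E v. h (Ed e) (h (Gh e) m))" .
    hence "foldr h [Vx v] m = free_op (\<Sum>e\<in>out_arcs E v. mon [Ed e, Gh e]) m"
      using h_regular[OF ck(1) assms(2)] by simp
    thus ?thesis unfolding ck(2) using fin m assms by (intro free_op_diff_mon free_elts_sum) auto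
  qed
qed

lemma free_op_ideal:
  assumes "a \<in> lpa_ideal E" "m \<in> carrier V"
  shows "free_op a m = \<zero>\<^bsub>V\<^esub>"
proof -
  let ?I = "{a \<in> free_elts E. \<forall>m\<in>carrier V. free_op a m = \<zero>\<^bsub>V\<^esub>}"
  interpret F: ring "free_alg E :: ('v, 'e, 'k) free ring" by (rule free_alg_ring)
  have zero: "free_op a \<zero>\<^bsub>V\<^esub> = \<zero>\<^bsub>V\<^esub>" if "a \<in> free_elts E" for a
    using linmap_zero[OF free_op_linmap[OF that] vspace_axioms] .
  have neg: "\<ominus>\<^bsub>free_alg E\<^esub> a = - a" if "a \<in> free_elts E" for a :: "('v, 'e, 'k) free"
    using F.minus_equality[of "- a" a] that by simp
  have "ideal ?I (free_alg E)"
  proof (rule idealI)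
    show "ring (free_alg E :: ('v, 'e, 'k) free ring)" by (rule free_alg_ring)
    show "subgroup ?I (add_monoid (free_alg E))"
    proof (rule F.add.subgroupI)
      show "?I \<subseteq> carrier (free_alg E)" by auto
      show "?I \<noteq> {}" by (auto simp: free_op_def intro!: exI[of _ 0])
      show "\<ominus>\<^bsub>free_alg E\<^esub> a \<in> ?I" if "a \<in> ?I" for a using that by (simp add: neg free_op_uminus)
      show "a \<oplus>\<^bsub>free_alg E\<^esub> b \<in> ?I" if "a \<in> ?I" "b \<in> ?I" for a b using that by (simp add: free_op_add)
    qed
    show "x \<otimes>\<^bsub>free_alg E\<^esub> a \<in> ?I" if "a \<in> ?I" "x \<in> carrier (free_alg E)" for a x
      using that zero by (simp add: free_op_mult)
    show "a \<otimes>\<^bsub>free_alg E\<^esub> x \<in> ?I" if "a \<in> ?I" "x \<in> carrier (free_alg E)" for a x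
      using that by (simp add: free_op_mult)
  qed
  moreover have "lpa_relators E \<subseteq> ?I" using relators_free free_op_relator by auto
  ultimately have "lpa_ideal E \<subseteq> ?I" unfolding lpa_ideal_def by (rule F.genideal_minimal)
  thus ?thesis using assms by blast
qed

lemma free_op_representative:
  assumes "a \<in> free_elts E" "b \<in> lpa_class E a" "m \<in> carrier V"
  shows "b \<in> free_elts E \<and> free_op b m = free_op a m"
proof -
  obtain i where i: "i \<in> lpa_ideal E" "b = i + a" using assms(2) by (auto simp: lpa_class_eq)
  hence "i \<in> free_elts E" using ideal_subset by blast
  thus ?thesis using i assms by (simp add: free_op_add free_op_ideal)
qed

lemma some_representative: "(SOME b. b \<in> lpa_class E a) \<in> lpa_class E a"
proof -
  have "0 + a \<in> lpa_class E a" unfolding lpa_class_eq using ideal_zero by blast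
  thus ?thesis by (rule someI)
qed

lemma alg_module_from_operators:
  assumes act: "\<And>a m. a \<in> free_elts E ==> m \<in> carrier V ==> act V (lpa_class E a) m = free_op a m"
  shows "alg_module (lpa E) V"
proof -
  have c: "\<exists>a\<in>aug E. z = lpa_class E a" if "z \<in> carrier (lpa E)" for z :: "('v, 'e, 'k) lpa_elt"
    using that unfolding lpa_carrier by blast
  show ?thesis unfolding alg_module_def
  proof (intro conjI ballI allI)
    show "module ring_of_type_algebra V" by (rule module_axioms)
    fix z :: "('v, 'e, 'k) lpa_elt" and m assume z: "z \<in> carrier (lpa E)" and m: "m \<in> carrier V"
    then obtain a where a: "a \<in> free_elts E" "z = lpa_class E a" using c by blast
    show "act V z m \<in> carrier V" using a m by (simp add: act)
    show "act V (k \<odot>\<^bsub>lpa E\<^esub> z) m = k \<odot>\<^bsub>V\<^esub> act V z m" for k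
      using a m free_op_single_mult[of unit_word a m k] by (simp add: lpa_smult act)
    show "act V z (k \<odot>\<^bsub>V\<^esub> m) = k \<odot>\<^bsub>V\<^esub> act V z m" for k
      using a m linmapD(3)[OF free_op_linmap[OF a(1)] m] by (simp add: act)
    show "act V z (m \<oplus>\<^bsub>V\<^esub> n) = act V z m \<oplus>\<^bsub>V\<^esub> act V z n" if n: "n \<in> carrier V" for n
      using a m n linmapD(2)[OF free_op_linmap[OF a(1)] m n] by (simp add: act)
    fix y :: "('v, 'e, 'k) lpa_elt" assume "y \<in> carrier (lpa E)"
    then obtain b where b: "b \<in> free_elts E" "y = lpa_class E b" using c by blast
    show "act V (z \<oplus>\<^bsub>lpa E\<^esub> y) m = act V z m \<oplus>\<^bsub>V\<^esub> act V y m"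
      using a b m by (simp add: lpa_add act free_op_add)
    show "act V (z \<otimes>\<^bsub>lpa E\<^esub> y) m = act V z (act V y m)"
      using a b m by (simp add: lpa_mult act free_op_mult)
  qed
qed

end

section \<open>Twisted Chen modules\<close>

locale chen_module = path_graph E + R: field R
  for E :: "('v, 'e) pre_digraph" and R :: "'r ring"
    and h :: "'k :: field => 'r" and x :: "('v, 'e) bpath" and b :: "('v, 'e, 'r) weights" +
  assumes x: "x \<in> boundary E"
    and h: "h \<in> ring_hom ring_of_type_algebra R"
    and units: "\<And>e p. e \<in> arcs E ==> p \<in> tail_class E x ==> head E e = bsource E p ==> b e p \<in> Units R"
begin

abbreviation V :: "('k, ('v, 'e, 'k) lpa_elt, ('v, 'e) bpath => 'r) lmodule" where
  "V \<equiv> twisted_chen E R h x b"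

abbreviation S :: "('v, 'e) bpath set" where "S \<equiv> tail_class E x"

lemma V_carrier_iff:
  "m \<in> carrier V \<longleftrightarrow> (\<forall>p. m p \<in> carrier R) \<and> (\<forall>p. p \<notin> S --> m p = \<zero>\<^bsub>R\<^esub>) \<and> finite {p. m p \<noteq> \<zero>\<^bsub>R\<^esub>}"
  by (simp add: twisted_chen_def)

lemma V_ops [simp]:
  "\<zero>\<^bsub>V\<^esub> = (\<lambda>p. \<zero>\<^bsub>R\<^esub>)" "m \<oplus>\<^bsub>V\<^esub> n = (\<lambda>p. m p \<oplus>\<^bsub>R\<^esub> n p)" "k \<odot>\<^bsub>V\<^esub> m = (\<lambda>p. h k \<otimes>\<^bsub>R\<^esub> m p)"
  by (simp_all add: twisted_chen_def)

lemma V_closed [simp]: "m \<in> carrier V ==> m p \<in> carrier R"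
  by (simp add: V_carrier_iff)

lemma V_outside: "m \<in> carrier V ==> p \<notin> S ==> m p = \<zero>\<^bsub>R\<^esub>"
  by (simp add: V_carrier_iff)

lemma h_closed [simp]: "h k \<in> carrier R"
  using ring_hom_closed[OF h, of k] by simp

lemma h_ops: "h (k + l) = h k \<oplus>\<^bsub>R\<^esub> h l" "h (k * l) = h k \<otimes>\<^bsub>R\<^esub> h l" "h 1 = \<one>\<^bsub>R\<^esub>"
  using ring_hom_add[OF h, of k l] ring_hom_mult[OF h, of k l] ring_hom_one[OF h] by simp_all

lemma V_support_subset:
  assumes "finite A" "\<And>p. m p \<in> carrier R" "\<And>p. p \<notin> S ==> m p = \<zero>\<^bsub>R\<^esub>" "\<And>p. p \<notin> A ==> m p = \<zero>\<^bsub>R\<^esub>"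
  shows "m \<in> carrier V"
proof -
  have "{p. m p \<noteq> \<zero>\<^bsub>R\<^esub>} \<subseteq> A" using assms(4) by blast
  thus ?thesis using assms finite_subset by (auto simp: V_carrier_iff)
qed

lemma V_supp: "m \<in> carrier V ==> finite {p. m p \<noteq> \<zero>\<^bsub>R\<^esub>}"
  by (simp add: V_carrier_iff)

lemma V_add_closed: "m \<in> carrier V ==> n \<in> carrier V ==> m \<oplus>\<^bsub>V\<^esub> n \<in> carrier V"
  by (rule V_support_subset[of "{p. m p \<noteq> \<zero>\<^bsub>R\<^esub>} \<union> {p. n p \<noteq> \<zero>\<^bsub>R\<^esub>}"]) (auto simp: V_supp V_outside)

lemma V_scale_closed: "m \<in> carrier V ==> r \<in> carrier R ==> (\<lambda>p. r \<otimes>\<^bsub>R\<^esub> m p) \<in> carrier V"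
  by (rule V_support_subset[of "{p. m p \<noteq> \<zero>\<^bsub>R\<^esub>}"]) (auto simp: V_supp V_outside)

lemma V_zero_closed: "(\<lambda>p. \<zero>\<^bsub>R\<^esub>) \<in> carrier V"
  by (simp add: V_carrier_iff)

lemma V_abelian_group: "abelian_group V"
proof (rule abelian_groupI)
  fix m assume m: "m \<in> carrier V"
  have "(\<lambda>p. \<ominus>\<^bsub>R\<^esub> m p) \<in> carrier V"
    using m by (intro V_support_subset[of "{p. m p \<noteq> \<zero>\<^bsub>R\<^esub>}"]) (auto simp: V_supp V_outside)
  moreover have "(\<lambda>p. \<ominus>\<^bsub>R\<^esub> m p) \<oplus>\<^bsub>V\<^esub> m = \<zero>\<^bsub>V\<^esub>" using m by (simp add: R.l_neg)
  ultimately show "\<exists>n\<in>carrier V. n \<oplus>\<^bsub>V\<^esub> m = \<zero>\<^bsub>V\<^esub>" by blast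
qed (auto simp: V_add_closed[simplified] V_zero_closed R.a_ac)

lemma V_vspace: "vspace V"
  unfolding vspace_def
proof (rule moduleI)
  show "cring (ring_of_type_algebra :: 'k ring)" by (rule cring_from_type_algebra)
  show "abelian_group V" by (rule V_abelian_group)
qed (auto simp: V_scale_closed h_ops R.l_distr R.r_distr R.m_assoc)

sublocale V: vspace V by (rule V_vspace)

lemma finsum_V_apply:
  assumes "finite I" "\<And>i. i \<in> I ==> f i \<in> carrier V"
  shows "(\<Oplus>\<^bsub>V\<^esub>i\<in>I. f i) q = (\<Oplus>\<^bsub>R\<^esub>i\<in>I. f i q)"
  using assms
proof (induction I rule: finite_induct)
  case (insert i I)
  have "(\<Oplus>\<^bsub>V\<^esub>j\<in>insert i I. f j) = f i \<oplus>\<^bsub>V\<^esub> (\<Oplus>\<^bsub>V\<^esub>j\<in>I. f j)"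
    using insert by (intro V.M.finsum_insert) auto
  moreover have "(\<Oplus>\<^bsub>R\<^esub>j\<in>insert i I. f j q) = f i q \<oplus>\<^bsub>R\<^esub> (\<Oplus>\<^bsub>R\<^esub>j\<in>I. f j q)"
    using insert by (intro R.finsum_insert) auto
  ultimately show ?case using insert by simp
qed simp

abbreviation op :: "('v, 'e) gen => (('v, 'e) bpath => 'r) => ('v, 'e) bpath => 'r" where
  "op \<equiv> gen_act E R S b"

lemma S_boundary: "p \<in> S ==> p \<in> boundary E"
  using tail_class_subset by blast

lemma b_units:
  assumes "e \<in> arcs E" "p \<in> S" "head E e = bsource E p"
  shows "b e p \<in> carrier R" "inv\<^bsub>R\<^esub> (b e p) \<in> carrier R" "b e p \<noteq> \<zero>\<^bsub>R\<^esub>"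
    "inv\<^bsub>R\<^esub> (b e p) \<otimes>\<^bsub>R\<^esub> b e p = \<one>\<^bsub>R\<^esub>" "b e p \<otimes>\<^bsub>R\<^esub> inv\<^bsub>R\<^esub> (b e p) = \<one>\<^bsub>R\<^esub>"
  using units[OF assms] R.Units_closed R.Units_inv_closed R.Units_l_inv R.Units_r_inv
    R.field_Units by auto

lemma S_econs:
  assumes "e \<in> arcs E" "p \<in> boundary E" "head E e = bsource E p"
  shows "econs E e p \<in> S \<longleftrightarrow> p \<in> S"
  by (rule tail_class_econs[OF assms])

text \<open>The partial action on basis paths is injective, so each of the sums defining the operators has
  at most one term.\<close>

lemma op_vertex:
  assumes "m \<in> carrier V"
  shows "op (Vx v) m q = (if v = bsource E q then m q else \<zero>\<^bsub>R\<^esub>)"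
proof -
  have "{p \<in> S. m p \<noteq> \<zero>\<^bsub>R\<^esub> \<and> basis_act E (Vx v) p = Some q} =
      (if v = bsource E q \<and> m q \<noteq> \<zero>\<^bsub>R\<^esub> then {q} else {})"
    using V_outside[OF assms, of q] by auto
  thus ?thesis using assms by (simp add: gen_act_def)
qed

lemma op_edge:
  assumes "m \<in> carrier V" "e \<in> arcs E" "p \<in> S" "head E e = bsource E p"
  shows "op (Ed e) m (econs E e p) = b e p \<otimes>\<^bsub>R\<^esub> m p"
proof -
  have "{p' \<in> S. m p' \<noteq> \<zero>\<^bsub>R\<^esub> \<and> basis_act E (Ed e) p' = Some (econs E e p)} =
      (if m p \<noteq> \<zero>\<^bsub>R\<^esub> then {p} else {})"
    using econs_inj[of e _ e p] assms by auto
  thus ?thesis using assms b_units[OF assms(2-4)] by (simp add: gen_act_def)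
qed

lemma op_edge_other:
  assumes "\<And>p. p \<in> S ==> head E e = bsource E p ==> q \<noteq> econs E e p"
  shows "op (Ed e) m q = \<zero>\<^bsub>R\<^esub>"
proof -
  have no: "{p' \<in> S. m p' \<noteq> \<zero>\<^bsub>R\<^esub> \<and> basis_act E (Ed e) p' = Some q} = {}"
    using assms by auto
  show ?thesis unfolding gen_act_def no by simp
qed

lemma basis_act_ghost_iff:
  assumes "e \<in> arcs E" "p \<in> boundary E"
  shows "basis_act E (Gh e) p = Some q \<longleftrightarrow> q \<in> boundary E \<and> head E e = bsource E q \<and> p = econs E e q"
proof -
  from assms(2) show ?thesis
  proof (cases rule: boundary_cases)
    case (edge f y)
    hence "basis_act E (Gh e) p = (if f = e then Some y else None)" by (cases y) auto
    thus ?thesis using edge econs_inj[of f y e q] by auto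
  qed auto
qed

lemma op_ghost:
  assumes "m \<in> carrier V" "e \<in> arcs E"
  shows "op (Gh e) m q = (if q \<in> S \<and> head E e = bsource E q then inv\<^bsub>R\<^esub> (b e q) \<otimes>\<^bsub>R\<^esub> m (econs E e q) else \<zero>\<^bsub>R\<^esub>)"
proof -
  have "{p \<in> S. m p \<noteq> \<zero>\<^bsub>R\<^esub> \<and> basis_act E (Gh e) p = Some q} =
      (if q \<in> S \<and> head E e = bsource E q \<and> m (econs E e q) \<noteq> \<zero>\<^bsub>R\<^esub> then {econs E e q} else {})"
  proof (cases "q \<in> S \<and> head E e = bsource E q")
    case True
    hence "econs E e q \<in> S" "q \<in> boundary E" using S_econs[of e q] assms(2) S_boundary by auto
    moreover have "basis_act E (Gh e) (econs E e q) = Some q"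
      using basis_act_ghost_iff[OF assms(2) S_boundary[OF calculation(1)]] True calculation(2) by simp
    ultimately show ?thesis using True basis_act_ghost_iff[OF assms(2) S_boundary] by auto
  next
    case False
    have "\<not> (p \<in> S \<and> basis_act E (Gh e) p = Some q)" for p
    proof
      assume p: "p \<in> S \<and> basis_act E (Gh e) p = Some q"
      hence "q \<in> boundary E" "head E e = bsource E q" "p = econs E e q"
        using basis_act_ghost_iff[OF assms(2) S_boundary[of p]] by auto
      thus False using False p S_econs[OF assms(2), of q] by simp
    qed
    thus ?thesis using False by auto
  qed
  moreover have "basis_act E (Gh e) (econs E e q) = Some q" if "q \<in> S" "head E e = bsource E q"
    using basis_act_ghost_iff[OF assms(2), of "econs E e q" q] that S_boundary[OF that(1)]
      econs_boundary[OF that(2)] assms(2) by simp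
  ultimately show ?thesis using assms b_units[OF assms(2)] by (simp add: gen_act_def)
qed

lemma op_closed:
  assumes "g \<in> gens E" "m \<in> carrier V"
  shows "op g m \<in> carrier V"
proof (cases g)
  case (Vx v)
  show ?thesis unfolding Vx using assms(2)
    by (intro V_support_subset[of "{p. m p \<noteq> \<zero>\<^bsub>R\<^esub>}"]) (auto simp: op_vertex V_supp V_outside)
next
  case (Ed e)
  have e: "e \<in> arcs E" using assms(1) Ed by simp
  have v: "op (Ed e) m q \<in> carrier R \<and> (q \<notin> S --> op (Ed e) m q = \<zero>\<^bsub>R\<^esub>) \<and>
      (q \<notin> econs E e ` {p. m p \<noteq> \<zero>\<^bsub>R\<^esub>} --> op (Ed e) m q = \<zero>\<^bsub>R\<^esub>)" for q
  proof (cases "\<exists>p\<in>S. head E e = bsource E p \<and> q = econs E e p")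
    case True
    then obtain p where p: "p \<in> S" "head E e = bsource E p" "q = econs E e p" by blast
    have "q \<in> S" using S_econs[OF e S_boundary[OF p(1)] p(2)] p by simp
    moreover have "op (Ed e) m q = b e p \<otimes>\<^bsub>R\<^esub> m p" using op_edge[OF assms(2) e p(1,2)] p(3) by simp
    moreover have "q \<notin> econs E e ` {p. m p \<noteq> \<zero>\<^bsub>R\<^esub>} ==> m p = \<zero>\<^bsub>R\<^esub>" using p(3) by auto
    ultimately show ?thesis using b_units[OF e p(1,2)] assms(2) by auto
  next
    case False
    hence "op (Ed e) m q = \<zero>\<^bsub>R\<^esub>" by (intro op_edge_other) blast
    thus ?thesis by simp
  qed
  show ?thesis unfolding Ed
    by (rule V_support_subset[of "econs E e ` {p. m p \<noteq> \<zero>\<^bsub>R\<^esub>}"]) (use v V_supp[OF assms(2)] in auto)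
next
  case (Gh e)
  have e: "e \<in> arcs E" using assms(1) Gh by simp
  let ?A = "{q. head E e = bsource E q \<and> m (econs E e q) \<noteq> \<zero>\<^bsub>R\<^esub>}"
  have inj: "inj_on (econs E e) ?A" by (rule inj_onI) (use econs_inj[of e _ e] in auto)
  have "econs E e ` ?A \<subseteq> {p. m p \<noteq> \<zero>\<^bsub>R\<^esub>}" by auto
  hence "finite (econs E e ` ?A)" using V_supp[OF assms(2)] by (rule finite_subset)
  hence "finite ?A" using inj by (rule finite_imageD)
  thus ?thesis unfolding Gh using assms(2) b_units[OF e]
    by (intro V_support_subset[of ?A]) (auto simp: op_ghost[OF assms(2) e])
qed

lemma econs_cases:
  obtains (edge) p where "p \<in> S" "head E e = bsource E p" "q = econs E e p"
  | (other) "\<And>p. p \<in> S ==> head E e = bsource E p ==> q \<noteq> econs E e p"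
proof (cases "\<exists>p. p \<in> S \<and> head E e = bsource E p \<and> q = econs E e p")
  case True
  then obtain p where "p \<in> S" "head E e = bsource E p" "q = econs E e p" by blast
  thus thesis by (rule edge)
next
  case False
  show thesis
  proof (rule other)
    fix p assume "p \<in> S" "head E e = bsource E p"
    thus "q \<noteq> econs E e p" using False by blast
  qed
qed

lemma op_linmap:
  assumes g: "g \<in> gens E"
  shows "linmap V V (op g)"
  unfolding linmap_def
proof (intro conjI ballI allI)
  fix m k assume m: "m \<in> carrier V"
  show "op g m \<in> carrier V" by (rule op_closed[OF g m])
  have km: "k \<odot>\<^bsub>V\<^esub> m \<in> carrier V" using m by (rule V.vsmult_closed)
  show "op g (k \<odot>\<^bsub>V\<^esub> m) = k \<odot>\<^bsub>V\<^esub> op g m"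
  proof
    fix q
    show "op g (k \<odot>\<^bsub>V\<^esub> m) q = (k \<odot>\<^bsub>V\<^esub> op g m) q"
    proof (cases g)
      case (Vx v)
      thus ?thesis using m op_vertex[OF m] op_vertex[OF km] by simp
    next
      case (Ed e)
      hence e: "e \<in> arcs E" using g by simp
      show ?thesis
      proof (cases rule: econs_cases[of e q])
        case (edge p)
        thus ?thesis using m op_edge[OF m e edge(1,2)] op_edge[OF km e edge(1,2)] Ed b_units[OF e edge(1,2)]
          by (simp add: R.m_lcomm)
      next
        case other
        thus ?thesis using op_edge_other[OF other] Ed by simp
      qed
    next
      case (Gh e)
      hence e: "e \<in> arcs E" using g by simp
      show ?thesis using m op_ghost[OF m e] op_ghost[OF km e] Gh b_units[OF e]
        by (simp add: R.m_lcomm)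
    qed
  qed
  fix n assume n: "n \<in> carrier V"
  have mn: "m \<oplus>\<^bsub>V\<^esub> n \<in> carrier V" using m n by (rule V.M.a_closed)
  show "op g (m \<oplus>\<^bsub>V\<^esub> n) = op g m \<oplus>\<^bsub>V\<^esub> op g n"
  proof
    fix q
    show "op g (m \<oplus>\<^bsub>V\<^esub> n) q = (op g m \<oplus>\<^bsub>V\<^esub> op g n) q"
    proof (cases g)
      case (Vx v)
      thus ?thesis using m n op_vertex[OF m] op_vertex[OF n] op_vertex[OF mn] by simp
    next
      case (Ed e)
      hence e: "e \<in> arcs E" using g by simp
      show ?thesis
      proof (cases rule: econs_cases[of e q])
        case (edge p)
        thus ?thesis using m n op_edge[OF m e edge(1,2)] op_edge[OF n e edge(1,2)] op_edge[OF mn e edge(1,2)]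
            Ed b_units[OF e edge(1,2)] by (simp add: R.r_distr)
      next
        case other
        thus ?thesis using op_edge_other[OF other] Ed by simp
      qed
    next
      case (Gh e)
      hence e: "e \<in> arcs E" using g by simp
      show ?thesis using m n op_ghost[OF m e] op_ghost[OF n e] op_ghost[OF mn e] Gh b_units[OF e]
        by (simp add: R.r_distr)
    qed
  qed
qed

sublocale ops: lpa_operators E V op
proof
  show "g \<in> gens E ==> linmap V V (op g)" for g by (rule op_linmap)
  show "op (Vx v) (op (Vx w) m) = (if v = w then op (Vx v) m else \<zero>\<^bsub>V\<^esub>)"
    if "v \<in> verts E" "w \<in> verts E" "m \<in> carrier V" for v w m
    using that op_vertex[OF op_closed[of "Vx w" m]] op_vertex[of m] by (auto simp: fun_eq_iff)
  fix e m assume e: "e \<in> arcs E" and m: "m \<in> carrier V"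
  have Ec: "op (Ed e) m \<in> carrier V" and Gc: "op (Gh e) m \<in> carrier V"
    and hc: "op (Vx (head E e)) m \<in> carrier V" and tc: "op (Vx (tail E e)) m \<in> carrier V"
    using op_closed[of _ m] e m by simp_all
  show "op (Vx (tail E e)) (op (Ed e) m) = op (Ed e) m"
  proof
    fix q
    show "op (Vx (tail E e)) (op (Ed e) m) q = op (Ed e) m q"
      unfolding op_vertex[OF Ec]
      by (cases rule: econs_cases[of e q]) (auto simp: op_edge_other)
  qed
  show "op (Ed e) (op (Vx (head E e)) m) = op (Ed e) m"
  proof
    fix q
    show "op (Ed e) (op (Vx (head E e)) m) q = op (Ed e) m q"
    proof (cases rule: econs_cases[of e q])
      case (edge p)
      thus ?thesis using op_edge[OF m e edge(1,2)] op_edge[OF hc e edge(1,2)] op_vertex[OF m] by simp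
    qed (simp add: op_edge_other)
  qed
  show "op (Vx (head E e)) (op (Gh e) m) = op (Gh e) m"
    unfolding fun_eq_iff op_vertex[OF Gc] op_ghost[OF m e] by auto
  show "op (Gh e) (op (Vx (tail E e)) m) = op (Gh e) m"
    unfolding fun_eq_iff op_ghost[OF m e] op_ghost[OF tc e] op_vertex[OF m] by simp
  fix f assume f: "f \<in> arcs E"
  have Fc: "op (Ed f) m \<in> carrier V" using op_closed[of "Ed f" m] f m by simp
  show "op (Gh e) (op (Ed f) m) = (if e = f then op (Vx (head E e)) m else \<zero>\<^bsub>V\<^esub>)"
  proof
    fix q
    show "op (Gh e) (op (Ed f) m) q = (if e = f then op (Vx (head E e)) m else \<zero>\<^bsub>V\<^esub>) q"
    proof (cases "q \<in> S \<and> head E e = bsource E q")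
      case True
      hence bq: "b e q \<in> carrier R" "inv\<^bsub>R\<^esub> (b e q) \<in> carrier R" "inv\<^bsub>R\<^esub> (b e q) \<otimes>\<^bsub>R\<^esub> b e q = \<one>\<^bsub>R\<^esub>"
        using b_units[OF e, of q] by auto
      show ?thesis
      proof (cases "e = f")
        case ef: True
        have "op (Gh e) (op (Ed f) m) q = inv\<^bsub>R\<^esub> (b e q) \<otimes>\<^bsub>R\<^esub> (b e q \<otimes>\<^bsub>R\<^esub> m q)"
          using True op_ghost[OF Fc e] op_edge[OF m e, of q] ef by simp
        also have "\<dots> = m q" using bq m by (simp flip: R.m_assoc)
        finally show ?thesis using True ef op_vertex[OF m] by simp
      next
        case False
        have "op (Ed f) m (econs E e q) = \<zero>\<^bsub>R\<^esub>"
        proof (rule op_edge_other)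
          fix p assume "p \<in> S" "head E f = bsource E p"
          thus "econs E e q \<noteq> econs E f p" using econs_inj[of e q f p] True False by auto
        qed
        thus ?thesis using True False op_ghost[OF Fc e] bq by simp
      qed
    next
      case False
      thus ?thesis using op_ghost[OF Fc e] op_vertex[OF m] V_outside[OF m] by auto
    qed
  qed
next
  fix v m assume v: "regular E v" and m: "m \<in> carrier V"
  have fin: "finite (out_arcs E v)" using v by (simp add: regular_def)
  have c: "op (Ed e) (op (Gh e) m) \<in> carrier V" if "e \<in> out_arcs E v" for e
    using op_closed m that by simp
  show "op (Vx v) m = (\<Oplus>\<^bsub>V\<^esub>e\<in>out_arcs E v. op (Ed e) (op (Gh e) m))"
  proof
    fix q
    have ee: "op (Ed e) (op (Gh e) m) q = (if \<exists>p\<in>S. head E e = bsource E p \<and> q = econs E e p then m q else \<zero>\<^bsub>R\<^esub>)"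
      if e: "e \<in> arcs E" for e
    proof (cases rule: econs_cases[of e q])
      case (edge p)
      have Gc: "op (Gh e) m \<in> carrier V" using op_closed e m by simp
      note bp = b_units[OF e edge(1,2)]
      have "op (Ed e) (op (Gh e) m) q = b e p \<otimes>\<^bsub>R\<^esub> (inv\<^bsub>R\<^esub> (b e p) \<otimes>\<^bsub>R\<^esub> m q)"
        using op_edge[OF Gc e edge(1,2)] op_ghost[OF m e] edge by simp
      also have "\<dots> = m q" using bp m by (simp flip: R.m_assoc)
      finally show ?thesis using edge by auto
    next
      case other
      thus ?thesis using op_edge_other[OF other] by auto
    qed
    have R: "(\<Oplus>\<^bsub>V\<^esub>e\<in>out_arcs E v. op (Ed e) (op (Gh e) m)) q =
        (\<Oplus>\<^bsub>R\<^esub>e\<in>out_arcs E v. op (Ed e) (op (Gh e) m) q)"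
      by (rule finsum_V_apply[OF fin c])
    show "op (Vx v) m q = (\<Oplus>\<^bsub>V\<^esub>e\<in>out_arcs E v. op (Ed e) (op (Gh e) m)) q"
    proof (cases "q \<in> S \<and> bsource E q = v")
      case True
      from S_boundary[of q] True obtain e y where e: "e \<in> arcs E" "y \<in> boundary E" "head E e = bsource E y"
        "q = econs E e y"
        using v by (cases rule: boundary_cases[of q]) auto
      hence y: "y \<in> S" using S_econs[OF e(1-3)] True by simp
      have ev: "e \<in> out_arcs E v" using True e by simp
      have "(\<Oplus>\<^bsub>R\<^esub>f\<in>out_arcs E v. op (Ed f) (op (Gh f) m) q) = (\<Oplus>\<^bsub>R\<^esub>f\<in>out_arcs E v. if e = f then m q else \<zero>\<^bsub>R\<^esub>)"
      proof (intro R.finsum_cong' refl)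
        fix f assume "f \<in> out_arcs E v"
        hence f: "f \<in> arcs E" by simp
        have "(\<exists>p\<in>S. head E f = bsource E p \<and> q = econs E f p) \<longleftrightarrow> e = f"
          using econs_inj[of e y f] e y by auto
        thus "op (Ed f) (op (Gh f) m) q = (if e = f then m q else \<zero>\<^bsub>R\<^esub>)" using ee[OF f] by simp
      qed (use m in auto)
      also have "\<dots> = m q" using R.add.finprod_singleton[OF ev fin, of "\<lambda>_. m q"] m by simp
      finally show ?thesis using True R op_vertex[OF m] by simp
    next
      case False
      have "(\<Oplus>\<^bsub>R\<^esub>f\<in>out_arcs E v. op (Ed f) (op (Gh f) m) q) = (\<Oplus>\<^bsub>R\<^esub>f\<in>out_arcs E v. \<zero>\<^bsub>R\<^esub>)"
      proof (intro R.finsum_cong' refl)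
        fix f assume f: "f \<in> out_arcs E v"
        show "op (Ed f) (op (Gh f) m) q = \<zero>\<^bsub>R\<^esub>"
        proof (cases "\<exists>p\<in>S. head E f = bsource E p \<and> q = econs E f p")
          case True
          then obtain p where "p \<in> S" "head E f = bsource E p" "q = econs E f p" by blast
          hence "q \<in> S \<and> bsource E q = v" using S_econs[of f p] S_boundary[of p] f by auto
          thus ?thesis using False by simp
        qed (use ee f in auto)
      qed auto
      thus ?thesis using False R op_vertex[OF m] V_outside[OF m] by auto
    qed
  qed
qed

lemma act_eq_free_op:
  assumes "a \<in> free_elts E" "m \<in> carrier V"
  shows "act V (lpa_class E a) m = ops.free_op a m"
proof -
  let ?b = "SOME c. c \<in> lpa_class E a"
  note rep = ops.free_op_representative[OF assms(1) ops.some_representative[of a] assms(2)]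
  have b: "?b \<in> free_elts E" "ops.free_op ?b m = ops.free_op a m"
    by (rule conjunct1[OF rep], rule conjunct2[OF rep])
  have w: "foldr op (letters w) m \<in> carrier V" if "w \<in> keys ?b" for w
    by (rule ops.word_op_closed[OF ops.free_keys[OF b(1) that] assms(2)])
  have "act V (lpa_class E a) m = free_act E R h S b ?b m" unfolding twisted_chen_def by (simp only: lmodule.simps)
  also have "\<dots> = ops.free_op ?b m"
  proof
    fix q
    have "ops.free_op ?b m q = (\<Oplus>\<^bsub>R\<^esub>w\<in>keys ?b.
        (lookup ?b w \<odot>\<^bsub>V\<^esub> foldr op (letters w) m) q)"
      unfolding ops.free_op_def lcomb_def
      by (rule finsum_V_apply[of "keys ?b"
          "\<lambda>w. lookup ?b w \<odot>\<^bsub>V\<^esub> foldr op (letters w) m" q, OF finite_keys V.vsmult_closed[OF w]])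
    thus "free_act E R h S b ?b m q = ops.free_op ?b m q" unfolding free_act_def V_ops by (rule sym)
  qed
  finally show ?thesis using b(2) by simp
qed

lemma alg_module_V: "alg_module (lpa E) V"
  by (rule ops.alg_module_from_operators[OF act_eq_free_op])

sublocale C: lpa_module E V
  by (rule lpa_moduleI[OF wf_digraph alg_module_V])

lemma C_G: "g \<in> gens E ==> m \<in> carrier V ==> C.G g m = op g m"
  using act_eq_free_op[of "mon [g]" m] ops.free_op_mon[of "[g]" m] by (simp add: C.G_def C.A_def)

text \<open>The idempotent \<open>\<mu>\<mu>\<^sup>*\<close> restricts a function to the cylinder of \<open>\<mu>\<close>, so the stalks consist of the
  functions supported at one point.\<close>

lemma proj_restricts:
  assumes "(u, p) \<in> fin_paths E" "m \<in> carrier V"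
  shows "C.proj (u, p) m q = (if q \<in> cyl E (u, p) then m q else \<zero>\<^bsub>R\<^esub>)"
  using assms
proof (induction p arbitrary: u m q)
  case Nil
  hence u: "u \<in> verts E" by simp
  have "C.proj (u, []) m q = (if u = bsource E q then m q else \<zero>\<^bsub>R\<^esub>)"
    using C.proj_Nil[OF u Nil(2)] C_G[of "Vx u" m] op_vertex[OF Nil(2)] u Nil(2) by simp
  thus ?case using V_outside[OF Nil(2), of q] S_boundary[of q] by auto
next
  case (Cons e p)
  hence e: "e \<in> arcs E" "u = tail E e" "(head E e, p) \<in> fin_paths E" by auto
  note m = Cons.prems(2)
  let ?n = "op (Gh e) m"
  have n: "?n \<in> carrier V" using op_closed e m by simp
  let ?N = "C.proj (head E e, p) ?n"
  have N: "?N \<in> carrier V" using C.proj_closed[OF e(3) n] .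
  have "C.proj (u, e # p) m = C.G (Ed e) (C.proj (head E e, p) (C.G (Gh e) m))" by (simp add: C.proj_def)
  also have "\<dots> = op (Ed e) ?N" using C_G e m N by simp
  finally have P: "C.proj (u, e # p) m q = op (Ed e) ?N q" by simp
  show ?case
  proof (cases rule: econs_cases[of e q])
    case (edge y)
    note by' = b_units[OF e(1) edge(1,2)]
    have cy: "q \<in> cyl E (u, e # p) \<longleftrightarrow> y \<in> cyl E (head E e, p)"
    proof
      assume "q \<in> cyl E (u, e # p)"
      then obtain z where z: "z \<in> cyl E (head E e, p)" "q = econs E e z" unfolding cyl_Cons by blast
      have "econs E e y = econs E e z" unfolding edge(3)[symmetric] by (rule z(2))
      hence "y = z" using econs_inj[of e y e z] edge(2) cyl_source[OF z(1)] by metis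
      thus "y \<in> cyl E (head E e, p)" using z(1) by simp
    next
      assume "y \<in> cyl E (head E e, p)"
      thus "q \<in> cyl E (u, e # p)" unfolding cyl_Cons using edge(3) e(1,2) by blast
    qed
    have "op (Ed e) ?N q = b e y \<otimes>\<^bsub>R\<^esub> ?N y" using op_edge[OF N e(1) edge(1,2)] edge(3) by simp
    also have "?N y = (if y \<in> cyl E (head E e, p) then inv\<^bsub>R\<^esub> (b e y) \<otimes>\<^bsub>R\<^esub> m q else \<zero>\<^bsub>R\<^esub>)"
      unfolding Cons.IH[OF e(3) n, of y] op_ghost[OF m e(1), of y] edge(3) using edge(1,2) by (simp only: simp_thms if_True)
    finally show ?thesis using P cy by' m by (auto simp flip: R.m_assoc)
  next
    case other
    have "op (Ed e) ?N q = \<zero>\<^bsub>R\<^esub>" by (rule op_edge_other[OF other])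
    moreover have "m q = \<zero>\<^bsub>R\<^esub>" if "q \<in> cyl E (u, e # p)"
    proof (rule V_outside[OF m])
      obtain y where y: "y \<in> cyl E (head E e, p)" "q = econs E e y" using \<open>q \<in> cyl E (u, e # p)\<close> by (auto simp: cyl_Cons)
      hence "y \<in> boundary E" "head E e = bsource E y" using cyl_boundary cyl_source by auto
      thus "q \<notin> S" using other[of y] S_econs[OF e(1), of y] y by auto
    qed
    ultimately show ?thesis using P by simp
  qed
qed

lemma stalk_iff:
  assumes "p \<in> boundary E"
  shows "m \<in> C.stalk p \<longleftrightarrow> m \<in> carrier V \<and> (\<forall>q. q \<noteq> p --> m q = \<zero>\<^bsub>R\<^esub>)"
proof
  assume m: "m \<in> C.stalk p"
  hence mc: "m \<in> carrier V" by simp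
  have "m q = \<zero>\<^bsub>R\<^esub>" if q: "q \<noteq> p" for q
  proof (cases "q \<in> S")
    case True
    obtain u r where ur: "(q \<in> cyl E (u, r)) \<noteq> (p \<in> cyl E (u, r))"
      using cyl_separates[OF S_boundary[OF True] assms] q by (metis surj_pair)
    hence f: "(u, r) \<in> fin_paths E" using cyl_fin_paths by blast
    have "C.proj (u, r) m q = (if p \<in> cyl E (u, r) then m q else \<zero>\<^bsub>R\<^esub>)"
      using C.stalkD(2)[OF m f] by simp
    thus ?thesis using proj_restricts[OF f mc, of q] ur by (auto split: if_splits)
  qed (rule V_outside[OF mc])
  thus "m \<in> carrier V \<and> (\<forall>q. q \<noteq> p --> m q = \<zero>\<^bsub>R\<^esub>)" using mc by simp
next
  assume m: "m \<in> carrier V \<and> (\<forall>q. q \<noteq> p --> m q = \<zero>\<^bsub>R\<^esub>)"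
  show "m \<in> C.stalk p"
  proof (rule C.stalkI)
    fix u r assume f: "(u, r) \<in> fin_paths E"
    show "C.proj (u, r) m = (if p \<in> cyl E (u, r) then m else \<zero>\<^bsub>V\<^esub>)"
    proof
      fix q
      show "C.proj (u, r) m q = (if p \<in> cyl E (u, r) then m else \<zero>\<^bsub>V\<^esub>) q"
        using proj_restricts[OF f, of m q] m by (cases "q = p") auto
    qed
  qed (use m in simp)
qed

definition \<delta> :: "('v, 'e) bpath => 'r => ('v, 'e) bpath => 'r" where
  "\<delta> p r = (\<lambda>q. if q = p then r else \<zero>\<^bsub>R\<^esub>)"

lemma \<delta>_stalk [simp]: "p \<in> S ==> r \<in> carrier R ==> \<delta> p r \<in> C.stalk p"
  unfolding stalk_iff[OF S_boundary] \<delta>_def by (intro conjI V_support_subset[of "{p}"]) auto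

lemma \<delta>_closed [simp]: "p \<in> S ==> r \<in> carrier R ==> \<delta> p r \<in> carrier V"
  using \<delta>_stalk C.stalk_carrier by blast

lemma \<delta>_eq_zero: "\<delta> p r = \<zero>\<^bsub>V\<^esub> \<longleftrightarrow> r = \<zero>\<^bsub>R\<^esub>"
  by (auto simp: \<delta>_def fun_eq_iff)

lemma \<delta>_apply [simp]: "\<delta> p r p = r"
  by (simp add: \<delta>_def)

lemma stalk_\<delta>:
  assumes "p \<in> boundary E" "m \<in> C.stalk p"
  shows "m = \<delta> p (m p)" "m p \<in> carrier R"
  using assms stalk_iff[OF assms(1), of m] by (auto simp: \<delta>_def fun_eq_iff)

lemma stalk_outside: "p \<in> boundary E ==> m \<in> C.stalk p ==> m \<noteq> \<zero>\<^bsub>V\<^esub> ==> p \<in> S"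
  using stalk_\<delta>[of p m] V_outside[of m p] \<delta>_eq_zero[of p "m p"] by auto

lemma x_in_S [simp]: "x \<in> S"
  by (rule tail_class_refl[OF x])

lemma spectral_V: "spectral E V"
  unfolding C.spectral_iff using x \<delta>_stalk[OF x_in_S R.one_closed] \<delta>_eq_zero[of x "\<one>\<^bsub>R\<^esub>"]
  by (intro bexI[of _ x] bexI[of _ "\<delta> x \<one>\<^bsub>R\<^esub>"]) auto

lemma V_decomp:
  assumes n: "n \<in> carrier V"
  shows "n = (\<Oplus>\<^bsub>V\<^esub>p\<in>{p. n p \<noteq> \<zero>\<^bsub>R\<^esub>}. \<delta> p (n p))"
proof
  fix y
  have c: "\<delta> p (n p) \<in> carrier V" if "p \<in> {p. n p \<noteq> \<zero>\<^bsub>R\<^esub>}" for p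
  proof (rule \<delta>_closed)
    show "p \<in> S" using that V_outside[OF n, of p] by blast
  qed (use n in simp)
  have "(\<Oplus>\<^bsub>V\<^esub>p\<in>{p. n p \<noteq> \<zero>\<^bsub>R\<^esub>}. \<delta> p (n p)) y = (\<Oplus>\<^bsub>R\<^esub>p\<in>{p. n p \<noteq> \<zero>\<^bsub>R\<^esub>}. if y = p then n p else \<zero>\<^bsub>R\<^esub>)"
    using finsum_V_apply[of "{p. n p \<noteq> \<zero>\<^bsub>R\<^esub>}" "\<lambda>p. \<delta> p (n p)" y, OF V_supp[OF n] c] by (simp add: \<delta>_def)
  also have "\<dots> = n y"
  proof (cases "n y = \<zero>\<^bsub>R\<^esub>")
    case True
    have "(\<Oplus>\<^bsub>R\<^esub>p\<in>{p. n p \<noteq> \<zero>\<^bsub>R\<^esub>}. if y = p then n p else \<zero>\<^bsub>R\<^esub>) = (\<Oplus>\<^bsub>R\<^esub>p\<in>{p. n p \<noteq> \<zero>\<^bsub>R\<^esub>}. \<zero>\<^bsub>R\<^esub>)"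
      using True by (intro R.finsum_cong' refl) auto
    thus ?thesis using True by simp
  next
    case False
    thus ?thesis using R.add.finprod_singleton[where i = y and f = n, OF _ V_supp[OF n]] n by simp
  qed
  finally show "n y = (\<Oplus>\<^bsub>V\<^esub>p\<in>{p. n p \<noteq> \<zero>\<^bsub>R\<^esub>}. \<delta> p (n p)) y" by simp
qed

lemma submodule_tr:
  assumes "alg_submodule (lpa E) V N" "(q, k, p) \<in> gpd E" "m \<in> N"
  shows "C.tr q k p m \<in> N"
proof -
  have mc: "m \<in> carrier V" using assms V.subspaceD(1)[of N] by (auto simp: alg_submodule_def)
  from assms(2) obtain \<mu> \<nu> z where r: "arrow_rep E q k p = (\<mu>, \<nu>)" "composable E \<mu> z" "composable E \<nu> z"
    by (rule arrow_rep)
  have f: "\<mu> \<in> fin_paths E" "\<nu> \<in> fin_paths E" using r by (auto simp: composable_def)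
  have "(mon (path_word \<mu> @ ghost_word \<nu>) :: ('v, 'e, 'k) free) \<in> aug E"
    using C.words_gens[OF f(1)] C.words_gens[OF f(2)] by (intro aug_mon) auto
  hence "(lpa_mono E \<mu> \<nu> :: ('v, 'e, 'k) lpa_elt) \<in> carrier (lpa E)" unfolding lpa_carrier lpa_mono_def by blast
  hence "act V (lpa_mono E \<mu> \<nu>) m \<in> N" using assms by (simp add: alg_submodule_def)
  thus ?thesis using C.act_lpa_mono[OF f mc] r(1) by (simp add: C.tr_def)
qed

lemma S_arrow:
  assumes "p \<in> S"
  obtains k where "(x, k, p) \<in> gpd E" "(p, - k, x) \<in> gpd E"
proof -
  obtain k where "(x, k, p) \<in> gpd E" using assms unfolding tail_class_eq by blast
  thus ?thesis using that gpd_inv by simp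
qed

text \<open>A nonzero submodule contains a nonzero vector of some stalk, by cutting with a cylinder that isolates
  a point of the support, hence by transport one of the stalk at \<open>x\<close>; it remains to know that such a
  vector generates the stalk at \<open>x\<close>.\<close>

lemma simple_V:
  assumes gen: "\<And>N r s. alg_submodule (lpa E) V N ==> r \<in> carrier R ==> r \<noteq> \<zero>\<^bsub>R\<^esub> ==> \<delta> x r \<in> N ==>
      s \<in> carrier R ==> \<delta> x s \<in> N"
  shows "simple_module (lpa E) V"
  unfolding simple_module_def
proof (intro conjI allI impI)
  show "alg_module (lpa E) V" by (rule alg_module_V)
  let ?u = "mon [Vx (bsource E x)] :: ('v, 'e, 'k) free"
  have "C.A ?u (\<delta> x \<one>\<^bsub>R\<^esub>) = \<delta> x \<one>\<^bsub>R\<^esub>" "?u \<in> aug E"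
    using C.stalk_unit[OF x \<delta>_stalk[OF x_in_S R.one_closed]] by auto
  moreover have "\<delta> x \<one>\<^bsub>R\<^esub> \<noteq> \<zero>\<^bsub>V\<^esub>" using \<delta>_eq_zero[of x "\<one>\<^bsub>R\<^esub>"] by simp
  ultimately have "act V (lpa_class E ?u) (\<delta> x \<one>\<^bsub>R\<^esub>) \<noteq> \<zero>\<^bsub>V\<^esub>" "lpa_class E ?u \<in> carrier (lpa E)"
    unfolding C.A_def lpa_carrier by auto
  thus "\<exists>a\<in>carrier (lpa E). \<exists>m\<in>carrier V. act V a m \<noteq> \<zero>\<^bsub>V\<^esub>"
    using \<delta>_closed[OF x_in_S R.one_closed] by blast
  fix N assume N: "alg_submodule (lpa E) V N"
  hence sub: "submodule N (ring_of_type_algebra :: 'k ring) V" by (simp add: alg_submodule_def)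
  note sd = V.subspaceD[OF sub]
  show "N = {\<zero>\<^bsub>V\<^esub>} \<or> N = carrier V"
  proof (cases "N = {\<zero>\<^bsub>V\<^esub>}")
    case False
    then obtain m where m: "m \<in> N" "m \<noteq> \<zero>\<^bsub>V\<^esub>" using sd(2) by blast
    hence mc: "m \<in> carrier V" using sd(1) by blast
    let ?P = "{p. m p \<noteq> \<zero>\<^bsub>R\<^esub>}"
    have "?P \<noteq> {}" using m(2) by (auto simp: fun_eq_iff)
    moreover have "?P \<subseteq> boundary E" using V_outside[OF mc] S_boundary by blast
    ultimately obtain p \<mu> where p: "p \<in> ?P" "?P \<inter> cyl E \<mu> = {p}"
      using cyl_isolates[OF V_supp[OF mc]] by blast
    obtain u q where \<mu>: "\<mu> = (u, q)" by (cases \<mu>)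
    have f: "(u, q) \<in> fin_paths E" using p \<mu> cyl_fin_paths[of p \<mu>] by blast
    have pS: "p \<in> S" using p V_outside[OF mc] by blast
    have "C.proj (u, q) m = \<delta> p (m p)"
    proof
      fix y
      have "y \<in> ?P \<inter> cyl E (u, q) \<longleftrightarrow> y = p" using p(2) \<mu> by blast
      thus "C.proj (u, q) m y = \<delta> p (m p) y"
        using proj_restricts[OF f mc, of y] by (auto simp: \<delta>_def)
    qed
    moreover have "C.proj (u, q) m \<in> N"
    proof -
      have "(mon (path_word (u, q) @ ghost_word (u, q)) :: ('v, 'e, 'k) free) \<in> aug E"
        using C.words_gens[OF f] by (intro aug_mon) auto
      hence "(lpa_mono E (u, q) (u, q) :: ('v, 'e, 'k) lpa_elt) \<in> carrier (lpa E)" unfolding lpa_carrier lpa_mono_def by blast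
      hence "act V (lpa_mono E (u, q) (u, q)) m \<in> N" using N m(1) by (simp add: alg_submodule_def)
      thus ?thesis using C.act_lpa_mono[OF f f mc] by (simp add: C.proj_def)
    qed
    ultimately have dN: "\<delta> p (m p) \<in> N" by simp
    have mp: "m p \<in> carrier R" "m p \<noteq> \<zero>\<^bsub>R\<^esub>" using mc p by auto
    obtain k where k: "(x, k, p) \<in> gpd E" using S_arrow[OF pS] by blast
    let ?t = "C.tr x k p (\<delta> p (m p))"
    have t: "?t \<in> C.stalk x" by (rule C.tr_stalk[OF k \<delta>_stalk[OF pS mp(1)]])
    have "?t \<noteq> \<zero>\<^bsub>V\<^esub>" using C.tr_eq_zero[OF k \<delta>_stalk[OF pS mp(1)]] \<delta>_eq_zero[of p "m p"] mp(2) by blast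
    hence "?t x \<noteq> \<zero>\<^bsub>R\<^esub>" using stalk_\<delta>(1)[OF x t] \<delta>_eq_zero[of x "?t x"] by metis
    moreover have "\<delta> x (?t x) \<in> N" using submodule_tr[OF N k dN] stalk_\<delta>(1)[OF x t] by metis
    ultimately have xN: "\<delta> x s \<in> N" if "s \<in> carrier R" for s
      by (rule gen[OF N stalk_\<delta>(2)[OF x t] _ _ that])
    have qN: "\<delta> q s \<in> N" if q: "q \<in> S" and s: "s \<in> carrier R" for q s
    proof -
      obtain l where l: "(x, l, q) \<in> gpd E" "(q, - l, x) \<in> gpd E" using S_arrow[OF q] by blast
      let ?t = "C.tr x l q (\<delta> q s)"
      have t: "?t \<in> C.stalk x" by (rule C.tr_stalk[OF l(1) \<delta>_stalk[OF q s]])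
      have "?t \<in> N" using xN[OF stalk_\<delta>(2)[OF x t]] stalk_\<delta>(1)[OF x t] by metis
      hence "C.tr q (- l) x ?t \<in> N" by (rule submodule_tr[OF N l(2)])
      thus ?thesis using C.tr_inverse[OF l(1) \<delta>_stalk[OF q s]] by simp
    qed
    have "carrier V \<subseteq> N"
    proof
      fix n assume n: "n \<in> carrier V"
      have "n = (\<Oplus>\<^bsub>V\<^esub>p\<in>{p. n p \<noteq> \<zero>\<^bsub>R\<^esub>}. \<delta> p (n p))" by (rule V_decomp[OF n])
      also have "\<dots> \<in> N"
      proof (rule V.subspace_finsum[OF sub V_supp[OF n]])
        fix p assume "p \<in> {p. n p \<noteq> \<zero>\<^bsub>R\<^esub>}"
        hence "p \<in> S" using V_outside[OF n, of p] by blast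
        thus "\<delta> p (n p) \<in> N" using n by (intro qN) simp_all
      qed
      finally show "n \<in> N" .
    qed
    thus ?thesis using sd(1) by blast
  qed simp
qed

end

section \<open>The fields K[t, 1/t]/(f)\<close>

lemma poly_mapping_single_induct [case_names zero single add]:
  fixes a :: "'i \<Rightarrow>\<^sub>0 'b :: comm_monoid_add"
  assumes "P 0" "\<And>i k. P (single i k)" "\<And>a b. P a ==> P b ==> P (a + b)"
  shows "P a"
proof -
  have "P (\<Sum>i\<in>I. single i (lookup a i))" if "finite I" for I
    using that assms by (induction I rule: finite_induct) simp_all
  thus ?thesis using poly_mapping_sum_singles[of a] finite_keys[of a] by metis
qed

abbreviation lp :: "'k :: field poly => int \<Rightarrow>\<^sub>0 'k" where "lp \<equiv> laurent_of_poly"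
abbreviation tpow :: "int => int \<Rightarrow>\<^sub>0 'k :: field" where "tpow i \<equiv> single i 1"
abbreviation const_laurent :: "'k :: field => int \<Rightarrow>\<^sub>0 'k" where "const_laurent k \<equiv> single 0 k"

lemma lookup_lp: "lookup (lp p) n = (if n \<ge> 0 then poly.coeff p (nat n) else 0)"
proof (cases "n \<ge> 0")
  case True
  then obtain j where n: "n = int j" by (metis nonneg_int_cases)
  have "lookup (lp p) n = (\<Sum>i\<le>degree p. if i = j then poly.coeff p i else 0)"
    by (auto simp: laurent_of_poly_def lookup_sum lookup_single when_def n intro!: sum.cong)
  thus ?thesis using n by (auto simp: coeff_eq_0)
next
  case False
  thus ?thesis by (auto simp: laurent_of_poly_def lookup_sum lookup_single when_def intro!: sum.neutral)
qed

lemma lp_add: "lp (p + q) = lp p + lp q"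
  by (rule poly_mapping_eqI) (simp add: lookup_lp lookup_add)

lemma lp_zero [simp]: "lp 0 = 0"
  by (rule poly_mapping_eqI) (simp add: lookup_lp)

lemma lp_inj: "lp p = lp q \<longleftrightarrow> p = q"
proof
  assume "lp p = lp q"
  hence "poly.coeff p n = poly.coeff q n" for n using lookup_lp[of p "int n"] lookup_lp[of q "int n"] by simp
  thus "p = q" by (simp add: poly_eq_iff)
qed simp

lemma lp_monom: "lp (monom k n) = single (int n) k"
  by (rule poly_mapping_eqI) (auto simp: lookup_lp lookup_single when_def)

lemma lp_diff: "lp (p - q) = lp p - lp q"
  by (rule poly_mapping_eqI) (simp add: lookup_lp lookup_minus)

lemma lp_sum: "lp (\<Sum>i\<in>I. f i) = (\<Sum>i\<in>I. lp (f i))"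
  by (induction I rule: infinite_finite_induct) (simp_all add: lp_add)

lemma lp_mult: "lp (p * q) = lp p * lp q"
proof -
  have m: "p = (\<Sum>i\<le>degree p. monom (poly.coeff p i) i)" for p :: "'k :: field poly"
    by (rule poly_as_sum_of_monoms[symmetric])
  have "p * q = (\<Sum>i\<le>degree p. \<Sum>j\<le>degree q. monom (poly.coeff p i * poly.coeff q j) (i + j))"
    by (subst m[of p], subst m[of q]) (simp add: sum_product mult_monom)
  moreover have "lp p * lp q = (\<Sum>i\<le>degree p. \<Sum>j\<le>degree q. lp (monom (poly.coeff p i * poly.coeff q j) (i + j)))"
    unfolding laurent_of_poly_def[of p] laurent_of_poly_def[of q] lp_monom
    by (simp add: sum_product mult_single)
  ultimately show ?thesis by (simp only: lp_sum)
qed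

lemma lp_const: "lp [:k:] = const_laurent k"
  using lp_monom[of k 0] by (simp add: monom_0)

lemma lp_one [simp]: "lp 1 = 1"
  using lp_const[of 1] by (simp add: one_pCons)

lemma lp_smult: "lp (Polynomial.smult k p) = const_laurent k * lp p"
  using lp_mult[of "[:k:]" p] by (simp add: lp_const)

lemma lp_t: "lp [:0, 1:] = tpow 1"
  using lp_monom[of 1 1] by (simp add: monom_Suc monom_0)

text \<open>Every Laurent polynomial is a polynomial up to a power of \<open>t\<close>.\<close>

lemma laurent_denominator: "\<exists>n P. tpow (int n) * Q = lp P"
proof (induction Q rule: poly_mapping_single_induct)
  case zero
  show ?case using lp_zero by (metis mult_zero_right)
next
  case (single i k)
  have "tpow (int (nat (- i))) * single i k = lp (monom k (nat (int (nat (- i)) + i)))"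
    by (simp add: mult_single lp_monom)
  thus ?case by blast
next
  case (add a b)
  then obtain n P m P' where *: "tpow (int n) * a = lp P" "tpow (int m) * b = lp P'" by blast
  have "tpow (int (n + m)) * (a + b) = tpow (int m) * (tpow (int n) * a) + tpow (int n) * (tpow (int m) * b)"
    by (simp add: algebra_simps mult_single flip: mult.assoc)
  also have "\<dots> = lp (monom 1 m * P + monom 1 n * P')" by (simp add: * lp_add lp_mult lp_monom)
  finally show ?case by blast
qed

lemma tpow_cancel: "tpow (- i) * (tpow i * Q) = (Q :: int \<Rightarrow>\<^sub>0 'k :: field)"
  by (simp add: mult_single flip: mult.assoc)

text \<open>A degree count: a non-unit factor of a linear polynomial is the linear polynomial up to a scalar.\<close>

lemma irreducible_not_dvd_t:
  fixes f :: "'k :: field poly"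
  assumes "Factorial_Ring.irreducible f" "f dvd [:a, 1:]"
  shows "\<exists>k. f = Polynomial.smult k [:a, 1:]"
proof -
  obtain g where g: "[:a, 1:] = f * g" using assms(2) by (auto simp: dvd_def)
  hence nz: "f \<noteq> 0" "g \<noteq> 0" by auto
  have "degree f \<noteq> 0" using assms(1) nz is_unit_iff_degree[of f] by (auto simp: Factorial_Ring.irreducible_def)
  moreover have "degree f + degree g = 1" using degree_mult_eq[OF nz] g by (metis degree_pCons_eq_if degree_pCons_0 one_neq_zero One_nat_def pCons_eq_0_iff)
  ultimately have "degree g = 0" by simp
  then obtain c where c: "g = [:c:]" by (rule degree_eq_zeroE)
  hence c0: "c \<noteq> 0" using nz(2) by auto
  have "Polynomial.smult (inverse c) [:a, 1:] = f" unfolding g c using c0 by simp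
  thus ?thesis by metis
qed

text \<open>An element of least degree in the ideal generated by \<open>f\<close> and \<open>P\<close> divides both, hence is a unit.\<close>

lemma bezout_irreducible:
  fixes f P :: "'k :: field poly"
  assumes "Factorial_Ring.irreducible f" "\<not> f dvd P"
  shows "\<exists>a b. a * f + b * P = 1"
proof -
  let ?S = "\<lambda>d. d \<noteq> 0 \<and> (\<exists>a b. d = a * f + b * P)"
  have "f \<noteq> 0" using assms(1) by auto
  hence "?S f" by (auto intro: exI[of _ 1] exI[of _ 0])
  then obtain d where d: "?S d" and min: "\<And>e. ?S e ==> degree d \<le> degree e"
    using ex_has_least_nat[of ?S f degree] by blast
  from d obtain a b where ab: "d = a * f + b * P" by blast
  have dv: "d dvd r * f + s * P" for r s
  proof (rule ccontr)
    assume nd: "\<not> d dvd r * f + s * P"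
    let ?u = "(r * f + s * P) mod d"
    have nz: "?u \<noteq> 0" using nd by (simp add: dvd_eq_mod_eq_0)
    define q where "q = (r * f + s * P) div d"
    have "?u = (r * f + s * P) - q * d" by (simp add: q_def minus_div_mult_eq_mod)
    also have "\<dots> = (r - q * a) * f + (s - q * b) * P" unfolding ab by (simp add: algebra_simps)
    finally have "?S ?u" using nz by blast
    moreover have "degree ?u < degree d" using degree_mod_less'[OF _ nz] d by blast
    ultimately show False using min[of ?u] by simp
  qed
  have df: "d dvd f" and dP: "d dvd P" using dv[of 1 0] dv[of 0 1] by simp_all
  have "d dvd 1"
  proof (rule ccontr)
    assume nu: "\<not> d dvd 1"
    obtain g where g: "f = d * g" using df by (auto simp: dvd_def)
    hence "g dvd 1" using assms(1) nu by (auto simp: Factorial_Ring.irreducible_def)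
    hence "f dvd d" unfolding g by (simp add: mult_unit_dvd_iff)
    thus False using dP assms(2) dvd_trans by blast
  qed
  then obtain e where "1 = d * e" by (auto simp: dvd_def)
  hence "(e * a) * f + (e * b) * P = 1" by (simp add: ab algebra_simps)
  thus ?thesis by blast
qed

lemma laurent_ideal: "ideal (laurent_ideal f) (ring_of_type_algebra :: (int \<Rightarrow>\<^sub>0 'k :: field) ring)"
  unfolding laurent_ideal_def by (rule cring.cgenideal_ideal[OF cring_from_type_algebra]) simp

lemma laurent_ideal_iff: "Q \<in> laurent_ideal f \<longleftrightarrow> lp f dvd Q"
  by (auto simp: laurent_ideal_def cgenideal_def dvd_def mult.commute)

lemma ext_class_hom: "ext_class f \<in> ring_hom ring_of_type_algebra (ext_field f)"
  using ideal.rcos_ring_hom[OF laurent_ideal] unfolding ext_class_def[abs_def] ext_field_def .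

lemma ext_class_ops:
  shows ext_class_add: "ext_class f (P + Q) = ext_class f P \<oplus>\<^bsub>ext_field f\<^esub> ext_class f Q"
    and ext_class_mult: "ext_class f (P * Q) = ext_class f P \<otimes>\<^bsub>ext_field f\<^esub> ext_class f Q"
    and ext_class_one: "ext_class f 1 = \<one>\<^bsub>ext_field f\<^esub>"
    and ext_class_closed [simp]: "ext_class f P \<in> carrier (ext_field f)"
  using ring_hom_add[OF ext_class_hom, of P Q f] ring_hom_mult[OF ext_class_hom, of P Q f]
    ring_hom_one[OF ext_class_hom, of f] ring_hom_closed[OF ext_class_hom, of P f] by simp_all

lemma ext_carrier: "carrier (ext_field f) = range (ext_class f)"
  by (auto simp: ext_field_def FactRing_def A_RCOSETS_def' ext_class_def)

lemma ext_cring: "cring (ext_field f)"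
  unfolding ext_field_def by (rule ideal.quotient_is_cring[OF laurent_ideal cring_from_type_algebra])

lemma ext_class_eq: "ext_class f P = {i + P | i. lp f dvd i}"
  unfolding ext_class_def by (auto simp: a_r_coset_def' laurent_ideal_iff)

lemma ext_class_eq_zero: "ext_class f P = \<zero>\<^bsub>ext_field f\<^esub> \<longleftrightarrow> lp f dvd P"
proof -
  have z: "\<zero>\<^bsub>ext_field f\<^esub> = {i. lp f dvd i}" by (auto simp: ext_field_def FactRing_def laurent_ideal_iff)
  show ?thesis
  proof
    assume "ext_class f P = \<zero>\<^bsub>ext_field f\<^esub>"
    moreover have "0 + P \<in> ext_class f P" unfolding ext_class_eq using dvd_0_right by blast
    ultimately show "lp f dvd P" unfolding z by simp
  next
    assume P: "lp f dvd P"
    show "ext_class f P = \<zero>\<^bsub>ext_field f\<^esub>" unfolding z ext_class_eq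
    proof (intro equalityI subsetI)
      fix Q assume "Q \<in> {i. lp f dvd i}"
      hence "lp f dvd Q - P" "Q = (Q - P) + P" using P by (auto intro: dvd_diff)
      thus "Q \<in> {i + P | i. lp f dvd i}" by blast
    qed (use P in auto)
  qed
qed

lemma ext_class_eq_iff: "ext_class f P = ext_class f Q \<longleftrightarrow> lp f dvd P - Q"
proof -
  interpret R: cring "ext_field f" by (rule ext_cring)
  have "ext_class f P = ext_class f (P - Q) \<oplus>\<^bsub>ext_field f\<^esub> ext_class f Q"
    using ext_class_add[of f "P - Q" Q] by simp
  moreover have "u \<oplus>\<^bsub>ext_field f\<^esub> v = v \<longleftrightarrow> u = \<zero>\<^bsub>ext_field f\<^esub>"
    if "u \<in> carrier (ext_field f)" "v \<in> carrier (ext_field f)" for u v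
    using that R.add.r_cancel_one[of v u] by simp
  ultimately show ?thesis using ext_class_eq_zero[of f "P - Q"] by simp
qed

locale ext_ring =
  fixes f :: "'k :: field poly"
  assumes irr: "Factorial_Ring.irreducible f" and not_t: "\<And>k. f \<noteq> Polynomial.smult k [:0, 1:]"
begin

abbreviation "K' \<equiv> ext_field f"
abbreviation "cl \<equiv> ext_class f"

text \<open>Clearing denominators turns divisibility of Laurent polynomials into divisibility of a multiple
  \<open>t\<^sup>n P\<close>, and \<open>f\<close> is prime to \<open>t\<close>.\<close>

lemma lp_dvd_iff: "lp f dvd lp P \<longleftrightarrow> f dvd P"
proof
  assume "lp f dvd lp P"
  then obtain Q where Q: "lp P = lp f * Q" by (auto simp: dvd_def)
  obtain n Q' where n: "tpow (int n) * Q = lp Q'" using laurent_denominator by blast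
  have "lp (monom 1 n * P) = lp f * (tpow (int n) * Q)" by (simp add: lp_mult lp_monom Q ac_simps)
  hence "monom 1 n * P = f * Q'" unfolding n by (simp add: lp_inj flip: lp_mult)
  hence "f dvd monom 1 n * P" by simp
  moreover have p: "prime_elem f" using irr by (rule field_poly_irreducible_imp_prime)
  ultimately have "f dvd monom 1 n \<or> f dvd P" using prime_elem_dvd_mult_iff by blast
  moreover have "\<not> f dvd monom 1 n"
  proof
    assume "f dvd monom 1 n"
    hence "f dvd [:0, 1:] ^ n" by (simp add: monom_altdef)
    hence "f dvd [:0, 1:]" using p prime_elem_dvd_power by blast
    thus False using irreducible_not_dvd_t[OF irr] not_t by blast
  qed
  ultimately show "f dvd P" by blast
next
  assume "f dvd P"
  thus "lp f dvd lp P" by (auto simp: dvd_def lp_mult)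
qed

lemma ext_inverse:
  assumes "\<not> lp f dvd Q"
  shows "\<exists>Q'. lp f dvd Q * Q' - 1"
proof -
  obtain n P where n: "tpow (int n) * Q = lp P" using laurent_denominator by blast
  have "\<not> f dvd P"
  proof
    assume "f dvd P"
    hence "lp f dvd tpow (- int n) * (tpow (int n) * Q)" using lp_dvd_iff n by (metis dvd_mult)
    thus False using assms tpow_cancel by metis
  qed
  then obtain a b where ab: "a * f + b * P = 1" using bezout_irreducible[OF irr] by blast
  have "Q * (tpow (int n) * lp b) = lp (b * P)" by (simp add: lp_mult n[symmetric] ac_simps)
  also have "b * P = 1 - a * f" using ab by (simp add: algebra_simps)
  finally have "Q * (tpow (int n) * lp b) - 1 = lp f * (- lp a)" by (simp add: lp_diff lp_mult mult.commute)
  thus ?thesis by (metis dvd_triv_left)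
qed

lemma ext_field: "field K'"
proof (rule cring.cring_fieldI2[OF ext_cring])
  show "\<zero>\<^bsub>K'\<^esub> \<noteq> \<one>\<^bsub>K'\<^esub>"
  proof
    assume "\<zero>\<^bsub>K'\<^esub> = \<one>\<^bsub>K'\<^esub>"
    hence "lp f dvd lp 1" using ext_class_eq_zero[of f 1] by (simp add: ext_class_one)
    thus False using lp_dvd_iff[of 1] irr by (simp add: Factorial_Ring.irreducible_def)
  qed
  fix a assume a: "a \<in> carrier K'" "a \<noteq> \<zero>\<^bsub>K'\<^esub>"
  from a(1) obtain Q where Q1: "a = cl Q" unfolding ext_carrier by blast
  have Q: "a = cl Q" "\<not> lp f dvd Q" using Q1 a(2) by (simp_all add: ext_class_eq_zero)
  obtain Q' where "lp f dvd Q * Q' - 1" using ext_inverse[OF Q(2)] by blast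
  hence "a \<otimes>\<^bsub>K'\<^esub> cl Q' = \<one>\<^bsub>K'\<^esub>"
    unfolding Q(1) by (simp only: ext_class_eq_iff flip: ext_class_mult ext_class_one)
  thus "\<exists>b\<in>carrier K'. a \<otimes>\<^bsub>K'\<^esub> b = \<one>\<^bsub>K'\<^esub>" by auto
qed

sublocale K': field K' by (rule ext_field)

lemma embed_hom: "ext_embed f \<in> ring_hom ring_of_type_algebra K'"
  by (rule ring_hom_memI)
    (simp_all add: ext_embed_def single_add ext_class_add ext_class_one flip: ext_class_mult, simp add: mult_single)

lemma cl_single: "cl (single i k) = ext_embed f k \<otimes>\<^bsub>K'\<^esub> cl (tpow i)"
  by (simp add: ext_embed_def mult_single flip: ext_class_mult)

lemma t_unit: "ext_t f \<in> Units K'" "cl (tpow (- 1)) \<otimes>\<^bsub>K'\<^esub> ext_t f = \<one>\<^bsub>K'\<^esub>"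
proof -
  have *: "cl (tpow (- 1)) \<otimes>\<^bsub>K'\<^esub> ext_t f = \<one>\<^bsub>K'\<^esub>"
    by (simp add: ext_t_def mult_single ext_class_one flip: ext_class_mult)
  thus "cl (tpow (- 1)) \<otimes>\<^bsub>K'\<^esub> ext_t f = \<one>\<^bsub>K'\<^esub>" .
  show "ext_t f \<in> Units K'" using * K'.m_comm[of "ext_t f" "cl (tpow (- 1))"]
    unfolding Units_def by (auto simp: ext_t_def)
qed

text \<open>Modulo \<open>f\<close> a power of \<open>t\<close> has a polynomial inverse, so remainders modulo \<open>f\<close> represent all classes.\<close>

lemma ext_representative:
  assumes "r \<in> carrier K'"
  obtains P where "r = cl (lp P)" "P = 0 \<or> degree P < degree f"
proof -
  obtain Q where Q: "r = cl Q" using assms by (auto simp: ext_carrier)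
  obtain n P where n: "tpow (int n) * Q = lp P" using laurent_denominator by blast
  have "\<not> f dvd monom 1 n"
  proof
    assume "f dvd monom 1 n"
    hence "lp f dvd tpow (- int n) * lp (monom 1 n)" using lp_dvd_iff[of "monom 1 n"] by (metis dvd_mult)
    hence "lp f dvd lp 1" by (simp add: lp_monom mult_single)
    thus False using lp_dvd_iff[of 1] irr by (simp add: Factorial_Ring.irreducible_def)
  qed
  then obtain a b where ab: "a * f + b * monom 1 n = 1" using bezout_irreducible[OF irr] by blast
  let ?P = "(b * P) mod f"
  have "Q = lp (a * f + b * monom 1 n) * Q" unfolding ab by simp
  also have "\<dots> = lp f * (lp a * Q) + lp b * (tpow (int n) * Q)"
    by (simp add: lp_add lp_mult lp_monom algebra_simps)
  also have "\<dots> = lp f * (lp a * Q) + lp (b * P)" by (simp add: n lp_mult)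
  also have "lp (b * P) = lp (b * P div f) * lp f + lp ?P" by (simp flip: lp_mult lp_add)
  finally have "Q - lp ?P = lp f * (lp a * Q + lp (b * P div f))"
    by (simp add: algebra_simps)
  hence "r = cl (lp ?P)" unfolding Q ext_class_eq_iff by simp
  moreover have "f \<noteq> 0" using irr by (simp add: Factorial_Ring.irreducible_def)
  hence "?P = 0 \<or> degree ?P < degree f" by (rule degree_mod_less)
  ultimately show thesis by (rule that)
qed

end

section \<open>The action of Laurent polynomials on stalks\<close>

definition isotropy_period :: "('v, 'e) pre_digraph => ('v, 'e) bpath => nat => bool" where
  "isotropy_period E x n \<longleftrightarrow> (\<forall>k. (x, k, x) \<in> gpd E \<longleftrightarrow> int n dvd k)"

context path_graph
begin

lemma isotropy_period_gpd: "isotropy_period E x n ==> (x, l * int n, x) \<in> gpd E"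
  by (simp add: isotropy_period_def)

lemma isotropy_period_boundary: "isotropy_period E x n ==> x \<in> boundary E"
  using isotropy_period_gpd[of x n 0] gpd_boundary[of x 0 x] by simp

lemma isotropy_period_cinf: "simple_closed E c ==> isotropy_period E (cinf c) (length c)"
  unfolding isotropy_period_def using simple_closed_isotropy[of c] by simp

end

context vspace
begin

lemma vsmult_sum:
  assumes "finite I" "m \<in> carrier M"
  shows "(\<Oplus>\<^bsub>M\<^esub>i\<in>I. \<kappa> i \<odot>\<^bsub>M\<^esub> m) = (\<Sum>i\<in>I. \<kappa> i) \<odot>\<^bsub>M\<^esub> m"
  using assms by (induction I rule: finite_induct) (simp_all add: vsmult_add Pi_def)

end

context lpa_module
begin

definition la :: "('v, 'e) bpath => nat => (int \<Rightarrow>\<^sub>0 'k) => 'm => 'm" where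
  "la x n Q m = lcomb M (\<lambda>l. tr x (l * int n) x m) Q"

lemma la_zero: "la x n 0 m = \<zero>\<^bsub>M\<^esub>"
  by (simp add: la_def)

lemma la_linmap: "isotropy_period E x n ==> linmap M M (la x n Q)"
  unfolding la_def[abs_def] by (rule linmap_lcomb_vectors) (rule tr_linmap[OF isotropy_period_gpd])

lemma la_stalk:
  assumes "isotropy_period E x n" "m \<in> stalk x"
  shows "la x n Q m \<in> stalk x"
  unfolding la_def lcomb_def
  by (rule stalk_finsum[OF finite_keys], rule stalk_smult, rule tr_stalk[OF isotropy_period_gpd[OF assms(1)] assms(2)])

lemma la_add:
  assumes "isotropy_period E x n" "m \<in> stalk x"
  shows "la x n (P + Q) m = la x n P m \<oplus>\<^bsub>M\<^esub> la x n Q m"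
  unfolding la_def
  by (rule lcomb_add) (rule tr_closed[OF isotropy_period_gpd[OF assms(1)] stalk_carrier[OF assms(2)]])

lemma la_single:
  assumes "isotropy_period E x n" "m \<in> stalk x"
  shows "la x n (single i k) m = k \<odot>\<^bsub>M\<^esub> tr x (i * int n) x m"
  unfolding la_def
  by (rule lcomb_single) (rule tr_closed[OF isotropy_period_gpd[OF assms(1)] stalk_carrier[OF assms(2)]])

lemma la_const:
  assumes "isotropy_period E x n" "m \<in> stalk x"
  shows "la x n (const_laurent k) m = k \<odot>\<^bsub>M\<^esub> m"
  using la_single[OF assms, of 0 k] tr_id[OF isotropy_period_boundary[OF assms(1)] assms(2)] by simp

text \<open>Functoriality of transport makes the stalk a module over the Laurent polynomials.\<close>

lemma la_mult:
  assumes ip: "isotropy_period E x n" and m: "m \<in> stalk x"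
  shows "la x n (P * Q) m = la x n P (la x n Q m)"
proof (induction P rule: poly_mapping_single_induct)
  case zero
  show ?case by (simp add: la_zero)
next
  case (single i k)
  note lin = la_linmap[OF ip, of "single i k"]
  show ?case
  proof (induction Q rule: poly_mapping_single_induct)
    case zero
    show ?case using linmap_zero[OF lin vspace_axioms] by (simp add: la_zero)
  next
    case (single j l)
    note t = tr_stalk[OF isotropy_period_gpd[OF ip] m]
    have "la x n (single i k) (la x n (single j l) m) =
        k \<odot>\<^bsub>M\<^esub> tr x (i * int n) x (l \<odot>\<^bsub>M\<^esub> tr x (j * int n) x m)"
      unfolding la_single[OF ip m] by (rule la_single[OF ip stalk_smult[OF t]])
    also have "\<dots> = k \<odot>\<^bsub>M\<^esub> (l \<odot>\<^bsub>M\<^esub> tr x (i * int n) x (tr x (j * int n) x m))"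
      unfolding linmapD(3)[OF tr_linmap[OF isotropy_period_gpd[OF ip]] stalk_carrier[OF t]] ..
    also have "\<dots> = k \<odot>\<^bsub>M\<^esub> (l \<odot>\<^bsub>M\<^esub> tr x ((i + j) * int n) x m)"
      unfolding tr_comp[OF isotropy_period_gpd[OF ip] isotropy_period_gpd[OF ip] m] by (simp only: distrib_right)
    also have "\<dots> = (k * l) \<odot>\<^bsub>M\<^esub> tr x ((i + j) * int n) x m"
      by (rule vsmult_mult[OF stalk_carrier[OF t], symmetric])
    also have "\<dots> = la x n (single i k * single j l) m"
      unfolding mult_single by (rule la_single[OF ip m, symmetric])
    finally show ?case by (rule sym)
  next
    case (add a b)
    show ?case unfolding distrib_left la_add[OF ip m] add
      by (rule linmapD(2)[OF lin stalk_carrier[OF la_stalk[OF ip m]] stalk_carrier[OF la_stalk[OF ip m]], symmetric])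
  qed
next
  case (add a b)
  show ?case unfolding distrib_right la_add[OF ip m] add
    by (rule la_add[OF ip la_stalk[OF ip m], symmetric])
qed

text \<open>Conjugation by an arrow identifies the infinite cyclic isotropy groups and preserves degrees, so the
  polynomial annihilators do not depend on the point of the orbit.\<close>

lemma la_transport:
  assumes g: "(y, k, x) \<in> gpd E" and ip: "isotropy_period E x n" "isotropy_period E y n" and m: "m \<in> stalk x"
  shows "la y n Q (tr y k x m) = tr y k x (la x n Q m)"
proof -
  have c: "tr x (l * int n) x m \<in> carrier M" for l
    by (rule tr_closed[OF isotropy_period_gpd[OF ip(1)] stalk_carrier[OF m]])
  have "tr y k x (la x n Q m) = lcomb M (\<lambda>l. tr y k x (tr x (l * int n) x m)) Q"
    unfolding la_def by (rule linmap_lcomb[OF tr_linmap[OF g] vspace_axioms c])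
  also have "\<dots> = lcomb M (\<lambda>l. tr y (l * int n) y (tr y k x m)) Q"
  proof (rule lcomb_cong)
    fix l
    show "tr y k x (tr x (l * int n) x m) = tr y (l * int n) y (tr y k x m)"
      using tr_comp[OF g isotropy_period_gpd[OF ip(1), of l] m] tr_comp[OF isotropy_period_gpd[OF ip(2), of l] g m]
      by (simp add: add.commute)
    show "tr y (l * int n) y (tr y k x m) \<in> carrier M"
      by (rule tr_closed[OF isotropy_period_gpd[OF ip(2)] tr_closed[OF g stalk_carrier[OF m]]])
  qed
  finally show ?thesis by (simp add: la_def)
qed

lemma finsum_la:
  assumes "isotropy_period E x n" "m \<in> stalk x" "finite I" "\<And>i. i \<in> I ==> int n dvd j i"
  shows "(\<Oplus>\<^bsub>M\<^esub>i\<in>I. \<kappa> i \<odot>\<^bsub>M\<^esub> tr x (j i) x m) =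
    la x n (\<Sum>i\<in>I. single (j i div int n) (\<kappa> i)) m"
  using assms(3,4)
proof (induction I rule: finite_induct)
  case (insert i I)
  have c: "\<kappa> i \<odot>\<^bsub>M\<^esub> tr x (j i) x m \<in> carrier M" if "i \<in> insert i' I" "\<And>i. i \<in> insert i' I ==> int n dvd j i" for i i'
    using that assms(1) tr_closed[of x "j i" x m] stalk_carrier[OF assms(2)] by (auto simp: isotropy_period_def)
  have "(\<Oplus>\<^bsub>M\<^esub>i\<in>insert i I. \<kappa> i \<odot>\<^bsub>M\<^esub> tr x (j i) x m) =
      \<kappa> i \<odot>\<^bsub>M\<^esub> tr x (j i) x m \<oplus>\<^bsub>M\<^esub> (\<Oplus>\<^bsub>M\<^esub>i\<in>I. \<kappa> i \<odot>\<^bsub>M\<^esub> tr x (j i) x m)"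
    using insert c[of _ i] by (intro M.finsum_insert) (auto simp: Pi_def)
  also have "\<kappa> i \<odot>\<^bsub>M\<^esub> tr x (j i) x m = la x n (single (j i div int n) (\<kappa> i)) m"
    using la_single[OF assms(1,2), of "j i div int n" "\<kappa> i"] insert.prems[of i] by simp
  finally show ?case using insert by (simp add: la_add[OF assms(1,2)])
qed (simp add: la_zero)

end

lemma (in lpa_hom) hom_la:
  assumes "isotropy_period E x n" "m \<in> M.stalk x"
  shows "f (M.la x n Q m) = N.la x n Q (f m)"
proof -
  note g = M.isotropy_period_gpd[OF assms(1)]
  have mc: "m \<in> carrier M" using assms(2) by simp
  have "f (M.la x n Q m) = lcomb N (\<lambda>l. f (M.tr x (l * int n) x m)) Q"
    unfolding M.la_def by (rule M.linmap_lcomb[OF lin N.vspace_axioms M.tr_closed[OF g mc]])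
  thus ?thesis unfolding N.la_def hom_tr[OF g mc] .
qed

text \<open>For a point whose isotropy group is generated by one arrow, the comparison of simple modules
  reduces to the annihilators in the Laurent polynomial ring.\<close>

lemma simple_modules_iso_periodic:
  fixes V :: "('k :: field, ('v, 'e, 'k) lpa_elt, 'm) lmodule"
    and M :: "('k, ('v, 'e, 'k) lpa_elt, 'n) lmodule"
  assumes E: "wf_digraph E" and sV: "simple_module (lpa E) V" and sM: "simple_module (lpa E) M"
    and ip: "isotropy_period E x n"
    and v: "v \<in> lpa_module.stalk E V x" "v \<noteq> \<zero>\<^bsub>V\<^esub>" and m: "m \<in> lpa_module.stalk E M x" "m \<noteq> \<zero>\<^bsub>M\<^esub>"
    and ann: "\<And>Q. lpa_module.la E V x n Q v = \<zero>\<^bsub>V\<^esub> ==> lpa_module.la E M x n Q m = \<zero>\<^bsub>M\<^esub>"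
  shows "module_iso (lpa E) V M"
proof -
  interpret V: lpa_module E V by (rule lpa_moduleI[OF E simple_alg_module[OF sV]])
  interpret M: lpa_module E M by (rule lpa_moduleI[OF E simple_alg_module[OF sM]])
  show ?thesis
  proof (rule simple_modules_iso[OF E sV sM V.isotropy_period_boundary[OF ip] v m])
    fix I :: "('v, 'e) gen fword set" and \<kappa> :: "_ => 'k" and j
    assume I: "finite I" "\<And>i. i \<in> I ==> (x, j i, x) \<in> gpd E"
      and z: "(\<Oplus>\<^bsub>V\<^esub>i\<in>I. \<kappa> i \<odot>\<^bsub>V\<^esub> V.tr x (j i) x v) = \<zero>\<^bsub>V\<^esub>"
    have d: "int n dvd j i" if "i \<in> I" for i using I(2)[OF that] ip by (simp add: isotropy_period_def)
    have "V.la x n (\<Sum>i\<in>I. single (j i div int n) (\<kappa> i)) v = \<zero>\<^bsub>V\<^esub>"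
      using V.finsum_la[OF ip v(1) I(1), of j \<kappa>, OF d] z by (rule trans[OF sym])
    hence "M.la x n (\<Sum>i\<in>I. single (j i div int n) (\<kappa> i)) m = \<zero>\<^bsub>M\<^esub>" by (rule ann)
    with M.finsum_la[OF ip m(1) I(1), of j \<kappa>, OF d]
    show "(\<Oplus>\<^bsub>M\<^esub>i\<in>I. \<kappa> i \<odot>\<^bsub>M\<^esub> M.tr x (j i) x m) = \<zero>\<^bsub>M\<^esub>" by (rule trans)
  qed
qed

section \<open>Transport between point vectors\<close>

context chen_module
begin

lemma \<delta>_add: "r \<in> carrier R ==> s \<in> carrier R ==> \<delta> p (r \<oplus>\<^bsub>R\<^esub> s) = \<delta> p r \<oplus>\<^bsub>V\<^esub> \<delta> p s"
  by (auto simp: \<delta>_def fun_eq_iff)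

lemma \<delta>_smult: "r \<in> carrier R ==> \<delta> p (h k \<otimes>\<^bsub>R\<^esub> r) = k \<odot>\<^bsub>V\<^esub> \<delta> p r"
  by (auto simp: \<delta>_def fun_eq_iff)

lemma edge_\<delta>:
  assumes e: "e \<in> arcs E" "p \<in> S" "head E e = bsource E p" and r: "r \<in> carrier R"
  shows "C.G (Ed e) (\<delta> p r) = \<delta> (econs E e p) (b e p \<otimes>\<^bsub>R\<^esub> r)"
proof
  fix q
  have d: "\<delta> p r \<in> carrier V" using e r by simp
  have g: "C.G (Ed e) (\<delta> p r) q = op (Ed e) (\<delta> p r) q" using C_G[of "Ed e" "\<delta> p r"] e(1) d by simp
  show "C.G (Ed e) (\<delta> p r) q = \<delta> (econs E e p) (b e p \<otimes>\<^bsub>R\<^esub> r) q"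
  proof (cases rule: econs_cases[of e q])
    case (edge p')
    note bp = b_units[OF e(1) edge(1,2)]
    have "econs E e p' = econs E e p \<longleftrightarrow> p' = p" using econs_inj[of e p' e p] e(3) edge(2) by metis
    thus ?thesis unfolding g unfolding edge(3) op_edge[OF d e(1) edge(1,2)] using bp r by (simp add: \<delta>_def)
  next
    case other
    have "q \<noteq> econs E e p" by (rule other[OF e(2,3)])
    moreover have "op (Ed e) (\<delta> p r) q = \<zero>\<^bsub>R\<^esub>" by (rule op_edge_other[OF other])
    ultimately show ?thesis unfolding g by (simp only: \<delta>_def[of "econs E e p"] if_False)
  qed
qed

primrec path_weight :: "'e list => ('v, 'e) bpath => 'r" where
  "path_weight [] z = \<one>\<^bsub>R\<^esub>"
| "path_weight (e # es) z = b e (prepend (head E e, es) z) \<otimes>\<^bsub>R\<^esub> path_weight es z"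

lemma vertex_\<delta>:
  assumes "p \<in> S" "r \<in> carrier R"
  shows "C.G (Vx (bsource E p)) (\<delta> p r) = \<delta> p r"
proof -
  have d: "\<delta> p r \<in> carrier V" using assms by simp
  have "C.G (Vx (bsource E p)) (\<delta> p r) = op (Vx (bsource E p)) (\<delta> p r)"
    using C_G[of "Vx (bsource E p)" "\<delta> p r"] bsource_verts[OF S_boundary[OF assms(1)]] d by simp
  also have "\<dots> = \<delta> p r"
  proof
    fix q show "op (Vx (bsource E p)) (\<delta> p r) q = \<delta> p r q"
      unfolding op_vertex[OF d] by (simp add: \<delta>_def)
  qed
  finally show ?thesis .
qed

lemma path_\<delta>:
  assumes "composable E (u, es) z" "z \<in> S" "r \<in> carrier R"
  shows "prepend (u, es) z \<in> S \<and> path_weight es z \<in> carrier R \<and>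
    C.pa u es (\<delta> z r) = \<delta> (prepend (u, es) z) (path_weight es z \<otimes>\<^bsub>R\<^esub> r)"
  using assms(1)
proof (induction es arbitrary: u)
  case Nil
  thus ?case using assms vertex_\<delta>[OF assms(2,3)] by (simp add: prepend_Nil)
next
  case (Cons e es)
  hence e: "e \<in> arcs E" "u = tail E e" "composable E (head E e, es) z" by simp_all
  let ?y = "prepend (head E e, es) z"
  note IH = Cons.IH[OF e(3)]
  have y: "?y \<in> S" "?y \<in> boundary E" "head E e = bsource E ?y" using IH composable_prepend[OF e(3)] by simp_all
  note b = b_units[OF e(1) y(1,3)]
  have eq: "prepend (u, e # es) z = econs E e ?y" unfolding e(2) by (rule prepend_Cons)
  have "C.pa u (e # es) (\<delta> z r) = C.G (Ed e) (\<delta> ?y (path_weight es z \<otimes>\<^bsub>R\<^esub> r))" using IH by simp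
  also have "\<dots> = \<delta> (econs E e ?y) (b e ?y \<otimes>\<^bsub>R\<^esub> (path_weight es z \<otimes>\<^bsub>R\<^esub> r))"
    using IH assms(3) by (intro edge_\<delta>[OF e(1) y(1,3)]) simp
  also have "b e ?y \<otimes>\<^bsub>R\<^esub> (path_weight es z \<otimes>\<^bsub>R\<^esub> r) = path_weight (e # es) z \<otimes>\<^bsub>R\<^esub> r"
    using IH assms(3) b(1) R.m_assoc[of "b e ?y" "path_weight es z" r] by simp
  finally have "C.pa u (e # es) (\<delta> z r) = \<delta> (prepend (u, e # es) z) (path_weight (e # es) z \<otimes>\<^bsub>R\<^esub> r)"
    unfolding eq .
  moreover have "prepend (u, e # es) z \<in> S" unfolding eq using S_econs[OF e(1) y(2,3)] y(1) by simp
  moreover have "path_weight (e # es) z \<in> carrier R" using IH b(1) by simp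
  ultimately show ?case by blast
qed

lemma tr_path_\<delta>:
  assumes "composable E \<mu> z" "z \<in> S" "r \<in> carrier R"
  shows "C.tr (prepend \<mu> z) (plength \<mu>) z (\<delta> z r) = \<delta> (prepend \<mu> z) (path_weight (snd \<mu>) z \<otimes>\<^bsub>R\<^esub> r)"
proof -
  obtain u es where \<mu>: "\<mu> = (u, es)" by (cases \<mu>)
  have zb: "z \<in> boundary E" by (rule S_boundary[OF assms(2)])
  have "C.tr (prepend \<mu> z) (plength \<mu>) z (\<delta> z r) = C.pa (fst \<mu>) (snd \<mu>) (C.gh (bsource E z) [] (\<delta> z r))"
    using C.tr_eq[OF assms(1), of "(bsource E z, [])" "plength \<mu>" "prepend \<mu> z" z "\<delta> z r"] zb assms
    by (simp add: plength_def prepend_Nil)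
  also have "C.gh (bsource E z) [] (\<delta> z r) = \<delta> z r" using vertex_\<delta>[OF assms(2,3)] by simp
  finally show ?thesis using path_\<delta>[of u es z r] assms \<mu> by simp
qed

lemma tr_\<delta>:
  assumes "composable E \<mu> z" "composable E \<nu> z" "z \<in> S" "r \<in> carrier R"
  shows "C.tr (prepend \<mu> z) (plength \<mu> - plength \<nu>) (prepend \<nu> z)
      (\<delta> (prepend \<nu> z) (path_weight (snd \<nu>) z \<otimes>\<^bsub>R\<^esub> r)) = \<delta> (prepend \<mu> z) (path_weight (snd \<mu>) z \<otimes>\<^bsub>R\<^esub> r)"
proof -
  have zb: "composable E (bsource E z, []) z" using S_boundary[OF assms(3)] by simp
  have g1: "(prepend \<nu> z, plength \<nu>, z) \<in> gpd E"
    using gpdI[OF assms(2) zb, of "plength \<nu>"] by (simp add: plength_def prepend_Nil)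
  have g2: "(prepend \<mu> z, plength \<mu> - plength \<nu>, prepend \<nu> z) \<in> gpd E" by (rule gpdI[OF assms(1,2) refl])
  have "plength \<mu> - plength \<nu> + plength \<nu> = plength \<mu>" by simp
  thus ?thesis using C.tr_comp[OF g2 g1 \<delta>_stalk[OF assms(3,4)]]
    unfolding tr_path_\<delta>[OF assms(2,3,4)] by (simp add: tr_path_\<delta>[OF assms(1,3,4)])
qed

text \<open>For \<open>z = c\<^sup>\<infinity>\<close> and \<open>es = c\<close> the right-hand side is the loop weight.\<close>

lemma path_weight_InfP:
  assumes "composable E (u, es) (InfP s)" "InfP s \<in> S"
  shows "path_weight es (InfP s) = (\<Otimes>\<^bsub>R\<^esub>i\<in>{..<length es}. b (es ! i) (InfP (drop (Suc i) es @- s))) \<and>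
    (\<forall>i<length es. b (es ! i) (InfP (drop (Suc i) es @- s)) \<in> carrier R)"
  using assms(1)
proof (induction es arbitrary: u)
  case (Cons e es)
  hence e: "e \<in> arcs E" "u = tail E e" "composable E (head E e, es) (InfP s)" by simp_all
  let ?y = "prepend (head E e, es) (InfP s)"
  note IH = Cons.IH[OF e(3)]
  have y: "?y \<in> S" "head E e = bsource E ?y"
    using path_\<delta>[OF e(3) assms(2) R.one_closed] composable_prepend[OF e(3)] by (blast, simp)
  note b = b_units(1)[OF e(1) y]
  let ?g = "\<lambda>i. b ((e # es) ! i) (InfP (drop (Suc i) (e # es) @- s))"
  have g: "?g i \<in> carrier R" if "i < Suc (length es)" for i
    using that IH b by (cases i) simp_all
  have "(\<Otimes>\<^bsub>R\<^esub>i\<in>{..<length (e # es)}. ?g i) = (\<Otimes>\<^bsub>R\<^esub>i\<in>insert 0 (Suc ` {..<length es}). ?g i)"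
    by (simp only: list.size(4) One_nat_def add_Suc_right add_0_right lessThan_Suc_eq_insert_0)
  also have "\<dots> = ?g 0 \<otimes>\<^bsub>R\<^esub> (\<Otimes>\<^bsub>R\<^esub>i\<in>Suc ` {..<length es}. ?g i)"
    by (rule R.finprod_insert) (use g g[of 0] in auto)
  also have "(\<Otimes>\<^bsub>R\<^esub>i\<in>Suc ` {..<length es}. ?g i) = (\<Otimes>\<^bsub>R\<^esub>i\<in>{..<length es}. ?g (Suc i))"
    by (rule R.finprod_reindex) (use g in auto)
  finally show ?case using IH g by simp
qed simp

end

section \<open>Chen modules without twist\<close>

locale plain_chen = path_graph E for E :: "('v, 'e) pre_digraph" +
  fixes x :: "('v, 'e) bpath" and type_of_field :: "'k :: field itself"
  assumes x: "x \<in> boundary E"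
begin

sublocale W: chen_module E "ring_of_type_algebra :: 'k ring" id x "edge_weights (\<lambda>e. 1)"
proof -
  interpret K: field "ring_of_type_algebra :: 'k ring" by (rule field_from_type_algebra)
  have "(1 :: 'k) \<in> Units ring_of_type_algebra" using K.Units_one_closed by simp
  thus "chen_module E (ring_of_type_algebra :: 'k ring) id x (edge_weights (\<lambda>e. 1))"
    by unfold_locales (auto simp: x edge_weights_def ring_hom_def)
qed

lemma V_eq: "W.V = chen E x"
  by (simp add: chen_def)

lemma weight_one: "W.path_weight es z = 1"
proof (induction es)
  case (Cons e es)
  show ?case unfolding W.path_weight.simps Cons by (simp add: edge_weights_def)
qed (unfold W.path_weight.simps, simp)

lemma tr_plain:
  assumes "(q, k, p) \<in> gpd E" "p \<in> tail_class E x"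
  shows "W.C.tr q k p (W.\<delta> p r) = W.\<delta> q r"
proof -
  from assms(1) obtain \<mu> \<nu> z where *: "composable E \<mu> z" "composable E \<nu> z"
    "k = plength \<mu> - plength \<nu>" "q = prepend \<mu> z" "p = prepend \<nu> z" by (rule gpdE)
  have "composable E (bsource E z, []) z" using *(1) composable_boundary by simp
  from gpdI[OF *(2) this, of "plength \<nu>"] have "(p, plength \<nu>, z) \<in> gpd E"
    by (simp add: plength_def prepend_Nil *(5))
  hence "z \<in> tail_class E x"
    using assms(2) gpd_comp[of x _ p "plength \<nu>" z] unfolding tail_class_eq by blast
  from W.tr_\<delta>[OF *(1,2) this, of r] show ?thesis by (simp add: * weight_one)
qed

lemma simple: "simple_module (lpa E) (chen E x :: ('k, _, _) lmodule)"
  unfolding V_eq[symmetric]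
proof (rule W.simple_V)
  fix N r s assume N: "alg_submodule (lpa E) W.V N" and r: "r \<noteq> \<zero>\<^bsub>ring_of_type_algebra\<^esub>" "W.\<delta> x r \<in> N"
  have sub: "submodule N (ring_of_type_algebra :: 'k ring) W.V" using N by (simp add: alg_submodule_def)
  have "W.\<delta> x s = (s / r) \<odot>\<^bsub>W.V\<^esub> W.\<delta> x r" using W.\<delta>_smult[of r x "s / r"] r(1) by simp
  thus "W.\<delta> x s \<in> N" using W.V.subspaceD(4)[OF sub r(2), of "s / r"] by simp
qed

lemma spectral: "spectral E (chen E x :: ('k, _, _) lmodule)"
  unfolding V_eq[symmetric] by (rule W.spectral_V)

text \<open>A simple module with a vector at \<open>x\<close> that is fixed by the isotropy group is the Chen module.\<close>

lemma iso_of_fixed_vector: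
  fixes M :: "('k, ('v, 'e, 'k) lpa_elt, 'm) lmodule"
  assumes sM: "simple_module (lpa E) M" and m: "m \<in> lpa_module.stalk E M x" "m \<noteq> \<zero>\<^bsub>M\<^esub>"
    and fixed: "\<And>k. (x, k, x) \<in> gpd E ==> lpa_module.tr E M x k x m = m"
  shows "module_iso (lpa E) (chen E x) M"
proof -
  interpret M: lpa_module E M by (rule lpa_moduleI[OF wf_digraph simple_alg_module[OF sM]])
  have mc: "m \<in> carrier M" by (rule M.stalk_carrier[OF m(1)])
  let ?v = "W.\<delta> x 1"
  have v: "?v \<in> W.C.stalk x" "?v \<noteq> \<zero>\<^bsub>W.V\<^esub>" using W.\<delta>_stalk[OF W.x_in_S] W.\<delta>_eq_zero[of x 1] by simp_all
  have vc: "?v \<in> carrier W.V" by (rule W.C.stalk_carrier[OF v(1)])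
  show ?thesis unfolding V_eq[symmetric]
  proof (rule simple_modules_iso[OF wf_digraph _ sM x v m])
    show "simple_module (lpa E) W.V" unfolding V_eq by (rule simple)
    fix I :: "('v, 'e) gen fword set" and \<kappa> :: "_ => 'k" and j
    assume I: "finite I" "\<And>i. i \<in> I ==> (x, j i, x) \<in> gpd E"
      and z: "(\<Oplus>\<^bsub>W.V\<^esub>i\<in>I. \<kappa> i \<odot>\<^bsub>W.V\<^esub> W.C.tr x (j i) x ?v) = \<zero>\<^bsub>W.V\<^esub>"
    have "(\<Oplus>\<^bsub>W.V\<^esub>i\<in>I. \<kappa> i \<odot>\<^bsub>W.V\<^esub> W.C.tr x (j i) x ?v) = (\<Oplus>\<^bsub>W.V\<^esub>i\<in>I. \<kappa> i \<odot>\<^bsub>W.V\<^esub> ?v)"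
    proof (rule W.V.M.finsum_cong'[OF refl])
      show "(\<lambda>i. \<kappa> i \<odot>\<^bsub>W.V\<^esub> ?v) \<in> I \<rightarrow> carrier W.V" by (rule Pi_I) (rule W.V.vsmult_closed[OF vc])
      show "\<kappa> i \<odot>\<^bsub>W.V\<^esub> W.C.tr x (j i) x ?v = \<kappa> i \<odot>\<^bsub>W.V\<^esub> ?v" if "i \<in> I" for i
        unfolding tr_plain[OF I(2)[OF that] W.x_in_S] ..
    qed
    hence "(\<Sum>i\<in>I. \<kappa> i) \<odot>\<^bsub>W.V\<^esub> ?v = \<zero>\<^bsub>W.V\<^esub>" using z W.V.vsmult_sum[OF I(1) vc, of \<kappa>] by metis
    hence 0: "(\<Sum>i\<in>I. \<kappa> i) = 0" using W.V.vsmult_eq_zero[OF vc] v(2) by blast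
    have "(\<Oplus>\<^bsub>M\<^esub>i\<in>I. \<kappa> i \<odot>\<^bsub>M\<^esub> M.tr x (j i) x m) = (\<Oplus>\<^bsub>M\<^esub>i\<in>I. \<kappa> i \<odot>\<^bsub>M\<^esub> m)"
    proof (rule M.M.finsum_cong'[OF refl])
      show "(\<lambda>i. \<kappa> i \<odot>\<^bsub>M\<^esub> m) \<in> I \<rightarrow> carrier M" by (rule Pi_I) (rule M.vsmult_closed[OF mc])
      show "\<kappa> i \<odot>\<^bsub>M\<^esub> M.tr x (j i) x m = \<kappa> i \<odot>\<^bsub>M\<^esub> m" if "i \<in> I" for i
        unfolding fixed[OF I(2)[OF that]] ..
    qed
    thus "(\<Oplus>\<^bsub>M\<^esub>i\<in>I. \<kappa> i \<odot>\<^bsub>M\<^esub> M.tr x (j i) x m) = \<zero>\<^bsub>M\<^esub>"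
      using M.vsmult_sum[OF I(1) mc, of \<kappa>] 0 mc by simp
  qed
qed

end

section \<open>The modules of irreducible polynomials\<close>

text \<open>All the weights along one period are \<open>1\<close> except at the edge that completes \<open>c\<^sup>\<infinity>\<close>, which carries \<open>t\<close>;
  since \<open>c\<close> is primitive this edge is met exactly once per period.\<close>

lemma (in path_graph) twists_exist:
  assumes "ext_ring f" "simple_closed E c"
  shows "twists E f c \<noteq> {}"
proof -
  interpret ext_ring f by fact
  let ?s = "Stream.cycle c"
  let ?b = "\<lambda>e p. if econs E e p = cinf c then ext_t f else \<one>\<^bsub>K'\<^esub>"
  have c: "c \<noteq> []" using closed_w_cycle(1)[of c] assms(2) by (simp add: simple_closed_def)
  have eq: "econs E (c ! i) (InfP (drop (Suc i) c @- ?s)) = cinf c \<longleftrightarrow> i = 0" if i: "i < length c" for i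
  proof -
    have "c ! i ## (drop (Suc i) c @- ?s) = drop i c @- ?s" using i by (simp flip: Cons_nth_drop_Suc)
    also have "\<dots> = sdrop i (c @- ?s)" using i by (simp add: sdrop_shift)
    also have "c @- ?s = ?s" using cycle_decomp[OF c] by simp
    finally have "econs E (c ! i) (InfP (drop (Suc i) c @- ?s)) = cinf c \<longleftrightarrow> sdrop i ?s = ?s"
      by (simp add: cinf_def)
    also have "\<dots> \<longleftrightarrow> length c dvd i" by (rule simple_closed_period[OF assms(2)])
    also have "\<dots> \<longleftrightarrow> i = 0" using i by (auto dest: dvd_imp_le)
    finally show ?thesis .
  qed
  have t: "ext_t f \<in> carrier K'" by (simp add: ext_t_def)
  have "loop_weight K' c ?b = (\<Otimes>\<^bsub>K'\<^esub>i\<in>{..<length c}. if 0 = i then ext_t f else \<one>\<^bsub>K'\<^esub>)"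
    unfolding loop_weight_def by (rule K'.finprod_cong') (use eq t in auto)
  also have "\<dots> = ext_t f" using K'.finprod_singleton[of 0 "{..<length c}" "\<lambda>_. ext_t f"] c t by simp
  finally have "?b \<in> twists E f c" using t_unit(1) by (simp add: twists_def)
  thus ?thesis by blast
qed

locale poly_chen = path_graph E + ext_ring f for E :: "('v, 'e) pre_digraph" and f :: "'k :: field poly" +
  fixes c b
  assumes c: "simple_closed E c" and b: "b \<in> twists E f c"
begin

abbreviation x :: "('v, 'e) bpath" where "x \<equiv> cinf c"
abbreviation n :: nat where "n \<equiv> length c"

sublocale W: chen_module E K' "ext_embed f" x b
proof
  show "x \<in> boundary E" by (rule cinf_boundary[OF c])
  show "ext_embed f \<in> ring_hom ring_of_type_algebra K'" by (rule embed_hom)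
  show "b e p \<in> Units K'" if "e \<in> arcs E" "p \<in> tail_class E x" "head E e = bsource E p" for e p
    using b that unfolding twists_def by blast
qed

lemma V_eq: "W.V = chen_poly E f c b"
  by (simp add: chen_poly_def)

lemma ip: "isotropy_period E x n"
  by (rule isotropy_period_cinf[OF c])

text \<open>The loop multiplies by the product of the weights along \<open>c\<close>, which is the class of \<open>t\<close>.\<close>

lemma tr_loop:
  assumes "r \<in> carrier K'"
  shows "W.C.tr x (int n) x (W.\<delta> x r) = W.\<delta> x (cl (tpow 1) \<otimes>\<^bsub>K'\<^esub> r)"
proof -
  have cw: "closed_w c" using c by (simp add: simple_closed_def)
  note cc = closed_w_cycle[OF cw]
  have comp: "composable E (bsource E x, c) x" using cc(3,4) cinf_boundary[OF c] by (simp add: composable_def)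
  have xx: "prepend (bsource E x, c) x = x" using cycle_decomp[OF cc(1)] by (simp add: cinf_def)
  have "W.path_weight c x = loop_weight K' c b"
    using W.path_weight_InfP[of _ c "Stream.cycle c"] comp W.x_in_S unfolding loop_weight_def cinf_def by blast
  hence "W.path_weight c x = cl (tpow 1)" using b by (simp add: twists_def ext_t_def)
  thus ?thesis using W.tr_path_\<delta>[OF comp W.x_in_S assms] xx by (simp add: plength_def)
qed

lemma tr_loop_power:
  "r \<in> carrier K' ==> W.C.tr x (l * int n) x (W.\<delta> x r) = W.\<delta> x (cl (tpow l) \<otimes>\<^bsub>K'\<^esub> r)"
proof -
  note g = isotropy_period_gpd[OF ip]
  have st: "W.\<delta> x r \<in> W.C.stalk x" if "r \<in> carrier K'" for r by (rule W.\<delta>_stalk[OF W.x_in_S that])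
  have pos: "W.C.tr x (int k * int n) x (W.\<delta> x r) = W.\<delta> x (cl (tpow (int k)) \<otimes>\<^bsub>K'\<^esub> r)" if "r \<in> carrier K'" for k r
    using that
  proof (induction k arbitrary: r)
    case 0
    thus ?case using W.C.tr_id[OF W.x st[OF 0]] by (simp add: ext_class_one)
  next
    case (Suc k)
    have "W.C.tr x (int (Suc k) * int n) x (W.\<delta> x r) = W.C.tr x (int k * int n) x (W.C.tr x (int n) x (W.\<delta> x r))"
      using W.C.tr_comp[OF g[of "int k"] _ st[OF Suc.prems], of "int n"] g[of 1] by (simp add: algebra_simps)
    also have "\<dots> = W.\<delta> x (cl (tpow (int k)) \<otimes>\<^bsub>K'\<^esub> (cl (tpow 1) \<otimes>\<^bsub>K'\<^esub> r))"
      unfolding tr_loop[OF Suc.prems] using Suc.prems by (intro Suc.IH) simp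
    also have "cl (tpow (int k)) \<otimes>\<^bsub>K'\<^esub> (cl (tpow 1) \<otimes>\<^bsub>K'\<^esub> r) = (cl (tpow (int k)) \<otimes>\<^bsub>K'\<^esub> cl (tpow 1)) \<otimes>\<^bsub>K'\<^esub> r"
      using Suc.prems by (simp add: K'.m_assoc)
    also have "cl (tpow (int k)) \<otimes>\<^bsub>K'\<^esub> cl (tpow 1) = cl (tpow (int (Suc k)))"
      by (simp add: mult_single add.commute flip: ext_class_mult)
    finally show ?case .
  qed
  assume r: "r \<in> carrier K'"
  show ?thesis
  proof (cases "l \<ge> 0")
    case True
    then obtain k where "l = int k" by (metis nonneg_int_cases)
    thus ?thesis using pos[OF r] by simp
  next
    case False
    define k where "k = nat (- l)"
    have k: "l = - int k" using False by (simp add: k_def)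
    let ?s = "cl (tpow l) \<otimes>\<^bsub>K'\<^esub> r"
    have s: "?s \<in> carrier K'" using r by simp
    have "cl (tpow (int k)) \<otimes>\<^bsub>K'\<^esub> ?s = (cl (tpow (int k)) \<otimes>\<^bsub>K'\<^esub> cl (tpow l)) \<otimes>\<^bsub>K'\<^esub> r"
      using r by (simp add: K'.m_assoc)
    also have "cl (tpow (int k)) \<otimes>\<^bsub>K'\<^esub> cl (tpow l) = \<one>\<^bsub>K'\<^esub>"
      by (simp add: mult_single k ext_class_one flip: ext_class_mult)
    finally have "W.C.tr x (int k * int n) x (W.\<delta> x ?s) = W.\<delta> x r" using pos[OF s, of k] r by simp
    thus ?thesis using W.C.tr_inverse[OF g[of "int k"] st[OF s]] by (simp add: k)
  qed
qed

lemma la_\<delta>: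
  assumes "r \<in> carrier K'"
  shows "W.C.la x n Q (W.\<delta> x r) = W.\<delta> x (cl Q \<otimes>\<^bsub>K'\<^esub> r)"
proof (induction Q rule: poly_mapping_single_induct)
  case zero
  have "cl 0 = \<zero>\<^bsub>K'\<^esub>" by (simp add: ext_class_eq_zero)
  thus ?case using assms W.\<delta>_eq_zero[of x "\<zero>\<^bsub>K'\<^esub>"] by (simp add: W.C.la_zero)
next
  case (single i k)
  have "W.C.la x n (single i k) (W.\<delta> x r) = k \<odot>\<^bsub>W.V\<^esub> W.\<delta> x (cl (tpow i) \<otimes>\<^bsub>K'\<^esub> r)"
    unfolding W.C.la_single[OF ip W.\<delta>_stalk[OF W.x_in_S assms]] tr_loop_power[OF assms] ..
  also have "\<dots> = W.\<delta> x (ext_embed f k \<otimes>\<^bsub>K'\<^esub> (cl (tpow i) \<otimes>\<^bsub>K'\<^esub> r))"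
    using assms by (intro W.\<delta>_smult[symmetric]) simp
  also have "ext_embed f k \<otimes>\<^bsub>K'\<^esub> (cl (tpow i) \<otimes>\<^bsub>K'\<^esub> r) = cl (single i k) \<otimes>\<^bsub>K'\<^esub> r"
    unfolding cl_single[of i k] using assms by (simp add: K'.m_assoc)
  finally show ?case .
next
  case (add P Q)
  show ?case unfolding W.C.la_add[OF ip W.\<delta>_stalk[OF W.x_in_S assms]] add ext_class_add
    using W.\<delta>_add[of "cl P \<otimes>\<^bsub>K'\<^esub> r" "cl Q \<otimes>\<^bsub>K'\<^esub> r" x] assms by (simp add: K'.l_distr)
qed

lemma la_submodule:
  assumes "alg_submodule (lpa E) W.V N" "m \<in> N"
  shows "W.C.la x n Q m \<in> N"
proof -
  have sub: "submodule N (ring_of_type_algebra :: 'k ring) W.V" using assms(1) by (simp add: alg_submodule_def)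
  show ?thesis unfolding W.C.la_def lcomb_def
    by (rule W.V.subspace_finsum[OF sub finite_keys], rule W.V.subspaceD(4)[OF sub],
        rule W.submodule_tr[OF assms(1) isotropy_period_gpd[OF ip] assms(2)])
qed

lemma simple: "simple_module (lpa E) (chen_poly E f c b)"
  unfolding V_eq[symmetric]
proof (rule W.simple_V)
  fix N r s assume N: "alg_submodule (lpa E) W.V N"
    and r: "r \<in> carrier K'" "r \<noteq> \<zero>\<^bsub>K'\<^esub>" "W.\<delta> x r \<in> N" and s: "s \<in> carrier K'"
  have u: "r \<in> Units K'" using r by (simp add: K'.field_Units)
  have c: "s \<otimes>\<^bsub>K'\<^esub> inv\<^bsub>K'\<^esub> r \<in> carrier K'" using s K'.Units_inv_closed[OF u] by (rule K'.m_closed)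
  then obtain Q where Q: "s \<otimes>\<^bsub>K'\<^esub> inv\<^bsub>K'\<^esub> r = cl Q" unfolding ext_carrier by blast
  have "cl Q \<otimes>\<^bsub>K'\<^esub> r = s"
    unfolding Q[symmetric] using s r(1) K'.Units_inv_closed[OF u] K'.Units_l_inv[OF u] by (simp add: K'.m_assoc)
  hence "W.\<delta> x s = W.C.la x n Q (W.\<delta> x r)" unfolding la_\<delta>[OF r(1)] by simp
  thus "W.\<delta> x s \<in> N" using la_submodule[OF N r(3), of Q] by simp
qed

lemma spectral: "spectral E (chen_poly E f c b)"
  unfolding V_eq[symmetric] by (rule W.spectral_V)

text \<open>A simple module with a vector at \<open>c\<^sup>\<infinity>\<close> that is annihilated by \<open>f\<close> is the module of \<open>f\<close>.\<close>

lemma iso_of_annihilated_vector: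
  fixes M :: "('k, ('v, 'e, 'k) lpa_elt, 'm) lmodule"
  assumes sM: "simple_module (lpa E) M" and m: "m \<in> lpa_module.stalk E M x" "m \<noteq> \<zero>\<^bsub>M\<^esub>"
    and ann: "lpa_module.la E M x n (lp f) m = \<zero>\<^bsub>M\<^esub>"
  shows "module_iso (lpa E) (chen_poly E f c b) M"
proof -
  interpret M: lpa_module E M by (rule lpa_moduleI[OF wf_digraph simple_alg_module[OF sM]])
  let ?v = "W.\<delta> x \<one>\<^bsub>K'\<^esub>"
  have v: "?v \<in> W.C.stalk x" "?v \<noteq> \<zero>\<^bsub>W.V\<^esub>"
    using W.\<delta>_stalk[OF W.x_in_S K'.one_closed] W.\<delta>_eq_zero[of x "\<one>\<^bsub>K'\<^esub>"] by simp_all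
  show ?thesis unfolding V_eq[symmetric]
  proof (rule simple_modules_iso_periodic[OF wf_digraph _ sM ip v m])
    show "simple_module (lpa E) W.V" unfolding V_eq by (rule simple)
    fix Q assume "W.C.la x n Q ?v = \<zero>\<^bsub>W.V\<^esub>"
    hence "W.\<delta> x (cl Q) = \<zero>\<^bsub>W.V\<^esub>" unfolding la_\<delta>[OF K'.one_closed] by simp
    hence "lp f dvd Q" using W.\<delta>_eq_zero[of x "cl Q"] by (simp add: ext_class_eq_zero)
    then obtain Q' where Q: "Q = Q' * lp f" by (auto simp: dvd_def mult.commute)
    show "M.la x n Q m = \<zero>\<^bsub>M\<^esub>"
      unfolding Q M.la_mult[OF ip m(1)] ann by (rule M.linmap_zero[OF M.la_linmap[OF ip] M.vspace_axioms])
  qed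
qed

end

section \<open>Classification of the simple spectral modules\<close>

lemma linear_ext_ring:
  assumes "a \<noteq> 0"
  shows "ext_ring [:a :: 'k :: field, 1:]"
proof
  show "Factorial_Ring.irreducible [:a, 1:]" by (rule irreducible_linear_field_poly) simp
  show "[:a, 1:] \<noteq> Polynomial.smult k [:0, 1:]" for k using assms by simp
qed

lemma (in ext_ring) not_unit: "\<not> f dvd 1" "f \<noteq> 0"
  using irr by (auto simp: Factorial_Ring.irreducible_def)

context lpa_module
begin

text \<open>If \<open>(1 + t) m\<close> is nonzero, it generates the module and hence \<open>m = Q(t) (1 + t) m\<close> for some Laurent
  polynomial \<open>Q\<close>; as \<open>1 + t\<close> is not invertible, this is a nontrivial relation.\<close>

lemma stalk_annihilating_laurent:
  assumes s: "simple_module (lpa E) M" and ip: "isotropy_period E x n" and m: "m \<in> stalk x" "m \<noteq> \<zero>\<^bsub>M\<^esub>"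
  shows "\<exists>Q. Q \<noteq> 0 \<and> la x n Q m = \<zero>\<^bsub>M\<^esub>"
proof -
  interpret l: ext_ring "[:1, 1:] :: 'k poly" by (rule linear_ext_ring) simp
  let ?L = "lp [:1, 1:] :: int \<Rightarrow>\<^sub>0 'k"
  let ?w = "la x n ?L m"
  have x: "x \<in> boundary E" by (rule isotropy_period_boundary[OF ip])
  have mc: "m \<in> carrier M" using m(1) by simp
  have w: "?w \<in> stalk x" by (rule la_stalk[OF ip m(1)])
  have L0: "?L \<noteq> 0" using lp_inj[of "[:1, 1:] :: 'k poly" 0] by simp
  show ?thesis
  proof (cases "?w = \<zero>\<^bsub>M\<^esub>")
    case True
    thus ?thesis using L0 by blast
  next
    case False
    obtain a where a: "a \<in> aug E" "m = A a ?w" by (rule simple_generated[OF s x w False mc])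
    define I where "I = {w \<in> keys a. word_act E (letters w) x \<noteq> None}"
    define q where "q = (\<lambda>w. fst (the (word_act E (letters w) x)))"
    define k where "k = (\<lambda>w. snd (the (word_act E (letters w) x)))"
    define \<kappa> where "\<kappa> = lookup a"
    have fin: "finite I" by (simp add: I_def)
    have g: "(q w, k w, x) \<in> gpd E" if w: "w \<in> I" for w
    proof -
      from w obtain q' k' where "word_act E (letters w) x = Some (q', k')" by (auto simp: I_def)
      thus ?thesis using word_act_gpd[OF x a(1), of w q' k'] w by (simp add: I_def q_def k_def)
    qed
    define u where "u = (\<lambda>w. \<kappa> w \<odot>\<^bsub>M\<^esub> tr (q w) (k w) x ?w)"
    have us: "u w \<in> stalk (q w)" if "w \<in> I" for w
      unfolding u_def by (rule stalk_smult[OF tr_stalk[OF g[OF that] w]])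
    have uc: "u w \<in> carrier M" if "w \<in> I" for w using us[OF that] by simp
    let ?U = "\<lambda>p. \<Oplus>\<^bsub>M\<^esub>w\<in>{w \<in> I. q w = p}. u w"
    have Us: "?U p \<in> stalk p" for p
    proof (rule stalk_finsum)
      show "finite {w \<in> I. q w = p}" using fin by simp
      show "u w \<in> stalk p" if "w \<in> {w \<in> I. q w = p}" for w using that us[of w] by blast
    qed
    have Uc: "?U p \<in> carrier M" for p by (rule stalk_carrier[OF Us])
    let ?P = "insert x (q ` I)"
    have "m = (\<Oplus>\<^bsub>M\<^esub>w\<in>I. u w)"
      using A_stalk[OF x w a(1)] a(2) unfolding I_def u_def \<kappa>_def q_def k_def by simp
    also have "\<dots> = (\<Oplus>\<^bsub>M\<^esub>p\<in>q ` I. ?U p)" by (rule finsum_group[OF fin uc])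
    also have "\<dots> = (\<Oplus>\<^bsub>M\<^esub>p\<in>?P. ?U p)"
    proof (rule M.add.finprod_mono_neutral_cong_left)
      show "?U p = \<zero>\<^bsub>M\<^esub>" if "p \<in> ?P - q ` I" for p
      proof -
        have "{w \<in> I. q w = p} = {}" using that by blast
        thus ?thesis by (simp only: M.finsum_empty)
      qed
    qed (use fin Uc in auto)
    finally have m_eq: "m = (\<Oplus>\<^bsub>M\<^esub>p\<in>?P. ?U p)" .
    let ?d = "\<lambda>p. if x = p then \<ominus>\<^bsub>M\<^esub> m else \<zero>\<^bsub>M\<^esub>"
    have neg: "\<ominus>\<^bsub>M\<^esub> m \<in> stalk x" using stalk_smult[OF m(1), of "-1"] vsmult_minus_one[OF mc] by simp
    have d: "?d p \<in> stalk p" for p by (cases "x = p") (use neg in auto)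
    have "(\<Oplus>\<^bsub>M\<^esub>p\<in>?P. ?d p) = \<ominus>\<^bsub>M\<^esub> m"
      using M.add.finprod_singleton[of x ?P "\<lambda>_. \<ominus>\<^bsub>M\<^esub> m"] fin mc by simp
    moreover have "(\<Oplus>\<^bsub>M\<^esub>p\<in>?P. ?U p \<oplus>\<^bsub>M\<^esub> ?d p) = (\<Oplus>\<^bsub>M\<^esub>p\<in>?P. ?U p) \<oplus>\<^bsub>M\<^esub> (\<Oplus>\<^bsub>M\<^esub>p\<in>?P. ?d p)"
      by (rule M.finsum_addf) (use Uc mc in auto)
    ultimately have "(\<Oplus>\<^bsub>M\<^esub>p\<in>?P. ?U p \<oplus>\<^bsub>M\<^esub> ?d p) = m \<oplus>\<^bsub>M\<^esub> \<ominus>\<^bsub>M\<^esub> m" by (simp only: m_eq[symmetric])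
    hence z: "(\<Oplus>\<^bsub>M\<^esub>p\<in>?P. ?U p \<oplus>\<^bsub>M\<^esub> ?d p) = \<zero>\<^bsub>M\<^esub>" using M.r_neg[OF mc] by simp
    have P: "?P \<subseteq> boundary E"
    proof
      fix p assume "p \<in> ?P"
      thus "p \<in> boundary E" using x gpd_boundary[OF g] by auto
    qed
    have "\<forall>p\<in>?P. ?U p \<oplus>\<^bsub>M\<^esub> ?d p = \<zero>\<^bsub>M\<^esub>"
      by (rule stalks_independent[OF _ P _ z]) (use fin in simp, rule stalk_add[OF Us d])
    hence "?U x \<oplus>\<^bsub>M\<^esub> \<ominus>\<^bsub>M\<^esub> m = \<zero>\<^bsub>M\<^esub>" by simp
    hence Um: "?U x = m" using minus_zero_imp_eq[OF Uc mc] by (simp add: a_minus_def)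
    have J: "finite {w \<in> I. q w = x}" using fin by simp
    have dv: "int n dvd k w" if "w \<in> {w \<in> I. q w = x}" for w
      using g[of w] that ip by (simp add: isotropy_period_def)
    define Q where "Q = (\<Sum>i\<in>{w \<in> I. q w = x}. single (k i div int n) (\<kappa> i))"
    have "?U x = (\<Oplus>\<^bsub>M\<^esub>i\<in>{w \<in> I. q w = x}. \<kappa> i \<odot>\<^bsub>M\<^esub> tr x (k i) x ?w)"
    proof (rule M.finsum_cong'[OF refl])
      show "u i = \<kappa> i \<odot>\<^bsub>M\<^esub> tr x (k i) x ?w" if "i \<in> {w \<in> I. q w = x}" for i using that by (simp add: u_def)
      thus "(\<lambda>i. \<kappa> i \<odot>\<^bsub>M\<^esub> tr x (k i) x ?w) \<in> {w \<in> I. q w = x} \<rightarrow> carrier M" using uc by fastforce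
    qed
    also have "\<dots> = la x n Q ?w" unfolding Q_def by (rule finsum_la[OF ip w J dv])
    finally have "la x n (Q * ?L) m = m" unfolding la_mult[OF ip m(1)] using Um by simp
    hence "la x n (Q * ?L + const_laurent (-1)) m = m \<oplus>\<^bsub>M\<^esub> \<ominus>\<^bsub>M\<^esub> m"
      unfolding la_add[OF ip m(1)] la_const[OF ip m(1)] using vsmult_minus_one[OF mc] by simp
    moreover have "Q * ?L + const_laurent (-1) \<noteq> 0"
    proof
      assume "Q * ?L + const_laurent (-1) = 0"
      hence "Q * ?L = 1" by (simp add: single_uminus add_eq_0_iff flip: single_one)
      hence "?L dvd lp 1" by (metis dvd_triv_right lp_one)
      thus False using l.lp_dvd_iff[of 1] l.not_unit by simp
    qed
    ultimately show ?thesis using M.r_neg[OF mc] by auto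
  qed
qed

text \<open>A polynomial of least degree that annihilates a nonzero vector of the stalk is irreducible.\<close>

lemma stalk_irreducible:
  assumes s: "simple_module (lpa E) M" and ip: "isotropy_period E x n" and m: "m \<in> stalk x" "m \<noteq> \<zero>\<^bsub>M\<^esub>"
  obtains f m' where "ext_ring f" "m' \<in> stalk x" "m' \<noteq> \<zero>\<^bsub>M\<^esub>" "la x n (lp f) m' = \<zero>\<^bsub>M\<^esub>"
proof -
  have la0: "la x n Q \<zero>\<^bsub>M\<^esub> = \<zero>\<^bsub>M\<^esub>" for Q by (rule linmap_zero[OF la_linmap[OF ip] vspace_axioms])
  have la1: "la x n 1 v = v" if "v \<in> stalk x" for v using la_const[OF ip that, of 1] that by simp
  let ?S = "\<lambda>g. g \<noteq> 0 \<and> (\<exists>v\<in>stalk x. v \<noteq> \<zero>\<^bsub>M\<^esub> \<and> la x n (lp g) v = \<zero>\<^bsub>M\<^esub>)"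
  obtain Q where Q: "Q \<noteq> 0" "la x n Q m = \<zero>\<^bsub>M\<^esub>" using stalk_annihilating_laurent[OF assms] by blast
  obtain k P where P: "tpow (int k) * Q = lp P" using laurent_denominator by blast
  have "P \<noteq> 0" using P Q(1) tpow_cancel[of "int k" Q] by auto
  moreover have "la x n (lp P) m = \<zero>\<^bsub>M\<^esub>" unfolding P[symmetric] la_mult[OF ip m(1)] Q(2) by (rule la0)
  ultimately have "?S P" using m by blast
  then obtain f where f: "?S f" and min: "\<And>g. ?S g ==> degree f \<le> degree g"
    using ex_has_least_nat[of ?S P degree] by blast
  from f obtain v where v: "v \<in> stalk x" "v \<noteq> \<zero>\<^bsub>M\<^esub>" "la x n (lp f) v = \<zero>\<^bsub>M\<^esub>" by blast
  have nu: "\<not> f dvd 1"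
  proof
    assume "f dvd 1"
    then obtain g where "1 = g * f" by (auto simp: dvd_def mult.commute)
    hence "la x n 1 v = la x n (lp g) (la x n (lp f) v)"
      unfolding la_mult[OF ip v(1), symmetric] lp_mult[symmetric] by simp
    thus False using la1[OF v(1)] v(2,3) la0 by simp
  qed
  have "Factorial_Ring.irreducible f"
  proof (rule irreducibleI)
    show "f \<noteq> 0" using f by blast
    show "\<not> f dvd 1" by (rule nu)
    fix g h assume gh: "f = g * h"
    show "g dvd 1 \<or> h dvd 1"
    proof (rule ccontr)
      assume "\<not> (g dvd 1 \<or> h dvd 1)"
      moreover have nz: "g \<noteq> 0" "h \<noteq> 0" using f gh by auto
      ultimately have "degree g \<noteq> 0" "degree h \<noteq> 0" using is_unit_iff_degree[of g] is_unit_iff_degree[of h] by auto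
      hence deg: "degree g < degree f" "degree h < degree f" unfolding gh degree_mult_eq[OF nz] by simp_all
      have gh0: "la x n (lp g) (la x n (lp h) v) = \<zero>\<^bsub>M\<^esub>"
        using v(3) unfolding gh lp_mult la_mult[OF ip v(1)] .
      show False
      proof (cases "la x n (lp h) v = \<zero>\<^bsub>M\<^esub>")
        case True
        hence "?S h" using v nz by blast
        thus False using min deg by fastforce
      next
        case False
        hence "?S g" using la_stalk[OF ip v(1), of "lp h"] gh0 nz by blast
        thus False using min deg by fastforce
      qed
    qed
  qed
  moreover have "f \<noteq> Polynomial.smult k [:0, 1:]" for k
  proof
    assume fk: "f = Polynomial.smult k [:0, 1:]"
    hence "k \<noteq> 0" using f by auto
    have "lp f = single 1 k" unfolding fk lp_smult lp_t by (simp add: mult_single)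
    hence "k \<odot>\<^bsub>M\<^esub> tr x (1 * int n) x v = \<zero>\<^bsub>M\<^esub>" using v(3) la_single[OF ip v(1), of 1 k] by simp
    hence "tr x (1 * int n) x v = \<zero>\<^bsub>M\<^esub>"
      using vsmult_eq_zero[OF tr_closed[OF isotropy_period_gpd[OF ip] stalk_carrier[OF v(1)]]] \<open>k \<noteq> 0\<close> by blast
    thus False using tr_eq_zero[OF isotropy_period_gpd[OF ip] v(1)] v(2) by blast
  qed
  ultimately have "ext_ring f" by unfold_locales
  thus thesis using that v by blast
qed

lemma fixed_by_isotropy:
  assumes ip: "isotropy_period E x n" and m: "m \<in> stalk x" and fx: "tr x (int n) x m = m"
    and k: "(x, k, x) \<in> gpd E"
  shows "tr x k x m = m"
proof -
  note g = isotropy_period_gpd[OF ip]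
  have pos: "tr x (int j * int n) x m = m" for j
  proof (induction j)
    case 0
    show ?case using tr_id[OF isotropy_period_boundary[OF ip] m] by simp
  next
    case (Suc j)
    have "tr x (int n) x (tr x (int j * int n) x m) = tr x (int n + int j * int n) x m"
      using tr_comp[OF _ g[of "int j"] m, of x "int n"] g[of 1] by simp
    thus ?case using Suc fx by (simp add: algebra_simps)
  qed
  from k ip obtain l where l: "k = int n * l" by (auto simp: isotropy_period_def)
  show ?thesis
  proof (cases "l \<ge> 0")
    case True
    then obtain j where "l = int j" by (metis nonneg_int_cases)
    thus ?thesis using pos[of j] l by (simp add: mult.commute)
  next
    case False
    define j where "j = nat (- l)"
    have "k = - (int j * int n)" using False l by (simp add: j_def mult.commute)
    thus ?thesis using tr_inverse[OF g[of "int j"] m] pos[of j] by simp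
  qed
qed

lemma fixed_iff_annihilated:
  assumes ip: "isotropy_period E x n" and m: "m \<in> stalk x"
  shows "la x n (lp [:-1, 1:]) m = \<zero>\<^bsub>M\<^esub> \<longleftrightarrow> tr x (int n) x m = m"
proof -
  have mc: "m \<in> carrier M" using m by simp
  have t: "tr x (int n) x m \<in> carrier M" using tr_closed[OF isotropy_period_gpd[OF ip, of 1] mc] by simp
  have "[:-1, 1:] = [:0, 1:] + [:-1 :: 'k:]" by simp
  hence "lp [:-1, 1:] = tpow 1 + const_laurent (-1 :: 'k)" by (simp only: lp_add lp_t lp_const)
  hence "la x n (lp [:-1, 1:]) m = tr x (int n) x m \<ominus>\<^bsub>M\<^esub> m"
    using la_add[OF ip m, of "tpow 1"] la_const[OF ip m, of "-1"] la_single[OF ip m, of 1 1] t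
      vsmult_minus_one[OF mc] by (simp add: a_minus_def)
  thus ?thesis using minus_eq_zero_iff[OF t mc] by simp
qed

end

lemma chen_cong: "tail_class E x = tail_class E y ==> chen E x = chen E y"
  by (simp add: chen_def twisted_chen_def)

context path_graph
begin

lemma plain_chen_at: "x \<in> boundary E ==> plain_chen E x"
  by unfold_locales

lemma poly_chen_at: "(f, c, b) \<in> poly_params E ==> poly_chen E f c b"
  by unfold_locales (auto simp: poly_params_def)

text \<open>The point \<open>x\<close> may be replaced by any other point of its orbit: by its range vertex if it is finite, by
  the representative in \<open>D\<close> if it is infinite and a vector is fixed by the isotropy group, and by a pure
  cycle if a nontrivial polynomial enters.\<close>

lemma simple_with_stalk_listed:
  fixes M :: "('k :: field, ('v, 'e, 'k) lpa_elt, 'm) lmodule"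
  assumes D: "\<forall>x \<in> boundary E. \<exists>!y. y \<in> D \<and> y \<in> orbit E x"
    and sM: "simple_module (lpa E) M" and x: "x \<in> boundary E"
    and m: "m \<in> lpa_module.stalk E M x" "m \<noteq> \<zero>\<^bsub>M\<^esub>" and P: "\<And>y. y \<in> tail_class E x ==> P y"
  shows "listed E D P M"
proof -
  interpret M: lpa_module E M by (rule lpa_moduleI[OF wf_digraph simple_alg_module[OF sM]])
  have plain: "listed E D P M" if y: "y \<in> boundary E" "tail_class E y = tail_class E x"
    and m': "m' \<in> M.stalk y" "m' \<noteq> \<zero>\<^bsub>M\<^esub>" "\<And>k. (y, k, y) \<in> gpd E ==> M.tr y k y m' = m'" for y m'
  proof -
    interpret Y: plain_chen E y "TYPE('k)" by (rule plain_chen_at[OF y(1)])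
    have "module_iso (lpa E) (chen E y) M" by (rule Y.iso_of_fixed_vector[OF sM m'])
    hence iso: "module_iso (lpa E) M (chen E y)" by (rule module_iso_sym[OF simple_alg_module[OF Y.simple]])
    show ?thesis
    proof (cases y)
      case (FinP u p)
      let ?w = "FinP (prange E (u, p)) [] :: ('v, 'e) bpath"
      have g: "(y, int (length p), ?w) \<in> gpd E" using gpd_vertex[of u p] y(1) FinP by simp
      have "?w \<in> tail_class E y" using g unfolding tail_class_eq by blast
      hence "?w \<in> tail_class E x" using y(2) by simp
      hence Pw: "P ?w" by (rule P)
      have "(chen E y :: ('k, _, _) lmodule) = chen E ?w" by (rule chen_cong[OF tail_class_eqI[OF g]])
      hence iso': "module_iso (lpa E) M (chen E ?w)" using iso by (simp only:)
      have "?w \<in> boundary E" using gpd_boundary[OF g] by blast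
      hence "prange E (u, p) \<in> verts E" "\<not> regular E (prange E (u, p))"
        using bsource_verts[of ?w] by (auto simp: boundary_def prange_def)
      thus ?thesis unfolding listed_def using Pw iso' by blast
    next
      case (InfP \<omega>)
      obtain d where d: "d \<in> D" "d \<in> tail_class E y" using D y(1) unfolding orbit_eq_tail_class by blast
      then obtain \<eta> where \<eta>: "d = InfP \<eta>" using tail_class_InfP[of d \<omega>] InfP by blast
      have "tail_class E y = tail_class E d" using d(2) tail_class_eqI unfolding tail_class_eq by blast
      hence "(chen E y :: ('k, _, _) lmodule) = chen E (InfP \<eta>)" unfolding \<eta> by (rule chen_cong)
      hence "module_iso (lpa E) M (chen E (InfP \<eta>))" using iso by (simp only:)
      moreover have "P (InfP \<eta>)" using P[of d] d(2) y(2) \<eta> by simp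
      ultimately show ?thesis unfolding listed_def using d(1) \<eta> by blast
    qed
  qed
  from x show ?thesis
  proof (cases rule: isotropy_cases)
    case trivial
    have "M.tr x k x m = m" if "(x, k, x) \<in> gpd E" for k using trivial[OF that] M.tr_id[OF x m(1)] by simp
    thus ?thesis by (rule plain[OF x refl m])
  next
    case (periodic c)
    let ?x = "cinf c :: ('v, 'e) bpath"
    obtain k where k: "(?x, k, x) \<in> gpd E" using periodic(2) unfolding tail_class_eq by blast
    have tc: "tail_class E ?x = tail_class E x" by (rule tail_class_eqI[OF k])
    have ip: "isotropy_period E ?x (length c)" by (rule isotropy_period_cinf[OF periodic(1)])
    have xb: "?x \<in> boundary E" by (rule cinf_boundary[OF periodic(1)])
    have "M.tr ?x k x m \<in> M.stalk ?x" "M.tr ?x k x m \<noteq> \<zero>\<^bsub>M\<^esub>"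
      using M.tr_stalk[OF k m(1)] M.tr_eq_zero[OF k m(1)] m(2) by auto
    then obtain f m' where f: "ext_ring f" and m': "m' \<in> M.stalk ?x" "m' \<noteq> \<zero>\<^bsub>M\<^esub>"
      "M.la ?x (length c) (lp f) m' = \<zero>\<^bsub>M\<^esub>" by (rule M.stalk_irreducible[OF sM ip])
    interpret F: ext_ring f by (rule f)
    show ?thesis
    proof (cases "\<exists>k. f = Polynomial.smult k [:-1, 1:]")
      case True
      then obtain k where fk: "f = Polynomial.smult k [:-1, 1:]" by blast
      hence k0: "k \<noteq> 0" using F.not_unit(2) by auto
      have ls: "M.la ?x (length c) (lp [:-1, 1:]) m' \<in> M.stalk ?x" by (rule M.la_stalk[OF ip m'(1)])
      have "k \<odot>\<^bsub>M\<^esub> M.la ?x (length c) (lp [:-1, 1:]) m' = \<zero>\<^bsub>M\<^esub>"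
        using m'(3) unfolding fk lp_smult M.la_mult[OF ip m'(1)] M.la_const[OF ip ls] .
      hence "M.la ?x (length c) (lp [:-1, 1:]) m' = \<zero>\<^bsub>M\<^esub>" using M.vsmult_eq_zero[OF M.stalk_carrier[OF ls]] k0 by blast
      hence fx: "M.tr ?x (int (length c)) ?x m' = m'" using M.fixed_iff_annihilated[OF ip m'(1)] by simp
      show ?thesis by (rule plain[OF xb tc m'(1,2) M.fixed_by_isotropy[OF ip m'(1) fx]])
    next
      case False
      obtain b where b: "b \<in> twists E f c" using twists_exist[OF f periodic(1)] by blast
      have pp: "(f, c, b) \<in> poly_params E"
        unfolding poly_params_def using F.irr F.not_t False periodic(1) b by blast
      interpret C: poly_chen E f c b by (rule poly_chen_at[OF pp])
      have "module_iso (lpa E) (chen_poly E f c b) M" by (rule C.iso_of_annihilated_vector[OF sM m'])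
      hence "module_iso (lpa E) M (chen_poly E f c b)" by (rule module_iso_sym[OF simple_alg_module[OF C.simple]])
      moreover have "P ?x" using P[of ?x] tail_class_refl[OF xb] tc by simp
      ultimately show ?thesis unfolding listed_def using pp by blast
    qed
  qed
qed

end

section \<open>Isomorphisms between modules in the list\<close>

context chen_module
begin

text \<open>Modules at \<open>x\<close> have nonzero stalks only at the points of the orbit of \<open>x\<close>, and an isomorphism preserves
  stalks together with the annihilators of their vectors.\<close>

lemma iso_stalk_support:
  fixes M :: "('k, ('v, 'e, 'k) lpa_elt, 'm) lmodule"
  assumes M: "alg_module (lpa E) M" and iso: "module_iso (lpa E) M V"
    and m: "m \<in> lpa_module.stalk E M p" "m \<noteq> \<zero>\<^bsub>M\<^esub>" and p: "p \<in> boundary E"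
  obtains m' where "m' \<in> C.stalk p" "m' \<noteq> \<zero>\<^bsub>V\<^esub>" "p \<in> S"
    "\<And>n Q. isotropy_period E p n ==> lpa_module.la E M p n Q m = \<zero>\<^bsub>M\<^esub> ==> C.la p n Q m' = \<zero>\<^bsub>V\<^esub>"
proof -
  interpret M: lpa_module E M by (rule lpa_moduleI[OF wf_digraph M])
  obtain f where f: "bij_betw f (carrier M) (carrier V)" "linmap M V f"
    "\<forall>a\<in>carrier (lpa E). \<forall>m\<in>carrier M. f (act M a m) = act V a (f m)" by (rule module_isoE[OF iso])
  interpret H: lpa_hom E M V f by unfold_locales (use f in auto)
  have f0: "f \<zero>\<^bsub>M\<^esub> = \<zero>\<^bsub>V\<^esub>" by (rule M.linmap_zero[OF f(2) V.vspace_axioms])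
  have mc: "m \<in> carrier M" using m(1) by simp
  have st: "f m \<in> C.stalk p" by (rule H.hom_stalk[OF m(1)])
  have "f m \<noteq> f \<zero>\<^bsub>M\<^esub>"
  proof
    assume "f m = f \<zero>\<^bsub>M\<^esub>"
    hence "m = \<zero>\<^bsub>M\<^esub>" using inj_onD[OF bij_betw_imp_inj_on[OF f(1)] _ mc M.M.zero_closed] by blast
    thus False using m(2) by blast
  qed
  hence nz: "f m \<noteq> \<zero>\<^bsub>V\<^esub>" unfolding f0 .
  show thesis
  proof (rule that[OF st nz stalk_outside[OF p st nz]])
    fix n Q assume "isotropy_period E p n" "M.la p n Q m = \<zero>\<^bsub>M\<^esub>"
    thus "C.la p n Q (f m) = \<zero>\<^bsub>V\<^esub>" using H.hom_la[of p n m Q] m(1) f0 by simp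
  qed
qed

end

lemma (in plain_chen) \<delta>_one: "W.\<delta> p 1 \<noteq> \<zero>\<^bsub>W.V\<^esub>"
  using W.\<delta>_eq_zero[of p 1] by simp

lemma (in poly_chen) annihilator:
  assumes "m \<in> W.C.stalk x" "m \<noteq> \<zero>\<^bsub>W.V\<^esub>" "W.C.la x n (lp g) m = \<zero>\<^bsub>W.V\<^esub>"
  shows "f dvd g"
proof -
  have m: "m = W.\<delta> x (m x)" "m x \<in> carrier K'" using W.stalk_\<delta>[OF W.x assms(1)] by blast+
  have "m x \<noteq> \<zero>\<^bsub>K'\<^esub>" using assms(2) m(1) W.\<delta>_eq_zero[of x "m x"] by metis
  moreover have "W.\<delta> x (cl (lp g) \<otimes>\<^bsub>K'\<^esub> m x) = \<zero>\<^bsub>W.V\<^esub>" using assms(3) la_\<delta>[OF m(2), of "lp g"] m(1) by metis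
  ultimately have "cl (lp g) = \<zero>\<^bsub>K'\<^esub>"
    using W.\<delta>_eq_zero[of x "cl (lp g) \<otimes>\<^bsub>K'\<^esub> m x"] K'.integral[of "cl (lp g)" "m x"] m(2) by auto
  thus ?thesis by (simp add: ext_class_eq_zero lp_dvd_iff)
qed

context path_graph
begin

lemma isotropy_period_transport:
  assumes "(y, k, x) \<in> gpd E" "isotropy_period E x n"
  shows "isotropy_period E y n"
proof -
  note inv = gpd_inv[OF assms(1)]
  have "(y, l, y) \<in> gpd E \<longleftrightarrow> (x, l, x) \<in> gpd E" for l
  proof
    assume "(y, l, y) \<in> gpd E"
    from gpd_comp[OF inv gpd_comp[OF this assms(1)]] show "(x, l, x) \<in> gpd E" by simp
  next
    assume "(x, l, x) \<in> gpd E"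
    from gpd_comp[OF assms(1) gpd_comp[OF this inv]] show "(y, l, y) \<in> gpd E" by simp
  qed
  thus ?thesis using assms(2) by (simp add: isotropy_period_def)
qed

lemma isotropy_period_unique:
  assumes "isotropy_period E x n" "isotropy_period E x n'"
  shows "n = n'"
proof -
  have "int n dvd k \<longleftrightarrow> int n' dvd k" for k using assms by (simp add: isotropy_period_def)
  from this[of "int n"] this[of "int n'"] show ?thesis by (simp add: dvd_antisym)
qed

lemma plain_chen_iso_tail_class:
  fixes kt :: "'k :: field itself"
  assumes "x \<in> boundary E" "y \<in> boundary E"
    and iso: "module_iso (lpa E) (chen E x :: ('k, _, _) lmodule) (chen E y)"
  shows "x \<in> tail_class E y"
proof -
  interpret X: plain_chen E x "TYPE('k)" by (rule plain_chen_at[OF assms(1)])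
  interpret Y: plain_chen E y "TYPE('k)" by (rule plain_chen_at[OF assms(2)])
  show ?thesis
    by (rule Y.W.iso_stalk_support[OF X.W.alg_module_V iso[folded X.V_eq Y.V_eq]
        X.W.\<delta>_stalk[OF X.W.x_in_S] X.\<delta>_one assms(1)]) simp_all
qed

lemma plain_poly_not_iso:
  assumes x: "x \<in> boundary E" and pp: "(f :: 'k :: field poly, c, b) \<in> poly_params E"
  shows "\<not> module_iso (lpa E) (chen E x) (chen_poly E f c b)"
proof
  assume iso: "module_iso (lpa E) (chen E x) (chen_poly E f c b)"
  interpret X: plain_chen E x "TYPE('k)" by (rule plain_chen_at[OF x])
  interpret F: poly_chen E f c b by (rule poly_chen_at[OF pp])
  let ?y = "cinf c :: ('v, 'e) bpath"
  note iso' = iso[folded X.V_eq F.V_eq]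
  have "x \<in> F.W.S"
    by (rule F.W.iso_stalk_support[OF X.W.alg_module_V iso' X.W.\<delta>_stalk[OF X.W.x_in_S] X.\<delta>_one x]) simp_all
  hence "tail_class E x = tail_class E ?y" using tail_class_eqI unfolding tail_class_eq by blast
  hence y: "?y \<in> X.W.S" using tail_class_refl[OF F.W.x] by simp
  let ?v = "X.W.\<delta> ?y 1"
  have v: "?v \<in> X.W.C.stalk ?y" using X.W.\<delta>_stalk[OF y] by simp
  obtain m' where m': "m' \<in> F.W.C.stalk ?y" "m' \<noteq> \<zero>\<^bsub>F.W.V\<^esub>"
    and ann: "\<And>n Q. isotropy_period E ?y n ==> X.W.C.la ?y n Q ?v = \<zero>\<^bsub>X.W.V\<^esub> ==> F.W.C.la ?y n Q m' = \<zero>\<^bsub>F.W.V\<^esub>"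
    by (rule F.W.iso_stalk_support[OF X.W.alg_module_V iso' v X.\<delta>_one F.W.x]) blast
  have "X.W.C.tr ?y (int (length c)) ?y ?v = ?v"
    using X.tr_plain[OF _ y, of ?y "int (length c)" 1] isotropy_period_gpd[OF F.ip, of 1] by simp
  hence "X.W.C.la ?y (length c) (lp [:-1, 1:]) ?v = \<zero>\<^bsub>X.W.V\<^esub>" using X.W.C.fixed_iff_annihilated[OF F.ip v] by blast
  hence "f dvd [:-1, 1:]" by (rule F.annihilator[OF m' ann[OF F.ip]])
  then obtain k where "f = Polynomial.smult k [:-1, 1:]" using irreducible_not_dvd_t[OF F.irr] by blast
  thus False using pp unfolding poly_params_def by blast
qed

lemma poly_iso_iff:
  assumes pf: "(f :: 'k :: field poly, c, b) \<in> poly_params E" and pg: "(g, d, b') \<in> poly_params E"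
  shows "module_iso (lpa E) (chen_poly E f c b) (chen_poly E g d b') \<longleftrightarrow>
    tail_class E (cinf c) = tail_class E (cinf d) \<and> (\<exists>k. g = Polynomial.smult k f)"
proof -
  interpret F: poly_chen E f c b by (rule poly_chen_at[OF pf])
  interpret G: poly_chen E g d b' by (rule poly_chen_at[OF pg])
  let ?x = "cinf c :: ('v, 'e) bpath" and ?y = "cinf d :: ('v, 'e) bpath"
  have len: "length c = length d" if "(?y, k, ?x) \<in> gpd E" for k
    by (rule isotropy_period_unique[OF isotropy_period_transport[OF that F.ip] G.ip])
  show ?thesis
  proof
    assume iso: "module_iso (lpa E) (chen_poly E f c b) (chen_poly E g d b')"
    let ?v = "F.W.\<delta> ?x \<one>\<^bsub>F.K'\<^esub>"
    have v: "?v \<in> F.W.C.stalk ?x" "?v \<noteq> \<zero>\<^bsub>F.W.V\<^esub>"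
      using F.W.\<delta>_stalk[OF F.W.x_in_S F.K'.one_closed] F.W.\<delta>_eq_zero[of ?x "\<one>\<^bsub>F.K'\<^esub>"] by simp_all
    obtain m' where m': "m' \<in> G.W.C.stalk ?x" "m' \<noteq> \<zero>\<^bsub>G.W.V\<^esub>" "?x \<in> G.W.S"
      and ann: "\<And>n Q. isotropy_period E ?x n ==> F.W.C.la ?x n Q ?v = \<zero>\<^bsub>F.W.V\<^esub> ==> G.W.C.la ?x n Q m' = \<zero>\<^bsub>G.W.V\<^esub>"
      by (rule G.W.iso_stalk_support[OF F.W.alg_module_V iso[folded F.V_eq G.V_eq] v F.W.x]) blast
    have tc: "tail_class E ?x = tail_class E ?y" using m'(3) tail_class_eqI unfolding tail_class_eq by blast
    obtain k where k: "(?y, k, ?x) \<in> gpd E" using m'(3) unfolding tail_class_eq by blast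
    have "F.cl (lp f) = \<zero>\<^bsub>F.K'\<^esub>" by (simp add: ext_class_eq_zero)
    hence "F.W.C.la ?x (length c) (lp f) ?v = \<zero>\<^bsub>F.W.V\<^esub>"
      unfolding F.la_\<delta>[OF F.K'.one_closed] F.W.\<delta>_eq_zero by simp
    hence 0: "G.W.C.la ?x (length c) (lp f) m' = \<zero>\<^bsub>G.W.V\<^esub>" by (rule ann[OF F.ip])
    let ?m = "G.W.C.tr ?y k ?x m'"
    have m: "?m \<in> G.W.C.stalk ?y" "?m \<noteq> \<zero>\<^bsub>G.W.V\<^esub>"
      using G.W.C.tr_stalk[OF k m'(1)] G.W.C.tr_eq_zero[OF k m'(1)] m'(2) by blast+
    have "G.W.C.la ?y (length d) (lp f) ?m = \<zero>\<^bsub>G.W.V\<^esub>"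
      using G.W.C.la_transport[OF k F.ip _ m'(1), of "lp f"] G.ip 0 len[OF k]
        G.W.V.linmap_zero[OF G.W.C.tr_linmap[OF k] G.W.V.vspace_axioms] by simp
    hence "g dvd f" by (rule G.annihilator[OF m])
    then obtain u where u: "f = g * u" by (auto simp: dvd_def)
    hence "u dvd 1" using F.irr G.not_unit(1) by (auto simp: Factorial_Ring.irreducible_def)
    then obtain a where a: "u = [:a:]" "a \<noteq> 0" by (auto simp: is_unit_poly_iff dvd_field_iff)
    have "g = Polynomial.smult (inverse a) f" unfolding u a(1) using a(2) by simp
    thus "tail_class E ?x = tail_class E ?y \<and> (\<exists>k. g = Polynomial.smult k f)" using tc by blast
  next
    assume "tail_class E ?x = tail_class E ?y \<and> (\<exists>k. g = Polynomial.smult k f)"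
    then obtain k where tc: "tail_class E ?x = tail_class E ?y" and gk: "g = Polynomial.smult k f" by blast
    have k0: "k \<noteq> 0" using gk G.not_unit(2) by auto
    have "?y \<in> tail_class E ?x" using tail_class_refl[OF G.W.x] tc by simp
    then obtain j where j: "(?x, j, ?y) \<in> gpd E" unfolding tail_class_eq by blast
    let ?v = "G.W.\<delta> ?y \<one>\<^bsub>G.K'\<^esub>"
    have v: "?v \<in> G.W.C.stalk ?y" "?v \<noteq> \<zero>\<^bsub>G.W.V\<^esub>"
      using G.W.\<delta>_stalk[OF G.W.x_in_S G.K'.one_closed] G.W.\<delta>_eq_zero[of ?y "\<one>\<^bsub>G.K'\<^esub>"] by simp_all
    let ?m = "G.W.C.tr ?x j ?y ?v"
    have m: "?m \<in> G.W.C.stalk ?x" "?m \<noteq> \<zero>\<^bsub>G.W.V\<^esub>"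
      using G.W.C.tr_stalk[OF j v(1)] G.W.C.tr_eq_zero[OF j v(1)] v(2) by blast+
    have "g dvd f" unfolding gk using k0 by (simp add: smult_dvd_iff)
    hence "G.cl (lp f) = \<zero>\<^bsub>G.K'\<^esub>" by (simp add: ext_class_eq_zero G.lp_dvd_iff)
    hence 0: "G.W.C.la ?y (length d) (lp f) ?v = \<zero>\<^bsub>G.W.V\<^esub>"
      unfolding G.la_\<delta>[OF G.K'.one_closed] G.W.\<delta>_eq_zero by simp
    have ipx: "isotropy_period E ?x (length d)" by (rule isotropy_period_transport[OF j G.ip])
    have "G.W.C.la ?x (length d) (lp f) ?m = \<zero>\<^bsub>G.W.V\<^esub>"
      using G.W.C.la_transport[OF j G.ip ipx v(1), of "lp f"] 0
        G.W.V.linmap_zero[OF G.W.C.tr_linmap[OF j] G.W.V.vspace_axioms] by simp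
    hence "G.W.C.la ?x (length c) (lp f) ?m = \<zero>\<^bsub>G.W.V\<^esub>" using isotropy_period_unique[OF F.ip ipx] by simp
    thus "module_iso (lpa E) (chen_poly E f c b) (chen_poly E g d b')"
      using F.iso_of_annihilated_vector[of G.W.V, OF _ m] G.simple unfolding G.V_eq by blast
  qed
qed

end

section \<open>Finite dimensional modules\<close>

context plain_chen
begin

lemma fin_dim:
  assumes "finite (tail_class E x)"
  shows "fin_dim (chen E x :: ('k, _, _) lmodule)"
  unfolding V_eq[symmetric] fin_dim_def
proof (intro exI conjI allI impI)
  let ?B = "(\<lambda>p. W.\<delta> p 1) ` tail_class E x"
  show "finite ?B" using assms by simp
  show "?B \<subseteq> carrier W.V" using W.\<delta>_closed by auto
  fix N assume N: "submodule N (ring_of_type_algebra :: 'k ring) W.V \<and> ?B \<subseteq> N"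
  note sub = W.V.subspaceD[OF conjunct1[OF N]]
  have "n \<in> N" if n: "n \<in> carrier W.V" for n
  proof -
    have "(\<Oplus>\<^bsub>W.V\<^esub>p\<in>{p. n p \<noteq> \<zero>\<^bsub>ring_of_type_algebra\<^esub>}. W.\<delta> p (n p)) \<in> N"
    proof (rule W.V.subspace_finsum[OF conjunct1[OF N] W.V_supp[OF n]])
      fix p assume "p \<in> {p. n p \<noteq> \<zero>\<^bsub>ring_of_type_algebra\<^esub>}"
      hence "p \<in> tail_class E x" using W.V_outside[OF n, of p] by blast
      hence "n p \<odot>\<^bsub>W.V\<^esub> W.\<delta> p 1 \<in> N" using sub(4) N by blast
      thus "W.\<delta> p (n p) \<in> N" using W.\<delta>_smult[of 1 p "n p"] by simp
    qed
    thus ?thesis using W.V_decomp[OF n] by metis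
  qed
  thus "N = carrier W.V" using sub(1) by blast
qed

end

context poly_chen
begin

lemma fin_dim:
  assumes "finite (tail_class E x)"
  shows "fin_dim (chen_poly E f c b)"
  unfolding V_eq[symmetric] fin_dim_def
proof (intro exI conjI allI impI)
  let ?B = "(\<lambda>(p, i). W.\<delta> p (cl (tpow (int i)))) ` (tail_class E x \<times> {..<degree f})"
  show "finite ?B" using assms by simp
  show "?B \<subseteq> carrier W.V" using W.\<delta>_closed by auto
  fix N assume N: "submodule N (ring_of_type_algebra :: 'k ring) W.V \<and> ?B \<subseteq> N"
  note sub = W.V.subspaceD[OF conjunct1[OF N]]
  have d: "W.\<delta> p r \<in> N" if p: "p \<in> tail_class E x" and r: "r \<in> carrier K'" for p r
  proof -
    obtain P where P: "r = cl (lp P)" "P = 0 \<or> degree P < degree f" by (rule ext_representative[OF r])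
    have z: "W.\<delta> p (cl 0) \<in> N"
    proof -
      have "cl 0 = \<zero>\<^bsub>K'\<^esub>" by (simp add: ext_class_eq_zero)
      hence "W.\<delta> p (cl 0) = \<zero>\<^bsub>W.V\<^esub>" using W.\<delta>_eq_zero by blast
      thus ?thesis using sub(2) by (simp only:)
    qed
    have s: "W.\<delta> p (cl (\<Sum>i\<in>I. single (int i) (poly.coeff P i))) \<in> N"
      if "finite I" "I \<subseteq> {..<degree f}" for I
      using that
    proof (induction I rule: finite_induct)
      case empty
      show ?case using z by simp
    next
      case (insert i I)
      have "W.\<delta> p (cl (tpow (int i))) \<in> N" using N p insert.prems by blast
      hence "poly.coeff P i \<odot>\<^bsub>W.V\<^esub> W.\<delta> p (cl (tpow (int i))) \<in> N" by (rule sub(4))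
      hence 1: "W.\<delta> p (cl (single (int i) (poly.coeff P i))) \<in> N"
        unfolding cl_single[of "int i" "poly.coeff P i"] using W.\<delta>_smult[of "cl (tpow (int i))" p "poly.coeff P i"] by simp
      have 2: "W.\<delta> p (cl (\<Sum>i\<in>I. single (int i) (poly.coeff P i))) \<in> N"
        by (rule insert.IH) (use insert.prems in blast)
      show ?case unfolding sum.insert[OF insert.hyps] ext_class_add
        using W.\<delta>_add[of "cl (single (int i) (poly.coeff P i))"
            "cl (\<Sum>i\<in>I. single (int i) (poly.coeff P i))" p] sub(3)[OF 1 2] by simp
    qed
    show ?thesis
    proof (cases "P = 0")
      case True
      thus ?thesis using z P(1) by simp
    next
      case False
      hence "{..degree P} \<subseteq> {..<degree f}" using P(2) by auto
      thus ?thesis using s[of "{..degree P}"] unfolding P(1) laurent_of_poly_def by simp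
    qed
  qed
  have "n \<in> N" if n: "n \<in> carrier W.V" for n
  proof -
    have "(\<Oplus>\<^bsub>W.V\<^esub>p\<in>{p. n p \<noteq> \<zero>\<^bsub>K'\<^esub>}. W.\<delta> p (n p)) \<in> N"
    proof (rule W.V.subspace_finsum[OF conjunct1[OF N] W.V_supp[OF n]])
      fix p assume "p \<in> {p. n p \<noteq> \<zero>\<^bsub>K'\<^esub>}"
      hence "p \<in> tail_class E x" using W.V_outside[OF n, of p] by blast
      thus "W.\<delta> p (n p) \<in> N" by (rule d) (rule W.V_closed[OF n])
    qed
    thus ?thesis using W.V_decomp[OF n] by metis
  qed
  thus "N = carrier W.V" using sub(1) by blast
qed

end

text \<open>Gaussian elimination: one unknown is eliminated by one equation.\<close>

lemma homogeneous_solution: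
  fixes c :: "'i => 'j => 'k :: field"
  assumes "finite B" "finite F" "card B < card F"
  shows "\<exists>x. (\<exists>i\<in>F. x i \<noteq> 0) \<and> (\<forall>b\<in>B. (\<Sum>i\<in>F. x i * c i b) = 0)"
  using assms
proof (induction B arbitrary: F c rule: finite_induct)
  case empty
  hence "F \<noteq> {}" by auto
  thus ?case by (intro exI[of _ "\<lambda>_. 1"]) auto
next
  case (insert b B)
  show ?case
  proof (cases "\<forall>i\<in>F. c i b = 0")
    case True
    have "card B < card F" using insert by simp
    then obtain x where x: "\<exists>i\<in>F. x i \<noteq> 0" "\<forall>b\<in>B. (\<Sum>i\<in>F. x i * c i b) = 0"
      using insert.IH[OF insert.prems(1), of c] by blast
    moreover have "(\<Sum>i\<in>F. x i * c i b) = 0" using True by (intro sum.neutral) simp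
    ultimately show ?thesis by blast
  next
    case False
    then obtain i0 where i0: "i0 \<in> F" "c i0 b \<noteq> 0" by blast
    let ?F = "F - {i0}"
    let ?r = "\<lambda>i. c i b / c i0 b"
    have F: "finite ?F" "card B < card ?F" using insert i0 by simp_all
    obtain x where x: "\<exists>i\<in>?F. x i \<noteq> 0" "\<forall>b'\<in>B. (\<Sum>i\<in>?F. x i * (c i b' - ?r i * c i0 b')) = 0"
      using insert.IH[OF F, of "\<lambda>i b'. c i b' - ?r i * c i0 b'"] by blast
    let ?y = "\<lambda>i. if i = i0 then - (\<Sum>i\<in>?F. x i * ?r i) else x i"
    have y: "(\<Sum>i\<in>F. ?y i * c i b') = (\<Sum>i\<in>?F. x i * (c i b' - ?r i * c i0 b'))" for b'
    proof -
      have "(\<Sum>i\<in>F. ?y i * c i b') = ?y i0 * c i0 b' + (\<Sum>i\<in>?F. ?y i * c i b')"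
        by (rule sum.remove[OF insert.prems(1) i0(1)])
      also have "(\<Sum>i\<in>?F. ?y i * c i b') = (\<Sum>i\<in>?F. x i * c i b')" by (rule sum.cong) auto
      finally show ?thesis by (simp add: sum_distrib_right right_diff_distrib sum_subtractf mult.assoc)
    qed
    have "(\<Sum>i\<in>?F. x i * (c i b - ?r i * c i0 b)) = 0" using i0(2) by (intro sum.neutral) simp
    hence "\<forall>b'\<in>insert b B. (\<Sum>i\<in>F. ?y i * c i b') = 0" unfolding y using x(2) by simp
    moreover have "\<exists>i\<in>F. ?y i \<noteq> 0" using x(1) by auto
    ultimately show ?thesis by (intro exI[of _ ?y]) blast
  qed
qed

context lpa_module
begin

lemma fin_dim_dependent:
  assumes fd: "fin_dim M" and I: "infinite I" and u: "\<And>i. i \<in> I ==> u i \<in> carrier M"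
  obtains F and x :: "'i => 'k" where "finite F" "F \<subseteq> I" "\<exists>i\<in>F. x i \<noteq> 0" "(\<Oplus>\<^bsub>M\<^esub>i\<in>F. x i \<odot>\<^bsub>M\<^esub> u i) = \<zero>\<^bsub>M\<^esub>"
proof -
  obtain B where B: "finite B" "B \<subseteq> carrier M"
    and gen: "\<And>N. submodule N (ring_of_type_algebra :: 'k ring) M \<and> B \<subseteq> N --> N = carrier M"
    using fd unfolding fin_dim_def by blast
  let ?c = "\<lambda>k. \<Oplus>\<^bsub>M\<^esub>b\<in>B. k b \<odot>\<^bsub>M\<^esub> b"
  have bc: "k b \<odot>\<^bsub>M\<^esub> b \<in> carrier M" if "b \<in> B" for k :: "'m => 'k" and b
    by (rule vsmult_closed) (use that B(2) in blast)
  have cc: "?c k \<in> carrier M" for k :: "'m => 'k" by (rule M.finsum_closed) (rule Pi_I, erule bc)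
  have add: "?c k \<oplus>\<^bsub>M\<^esub> ?c l = ?c (\<lambda>b. k b + l b)" for k l :: "'m => 'k"
  proof -
    have "?c (\<lambda>b. k b + l b) = (\<Oplus>\<^bsub>M\<^esub>b\<in>B. k b \<odot>\<^bsub>M\<^esub> b \<oplus>\<^bsub>M\<^esub> l b \<odot>\<^bsub>M\<^esub> b)"
    proof (rule M.finsum_cong'[OF refl])
      show "(\<lambda>b. k b \<odot>\<^bsub>M\<^esub> b \<oplus>\<^bsub>M\<^esub> l b \<odot>\<^bsub>M\<^esub> b) \<in> B \<rightarrow> carrier M" by (rule Pi_I) (intro M.a_closed bc)
      show "(k b + l b) \<odot>\<^bsub>M\<^esub> b = k b \<odot>\<^bsub>M\<^esub> b \<oplus>\<^bsub>M\<^esub> l b \<odot>\<^bsub>M\<^esub> b" if "b \<in> B" for b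
        by (rule vsmult_add) (use that B(2) in blast)
    qed
    also have "\<dots> = ?c k \<oplus>\<^bsub>M\<^esub> ?c l" by (rule M.finsum_addf) (rule Pi_I, erule bc)+
    finally show ?thesis by simp
  qed
  have smult: "a \<odot>\<^bsub>M\<^esub> ?c k = ?c (\<lambda>b. a * k b)" for a and k :: "'m => 'k"
  proof -
    have "a \<odot>\<^bsub>M\<^esub> ?c k = (\<Oplus>\<^bsub>M\<^esub>b\<in>B. a \<odot>\<^bsub>M\<^esub> (k b \<odot>\<^bsub>M\<^esub> b))"
      by (rule linmap_finsum[OF linmap_smult vspace_axioms B(1) bc])
    also have "\<dots> = ?c (\<lambda>b. a * k b)"
    proof (rule M.finsum_cong'[OF refl])
      show "(\<lambda>b. (a * k b) \<odot>\<^bsub>M\<^esub> b) \<in> B \<rightarrow> carrier M" by (rule Pi_I) (rule bc)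
      show "a \<odot>\<^bsub>M\<^esub> (k b \<odot>\<^bsub>M\<^esub> b) = (a * k b) \<odot>\<^bsub>M\<^esub> b" if "b \<in> B" for b
        by (rule vsmult_mult[symmetric]) (use that B(2) in blast)
    qed
    finally show ?thesis .
  qed
  have zero: "?c (\<lambda>_. 0) = \<zero>\<^bsub>M\<^esub>"
  proof -
    have "?c (\<lambda>_. 0) = 0 \<odot>\<^bsub>M\<^esub> ?c (\<lambda>_. 0)" unfolding smult by simp
    thus ?thesis using vsmult_zero[OF cc] by simp
  qed
  have "range ?c = carrier M"
  proof (rule gen[rule_format], intro conjI)
    show "submodule (range ?c) (ring_of_type_algebra :: 'k ring) M"
    proof (rule subspaceI)
      show "range ?c \<subseteq> carrier M" using cc by blast
      show "\<zero>\<^bsub>M\<^esub> \<in> range ?c" by (rule range_eqI[where x = "\<lambda>_. 0"]) (rule zero[symmetric])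
      show "m \<oplus>\<^bsub>M\<^esub> n \<in> range ?c" if mn: "m \<in> range ?c" "n \<in> range ?c" for m n
      proof -
        from mn obtain k l where kl: "m = ?c k" "n = ?c l" by blast
        show ?thesis unfolding kl by (rule range_eqI[where x = "\<lambda>b. k b + l b"]) (rule add)
      qed
      show "a \<odot>\<^bsub>M\<^esub> m \<in> range ?c" if m: "m \<in> range ?c" for a m
      proof -
        from m obtain k where "m = ?c k" by blast
        hence am: "a \<odot>\<^bsub>M\<^esub> m = ?c (\<lambda>b. a * k b)" using smult by simp
        show ?thesis by (rule range_eqI[where x = "\<lambda>b. a * k b"]) (rule am)
      qed
    qed
    show "B \<subseteq> range ?c"
    proof
      fix b0 assume b0: "b0 \<in> B"
      have "?c (\<lambda>b. if b0 = b then 1 else 0) = (\<Oplus>\<^bsub>M\<^esub>b\<in>B. if b0 = b then b else \<zero>\<^bsub>M\<^esub>)"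
        by (rule M.finsum_cong'[OF refl]) (use B(2) in auto)
      also have "\<dots> = b0" using M.add.finprod_singleton[OF b0 B(1), of "\<lambda>b. b"] B(2) by auto
      finally have e: "?c (\<lambda>b. if b0 = b then 1 else 0) = b0" .
      show "b0 \<in> range ?c" by (rule range_eqI[where x = "\<lambda>b. if b0 = b then 1 else 0"]) (rule e[symmetric])
    qed
  qed
  hence "\<forall>i\<in>I. u i \<in> range ?c" using u by simp
  hence "\<forall>i\<in>I. \<exists>k. u i = ?c k" unfolding image_iff bex_UNIV .
  from bchoice[OF this] obtain c where c0: "\<forall>i\<in>I. u i = ?c (c i)" by (rule exE)
  note c = bspec[OF c0]
  obtain F where F: "F \<subseteq> I" "finite F" "card F = Suc (card B)"
    using infinite_arbitrarily_large[OF I] by blast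
  obtain x where x: "\<exists>i\<in>F. x i \<noteq> 0" "\<forall>b\<in>B. (\<Sum>i\<in>F. x i * c i b) = 0"
    using homogeneous_solution[OF B(1) F(2), of c] F(3) by auto
  have "(\<Oplus>\<^bsub>M\<^esub>i\<in>G. x i \<odot>\<^bsub>M\<^esub> u i) = ?c (\<lambda>b. \<Sum>i\<in>G. x i * c i b)" if "finite G" "G \<subseteq> I" for G
    using that
  proof (induction G rule: finite_induct)
    case empty
    show ?case using zero by simp
  next
    case (insert i G)
    have "(\<Oplus>\<^bsub>M\<^esub>i\<in>insert i G. x i \<odot>\<^bsub>M\<^esub> u i) = x i \<odot>\<^bsub>M\<^esub> u i \<oplus>\<^bsub>M\<^esub> (\<Oplus>\<^bsub>M\<^esub>i\<in>G. x i \<odot>\<^bsub>M\<^esub> u i)"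
    proof (rule M.finsum_insert[OF insert.hyps])
      show "(\<lambda>i. x i \<odot>\<^bsub>M\<^esub> u i) \<in> G \<rightarrow> carrier M"
        by (rule Pi_I, rule vsmult_closed, rule u) (use insert.prems in blast)
      show "x i \<odot>\<^bsub>M\<^esub> u i \<in> carrier M" by (rule vsmult_closed, rule u) (use insert.prems in blast)
    qed
    also have "x i \<odot>\<^bsub>M\<^esub> u i = ?c (\<lambda>b. x i * c i b)" unfolding c[OF subsetD[OF insert.prems insertI1]] by (rule smult)
    also have "(\<Oplus>\<^bsub>M\<^esub>i\<in>G. x i \<odot>\<^bsub>M\<^esub> u i) = ?c (\<lambda>b. \<Sum>i\<in>G. x i * c i b)" by (rule insert.IH) (use insert.prems in blast)
    finally show ?case unfolding add sum.insert[OF insert.hyps] .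
  qed
  from this[OF F(2,1)] have "(\<Oplus>\<^bsub>M\<^esub>i\<in>F. x i \<odot>\<^bsub>M\<^esub> u i) = ?c (\<lambda>b. \<Sum>i\<in>F. x i * c i b)" .
  also have "\<dots> = ?c (\<lambda>_. 0)"
    by (rule M.finsum_cong'[OF refl]) (use x(2) bc[of _ "\<lambda>_. 0"] in auto)
  finally show thesis using that[OF F(2,1) x(1)] zero by simp
qed

text \<open>Translates of a vector to distinct points of its orbit are independent.\<close>

lemma fin_dim_orbit:
  assumes fd: "fin_dim M" and m: "m \<in> stalk x" "m \<noteq> \<zero>\<^bsub>M\<^esub>"
  shows "finite (tail_class E x)"
proof (rule ccontr)
  assume inf: "infinite (tail_class E x)"
  have "\<forall>p\<in>tail_class E x. \<exists>k. (p, k, x) \<in> gpd E"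
  proof
    fix p assume "p \<in> tail_class E x"
    then obtain k where "(x, k, p) \<in> gpd E" unfolding tail_class_eq by blast
    from gpd_inv[OF this] show "\<exists>k. (p, k, x) \<in> gpd E" by blast
  qed
  then obtain k where k: "\<And>p. p \<in> tail_class E x ==> (p, k p, x) \<in> gpd E" by metis
  let ?u = "\<lambda>p. tr p (k p) x m"
  have us: "?u p \<in> stalk p" if "p \<in> tail_class E x" for p by (rule tr_stalk[OF k[OF that] m(1)])
  obtain F and c :: "_ => 'k" where F: "finite F" "F \<subseteq> tail_class E x" "\<exists>i\<in>F. c i \<noteq> 0"
    "(\<Oplus>\<^bsub>M\<^esub>p\<in>F. c p \<odot>\<^bsub>M\<^esub> ?u p) = \<zero>\<^bsub>M\<^esub>"
    by (rule fin_dim_dependent[OF fd inf, of ?u]) (rule stalk_carrier[OF us], blast+)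
  have "\<forall>p\<in>F. c p \<odot>\<^bsub>M\<^esub> ?u p = \<zero>\<^bsub>M\<^esub>"
  proof (rule stalks_independent[OF F(1) _ _ F(4)])
    show "F \<subseteq> boundary E" using F(2) tail_class_subset by blast
    show "c p \<odot>\<^bsub>M\<^esub> ?u p \<in> stalk p" if "p \<in> F" for p by (rule stalk_smult[OF us]) (use that F(2) in blast)
  qed
  then obtain p where p: "p \<in> F" "c p \<noteq> 0" "c p \<odot>\<^bsub>M\<^esub> ?u p = \<zero>\<^bsub>M\<^esub>" using F(3) by blast
  have pS: "p \<in> tail_class E x" using p(1) F(2) by blast
  have "?u p = \<zero>\<^bsub>M\<^esub>" using vsmult_eq_zero[OF stalk_carrier[OF us[OF pS]] p(3)] p(2) by blast
  thus False using tr_eq_zero[OF k[OF pS] m(1)] m(2) by blast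
qed

text \<open>Every generator takes values in the range of the idempotent of its source vertex, and the algebra does
  not act as zero.\<close>

lemma vertex_vector:
  assumes s: "simple_module (lpa E) M"
  obtains v m where "v \<in> verts E" "m \<in> carrier M" "m \<noteq> \<zero>\<^bsub>M\<^esub>" "G (Vx v) m = m"
proof -
  obtain z m where z: "z \<in> carrier (lpa E)" and m: "m \<in> carrier M" "act M z m \<noteq> \<zero>\<^bsub>M\<^esub>"
    using s unfolding simple_module_def by blast
  obtain a where a: "a \<in> aug E" "z = lpa_class E a" using z unfolding lpa_carrier by blast
  have nz: "lcomb M (\<lambda>w. foldr G (letters w) m) a \<noteq> \<zero>\<^bsub>M\<^esub>"
    using m(2) A_expand[OF a(1) m(1)] by (simp add: A_def a(2))
  have "\<exists>w\<in>keys a. foldr G (letters w) m \<noteq> \<zero>\<^bsub>M\<^esub>"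
  proof (rule ccontr)
    assume no: "\<not> ?thesis"
    have "lcomb M (\<lambda>w. foldr G (letters w) m) a = (\<Oplus>\<^bsub>M\<^esub>w\<in>keys a. \<zero>\<^bsub>M\<^esub>)"
      unfolding lcomb_def by (rule M.finsum_cong'[OF refl]) (use no in auto)
    thus False using nz by simp
  qed
  then obtain w where w: "w \<in> keys a" "foldr G (letters w) m \<noteq> \<zero>\<^bsub>M\<^esub>" by blast
  note wk = aug_keys[OF a(1) w(1)]
  then obtain g w' where gw: "letters w = g # w'" by (cases "letters w") auto
  hence g: "g \<in> gens E" "set w' \<subseteq> gens E" using wk by auto
  define m' where "m' = foldr G w' m"
  have m': "m' \<in> carrier M" unfolding m'_def by (rule linmapD(1)[OF word_linmap[OF g(2)] m(1)])
  have n: "G g m' \<in> carrier M" "G g m' \<noteq> \<zero>\<^bsub>M\<^esub>" using g(1) m' w(2) gw by (simp_all add: m'_def)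
  show thesis
  proof (cases g)
    case (Vx v)
    hence "v \<in> verts E" using g(1) by simp
    thus thesis using that[of v "G g m'"] n G_vertex_vertex[of v v m'] m' Vx by simp
  next
    case (Ed e)
    hence e: "e \<in> arcs E" using g(1) by simp
    thus thesis using that[of "tail E e" "G g m'"] n G_source_edge[OF e m'] Ed by simp
  next
    case (Gh e)
    hence e: "e \<in> arcs E" using g(1) by simp
    thus thesis using that[of "head E e" "G g m'"] n G_range_ghost[OF e m'] Gh by simp
  qed
qed

text \<open>At a regular vertex \<open>v = \<Sum> ee\<^sup>*\<close> would kill \<open>m\<close>; so \<open>w\<close> is singular and \<open>m\<close> lives at the trivial path.\<close>

lemma singular_vertex_stalk:
  assumes w: "w \<in> verts E" and m: "m \<in> carrier M" "m \<noteq> \<zero>\<^bsub>M\<^esub>" "G (Vx w) m = m"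
    and no: "\<And>e. e \<in> out_arcs E w ==> G (Gh e) m = \<zero>\<^bsub>M\<^esub>"
  shows "FinP w [] \<in> boundary E" "m \<in> stalk (FinP w [])"
proof -
  have nr: "\<not> regular E w"
  proof
    assume reg: "regular E w"
    have "m = G (Vx w) m" by (rule m(3)[symmetric])
    also have "\<dots> = (\<Oplus>\<^bsub>M\<^esub>e\<in>out_arcs E w. G (Ed e) (G (Gh e) m))" by (rule G_regular[OF reg m(1)])
    also have "\<dots> = (\<Oplus>\<^bsub>M\<^esub>e\<in>out_arcs E w. \<zero>\<^bsub>M\<^esub>)"
      by (rule M.finsum_cong'[OF refl]) (use no in auto)
    finally show False using m(2) by simp
  qed
  show b: "FinP w [] \<in> boundary E" using nr w by (auto simp: boundary_def)
  have gh0: "G (Gh e) m = \<zero>\<^bsub>M\<^esub>" if e: "e \<in> arcs E" for e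
  proof (cases "tail E e = w")
    case True
    thus ?thesis using no[of e] e by simp
  next
    case False
    have "G (Gh e) m = G (Gh e) (G (Vx (tail E e)) (G (Vx w) m))" using G_ghost_source[OF e m(1)] m(3) by simp
    also have "\<dots> = \<zero>\<^bsub>M\<^esub>" using G_vertex_vertex[of "tail E e" w m] False w e m(1) by simp
    finally show ?thesis .
  qed
  show "m \<in> stalk (FinP w [])"
  proof (rule stalkI[OF m(1)])
    fix u q assume f: "(u, q) \<in> fin_paths E"
    show "proj (u, q) m = (if FinP w [] \<in> cyl E (u, q) then m else \<zero>\<^bsub>M\<^esub>)"
    proof (cases q)
      case Nil
      hence u: "u \<in> verts E" using f by simp
      have "G (Vx u) m = (if u = w then m else \<zero>\<^bsub>M\<^esub>)" using G_vertex_vertex[OF u w m(1)] m(3) by auto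
      thus ?thesis using Nil proj_Nil[OF u m(1)] b by auto
    next
      case (Cons e q')
      hence e: "e \<in> arcs E" "(head E e, q') \<in> fin_paths E" "u = tail E e" using f by auto
      have "gh u q m = \<zero>\<^bsub>M\<^esub>" using gh0[OF e(1)] gh_zero[OF e(2)] Cons by simp
      hence "proj (u, q) m = \<zero>\<^bsub>M\<^esub>" using pa_zero[OF f] by (simp add: proj_def)
      moreover have "FinP w [] \<notin> cyl E (u, q)" unfolding Cons cyl_Cons by simp
      ultimately show ?thesis by simp
    qed
  qed
qed

text \<open>Along an infinite path the idempotents of the initial segments decrease. If they never become
  stationary on \<open>m\<close>, the images of \<open>m\<close> at the strict decreases are independent: in a linear relation the
  idempotent following the first index changes only the first term.\<close>

lemma stationary_projections:
  assumes fd: "fin_dim M" and m: "m \<in> carrier M" and a: "\<And>k. (v, a k) \<in> fin_paths E" "\<And>k. \<exists>e. a (Suc k) = a k @ [e]"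
  obtains K where "\<And>k. k \<ge> K ==> proj (v, a k) m = proj (v, a K) m"
proof -
  define mm where "mm = (\<lambda>k. proj (v, a k) m)"
  have mc: "mm k \<in> carrier M" for k unfolding mm_def by (rule proj_closed[OF a(1) m])
  have pre: "\<exists>q. a (i + r) = a i @ q" for i r
  proof (induction r)
    case (Suc r)
    then obtain q where "a (i + r) = a i @ q" by blast
    thus ?case using a(2)[of "i + r"] by auto
  qed simp
  have low: "proj (v, a i) (mm k) = mm k" if ik: "i \<le> k" for i k
  proof -
    obtain q where q: "a k = a i @ q" using pre[of i "k - i"] ik by auto
    have f: "(v, a i @ q) \<in> fin_paths E" using a(1)[of k] q by simp
    have g: "gh v (a k) m \<in> carrier M" by (rule linmapD(1)[OF gh_linmap[OF a(1)] m])
    show ?thesis using proj_pa_prefix[OF f g] by (simp add: mm_def q proj_def[of "(v, a i @ q)"])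
  qed
  have up: "proj (v, a (Suc j)) (mm j) = mm (Suc j)" for j
  proof -
    obtain e where e: "a (Suc j) = a j @ [e]" using a(2) by blast
    have f: "(v, a j) \<in> fin_paths E" "(prange E (v, a j), [e]) \<in> fin_paths E" "(v, a j @ [e]) \<in> fin_paths E"
      using a(1)[of "Suc j"] a(1)[of j] unfolding e by (simp_all add: fin_paths_append)
    have g: "gh v (a j) m \<in> carrier M" by (rule linmapD(1)[OF gh_linmap[OF f(1)] m])
    have "proj (v, a (Suc j)) (mm j) = pa v (a j) (proj (prange E (v, a j), [e]) (gh v (a j) m))"
      using proj_pa[OF f(1,2) g] by (simp add: mm_def proj_def[of "(v, a j)"] e)
    also have "\<dots> = pa v (a j) (gh v (a j) (proj (v, a j @ [e]) m))" unfolding gh_proj[OF f(1,2) m] ..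
    also have "\<dots> = proj (v, a j) (mm (Suc j))" by (simp add: proj_def[of "(v, a j)"] mm_def e)
    also have "\<dots> = mm (Suc j)" by (rule low) simp
    finally show ?thesis .
  qed
  let ?I = "{k. mm k \<noteq> mm (Suc k)}"
  have "finite ?I"
  proof (rule ccontr)
    assume inf: "infinite ?I"
    obtain F and x :: "nat => 'k" where F: "finite F" "F \<subseteq> ?I" "\<exists>i\<in>F. x i \<noteq> 0"
      "(\<Oplus>\<^bsub>M\<^esub>k\<in>F. x k \<odot>\<^bsub>M\<^esub> mm k) = \<zero>\<^bsub>M\<^esub>"
      by (rule fin_dim_dependent[OF fd inf, of mm]) (rule mc, blast+)
    let ?F = "{k \<in> F. x k \<noteq> 0}"
    define j where "j = Min ?F"
    have fin: "finite ?F" using F(1) by simp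
    have ne: "?F \<noteq> {}" using F(3) by blast
    have j: "j \<in> ?F" unfolding j_def by (rule Min_in[OF fin ne])
    have jm: "j < k" if "k \<in> ?F - {j}" for k
    proof -
      have "j \<le> k" unfolding j_def by (rule Min_le[OF fin]) (use that in blast)
      thus ?thesis using that by auto
    qed
    have xc: "x k \<odot>\<^bsub>M\<^esub> mm k \<in> carrier M" for k by (rule vsmult_closed[OF mc])
    let ?r = "\<Oplus>\<^bsub>M\<^esub>k\<in>?F - {j}. x k \<odot>\<^bsub>M\<^esub> mm k"
    have rc: "?r \<in> carrier M" by (rule M.finsum_closed) (rule Pi_I, rule xc)
    have "(\<Oplus>\<^bsub>M\<^esub>k\<in>F. x k \<odot>\<^bsub>M\<^esub> mm k) = (\<Oplus>\<^bsub>M\<^esub>k\<in>?F. x k \<odot>\<^bsub>M\<^esub> mm k)"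
      by (rule M.add.finprod_mono_neutral_cong_right) (use F(1) mc in auto)
    also have "\<dots> = (\<Oplus>\<^bsub>M\<^esub>k\<in>insert j (?F - {j}). x k \<odot>\<^bsub>M\<^esub> mm k)" using insert_Diff[OF j] by simp
    also have "\<dots> = x j \<odot>\<^bsub>M\<^esub> mm j \<oplus>\<^bsub>M\<^esub> ?r"
      by (rule M.finsum_insert) (use fin xc in auto)
    finally have s: "x j \<odot>\<^bsub>M\<^esub> mm j \<oplus>\<^bsub>M\<^esub> ?r = \<zero>\<^bsub>M\<^esub>" using F(4) by simp
    note lin = proj_linmap[OF a(1)[of "Suc j"]]
    have "proj (v, a (Suc j)) ?r = (\<Oplus>\<^bsub>M\<^esub>k\<in>?F - {j}. proj (v, a (Suc j)) (x k \<odot>\<^bsub>M\<^esub> mm k))"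
      by (rule linmap_finsum[OF lin vspace_axioms _ xc]) (use fin in simp)
    also have "\<dots> = ?r"
    proof (rule M.finsum_cong'[OF refl])
      show "(\<lambda>k. x k \<odot>\<^bsub>M\<^esub> mm k) \<in> ?F - {j} \<rightarrow> carrier M" by (rule Pi_I) (rule xc)
      show "proj (v, a (Suc j)) (x k \<odot>\<^bsub>M\<^esub> mm k) = x k \<odot>\<^bsub>M\<^esub> mm k" if "k \<in> ?F - {j}" for k
        unfolding linmapD(3)[OF lin mc] using low[of "Suc j" k] jm[OF that] by simp
    qed
    finally have r: "proj (v, a (Suc j)) ?r = ?r" .
    have "proj (v, a (Suc j)) (x j \<odot>\<^bsub>M\<^esub> mm j \<oplus>\<^bsub>M\<^esub> ?r) = x j \<odot>\<^bsub>M\<^esub> mm (Suc j) \<oplus>\<^bsub>M\<^esub> ?r"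
      unfolding linmapD(2)[OF lin xc rc] linmapD(3)[OF lin mc] up r ..
    hence e0: "x j \<odot>\<^bsub>M\<^esub> mm (Suc j) \<oplus>\<^bsub>M\<^esub> ?r = x j \<odot>\<^bsub>M\<^esub> mm j \<oplus>\<^bsub>M\<^esub> ?r"
      unfolding s proj_zero[OF a(1)] by (rule sym)
    have e: "x j \<odot>\<^bsub>M\<^esub> mm (Suc j) = x j \<odot>\<^bsub>M\<^esub> mm j"
      by (rule M.add.r_cancel[OF e0]) (rule rc vsmult_closed[OF mc])+
    have "inverse (x j) \<odot>\<^bsub>M\<^esub> (x j \<odot>\<^bsub>M\<^esub> mm k) = mm k" for k
      using vsmult_mult[OF mc[of k], of "inverse (x j)" "x j"] j mc by simp
    hence "mm (Suc j) = mm j" using e by metis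
    thus False using j F(2) by auto
  qed
  then obtain K where K: "\<And>k. k \<in> ?I ==> k < K" using finite_nat_set_iff_bounded by auto
  have "mm (K + r) = mm K" for r
  proof (induction r)
    case (Suc r)
    have "K + r \<notin> ?I" using K[of "K + r"] by auto
    thus ?case using Suc by simp
  qed simp
  hence "mm k = mm K" if "k \<ge> K" for k using that le_Suc_ex by metis
  thus thesis using that unfolding mm_def by blast
qed

text \<open>Follow the edges \<open>e\<close> with \<open>e\<^sup>* \<noteq> 0\<close> on the current vector.  Either the walk stops at a singular vertex,
  or it yields an infinite path along which the idempotents become stationary on the start vector.\<close>

lemma fin_dim_stalk:
  assumes s: "simple_module (lpa E) M" and fd: "fin_dim M"
  obtains x m where "x \<in> boundary E" "m \<in> stalk x" "m \<noteq> \<zero>\<^bsub>M\<^esub>"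
proof -
  obtain v m0 where v: "v \<in> verts E" and m0: "m0 \<in> carrier M" "m0 \<noteq> \<zero>\<^bsub>M\<^esub>" "G (Vx v) m0 = m0"
    by (rule vertex_vector[OF s])
  let ?T = "\<lambda>p. (v, p) \<in> fin_paths E \<and> gh v p m0 \<noteq> \<zero>\<^bsub>M\<^esub>"
  show thesis
  proof (cases "\<exists>p. ?T p \<and> (\<forall>e\<in>out_arcs E (prange E (v, p)). \<not> ?T (p @ [e]))")
    case True
    then obtain p where p0: "?T p \<and> (\<forall>e\<in>out_arcs E (prange E (v, p)). \<not> ?T (p @ [e]))" by (rule exE)
    note p = conjunct1[OF p0] bspec[OF conjunct2[OF p0]]
    let ?w = "prange E (v, p)" and ?m = "gh v p m0"
    have f: "(v, p) \<in> fin_paths E" using p(1) by blast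
    have w: "?w \<in> verts E" using f by (rule fin_paths_prange)
    have mc: "?m \<in> carrier M" by (rule linmapD(1)[OF gh_linmap[OF f] m0(1)])
    have no: "G (Gh e) ?m = \<zero>\<^bsub>M\<^esub>" if e: "e \<in> out_arcs E ?w" for e
    proof -
      have e': "e \<in> arcs E" "tail E e = ?w" using e by auto
      hence fe: "(v, p @ [e]) \<in> fin_paths E" using f by (auto simp: fin_paths_append)
      have "gh v (p @ [e]) m0 = G (Gh e) ?m"
        unfolding gh_append[OF fe m0(1)] using G_range_ghost[OF e'(1) mc] by simp
      thus ?thesis using p(2)[OF e] fe by simp
    qed
    have mw: "G (Vx ?w) ?m = ?m" by (rule gh_range[OF f m0(1)])
    have nz: "?m \<noteq> \<zero>\<^bsub>M\<^esub>" using p(1) by blast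
    show thesis by (rule that[OF singular_vertex_stalk[OF w mc nz mw no] nz])
  next
    case False
    have "\<forall>p. \<exists>e. ?T p --> e \<in> out_arcs E (prange E (v, p)) \<and> ?T (p @ [e])"
    proof
      fix p
      show "\<exists>e. ?T p --> e \<in> out_arcs E (prange E (v, p)) \<and> ?T (p @ [e])"
      proof (rule ccontr)
        assume no: "\<not> ?thesis"
        have "?T p \<and> (\<forall>e\<in>out_arcs E (prange E (v, p)). \<not> ?T (p @ [e]))" using no by simp
        hence "\<exists>p. ?T p \<and> (\<forall>e\<in>out_arcs E (prange E (v, p)). \<not> ?T (p @ [e]))" by (rule exI)
        with False show False by (rule notE)
      qed
    qed
    from choice[OF this] obtain nxt
      where nxt0: "\<forall>p. ?T p --> nxt p \<in> out_arcs E (prange E (v, p)) \<and> ?T (p @ [nxt p])" by (rule exE)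
    note nxt = nxt0[THEN spec, THEN mp]
    define a where "a = rec_nat [] (\<lambda>k p. p @ [nxt p])"
    have a0: "a 0 = []" and aS: "a (Suc k) = a k @ [nxt (a k)]" for k by (simp_all add: a_def)
    have T: "?T (a k)" for k
    proof (induction k)
      case 0
      show ?case using v m0 by (simp add: a0)
    next
      case (Suc k)
      show ?case unfolding aS by (rule conjunct2[OF nxt[OF Suc]])
    qed
    define \<omega> where "\<omega> = smap (\<lambda>k. nxt (a k)) (fromN 0)"
    have \<omega>n: "\<omega> !! k = nxt (a k)" for k by (simp add: \<omega>_def)
    have st: "stake k \<omega> = a k" for k
    proof (induction k)
      case (Suc k)
      have "stake (Suc k) \<omega> = stake k \<omega> @ [\<omega> !! k]" by (rule stake_Suc)
      thus ?case unfolding Suc \<omega>n aS .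
    qed (simp add: a0)
    have len: "length (a k) = k" for k using length_stake[of k \<omega>] st by simp
    have walk: "awalk v (a k) (prange E (v, a k))" for k using conjunct1[OF T[of k]] by (auto simp: fin_paths_def prange_def)
    have inf: "\<omega> \<in> inf_paths E" unfolding inf_paths_def
    proof (intro CollectI conjI allI subsetI)
      fix e assume "e \<in> sset \<omega>"
      then obtain k where "e = \<omega> !! k" by (auto simp: sset_range)
      thus "e \<in> arcs E" using conjunct1[OF nxt[OF T[of k]]] unfolding \<omega>n by simp
    next
      fix i
      have "a (Suc (Suc i)) ! i = \<omega> !! i" "a (Suc (Suc i)) ! Suc i = \<omega> !! Suc i"
        using stake_nth[of i "Suc (Suc i)" \<omega>] stake_nth[of "Suc i" "Suc (Suc i)" \<omega>] unfolding st by simp_all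
      thus "head E (\<omega> !! i) = tail E (\<omega> !! Suc i)"
        using closed_walk_nth[OF walk[of "Suc (Suc i)"], of i] len[of "Suc (Suc i)"] by simp
    qed
    have "shd \<omega> = nxt []" using \<omega>n[of 0] a0 by simp
    hence tl: "tail E (shd \<omega>) = v" using conjunct1[OF nxt[OF T[of 0]]] unfolding a0 by (simp add: prange_def)
    have xc: "InfP \<omega> \<in> cyl E (v, a k)" for k using cyl_stake[OF inf, of k] tl st by simp
    have T1: "(v, a k) \<in> fin_paths E" for k by (rule conjunct1[OF T])
    have T2: "\<exists>e. a (Suc k) = a k @ [e]" for k by (rule exI) (rule aS)
    have "\<exists>K. \<forall>k\<ge>K. proj (v, a k) m0 = proj (v, a K) m0"
    proof (rule stationary_projections[where v = v and a = a, OF fd m0(1) T1 T2])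
      fix K assume "\<And>k. k \<ge> K ==> proj (v, a k) m0 = proj (v, a K) m0"
      thus "\<exists>K. \<forall>k\<ge>K. proj (v, a k) m0 = proj (v, a K) m0" by (intro exI[of _ K] allI impI)
    qed
    then obtain K where K0: "\<forall>k\<ge>K. proj (v, a k) m0 = proj (v, a K) m0" by (rule exE)
    note K = K0[rule_format]
    let ?m = "proj (v, a K) m0"
    have fK: "(v, a K) \<in> fin_paths E" by (rule T1)
    have gc: "gh v (a k) m0 \<in> carrier M" for k by (rule linmapD(1)[OF gh_linmap[OF T1] m0(1)])
    have "gh v (a K) ?m = gh v (a K) m0"
      using gh_pa[OF fK gc] gh_range[OF fK m0(1)] by (simp add: proj_def)
    hence nz: "?m \<noteq> \<zero>\<^bsub>M\<^esub>" using conjunct2[OF T[of K]] gh_zero[OF fK] by auto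
    have "?m \<in> stalk (InfP \<omega>)"
    proof (rule stalkI)
      show "?m \<in> carrier M" by (rule proj_closed[OF fK m0(1)])
      fix u q assume f: "(u, q) \<in> fin_paths E"
      define k where "k = max K (length q)"
      have mk: "?m = pa v (a k) (gh v (a k) m0)" using K[of k] by (simp add: k_def proj_def)
      have fk: "(v, a k) \<in> fin_paths E" by (rule T1)
      have lq: "length q \<le> length (a k)" using len by (simp add: k_def)
      show "proj (u, q) ?m = (if InfP \<omega> \<in> cyl E (u, q) then ?m else \<zero>\<^bsub>M\<^esub>)"
      proof (cases "InfP \<omega> \<in> cyl E (u, q)")
        case True
        then obtain r where r: "u = v" "a k = q @ r" using cyl_meet[OF True xc lq] by blast
        have f': "(v, q @ r) \<in> fin_paths E" using fk r(2) by simp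
        have "proj (u, q) (pa v (a k) (gh v (a k) m0)) = pa v (a k) (gh v (a k) m0)"
          unfolding r(1) unfolding r(2) by (rule proj_pa_prefix[OF f']) (use gc[of k] r(2) in simp)
        thus ?thesis using True mk by simp
      next
        case False
        have inc: "\<not> (u = v \<and> (\<exists>r. a k = q @ r \<or> q = a k @ r))"
        proof
          assume "u = v \<and> (\<exists>r. a k = q @ r \<or> q = a k @ r)"
          then obtain r where r: "u = v" "a k = q @ r \<or> q = a k @ r" by blast
          have "\<exists>r. a k = q @ r"
          proof (cases "\<exists>r. a k = q @ r")
            case False
            then obtain r' where "q = a k @ r'" using r(2) by blast
            hence "a k = q @ []" using lq by simp
            thus ?thesis by (rule exI)
          qed
          then obtain r' where r': "a k = q @ r'" by blast
          have "InfP \<omega> \<in> cyl E (v, q @ r')" using xc[of k] unfolding r' .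
          hence "InfP \<omega> \<in> cyl E (v, q)" by (rule cyl_append_subset)
          thus False using False r(1) by simp
        qed
        show ?thesis using proj_pa_incomparable[OF f fk gc inc] False mk by simp
      qed
    qed
    moreover have "InfP \<omega> \<in> boundary E" using inf by (simp add: boundary_def)
    ultimately show thesis using that nz by blast
  qed
qed

end

section \<open>The classification theorem\<close>

lemma ball_tripleI: "(\<And>a b c. (a, b, c) \<in> A ==> Q a b c) ==> \<forall>(a, b, c) \<in> A. Q a b c"
  by auto

theorem theorem2p1:
  fixes E :: "('v, 'e) pre_digraph" and D :: "('v, 'e) bpath set"
  assumes "wf_digraph E"
    and "D \<subseteq> boundary E"
    and "\<forall>x \<in> boundary E. \<exists>!y. y \<in> D \<and> y \<in> orbit E x"
  shows "
    \<comment> \<open>the modules in the list are simple and spectral\<close>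
    ((\<forall>\<omega>. InfP \<omega> \<in> D \<longrightarrow>
        simple_module (lpa E) (chen E (InfP \<omega>) :: ('k :: field, _, _) lmodule) \<and>
        spectral E (chen E (InfP \<omega>) :: ('k, _, _) lmodule)) \<and>
     (\<forall>w \<in> verts E. \<not> regular E w \<longrightarrow>
        simple_module (lpa E) (chen E (FinP w []) :: ('k, _, _) lmodule) \<and>
        spectral E (chen E (FinP w []) :: ('k, _, _) lmodule)) \<and>
     (\<forall>(f :: 'k poly, c, b) \<in> poly_params E.
        simple_module (lpa E) (chen_poly E f c b) \<and> spectral E (chen_poly E f c b))) \<and>
    \<comment> \<open>they are pairwise nonisomorphic\<close>
    ((\<forall>\<omega> \<eta>. InfP \<omega> \<in> D \<and> InfP \<eta> \<in> D \<and> \<omega> \<noteq> \<eta> \<longrightarrow>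
        \<not> module_iso (lpa E) (chen E (InfP \<omega>) :: ('k, _, _) lmodule) (chen E (InfP \<eta>))) \<and>
     (\<forall>v \<in> verts E. \<forall>w \<in> verts E. \<not> regular E v \<and> \<not> regular E w \<and> v \<noteq> w \<longrightarrow>
        \<not> module_iso (lpa E) (chen E (FinP v []) :: ('k, _, _) lmodule) (chen E (FinP w []))) \<and>
     (\<forall>(f :: 'k poly, c, b) \<in> poly_params E. \<forall>(g, d, b') \<in> poly_params E.
        module_iso (lpa E) (chen_poly E f c b) (chen_poly E g d b') \<longleftrightarrow>
          tail_class E (cinf c) = tail_class E (cinf d) \<and> (\<exists>k. g = Polynomial.smult k f)) \<and>
     (\<forall>\<omega>. \<forall>w \<in> verts E. InfP \<omega> \<in> D \<and> \<not> regular E w \<longrightarrow>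
        \<not> module_iso (lpa E) (chen E (InfP \<omega>) :: ('k, _, _) lmodule) (chen E (FinP w []))) \<and>
     (\<forall>\<omega>. \<forall>(f :: 'k poly, c, b) \<in> poly_params E. InfP \<omega> \<in> D \<longrightarrow>
        \<not> module_iso (lpa E) (chen E (InfP \<omega>)) (chen_poly E f c b)) \<and>
     (\<forall>w \<in> verts E. \<forall>(f :: 'k poly, c, b) \<in> poly_params E. \<not> regular E w \<longrightarrow>
        \<not> module_iso (lpa E) (chen E (FinP w [])) (chen_poly E f c b))) \<and>
    \<comment> \<open>every simple spectral module is isomorphic to one of them\<close>
    (\<forall>M :: ('k, ('v, 'e, 'k) lpa_elt, 'm) lmodule.
        simple_module (lpa E) M \<and> spectral E M \<longrightarrow> listed E D (\<lambda>x. True) M) \<and>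
    \<comment> \<open>the finite dimensional simple modules are those with finite orbits\<close>
    ((\<forall>\<omega>. InfP \<omega> \<in> D \<and> finite (orbit E (InfP \<omega>)) \<longrightarrow>
        fin_dim (chen E (InfP \<omega>) :: ('k, _, _) lmodule)) \<and>
     (\<forall>w \<in> verts E. \<not> regular E w \<and> finite (orbit E (FinP w [])) \<longrightarrow>
        fin_dim (chen E (FinP w []) :: ('k, _, _) lmodule)) \<and>
     (\<forall>(f :: 'k poly, c, b) \<in> poly_params E. finite (orbit E (cinf c)) \<longrightarrow>
        fin_dim (chen_poly E f c b)) \<and>
     (\<forall>M :: ('k, ('v, 'e, 'k) lpa_elt, 'm) lmodule.
        simple_module (lpa E) M \<and> fin_dim M \<longrightarrow> listed E D (\<lambda>x. finite (orbit E x)) M))"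
proof -
  interpret wf_digraph E by (rule assms(1))
  interpret path_graph E by unfold_locales
  have Db: "InfP \<omega> \<in> boundary E" if "InfP \<omega> \<in> D" for \<omega> using that assms(2) by blast
  have wb: "FinP w [] \<in> boundary E" if "w \<in> verts E" "\<not> regular E w" for w
    using that by (auto simp: boundary_def)
  have chen: "simple_module (lpa E) (chen E x :: ('k, _, _) lmodule)" "spectral E (chen E x :: ('k, _, _) lmodule)"
    "finite (orbit E x) \<Longrightarrow> fin_dim (chen E x :: ('k, _, _) lmodule)" if "x \<in> boundary E" for x
  proof -
    interpret X: plain_chen E x "TYPE('k)" by (rule plain_chen_at[OF that])
    show "simple_module (lpa E) (chen E x :: ('k, _, _) lmodule)" by (rule X.simple)
    show "spectral E (chen E x :: ('k, _, _) lmodule)" by (rule X.spectral)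
    show "finite (orbit E x) \<Longrightarrow> fin_dim (chen E x :: ('k, _, _) lmodule)"
      unfolding orbit_eq_tail_class by (rule X.fin_dim)
  qed
  have poly: "simple_module (lpa E) (chen_poly E f c b)" "spectral E (chen_poly E f c b)"
    "finite (orbit E (cinf c)) \<Longrightarrow> fin_dim (chen_poly E f c b)" if "(f :: 'k poly, c, b) \<in> poly_params E" for f c b
  proof -
    interpret F: poly_chen E f c b by (rule poly_chen_at[OF that])
    show "simple_module (lpa E) (chen_poly E f c b)" by (rule F.simple)
    show "spectral E (chen_poly E f c b)" by (rule F.spectral)
    show "finite (orbit E (cinf c)) \<Longrightarrow> fin_dim (chen_poly E f c b)"
      unfolding orbit_eq_tail_class by (rule F.fin_dim)
  qed
  note plain_iso = plain_chen_iso_tail_class[where 'k = 'k]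
  have inf: "\<not> module_iso (lpa E) (chen E (InfP \<omega>) :: ('k, _, _) lmodule) (chen E (InfP \<eta>))"
    if "InfP \<omega> \<in> D" "InfP \<eta> \<in> D" "\<omega> \<noteq> \<eta>" for \<omega> \<eta>
  proof
    assume "module_iso (lpa E) (chen E (InfP \<omega>) :: ('k, _, _) lmodule) (chen E (InfP \<eta>))"
    hence "InfP \<omega> \<in> tail_class E (InfP \<eta>)" by (rule plain_iso[OF Db[OF that(1)] Db[OF that(2)]])
    moreover have "InfP \<eta> \<in> tail_class E (InfP \<eta>)" by (rule tail_class_refl[OF Db[OF that(2)]])
    ultimately have "InfP \<omega> = InfP \<eta>"
      using assms(3) Db[OF that(2)] that(1,2) unfolding orbit_eq_tail_class by blast
    thus False using that(3) by simp
  qed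
  have fin: "\<not> module_iso (lpa E) (chen E (FinP v []) :: ('k, _, _) lmodule) (chen E (FinP w []))"
    if v: "v \<in> verts E" "\<not> regular E v" and w: "w \<in> verts E" "\<not> regular E w" and "v \<noteq> w" for v w
  proof
    assume "module_iso (lpa E) (chen E (FinP v []) :: ('k, _, _) lmodule) (chen E (FinP w []))"
    hence "FinP v [] \<in> tail_class E (FinP w [])" by (rule plain_iso[OF wb[OF v] wb[OF w]])
    then obtain k where "(FinP w [], k, FinP v []) \<in> gpd E" unfolding tail_class_eq by blast
    from gpd_FinP[OF this] have "w = v" by (auto simp: prange_def)
    thus False using \<open>v \<noteq> w\<close> by simp
  qed
  have inf_fin: "\<not> module_iso (lpa E) (chen E (InfP \<omega>) :: ('k, _, _) lmodule) (chen E (FinP w []))"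
    if \<omega>: "InfP \<omega> \<in> D" and w: "w \<in> verts E" "\<not> regular E w" for \<omega> w
  proof
    assume "module_iso (lpa E) (chen E (InfP \<omega>) :: ('k, _, _) lmodule) (chen E (FinP w []))"
    hence "InfP \<omega> \<in> tail_class E (FinP w [])" by (rule plain_iso[OF Db[OF \<omega>] wb[OF w]])
    then obtain k where "(FinP w [], k, InfP \<omega>) \<in> gpd E" unfolding tail_class_eq by blast
    from gpd_FinP[OF gpd_inv[OF this]] show False by simp
  qed
  have listed: "listed E D (\<lambda>x. True) M" if s: "simple_module (lpa E) M" and sp: "spectral E M"
    for M :: "('k, ('v, 'e, 'k) lpa_elt, 'm) lmodule"
  proof -
    interpret M: lpa_module E M by (rule lpa_moduleI[OF wf_digraph simple_alg_module[OF s]])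
    obtain x m where x: "x \<in> boundary E" "m \<in> M.stalk x" "m \<noteq> \<zero>\<^bsub>M\<^esub>" using sp unfolding M.spectral_iff by blast
    show ?thesis by (rule simple_with_stalk_listed[OF assms(3) s x]) simp
  qed
  have fd: "listed E D (\<lambda>x. finite (orbit E x)) M" if s: "simple_module (lpa E) M" and fd: "fin_dim M"
    for M :: "('k, ('v, 'e, 'k) lpa_elt, 'm) lmodule"
  proof -
    interpret M: lpa_module E M by (rule lpa_moduleI[OF wf_digraph simple_alg_module[OF s]])
    obtain x m where x: "x \<in> boundary E" "m \<in> M.stalk x" "m \<noteq> \<zero>\<^bsub>M\<^esub>" by (rule M.fin_dim_stalk[OF s fd])
    have fo: "finite (tail_class E x)" by (rule M.fin_dim_orbit[OF fd x(2,3)])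
    show ?thesis
    proof (rule simple_with_stalk_listed[OF assms(3) s x])
      fix y assume "y \<in> tail_class E x"
      then obtain k where "(x, k, y) \<in> gpd E" unfolding tail_class_eq by blast
      hence "tail_class E x = tail_class E y" by (rule tail_class_eqI)
      thus "finite (orbit E y)" using fo by (simp add: orbit_eq_tail_class)
    qed
  qed
  show ?thesis
  proof (intro conjI)
    show "\<forall>\<omega>. InfP \<omega> \<in> D \<longrightarrow>
        simple_module (lpa E) (chen E (InfP \<omega>) :: ('k, _, _) lmodule) \<and>
        spectral E (chen E (InfP \<omega>) :: ('k, _, _) lmodule)" 
    proof (intro allI impI conjI)
      fix \<omega> assume "InfP \<omega> \<in> D"
      note x = Db[OF this]
      show "simple_module (lpa E) (chen E (InfP \<omega>) :: ('k, _, _) lmodule)" by (rule chen(1)[OF x])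
      show "spectral E (chen E (InfP \<omega>) :: ('k, _, _) lmodule)" by (rule chen(2)[OF x])
    qed
    show "\<forall>w \<in> verts E. \<not> regular E w \<longrightarrow>
        simple_module (lpa E) (chen E (FinP w []) :: ('k, _, _) lmodule) \<and>
        spectral E (chen E (FinP w []) :: ('k, _, _) lmodule)" 
    proof (intro ballI impI conjI)
      fix w assume "w \<in> verts E" "\<not> regular E w"
      note x = wb[OF this]
      show "simple_module (lpa E) (chen E (FinP w []) :: ('k, _, _) lmodule)" by (rule chen(1)[OF x])
      show "spectral E (chen E (FinP w []) :: ('k, _, _) lmodule)" by (rule chen(2)[OF x])
    qed
    show "\<forall>(f :: 'k poly, c, b) \<in> poly_params E.
        simple_module (lpa E) (chen_poly E f c b) \<and> spectral E (chen_poly E f c b)" 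
      by (rule ball_tripleI, rule conjI, erule poly(1), erule poly(2))
    show "\<forall>(f :: 'k poly, c, b) \<in> poly_params E. \<forall>(g, d, b') \<in> poly_params E.
        module_iso (lpa E) (chen_poly E f c b) (chen_poly E g d b') \<longleftrightarrow>
          tail_class E (cinf c) = tail_class E (cinf d) \<and> (\<exists>k. g = Polynomial.smult k f)"
      by (rule ball_tripleI, rule ball_tripleI, rule poly_iso_iff)
    show "\<forall>\<omega>. \<forall>(f :: 'k poly, c, b) \<in> poly_params E. InfP \<omega> \<in> D \<longrightarrow>
        \<not> module_iso (lpa E) (chen E (InfP \<omega>)) (chen_poly E f c b)" 
      by (rule allI, rule ball_tripleI, rule impI, rule plain_poly_not_iso, erule Db)
    show "\<forall>w \<in> verts E. \<forall>(f :: 'k poly, c, b) \<in> poly_params E. \<not> regular E w \<longrightarrow>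
        \<not> module_iso (lpa E) (chen E (FinP w [])) (chen_poly E f c b)" 
      by (rule ballI, rule ball_tripleI, rule impI, rule plain_poly_not_iso, erule wb)
    show "\<forall>(f :: 'k poly, c, b) \<in> poly_params E. finite (orbit E (cinf c)) \<longrightarrow>
        fin_dim (chen_poly E f c b)" by (rule ball_tripleI, rule impI, rule poly(3))
    show "\<forall>\<omega>. InfP \<omega> \<in> D \<and> finite (orbit E (InfP \<omega>)) \<longrightarrow>
        fin_dim (chen E (InfP \<omega>) :: ('k, _, _) lmodule)" by (rule allI, rule impI, erule conjE, rule chen(3), erule Db)
    show "\<forall>w \<in> verts E. \<not> regular E w \<and> finite (orbit E (FinP w [])) \<longrightarrow>
        fin_dim (chen E (FinP w []) :: ('k, _, _) lmodule)" by (rule ballI, rule impI, erule conjE, rule chen(3), erule wb)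
  
    show "\<forall>\<omega> \<eta>. InfP \<omega> \<in> D \<and> InfP \<eta> \<in> D \<and> \<omega> \<noteq> \<eta> \<longrightarrow>
        \<not> module_iso (lpa E) (chen E (InfP \<omega>) :: ('k, _, _) lmodule) (chen E (InfP \<eta>))"
      by (intro allI impI, elim conjE, rule inf)
    show "\<forall>v \<in> verts E. \<forall>w \<in> verts E. \<not> regular E v \<and> \<not> regular E w \<and> v \<noteq> w \<longrightarrow>
        \<not> module_iso (lpa E) (chen E (FinP v []) :: ('k, _, _) lmodule) (chen E (FinP w []))"
      by (intro ballI impI, elim conjE, rule fin)
    show "\<forall>\<omega>. \<forall>w \<in> verts E. InfP \<omega> \<in> D \<and> \<not> regular E w \<longrightarrow>
        \<not> module_iso (lpa E) (chen E (InfP \<omega>) :: ('k, _, _) lmodule) (chen E (FinP w []))"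
      by (intro allI ballI impI, elim conjE, rule inf_fin)
    show "\<forall>M :: ('k, ('v, 'e, 'k) lpa_elt, 'm) lmodule.
        simple_module (lpa E) M \<and> spectral E M \<longrightarrow> listed E D (\<lambda>x. True) M"
      by (intro allI impI, elim conjE, rule listed)
    show "\<forall>M :: ('k, ('v, 'e, 'k) lpa_elt, 'm) lmodule.
        simple_module (lpa E) M \<and> fin_dim M \<longrightarrow> listed E D (\<lambda>x. finite (orbit E x)) M"
      by (intro allI impI, elim conjE, rule fd)
  qed
qed

end
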